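(* Let $N\in\mathbb{Z}_{>0}$ be even, $l\in\frac12\mathbb{Z}_{>0}$, $\tau\in i\mathbb{R}_{>0}$, and let $\eta=\frac{r'}{2lr}\in\bigl[-\frac{1}{2(2l+1)},\frac{1}{2(2l+1)}\bigr]$ with $r,r'\in\mathbb{Z}$, $r>0$. Let $\mathcal{H}$, $T(u)$, $U_1$, $U_3$, $h_\pm(u)$, $[z;a]_k$ and the scalar products be as in the context. For $\lambda,u,v\in\mathbb{C}$ put $$\omega_\lambda(u;v):=\Bigl[z;\tfrac{\lambda+u-v}{2}+(-l+1)\eta\Bigr]_{2l}\in\Theta^{4l+}_{00}$$ (a function of $z$). Fix parameters $\lambda_0,v\in\mathbb{C}$ and generic complex parameters $\tau_{kj}$ ($1\le k\le 2l+1$, $1\le j\le 2r$). For $i,j\in\{1,\dots,2r\}$ define linear maps $S^i_j(u):\mathbb{C}^{2l+1}\to\Theta^{4l+}_{00}$ on the standard basis $e_1,\dots,e_{2l+1}$ by $$S^{i}_j(u)e_k=\tau_{kj}\,\omega_{\pm\lambda_0\pm4jl\eta}(u;\pm v)\quad\text{if } i\equiv j\pm1 \pmod{2r}$$ (same sign throughout) and $S^i_j(u)=0$ for all other $(i,j)$. Define $Q_R(u):(\mathbb{C}^{2l+1})^{\otimes N}\to\mathcal{H}$ by $$Q_R(u)(e_{k_N}\otimes\cdots\otimes e_{k_1})=\sum_{i_1,\dots,i_N=1}^{2r}S^{i_N}_{i_{N-1}}(u)e_{k_N}\otimes\cdots\otimes S^{i_2}_{i_1}(u)e_{k_2}\otimes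 S^{i_1}_{i_0}(u)e_{k_1},\qquad i_0:=i_N,$$ and $Q_L(u):=Q_R(-\bar u)^*:\mathcal{H}\to(\mathbb{C}^{2l+1})^{\otimes N}$ (Hermitian adjoint). Then for all $u\in\mathbb{C}$: (i) $T(u)Q_R(u)=h_-(u)Q_R(u-2\eta)+h_+(u)Q_R(u+2\eta)$. (ii) $Q_L(u)T(u)=h_-(u)Q_L(u-2\eta)+h_+(u)Q_L(u+2\eta)$. Assume moreover that $\lambda_0-v=2r''l\eta$ for some $r''\in\mathbb{Z}$. Then for all $u,u'\in\mathbb{C}$: (iii) $Q_L(u)Q_R(u')=Q_L(u')Q_R(u)$. (iv) $U_1^{\otimes N}Q_R(u)=e^{-Nl\pi i}Q_R(u+1)$, $\ U_3^{\otimes N}Q_R(u)=e^{Nl\pi i(\tau-1)+2Nl\pi iu}Q_R(u+\tau)$, $\ Q_L(u)U_1^{\otimes N}=e^{-Nl\pi i}Q_L(u+1)$, $\ Q_L(u)U_3^{\otimes N}=e^{Nl\pi i(\tau-1)+2Nl\pi iu}Q_L(u+\tau)$. (v) If there exists $u_0\in\mathbb{C}$ such that $Q_R(u_0)$ and $Q_L(u_0)$ are invertible, then $Q_R(u)Q_R(u_0)^{-1}=Q_L(u_0)^{-1}Q_L(u)$ for all $u$, and the operator $Q(u):=Q_R(u)Q_R(u_0)^{-1}$ on $\mathcal{H}$ satisfies, for all $u,w\in\mathbb{C}$, $$T(u)Q(u)=Q(u)T(u)=h_-(u)Q(u-2\eta)+h_+(u)Q(u+2\eta),\qquad Q(u)Q(w)=Q(w)Q(u),$$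 $$U_1^{\otimes N}Q(u)=Q(u)U_1^{\otimes N}=e^{-Nl\pi i}Q(u+1),$$ $$U_3^{\otimes N}Q(u)=Q(u)U_3^{\otimes N}=e^{Nl\pi i(\tau-1)+2Nl\pi iu}Q(u+\tau).$$
   Context: Theta functions: $\theta_{ab}(z,\tau)=\sum_{n\in\mathbb{Z}}\exp\bigl(\pi i(\frac a2+n)^2\tau+2\pi i(\frac a2+n)(\frac b2+z)\bigr)$ for $a,b\in\{0,1\}$; $[z]:=\theta_{11}(z,\tau)$; $[z]_k:=\prod_{j=0}^{k-1}[z+2j\eta]$, $[z]_0=1$; $[z;a]_k:=[z+a]_k[-z+a]_k$ (regarded as a function of $z$). Pauli matrices: $\sigma^0=\begin{pmatrix}1&0\\0&1\end{pmatrix}$, $\sigma^1=\begin{pmatrix}0&1\\1&0\end{pmatrix}$, $\sigma^2=\begin{pmatrix}0&-i\\i&0\end{pmatrix}$, $\sigma^3=\begin{pmatrix}1&0\\0&-1\end{pmatrix}$. Local space: $\Theta^{4l+}_{00}$ is the space of entire functions $f$ with $f(z+1)=f(-z)=f(z)$ and $f(z+\tau)=e^{-4l\pi i(2z+\tau)}f(z)$; it has dimension $2l+1$. Spin $l$ representation $\rho^l$ of the generators $S^0,\dots,S^3$ of the Sklyanin algebra on $\Theta^{4l+}_{00}$: $$(\rho^l(S^a)f)(z)=\frac{s_a(z-l\eta)f(z+\eta)-s_a(-z-l\eta)f(z-\eta)}{\theta_{11}(2z,\tau)},$$ $s_0(z)=\theta_{11}(\eta,\tau)\theta_{11}(2z,\tau)$,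 $s_1(z)=\theta_{10}(\eta,\tau)\theta_{10}(2z,\tau)$, $s_2(z)=i\theta_{00}(\eta,\tau)\theta_{00}(2z,\tau)$, $s_3(z)=\theta_{01}(\eta,\tau)\theta_{01}(2z,\tau)$. Transfer matrix: $\mathcal{H}=V_N\otimes\cdots\otimes V_1$ with every $V_n=\Theta^{4l+}_{00}$. Put $W_0^L(u)=\frac{\theta_{11}(u,\tau)}{\theta_{11}(\eta,\tau)}$, $W_1^L(u)=\frac{\theta_{10}(u,\tau)}{\theta_{10}(\eta,\tau)}$, $W_2^L(u)=\frac{\theta_{00}(u,\tau)}{\theta_{00}(\eta,\tau)}$, $W_3^L(u)=\frac{\theta_{01}(u,\tau)}{\theta_{01}(\eta,\tau)}$, and $L_n(u)=\sum_{a=0}^3W_a^L(u)\rho_n(S^a)\otimes\sigma^a$ on $\mathcal{H}\otimes\mathbb{C}^2$, where $\rho_n(S^a)$ acts as $\rho^l(S^a)$ on $V_n$ and as the identity on the other factors. Then $T(u)=\operatorname{tr}_{\mathbb{C}^2}L_N(u)L_{N-1}(u)\cdots L_1(u)$, an operator on $\mathcal{H}$. Also $h_\pm(u):=(2[u\mp2l\eta])^N$. Scalar products: on $\Theta^{4l+}_{00}$ the Sklyanin form (conjugate-linear in the first argument) is $$\langle f,g\rangle=\int_0^1dx\int_0^{\tau/i}dy\,\overline{f(z)}g(z)\mu(z,\bar z),\quad z=x+iy,$$ $$\mu(z,w)=\frac{\theta_{11}(2z,\tau)\theta_{11}(2w,\tau)}{\prod_{j=0}^{2l+1}\theta_{00}(z+w+(2j-2l-1)\eta,\tau)\,\theta_{00}(z-w+(2j-2l-1)\eta,\tau)};$$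 it is a positive definite Hermitian scalar product. $\mathcal{H}$ carries the tensor product scalar product, and $(\mathbb{C}^{2l+1})^{\otimes N}$ the tensor product of the standard scalar product on $\mathbb{C}^{2l+1}$, $(e_i,e_j)=\delta_{ij}$. The adjoint $^*$ is taken with respect to these. Unitary operators on $\Theta^{4l+}_{00}$: $(U_1f)(z)=e^{\pi il}f(z+\frac12)$, $(U_3f)(z)=e^{\pi il}e^{\pi il(4z+\tau)}f(z+\frac\tau2)$; $U_a^{\otimes N}$ acts on $\mathcal{H}$.
   Formalization: Assumes η ≠ 0, since W_0^L(u)=θ_11(u)/θ_11(η), hence T(u), is undefined at η=0; all claims involving Q_L ((ii), (iii), the Q_L half of (iv), (v)) assume |η|<1/(2(2l+1)), since at the endpoints the integral defining the Sklyanin form diverges. *)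

theory Defs
  imports "HOL-Complex_Analysis.Complex_Analysis" "HOL-Number_Theory.Cong"
begin

unbundle no fps_syntax

section \<open>Theta functions\<close>

definition theta :: "nat \<Rightarrow> nat \<Rightarrow> complex \<Rightarrow> complex \<Rightarrow> complex" where
  "theta a b z \<tau> = (\<Sum>\<^sub>\<infinity>n\<in>(UNIV :: int set).
     exp (pi * \<i> * (of_nat a / 2 + of_int n)^2 * \<tau>
          + 2 * pi * \<i> * (of_nat a / 2 + of_int n) * (of_nat b / 2 + z)))"

text \<open>\<open>bracket \<tau> \<eta> k z\<close> is $[z]_k$ and \<open>bracket2 \<tau> \<eta> k a z\<close> is $[z;a]_k$.\<close>

definition bracket :: "complex \<Rightarrow> real \<Rightarrow> nat \<Rightarrow> complex \<Rightarrow> complex" where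
  "bracket \<tau> \<eta> k z = (\<Prod>j<k. theta 1 1 (z + 2 * of_nat j * \<eta>) \<tau>)"

definition bracket2 :: "complex \<Rightarrow> real \<Rightarrow> nat \<Rightarrow> complex \<Rightarrow> complex \<Rightarrow> complex" where
  "bracket2 \<tau> \<eta> k a z = bracket \<tau> \<eta> k (z + a) * bracket \<tau> \<eta> k (- z + a)"

section \<open>The local space and the Sklyanin algebra\<close>

text \<open>The spin \<open>l\<close> is a real number with \<open>2 * l\<close> a positive integer; this is that integer
  as a natural number.\<close>

definition twice :: "real \<Rightarrow> nat" where
  "twice l = nat \<lfloor>2 * l\<rfloor>"

definition Theta_space :: "complex \<Rightarrow> real \<Rightarrow> (complex \<Rightarrow> complex) set" where
  "Theta_space \<tau> l = {f. f holomorphic_on UNIV \<and>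
     (\<forall>z. f (z + 1) = f z \<and> f (- z) = f z \<and>
          f (z + \<tau>) = exp (- 4 * l * pi * \<i> * (2 * z + \<tau>)) * f z)}"

text \<open>The theta function attached to the index \<open>a \<in> {0, 1, 2, 3}\<close> of a generator.\<close>

definition theta_idx :: "nat \<Rightarrow> complex \<Rightarrow> complex \<Rightarrow> complex" where
  "theta_idx a = (if a = 0 then theta 1 1 else if a = 1 then theta 1 0
                  else if a = 2 then theta 0 0 else theta 0 1)"

definition s_fun :: "complex \<Rightarrow> real \<Rightarrow> nat \<Rightarrow> complex \<Rightarrow> complex" where
  "s_fun \<tau> \<eta> a z = (if a = 2 then \<i> else 1) * theta_idx a \<eta> \<tau> * theta_idx a (2 * z) \<tau>"

text \<open>The quotient defining $\rho^l(S^a) f$ has removable singularities at the zeros of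
  $\theta_{11}(2z)$, where HOL's division would give \<open>0\<close>; \<open>remove_sings\<close> takes the continuous
  extension, so that the result is again an entire function.\<close>

definition rho :: "complex \<Rightarrow> real \<Rightarrow> real \<Rightarrow> nat \<Rightarrow> (complex \<Rightarrow> complex) \<Rightarrow> (complex \<Rightarrow> complex)" where
  "rho \<tau> \<eta> l a f = remove_sings (\<lambda>z.
     (s_fun \<tau> \<eta> a (z - l * \<eta>) * f (z + \<eta>) - s_fun \<tau> \<eta> a (- z - l * \<eta>) * f (z - \<eta>))
       / theta 1 1 (2 * z) \<tau>)"

definition U1 :: "real \<Rightarrow> (complex \<Rightarrow> complex) \<Rightarrow> (complex \<Rightarrow> complex)" where
  "U1 l f = (\<lambda>z. exp (pi * \<i> * l) * f (z + 1 / 2))"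

definition U3 :: "complex \<Rightarrow> real \<Rightarrow> (complex \<Rightarrow> complex) \<Rightarrow> (complex \<Rightarrow> complex)" where
  "U3 \<tau> l f = (\<lambda>z. exp (pi * \<i> * l) * exp (pi * \<i> * l * (4 * z + \<tau>)) * f (z + \<tau> / 2))"

section \<open>The state space\<close>

text \<open>A tensor product of spaces of functions of one variable is realised as a space of functions
  of several variables: $f_N \otimes \cdots \otimes f_1$ is the function
  $z \mapsto f_N(z_N) \cdots f_1(z_1)$. A point is a map \<open>z :: nat \<Rightarrow> complex\<close>, of which only the
  coordinates \<open>1, \<dots>, N\<close> matter.\<close>

type_synonym mfun = "(nat \<Rightarrow> complex) \<Rightarrow> complex"

definition pure_tensor :: "nat \<Rightarrow> (nat \<Rightarrow> complex \<Rightarrow> complex) \<Rightarrow> mfun" where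
  "pure_tensor N f = (\<lambda>z. \<Prod>n=1..N. f n (z n))"

text \<open>The span of the pure tensors; scalar coefficients can be absorbed in a factor
  because \<open>N > 0\<close>.\<close>

definition H_space :: "complex \<Rightarrow> real \<Rightarrow> nat \<Rightarrow> mfun set" where
  "H_space \<tau> l N = {(\<lambda>z. \<Sum>p<K. pure_tensor N (f p) z) | (K :: nat) f.
     \<forall>p<K. \<forall>n\<in>{1..N}. f p n \<in> Theta_space \<tau> l}"

text \<open>The operator acting as \<open>A\<close> on the \<open>n\<close>-th factor and as the identity on the others.\<close>

definition on_site :: "nat \<Rightarrow> ((complex \<Rightarrow> complex) \<Rightarrow> (complex \<Rightarrow> complex)) \<Rightarrow> mfun \<Rightarrow> mfun" where
  "on_site n A F = (\<lambda>z. A (\<lambda>w. F (z(n := w))) (z n))"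

primrec tensor_power :: "nat \<Rightarrow> ((complex \<Rightarrow> complex) \<Rightarrow> (complex \<Rightarrow> complex)) \<Rightarrow> mfun \<Rightarrow> mfun" where
  "tensor_power 0 A = id"
| "tensor_power (Suc n) A = on_site (Suc n) A \<circ> tensor_power n A"

section \<open>The transfer matrix\<close>

definition pauli :: "nat \<Rightarrow> complex^2^2" where
  "pauli a = (if a = 0 then vector [vector [1, 0], vector [0, 1]]
              else if a = 1 then vector [vector [0, 1], vector [1, 0]]
              else if a = 2 then vector [vector [0, - \<i>], vector [\<i>, 0]]
              else vector [vector [1, 0], vector [0, - 1]])"

text \<open>Meaningful only for \<open>\<eta> \<noteq> 0\<close>, since \<open>theta 1 1 0 \<tau> = 0\<close>.\<close>

definition W_L :: "complex \<Rightarrow> real \<Rightarrow> nat \<Rightarrow> complex \<Rightarrow> complex" where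
  "W_L \<tau> \<eta> a u = theta_idx a u \<tau> / theta_idx a \<eta> \<tau>"

text \<open>An element of the tensor product of the state space with $\mathbb{C}^2$ is given by its two
  components, as a map \<open>2 \<Rightarrow> mfun\<close>.\<close>

definition L_op :: "complex \<Rightarrow> real \<Rightarrow> real \<Rightarrow> nat \<Rightarrow> complex \<Rightarrow> (2 \<Rightarrow> mfun) \<Rightarrow> (2 \<Rightarrow> mfun)" where
  "L_op \<tau> \<eta> l n u \<Psi> = (\<lambda>\<alpha> z. \<Sum>a\<le>3. \<Sum>\<beta>\<in>UNIV.
     W_L \<tau> \<eta> a u * (pauli a $ \<alpha> $ \<beta>) * on_site n (rho \<tau> \<eta> l a) (\<Psi> \<beta>) z)"

primrec monodromy :: "complex \<Rightarrow> real \<Rightarrow> real \<Rightarrow> nat \<Rightarrow> complex \<Rightarrow> (2 \<Rightarrow> mfun) \<Rightarrow> (2 \<Rightarrow> mfun)" where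
  "monodromy \<tau> \<eta> l 0 u = id"
| "monodromy \<tau> \<eta> l (Suc n) u = L_op \<tau> \<eta> l (Suc n) u \<circ> monodromy \<tau> \<eta> l n u"

definition transfer_matrix :: "complex \<Rightarrow> real \<Rightarrow> real \<Rightarrow> nat \<Rightarrow> complex \<Rightarrow> mfun \<Rightarrow> mfun" where
  "transfer_matrix \<tau> \<eta> l N u F = (\<lambda>z. \<Sum>\<alpha>\<in>UNIV.
     monodromy \<tau> \<eta> l N u (\<lambda>\<beta>. if \<beta> = \<alpha> then F else (\<lambda>_. 0)) \<alpha> z)"

definition h_plus :: "complex \<Rightarrow> real \<Rightarrow> real \<Rightarrow> nat \<Rightarrow> complex \<Rightarrow> complex" where
  "h_plus \<tau> \<eta> l N u = (2 * theta 1 1 (u - 2 * l * \<eta>) \<tau>) ^ N"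

definition h_minus :: "complex \<Rightarrow> real \<Rightarrow> real \<Rightarrow> nat \<Rightarrow> complex \<Rightarrow> complex" where
  "h_minus \<tau> \<eta> l N u = (2 * theta 1 1 (u + 2 * l * \<eta>) \<tau>) ^ N"

section \<open>Scalar products and adjoints\<close>

definition mu :: "complex \<Rightarrow> real \<Rightarrow> real \<Rightarrow> complex \<Rightarrow> complex \<Rightarrow> complex" where
  "mu \<tau> \<eta> l z w = theta 1 1 (2 * z) \<tau> * theta 1 1 (2 * w) \<tau> /
     (\<Prod>j=0..twice l + 1. theta 0 0 (z + w + (2 * real j - 2 * l - 1) * \<eta>) \<tau>
                         * theta 0 0 (z - w + (2 * real j - 2 * l - 1) * \<eta>) \<tau>)"

text \<open>Here $\tau / i$ is the real number \<open>Im \<tau>\<close>, since $\tau$ is purely imaginary. The integral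
  converges for \<open>\<bar>\<eta>\<bar> < 1 / (2 * (2 * l + 1))\<close>. At the end points
  \<open>\<bar>\<eta>\<bar> = 1 / (2 * (2 * l + 1))\<close> the factors \<open>j = 0\<close> and \<open>j = 2 * l + 1\<close> of the denominator of
  \<open>mu\<close> vanish together on the lines $\mathrm{Im}\, z = \mathrm{Im}\,\tau / 4$ and
  $\mathrm{Im}\, z = 3\,\mathrm{Im}\,\tau / 4$, so that $\langle f, f\rangle = \infty$ for all
  $f \neq 0$ and there is no scalar product.\<close>

definition sklyanin_form ::
  "complex \<Rightarrow> real \<Rightarrow> real \<Rightarrow> (complex \<Rightarrow> complex) \<Rightarrow> (complex \<Rightarrow> complex) \<Rightarrow> complex" where
  "sklyanin_form \<tau> \<eta> l f g =
     integral {0..1} (\<lambda>x. integral {0..Im \<tau>} (\<lambda>y.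
       let z = Complex x y in cnj (f z) * g z * mu \<tau> \<eta> l z (cnj z)))"

text \<open>Conjugate-linear in the first and linear in the second argument, on a space \<open>V\<close> of
  complex-valued functions.\<close>

definition sesquilinear_on ::
  "('x \<Rightarrow> complex) set \<Rightarrow> (('x \<Rightarrow> complex) \<Rightarrow> ('x \<Rightarrow> complex) \<Rightarrow> complex) \<Rightarrow> bool" where
  "sesquilinear_on V B \<longleftrightarrow> (\<forall>F\<in>V. \<forall>G\<in>V. \<forall>K\<in>V. \<forall>c.
     B (\<lambda>x. c * F x + G x) K = cnj c * B F K + B G K \<and>
     B K (\<lambda>x. c * F x + G x) = c * B K F + B K G)"

text \<open>The tensor product of the Sklyanin forms: the unique sesquilinear form on the state space
  which is multiplicative on pure tensors. It is set to \<open>0\<close> outside the state space.\<close>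

definition H_form :: "complex \<Rightarrow> real \<Rightarrow> real \<Rightarrow> nat \<Rightarrow> mfun \<Rightarrow> mfun \<Rightarrow> complex" where
  "H_form \<tau> \<eta> l N = (THE B. sesquilinear_on (H_space \<tau> l N) B \<and>
     (\<forall>f g. (\<forall>n\<in>{1..N}. f n \<in> Theta_space \<tau> l \<and> g n \<in> Theta_space \<tau> l) \<longrightarrow>
        B (pure_tensor N f) (pure_tensor N g) = (\<Prod>n=1..N. sklyanin_form \<tau> \<eta> l (f n) (g n))) \<and>
     (\<forall>F G. F \<notin> H_space \<tau> l N \<or> G \<notin> H_space \<tau> l N \<longrightarrow> B F G = 0))"

text \<open>$(\mathbb{C}^{2l+1})^{\otimes N}$ in coordinates: the basis vector
  $e_{k_N} \otimes \cdots \otimes e_{k_1}$ corresponds to the multi-index \<open>k\<close>, and the tensor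
  product of the standard scalar products makes these vectors orthonormal.\<close>

definition multi_idx :: "real \<Rightarrow> nat \<Rightarrow> (nat \<Rightarrow> nat) set" where
  "multi_idx l N = {1..N} \<rightarrow>\<^sub>E {1..twice l + 1}"

definition C_space :: "real \<Rightarrow> nat \<Rightarrow> ((nat \<Rightarrow> nat) \<Rightarrow> complex) set" where
  "C_space l N = {c. \<forall>k. k \<notin> multi_idx l N \<longrightarrow> c k = 0}"

definition C_form ::
  "real \<Rightarrow> nat \<Rightarrow> ((nat \<Rightarrow> nat) \<Rightarrow> complex) \<Rightarrow> ((nat \<Rightarrow> nat) \<Rightarrow> complex) \<Rightarrow> complex" where
  "C_form l N c d = (\<Sum>k\<in>multi_idx l N. cnj (c k) * d k)"

text \<open>The adjoint of \<open>A : V \<rightarrow> W\<close>, for forms \<open>p\<close> on \<open>V\<close> and \<open>q\<close> on \<open>W\<close>.\<close>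

definition hermitian_adjoint ::
  "'a set \<Rightarrow> ('a \<Rightarrow> 'a \<Rightarrow> complex) \<Rightarrow> 'b set \<Rightarrow> ('b \<Rightarrow> 'b \<Rightarrow> complex) \<Rightarrow> ('a \<Rightarrow> 'b) \<Rightarrow> 'b \<Rightarrow> 'a" where
  "hermitian_adjoint V p W q A =
     (THE B. B \<in> W \<rightarrow>\<^sub>E V \<and> (\<forall>x\<in>V. \<forall>y\<in>W. q (A x) y = p x (B y)))"

section \<open>The operators $Q_R$ and $Q_L$\<close>

definition omega ::
  "complex \<Rightarrow> real \<Rightarrow> real \<Rightarrow> complex \<Rightarrow> complex \<Rightarrow> complex \<Rightarrow> complex \<Rightarrow> complex" where
  "omega \<tau> \<eta> l lam u v = bracket2 \<tau> \<eta> (twice l) ((lam + u - v) / 2 + (- l + 1) * \<eta>)"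

text \<open>\<open>S_basis \<dots> u i j k\<close> is the image $S^i_j(u) e_k$. Both congruences can hold together only
  for \<open>r = 1\<close>, which is impossible for the values of \<open>\<eta> \<noteq> 0\<close> under consideration.\<close>

definition S_basis :: "complex \<Rightarrow> real \<Rightarrow> real \<Rightarrow> nat \<Rightarrow> complex \<Rightarrow> complex \<Rightarrow> (nat \<Rightarrow> nat \<Rightarrow> complex) \<Rightarrow>
    complex \<Rightarrow> nat \<Rightarrow> nat \<Rightarrow> nat \<Rightarrow> (complex \<Rightarrow> complex)" where
  "S_basis \<tau> \<eta> l r lam0 v t u i j k =
     (if [int i = int j + 1] (mod (2 * int r))
        then (\<lambda>z. t k j * omega \<tau> \<eta> l (lam0 + 4 * of_nat j * l * \<eta>) u v z)
      else if [int i = int j - 1] (mod (2 * int r))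
        then (\<lambda>z. t k j * omega \<tau> \<eta> l (- lam0 - 4 * of_nat j * l * \<eta>) u (- v) z)
      else (\<lambda>z. 0))"

text \<open>The linear extension of the formula for the images of the basis vectors
  $e_{k_N} \otimes \cdots \otimes e_{k_1}$, with $i_0 = i_N$.\<close>

definition Q_R :: "complex \<Rightarrow> real \<Rightarrow> real \<Rightarrow> nat \<Rightarrow> nat \<Rightarrow> complex \<Rightarrow> complex \<Rightarrow> (nat \<Rightarrow> nat \<Rightarrow> complex) \<Rightarrow>
    complex \<Rightarrow> ((nat \<Rightarrow> nat) \<Rightarrow> complex) \<Rightarrow> mfun" where
  "Q_R \<tau> \<eta> l N r lam0 v t u c = (\<lambda>z. \<Sum>k\<in>multi_idx l N. c k *
     (\<Sum>i\<in>{1..N} \<rightarrow>\<^sub>E {1..2 * r}.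
        pure_tensor N (\<lambda>n. S_basis \<tau> \<eta> l r lam0 v t u (i n) (i (if n = 1 then N else n - 1)) (k n)) z))"

definition Q_L :: "complex \<Rightarrow> real \<Rightarrow> real \<Rightarrow> nat \<Rightarrow> nat \<Rightarrow> complex \<Rightarrow> complex \<Rightarrow> (nat \<Rightarrow> nat \<Rightarrow> complex) \<Rightarrow>
    complex \<Rightarrow> mfun \<Rightarrow> ((nat \<Rightarrow> nat) \<Rightarrow> complex)" where
  "Q_L \<tau> \<eta> l N r lam0 v t u =
     hermitian_adjoint (C_space l N) (C_form l N) (H_space \<tau> l N) (H_form \<tau> \<eta> l N)
       (Q_R \<tau> \<eta> l N r lam0 v t (- cnj u))"

end

theory Submission
  imports Defs
begin

text \<open>
  Everything rests on one addition formula. Write \<open>al\<close> and \<open>be\<close> for $\theta_{00}$ and $\theta_{01}$ with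
  the halved period $\tau/2$. Products of two theta functions at $x + y$ and $x - y$ are bilinear in
  the values of \<open>al\<close>, \<open>be\<close> at $x$ and at $y$ (\<open>products\<close>). Two consequences carry the algebra: the three-term identities,
  and the fact that the matrix $\sum_a W^L_a(u)\, s_a(z)\, \sigma^a$ has rank one, a column depending
  on $u/2 - z$ times a row depending on $u/2 + z$ (\<open>L_factorised\<close>). Therefore $L(u)\omega$, for a vector
  $\omega$ of the given form, sends a suitable constant column to a scalar function times another constant column
  (\<open>L_om_col\<close>), and there is a similar statement for rows (\<open>row_L_om\<close>). The columns attached to
  the vertices of a walk depend on the vertex modulo $2r$ only, because $2lr\eta$ is an integer. Hence for a closed walk
  the product of the $L(u)\omega$ has a column eigenvector and a row eigenvector which annihilate
  each other, and its trace is the sum of the two eigenvalues. This is (i), for all parameters.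

  For the scalar product the essential point is that the generators are self-adjoint
  (\<open>rho_selfadjoint\<close>). After a translation of $z$ by $\eta$ the difference of both sides has an integrand
  which, by a three-term identity, has no pole near the path, so that the translation
  can be undone by a change of contour; what remains is odd. Since $N$ is even, the adjoint of $T(u)$ is
  $T(-\bar u)$, and (ii) is the adjoint of (i). Part (iv) is a computation on the vectors $\omega$
  on the right; on the left it follows because the tensor powers of $U_1$ and $U_3$ are unitary involutions for even $N$.

  For (iii), a matrix element of $Q_L(u) Q_R(u')$ is a sum over pairs of closed walks of products of scalar
  products $\Phi(p, q)$ of two vectors $\omega$. Self-adjointness of the generators gives a difference
  equation for $\Phi$ (\<open>Phi_recursion\<close>). In the variables $x = p + q$ and $y = p - q$ it determines
  how $\Phi$ changes when $x$ moves by multiples of $2\eta$. The exchange of $u$ and $u'$ moves every factor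
  in this way, so that it multiplies the factor of one step of the two walks by an explicit theta quotient. This quotient
  is the ratio of the values at the two ends of the step of a function on $\mathbb{Z}/2r$ (\<open>cyclic_potential\<close>), and such ratios multiply to $1$ along a closed
  walk. Part (v) is a formal consequence of (i) to (iv), because both $Q_R(u_0)$ and $Q_L(u_0)$ can be cancelled.
\<close>

section \<open>Theta functions\<close>

definition theta_term :: "nat \<Rightarrow> nat \<Rightarrow> complex \<Rightarrow> complex \<Rightarrow> int \<Rightarrow> complex" where
  "theta_term a b z \<tau> n = exp (pi * \<i> * (of_nat a / 2 + of_int n)^2 * \<tau>
          + 2 * pi * \<i> * (of_nat a / 2 + of_int n) * (of_nat b / 2 + z))"

lemma theta_eq: "theta a b z \<tau> = (\<Sum>\<^sub>\<infinity>n. theta_term a b z \<tau> n)"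
  by (simp add: theta_def theta_term_def)

lemma exp_of_int_pi: "exp (of_int (2 * n) * of_real pi * \<i>) = (1 :: complex)"
  by (simp add: exp_eq_1)

lemma exp_pi_nat: "exp (of_nat a * of_real pi * \<i>) = (-1 :: complex) ^ a"
proof -
  have "exp (of_nat a * (of_real pi * \<i>)) = exp (of_real pi * \<i>) ^ a"
    by (rule exp_of_nat_mult)
  then show ?thesis by (simp add: exp_pi_i mult.assoc)
qed

lemma theta_add_1: "theta a b (z + 1) \<tau> = (-1) ^ a * theta a b z \<tau>"
proof -
  have "theta_term a b (z + 1) \<tau> n = (-1) ^ a * theta_term a b z \<tau> n" for n
  proof -
    have "theta_term a b (z + 1) \<tau> n =
        exp (of_nat a * of_real pi * \<i>) * exp (of_int (2 * n) * of_real pi * \<i>) * theta_term a b z \<tau> n"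
      unfolding theta_term_def exp_add[symmetric]
      by (rule arg_cong[where f = exp]) (simp add: field_simps)
    then show ?thesis by (simp only: exp_of_int_pi exp_pi_nat mult_1_right)
  qed
  then show ?thesis by (simp add: theta_eq infsum_cmult_right')
qed

lemma theta_add_tau:
  "theta a b (z + \<tau>) \<tau> = (-1) ^ b * exp (- pi * \<i> * \<tau> - 2 * pi * \<i> * z) * theta a b z \<tau>"
proof -
  let ?c = "(-1) ^ b * exp (- pi * \<i> * \<tau> - 2 * pi * \<i> * z)"
  have "theta_term a b (z + \<tau>) \<tau> n = ?c * theta_term a b z \<tau> (n + 1)" for n
  proof -
    have "?c * theta_term a b z \<tau> (n + 1) =
        exp (of_nat b * of_real pi * \<i>) * exp (- pi * \<i> * \<tau> - 2 * pi * \<i> * z) * theta_term a b z \<tau> (n + 1)"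
      by (simp only: exp_pi_nat)
    also have "\<dots> = theta_term a b (z + \<tau>) \<tau> n * exp (of_int (2 * int b) * of_real pi * \<i>)"
      unfolding theta_term_def exp_add[symmetric]
      by (rule arg_cong[where f = exp]) (simp add: field_simps power2_eq_square)
    finally show ?thesis by (simp only: exp_of_int_pi mult_1_right)
  qed
  then have "theta a b (z + \<tau>) \<tau> = ?c * (\<Sum>\<^sub>\<infinity>n. theta_term a b z \<tau> (n + 1))"
    by (simp add: theta_eq infsum_cmult_right')
  also have "(\<Sum>\<^sub>\<infinity>n. theta_term a b z \<tau> (n + 1)) = theta a b z \<tau>"
    unfolding theta_eq
    by (rule infsum_reindex_bij_witness[of _ "\<lambda>n. n - 1" "\<lambda>n. n + 1"]) auto
  finally show ?thesis .
qed

lemma theta_minus: "theta a b (- z) \<tau> = (-1) ^ (a * b) * theta a b z \<tau>"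
proof -
  have "theta_term a b (- z) \<tau> n = (-1) ^ (a * b) * theta_term a b z \<tau> (- n - int a)" for n
  proof -
    have "(-1) ^ (a * b) * theta_term a b z \<tau> (- n - int a) =
       exp (of_nat (a * b) * of_real pi * \<i>) * theta_term a b z \<tau> (- n - int a)
         * exp (of_int (2 * (n * int b)) * of_real pi * \<i>)"
      by (simp only: exp_pi_nat exp_of_int_pi mult_1_right)
    also have "\<dots> = theta_term a b (- z) \<tau> n"
      unfolding theta_term_def exp_add[symmetric]
      by (rule arg_cong[where f = exp]) (simp add: field_simps power2_eq_square)
    finally show ?thesis by simp
  qed
  then have "theta a b (- z) \<tau> = (-1) ^ (a * b) * (\<Sum>\<^sub>\<infinity>n. theta_term a b z \<tau> (- n - int a))"
    by (simp add: theta_eq infsum_cmult_right')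
  also have "(\<Sum>\<^sub>\<infinity>n. theta_term a b z \<tau> (- n - int a)) = theta a b z \<tau>"
    unfolding theta_eq
    by (rule infsum_reindex_bij_witness[of _ "\<lambda>n. - n - int a" "\<lambda>n. - n - int a"]) auto
  finally show ?thesis .
qed

text \<open>All analytic properties are transferred from $\theta_{00}$ along this relation.\<close>

lemma theta_eq_theta00:
  "theta a b z \<tau> = exp (pi * \<i> * (of_nat a ^ 2 / 4 * \<tau> + of_nat a * (of_nat b / 2 + z)))
     * theta 0 0 (z + of_nat a * \<tau> / 2 + of_nat b / 2) \<tau>"
proof -
  have "theta_term a b z \<tau> n = exp (pi * \<i> * (of_nat a ^ 2 / 4 * \<tau> + of_nat a * (of_nat b / 2 + z)))
     * theta_term 0 0 (z + of_nat a * \<tau> / 2 + of_nat b / 2) \<tau> n" for n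
    unfolding theta_term_def exp_add[symmetric]
    by (rule arg_cong[where f = exp]) (simp add: field_simps power2_eq_square)
  then show ?thesis by (simp add: theta_eq infsum_cmult_right')
qed

lemma theta_cnj:
  assumes "Re \<tau> = 0"
  shows "cnj (theta a b z \<tau>) = theta a b (cnj z) \<tau>"
proof -
  have \<tau>: "cnj \<tau> = - \<tau>" using assms by (simp add: complex_eq_iff)
  have "theta_term a b (cnj z) \<tau> n = cnj (theta_term a b z \<tau> (- n - int a))" for n
    unfolding theta_term_def exp_cnj
    by (rule arg_cong[where f = exp]) (simp add: \<tau> field_simps power2_eq_square)
  then have "theta a b (cnj z) \<tau> = (\<Sum>\<^sub>\<infinity>n. cnj (theta_term a b z \<tau> (- n - int a)))"
    by (simp add: theta_eq)
  also have "\<dots> = (\<Sum>\<^sub>\<infinity>n. cnj (theta_term a b z \<tau> n))"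
    by (rule infsum_reindex_bij_witness[of _ "\<lambda>n. - n - int a" "\<lambda>n. - n - int a"]) auto
  finally show ?thesis by (simp add: theta_eq)
qed

lemma theta_half_period:
  "theta 0 0 (z + 1/2) \<tau> = theta 0 1 z \<tau>"
  "theta 0 1 (z + 1/2) \<tau> = theta 0 0 z \<tau>"
  "theta 1 0 (z + 1/2) \<tau> = theta 1 1 z \<tau>"
  "theta 1 1 (z + 1/2) \<tau> = - theta 1 0 z \<tau>"
proof -
  show A: "theta 0 0 (z + 1/2) \<tau> = theta 0 1 z \<tau>" for z
    by (simp add: theta_def algebra_simps)
  show "theta 0 1 (z + 1/2) \<tau> = theta 0 0 z \<tau>"
    using theta_add_1[of 0 0 z \<tau>] by (simp add: A[symmetric] add.assoc del: One_nat_def)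
  show B: "theta 1 0 (z + 1/2) \<tau> = theta 1 1 z \<tau>" for z
    by (simp add: theta_def algebra_simps)
  show "theta 1 1 (z + 1/2) \<tau> = - theta 1 0 z \<tau>"
    using theta_add_1[of 1 0 z \<tau>] by (simp add: B[symmetric] add.assoc del: One_nat_def)
qed

subsection \<open>Convergence\<close>

lemma summable_exp_minus_abs_int: "(\<lambda>n::int. exp (- \<bar>of_int n\<bar>) :: real) summable_on UNIV"
proof -
  have "summable (\<lambda>n. exp (- 1 :: real) ^ n)" by (rule summable_geometric) simp
  then have "(\<lambda>n. exp (- 1 :: real) ^ n) summable_on UNIV"
    by (subst summable_on_UNIV_nonneg_real_iff) auto
  then have nat: "(\<lambda>n::nat. exp (- real n)) summable_on UNIV"
    by (simp add: exp_of_nat_mult[symmetric])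
  have pos: "(\<lambda>n::int. exp (- \<bar>of_int n\<bar>) :: real) summable_on range int"
    using nat by (subst summable_on_reindex) (auto simp: o_def inj_on_def)
  have neg: "(\<lambda>n::int. exp (- \<bar>of_int n\<bar>) :: real) summable_on range (\<lambda>n. - int n)"
    using nat by (subst summable_on_reindex) (auto simp: o_def inj_on_def)
  have "range int \<union> range (\<lambda>n. - int n) = UNIV"
  proof -
    have "n \<in> range int \<union> range (\<lambda>n. - int n)" for n
      by (cases n rule: int_cases2) auto
    then show ?thesis by blast
  qed
  then show ?thesis using summable_on_union[OF pos neg] by simp
qed

text \<open>Completing the square in $|n|$ leaves the linear term $-|n|$, uniformly on horizontal strips.\<close>

lemma norm_theta_term_le:
  assumes "Im \<tau> > 0" "\<bar>Im z\<bar> \<le> R"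
  shows "norm (theta_term 0 0 z \<tau> n) \<le> exp ((2 * pi * R + 1)\<^sup>2 / (4 * pi * Im \<tau>)) * exp (- \<bar>of_int n\<bar>)"
proof -
  define m where "m = \<bar>real_of_int n\<bar>"
  have m: "(real_of_int n)\<^sup>2 = m\<^sup>2" by (simp add: m_def)
  have "- 2 * pi * n * Im z \<le> 2 * pi * m * R"
  proof -
    have "- (n * Im z) \<le> \<bar>n * Im z\<bar>" by simp
    also have "\<dots> \<le> m * R" unfolding abs_mult m_def by (rule mult_left_mono) (use assms in auto)
    finally have "2 * pi * - (n * Im z) \<le> 2 * pi * (m * R)"
      by (rule mult_left_mono) simp
    then show ?thesis by simp
  qed
  moreover have "2 * pi * m * R + m \<le> pi * Im \<tau> * m\<^sup>2 + (2 * pi * R + 1)\<^sup>2 / (4 * pi * Im \<tau>)"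
  proof -
    have "0 \<le> (2 * (pi * Im \<tau>) * m - (2 * pi * R + 1))\<^sup>2 / (4 * (pi * Im \<tau>))"
      using assms by (intro divide_nonneg_nonneg) auto
    also have "\<dots> = pi * Im \<tau> * m\<^sup>2 - (2 * pi * R + 1) * m + (2 * pi * R + 1)\<^sup>2 / (4 * pi * Im \<tau>)"
      using assms(1) by (simp add: power2_eq_square field_simps)
    finally show ?thesis by (simp add: algebra_simps)
  qed
  ultimately have "- (pi * Im \<tau> * m\<^sup>2) - 2 * pi * n * Im z
      \<le> (2 * pi * R + 1)\<^sup>2 / (4 * pi * Im \<tau>) - m" by linarith
  moreover have "norm (theta_term 0 0 z \<tau> n) = exp (- (pi * Im \<tau> * m\<^sup>2) - 2 * pi * n * Im z)"
    unfolding m[symmetric]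
    by (simp add: theta_term_def norm_exp_eq_Re power2_eq_square algebra_simps)
  ultimately show ?thesis by (simp add: exp_add[symmetric] m_def)
qed

lemma theta_term_abs_summable:
  assumes "Im \<tau> > 0"
  shows "(\<lambda>n. norm (theta_term 0 0 z \<tau> n)) summable_on UNIV"
  by (rule summable_on_comparison_test[OF summable_on_cmult_right[OF summable_exp_minus_abs_int]])
     (use norm_theta_term_le[OF assms order_refl] in auto)

lemma theta00_holomorphic:
  assumes "Im \<tau> > 0"
  shows "(\<lambda>z. theta 0 0 z \<tau>) holomorphic_on UNIV"
proof -
  have "(\<lambda>z. theta 0 0 z \<tau>) holomorphic_on ball 0 R" for R :: real
  proof -
    define M where "M = (\<lambda>n::int. exp ((2 * pi * R + 1)\<^sup>2 / (4 * pi * Im \<tau>)) * exp (- \<bar>of_int n\<bar>) :: real)"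
    have ul: "uniform_limit (cball 0 R) (\<lambda>X z. \<Sum>n\<in>X. theta_term 0 0 z \<tau> n)
       (\<lambda>z. \<Sum>\<^sub>\<infinity>n. theta_term 0 0 z \<tau> n) (finite_subsets_at_top UNIV)"
    proof (rule Weierstrass_m_test_general)
      fix n :: int and z :: complex assume "z \<in> cball 0 R"
      then have "\<bar>Im z\<bar> \<le> R" using abs_Im_le_cmod[of z] by simp
      then show "norm (theta_term 0 0 z \<tau> n) \<le> M n"
        unfolding M_def by (rule norm_theta_term_le[OF assms])
    next
      show "M summable_on UNIV" unfolding M_def
        by (rule summable_on_cmult_right[OF summable_exp_minus_abs_int])
    qed
    have hol: "(\<lambda>z. \<Sum>n\<in>X. theta_term 0 0 z \<tau> n) holomorphic_on UNIV" for X
      unfolding theta_term_def by (intro holomorphic_intros)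
    have "\<forall>\<^sub>F X in finite_subsets_at_top UNIV.
        continuous_on (cball 0 R) (\<lambda>z. \<Sum>n\<in>X. theta_term 0 0 z \<tau> n) \<and>
        (\<lambda>z. \<Sum>n\<in>X. theta_term 0 0 z \<tau> n) holomorphic_on ball 0 R"
      by (intro always_eventually allI conjI holomorphic_on_imp_continuous_on
          holomorphic_on_subset[OF hol]) auto
    then show ?thesis
      using holomorphic_uniform_limit[OF _ ul] unfolding theta_eq[symmetric]
      by (metis finite_subsets_at_top_neq_bot)
  qed
  then have "(\<lambda>z. theta 0 0 z \<tau>) holomorphic_on (\<Union>R\<in>UNIV. ball 0 R)"
    by (intro holomorphic_on_UN_open) auto
  moreover have "(\<Union>R\<in>UNIV. ball (0::complex) R) = UNIV"
  proof -
    have "z \<in> ball 0 (norm z + 1)" for z :: complex by simp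
    then show ?thesis by blast
  qed
  ultimately show ?thesis by simp
qed

lemma theta_holomorphic_UNIV:
  assumes "Im \<tau> > 0"
  shows "(\<lambda>z. theta a b z \<tau>) holomorphic_on UNIV"
proof -
  have "((\<lambda>z. theta 0 0 z \<tau>) \<circ> (\<lambda>z. z + of_nat a * \<tau> / 2 + of_nat b / 2)) holomorphic_on UNIV"
    by (intro holomorphic_on_compose holomorphic_intros
        holomorphic_on_subset[OF theta00_holomorphic[OF assms]]) auto
  then have "(\<lambda>z. exp (pi * \<i> * (of_nat a ^ 2 / 4 * \<tau> + of_nat a * (of_nat b / 2 + z)))
     * theta 0 0 (z + of_nat a * \<tau> / 2 + of_nat b / 2) \<tau>) holomorphic_on UNIV"
    unfolding o_def by (intro holomorphic_intros) auto
  then show ?thesis by (subst theta_eq_theta00)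
qed

text \<open>For purely imaginary $\tau$ the series at $z = 0$ has positive terms only.\<close>

lemma theta00_0_nonzero:
  assumes "Re \<tau> = 0" "Im \<tau> > 0"
  shows "theta 0 0 0 \<tau> \<noteq> 0"
proof -
  define g where "g = (\<lambda>n::int. exp (- (pi * Im \<tau> * (of_int n)\<^sup>2)) :: real)"
  have trm: "theta_term 0 0 0 \<tau> n = of_real (g n)" for n
  proof -
    have "\<i> * \<tau> = - of_real (Im \<tau>)" using assms(1) by (simp add: complex_eq_iff)
    moreover have "complex_of_real pi * \<i> * (of_int n)^2 * \<tau> = (\<i> * \<tau>) * (complex_of_real pi * (of_int n)^2)"
      by (simp only: mult_ac)
    ultimately have "complex_of_real pi * \<i> * (of_int n)^2 * \<tau> = of_real (- (pi * Im \<tau> * (of_int n)\<^sup>2))"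
      by (simp add: mult_ac)
    then show ?thesis unfolding theta_term_def g_def exp_of_real[symmetric] by simp
  qed
  have norm: "norm (theta_term 0 0 0 \<tau> n) = g n" for n by (simp add: trm g_def)
  have step_in_sign: "g summable_on UNIV" using theta_term_abs_summable[OF assms(2), of 0] by (simp add: norm)
  have "(\<Sum>n\<in>{0}. g n) \<le> infsum g UNIV"
    by (rule finite_sum_le_infsum[OF step_in_sign]) (auto simp: g_def)
  then have "infsum g UNIV > 0" by (simp add: g_def)
  moreover have "((\<lambda>n. of_real (g n) :: complex) has_sum of_real (infsum g UNIV)) UNIV"
    using step_in_sign by (subst has_sum_of_real_iff) (rule has_sum_infsum)
  then have "theta 0 0 0 \<tau> = of_real (infsum g UNIV)"
    by (simp add: theta_eq trm infsumI)
  ultimately show ?thesis by simp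
qed

subsection \<open>The addition formula\<close>

text \<open>The double series on the left is split according to the parity of $p + q$. With
  $(p, q) = (n + m, n - m)$ or $(n + m + 1, n - m)$ the quadratic form $p^2 + q^2$ becomes twice a sum of squares, which
  is compensated by the halved period.\<close>

lemma theta_product_half_tau:
  assumes "Im \<tau> > 0"
  shows "theta 0 0 x (\<tau>/2) * theta 0 0 y (\<tau>/2) =
     theta 0 0 (x + y) \<tau> * theta 0 0 (x - y) \<tau> + theta 1 0 (x + y) \<tau> * theta 1 0 (x - y) \<tau>"
proof -
  have abs: "(\<lambda>n. norm (theta_term 0 0 z \<sigma> n)) summable_on UNIV" if "Im \<sigma> > 0" for z \<sigma>
    using theta_term_abs_summable[OF that] .
  have abs1: "(\<lambda>n. norm (theta_term 1 0 z \<tau> n)) summable_on UNIV" for z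
  proof -
    have "(\<lambda>n. norm (exp (pi * \<i> * (\<tau> / 4 + z))) * norm (theta_term 0 0 (z + \<tau> / 2) \<tau> n)) summable_on UNIV"
      by (rule summable_on_cmult_right[OF theta_term_abs_summable[OF assms]])
    moreover have "norm (exp (pi * \<i> * (\<tau> / 4 + z))) * norm (theta_term 0 0 (z + \<tau> / 2) \<tau> n) =
        norm (theta_term 1 0 z \<tau> n)" for n
      unfolding theta_term_def norm_mult[symmetric] exp_add[symmetric]
      by (rule arg_cong[where f = "\<lambda>x. norm (exp x)"]) (simp add: field_simps power2_eq_square)
    ultimately show ?thesis by simp
  qed
  have \<tau>2: "Im (\<tau>/2) > 0" using assms by simp
  define F where "F = (\<lambda>(p, q). theta_term 0 0 x (\<tau>/2) p * theta_term 0 0 y (\<tau>/2) q)"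
  have prodsum: "infsum f UNIV * infsum g UNIV = infsum (\<lambda>(p, q). f p * g q) UNIV
      \<and> (\<lambda>(p, q). f p * g q) summable_on UNIV"
    if "(\<lambda>n. norm (f n)) summable_on UNIV" "(\<lambda>n. norm (g n)) summable_on UNIV" for f g :: "int \<Rightarrow> complex"
  proof -
    have "(\<lambda>x. norm (case x of (p, q) \<Rightarrow> f p * g q)) summable_on UNIV \<times> UNIV"
      unfolding Infinite_Sum.abs_summable_on_Sigma_iff using that
      by (auto simp: norm_mult abs_mult infsum_cmult_right' intro!: summable_on_cmult_right summable_on_cmult_left)
    then have s: "(\<lambda>(p, q). f p * g q) summable_on UNIV \<times> UNIV"
      by (rule abs_summable_summable)
    have "infsum f UNIV * infsum g UNIV = (\<Sum>\<^sub>\<infinity>p. \<Sum>\<^sub>\<infinity>q. f p * g q)"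
      by (simp add: infsum_cmult_right' infsum_cmult_left')
    also have "\<dots> = infsum (\<lambda>(p, q). f p * g q) (UNIV \<times> UNIV)"
      using s by (rule infsum_Sigma'_banach)
    finally show ?thesis using s by simp
  qed
  have L: "theta 0 0 x (\<tau>/2) * theta 0 0 y (\<tau>/2) = infsum F UNIV" and sF: "F summable_on UNIV"
    using prodsum[OF abs[OF \<tau>2, of x] abs[OF \<tau>2, of y]] by (auto simp: theta_eq F_def)
  define E where "E = range (\<lambda>(n::int, m::int). (n + m, n - m))"
  define D where "D = range (\<lambda>(n::int, m::int). (n + m + 1, n - m))"
  have un: "E \<union> D = UNIV"
  proof -
    have "(p, q) \<in> E \<union> D" for p q
    proof (cases "even (p + q)")
      case True
      then obtain k where "p + q = 2 * k" by (elim evenE)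
      then have "(p, q) = (\<lambda>(n, m). (n + m, n - m)) (k, p - k)" by auto
      then show ?thesis unfolding E_def by blast
    next
      case False
      then obtain k where "p + q = 2 * k + 1" by (elim oddE)
      then have "(p, q) = (\<lambda>(n, m). (n + m + 1, n - m)) (k, p - 1 - k)" by auto
      then show ?thesis unfolding D_def by blast
    qed
    then show ?thesis by auto
  qed
  have disj: "E \<inter> D = {}"
    unfolding E_def D_def by (auto; presburger)
  have "infsum F UNIV = infsum F E + infsum F D"
    using infsum_Un_disjoint[OF summable_on_subset_banach[OF sF] summable_on_subset_banach[OF sF] disj] un
    by simp
  also have "infsum F E = infsum (F \<circ> (\<lambda>(n, m). (n + m, n - m))) UNIV"
    unfolding E_def by (rule infsum_reindex) (auto simp: inj_on_def)
  also have "F \<circ> (\<lambda>(n, m). (n + m, n - m)) = (\<lambda>(n, m). theta_term 0 0 (x + y) \<tau> n * theta_term 0 0 (x - y) \<tau> m)"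
    unfolding theta_term_def F_def exp_add[symmetric] o_def
    by (rule ext, simp only: split_def fst_conv snd_conv, rule arg_cong[where f = exp])
       (simp add: field_simps power2_eq_square)
  also have "infsum \<dots> UNIV = theta 0 0 (x + y) \<tau> * theta 0 0 (x - y) \<tau>"
    using prodsum[OF abs[OF assms, of "x + y"] abs[OF assms, of "x - y"]] by (auto simp: theta_eq)
  also have "infsum F D = infsum (F \<circ> (\<lambda>(n, m). (n + m + 1, n - m))) UNIV"
    unfolding D_def by (rule infsum_reindex) (auto simp: inj_on_def)
  also have "F \<circ> (\<lambda>(n, m). (n + m + 1, n - m)) = (\<lambda>(n, m). theta_term 1 0 (x + y) \<tau> n * theta_term 1 0 (x - y) \<tau> m)"
    unfolding theta_term_def F_def exp_add[symmetric] o_def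
    by (rule ext, simp only: split_def fst_conv snd_conv, rule arg_cong[where f = exp])
       (simp add: field_simps power2_eq_square)
  also have "infsum \<dots> UNIV = theta 1 0 (x + y) \<tau> * theta 1 0 (x - y) \<tau>"
    using prodsum[OF abs1[of "x + y"] abs1[of "x - y"]] by (auto simp: theta_eq)
  finally show ?thesis using L by simp
qed

text \<open>The characteristic of \<open>theta 1 1\<close> would otherwise be rewritten to a successor.\<close>

declare One_nat_def [simp del]

section \<open>Entire functions\<close>

lemma entire_shift:
  assumes "f holomorphic_on (UNIV :: complex set)"
  shows "(\<lambda>z. f (a * z + b)) holomorphic_on UNIV"
proof -
  have "(f \<circ> (\<lambda>z. a * z + b)) holomorphic_on UNIV"
    by (intro holomorphic_on_compose holomorphic_intros holomorphic_on_subset[OF assms]) auto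
  then show ?thesis by (simp add: o_def)
qed

lemma entire_cancel:
  assumes f: "f holomorphic_on (UNIV :: complex set)" and g: "g holomorphic_on UNIV"
    and h: "h holomorphic_on UNIV" and "h p \<noteq> 0" and eq: "\<And>z. h z * f z = h z * g z"
  shows "f = g"
proof -
  have "continuous_on UNIV h" using h by (rule holomorphic_on_imp_continuous_on)
  then have "open {z. h z \<noteq> 0}" by (intro open_Collect_neq) auto
  then have "f z = g z" for z
    by (rule analytic_continuation_open[of "{z. h z \<noteq> 0}" UNIV])
       (use assms in auto)
  then show ?thesis by auto
qed

text \<open>At a simple zero of \<open>h\<close> the quotient extends continuously by the quotient of the derivatives, and
  an isolated singularity of a continuous function is removable.\<close>

lemma entire_division:
  assumes f: "f holomorphic_on (UNIV :: complex set)" and h: "h holomorphic_on UNIV"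
    and zero: "\<And>z. h z = 0 \<Longrightarrow> f z = 0" and simple: "\<And>z. h z = 0 \<Longrightarrow> deriv h z \<noteq> 0"
  obtains g where "g holomorphic_on UNIV" "\<And>z. f z = h z * g z"
proof -
  define g where "g z = (if h z = 0 then deriv f z / deriv h z else f z / h z)" for z
  have fd: "(f has_field_derivative deriv f z) (at z)" for z
    using f by (simp add: holomorphic_derivI)
  have hd: "(h has_field_derivative deriv h z) (at z)" for z
    using h by (simp add: holomorphic_derivI)
  have conth: "continuous_on UNIV h" using h by (rule holomorphic_on_imp_continuous_on)
  have iso: "\<exists>e>0. \<forall>w. w \<noteq> z \<and> dist w z < e \<longrightarrow> h w \<noteq> 0" for z
  proof (cases "h z = 0")
    case True
    have "\<exists>r>0. \<forall>w\<in>ball z r - {z}. h w \<noteq> 0"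
    proof -
      have "\<not> h constant_on UNIV"
      proof
        assume "h constant_on UNIV"
        then obtain c where "h = (\<lambda>_. c)" by (auto simp: constant_on_def)
        then show False using simple[OF True] by simp
      qed
      then show ?thesis
        using isolated_zeros[of h UNIV z] h True unfolding constant_on_def
        by (metis Diff_iff UNIV_I connected_UNIV open_UNIV singletonI)
    qed
    then show ?thesis by (force simp: dist_commute)
  next
    case False
    then have "\<forall>\<^sub>F w in nhds z. h w \<noteq> 0"
      using conth by (intro tendsto_imp_eventually_ne[of h "h z"])
        (auto simp: continuous_on_eq_continuous_at isCont_def tendsto_at_iff_tendsto_nhds)
    then show ?thesis by (auto simp: eventually_nhds_metric)
  qed
  have cont: "isCont g z" for z
  proof (cases "h z = 0")
    case True
    from iso obtain e where e: "e > 0" "\<And>w. w \<noteq> z \<Longrightarrow> dist w z < e \<Longrightarrow> h w \<noteq> 0" by blast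
    have "(\<lambda>w. ((f w - f z) / (w - z)) / ((h w - h z) / (w - z))) \<midarrow>z\<rightarrow> deriv f z / deriv h z"
      using fd[of z] hd[of z] simple[OF True] by (intro tendsto_divide) (auto simp: has_field_derivative_iff)
    moreover have "\<forall>\<^sub>F w in at z. ((f w - f z) / (w - z)) / ((h w - h z) / (w - z)) = g w"
      unfolding eventually_at using e(1) 
      by (intro exI[of _ e]) (use e zero[OF True] True in \<open>auto simp: g_def\<close>)
    ultimately have "g \<midarrow>z\<rightarrow> deriv f z / deriv h z" by (rule Lim_transform_eventually)
    then show ?thesis by (simp add: isCont_def g_def True)
  next
    case False
    from iso obtain e where e: "e > 0" "\<And>w. w \<noteq> z \<Longrightarrow> dist w z < e \<Longrightarrow> h w \<noteq> 0" by blast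
    have "\<forall>\<^sub>F w in nhds z. g w = f w / h w"
      unfolding eventually_nhds_metric using e False by (intro exI[of _ e]) (auto simp: g_def, metis)
    moreover have "isCont (\<lambda>w. f w / h w) z"
      using fd[of z] hd[of z] False by (intro continuous_intros) (auto intro: DERIV_isCont)
    ultimately show ?thesis by (simp add: isCont_cong)
  qed
  have "g holomorphic_on ball z e" if e: "\<forall>w. w \<noteq> z \<and> dist w z < e \<longrightarrow> h w \<noteq> 0" for z e
  proof (rule no_isolated_singularity[of _ _ "{z}"])
    show "continuous_on (ball z e) g" using cont by (simp add: continuous_at_imp_continuous_on)
    have "(\<lambda>w. f w / h w) holomorphic_on ball z e - {z}"
      using e by (intro holomorphic_intros holomorphic_on_subset[OF f] holomorphic_on_subset[OF h])
        (auto simp: dist_commute)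
    then show "g holomorphic_on ball z e - {z}"
      by (rule holomorphic_transform) (use e in \<open>auto simp: g_def dist_commute\<close>)
  qed auto
  then have "g field_differentiable at z" for z
    using iso[of z] by (metis centre_in_ball holomorphic_on_imp_differentiable_at open_ball)
  then have "g holomorphic_on UNIV" by (simp add: holomorphic_on_def field_differentiable_at_within)
  moreover have "f z = h z * g z" for z using zero by (auto simp: g_def)
  ultimately show ?thesis by (rule that)
qed

lemma periodic_of_int:
  fixes f :: "complex \<Rightarrow> 'a"
  assumes "\<And>z. f (z + p) = f z"
  shows "f (z + of_int m * p) = f z"
proof (induction m rule: int_induct[of _ 0])
  case (step1 i)
  then show ?case using assms[of "z + of_int i * p"] by (simp add: algebra_simps)
next
  case (step2 i)
  then show ?case using assms[of "z + of_int (i - 1) * p"] by (simp add: algebra_simps)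
qed simp

lemma doubly_periodic_bounded:
  fixes f :: "complex \<Rightarrow> complex"
  assumes cont: "continuous_on UNIV f" and T: "T > 0"
    and p1: "\<And>z. f (z + 1) = f z" and p2: "\<And>z. f (z + Complex 0 T) = f z"
  shows "bounded (range f)"
proof -
  have "range f \<subseteq> f ` cbox 0 (Complex 1 T)"
  proof
    fix w assume "w \<in> range f"
    then obtain z where w: "w = f z" by auto
    define m n where "m = \<lfloor>Re z\<rfloor>" and "n = \<lfloor>Im z / T\<rfloor>"
    define z' where "z' = z + of_int (- m) * 1 + of_int (- n) * Complex 0 T"
    have "f z' = f z" unfolding z'_def
      by (simp only: periodic_of_int[of f, OF p2] periodic_of_int[of f, OF p1])
    moreover have "0 \<le> Im z - of_int n * T" "Im z - of_int n * T \<le> T"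
    proof -
      have "of_int n \<le> Im z / T" "Im z / T \<le> of_int n + 1" unfolding n_def by linarith+
      then show "0 \<le> Im z - of_int n * T" "Im z - of_int n * T \<le> T" using T by (auto simp: field_simps)
    qed
    moreover have "0 \<le> Re z - of_int m" "Re z - of_int m \<le> 1" unfolding m_def by linarith+
    ultimately show "w \<in> f ` cbox 0 (Complex 1 T)"
      using w by (intro image_eqI[of _ _ z']) (auto simp: z'_def in_cbox_complex_iff)
  qed
  moreover have "compact (f ` cbox 0 (Complex 1 T))"
    by (intro compact_continuous_image continuous_on_subset[OF cont]) auto
  ultimately show ?thesis using bounded_subset compact_imp_bounded by blast
qed

section \<open>Identities and zeros for a purely imaginary period\<close>

locale theta_tau =
  fixes \<tau> :: complex
  assumes Re_tau: "Re \<tau> = 0" and Im_tau: "Im \<tau> > 0"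
begin

abbreviation "t00 z \<equiv> theta 0 0 z \<tau>"
abbreviation "t01 z \<equiv> theta 0 1 z \<tau>"
abbreviation "t10 z \<equiv> theta 1 0 z \<tau>"
abbreviation "t11 z \<equiv> theta 1 1 z \<tau>"
text \<open>The pair \<open>(al, be)\<close> serves as a two-component vector; bilinear expressions in two such vectors are
  products of two theta functions with parameter \<open>\<tau>\<close>.\<close>

abbreviation "al z \<equiv> theta 0 0 z (\<tau>/2)"
abbreviation "be z \<equiv> theta 0 1 z (\<tau>/2)"

lemma holo_theta: "(\<lambda>z. theta a b z \<tau>) holomorphic_on UNIV"
  by (rule theta_holomorphic_UNIV[OF Im_tau])

lemma holo_half: "(\<lambda>z. theta a b z (\<tau>/2)) holomorphic_on UNIV"
  by (rule theta_holomorphic_UNIV) (use Im_tau in simp)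

lemma products:
  "al x * al y = t00 (x + y) * t00 (x - y) + t10 (x + y) * t10 (x - y)"
  "be x * be y = t00 (x + y) * t00 (x - y) - t10 (x + y) * t10 (x - y)"
  "be x * al y = t01 (x + y) * t01 (x - y) + t11 (x + y) * t11 (x - y)"
  "al x * be y = t01 (x + y) * t01 (x - y) - t11 (x + y) * t11 (x - y)"
proof -
  show A: "al x * al y = t00 (x + y) * t00 (x - y) + t10 (x + y) * t10 (x - y)" for x y
    by (rule theta_product_half_tau[OF Im_tau])
  have [simp]: "x + 1/2 + (y + 1/2) = x + y + 1" "x + 1/2 - (y + 1/2) = x - y"
     "x + 1/2 + y = x + y + 1/2" "x + 1/2 - y = x - y + 1/2" "x + (y + 1/2) = x + y + 1/2"
     "x - (y + 1/2) = x - y - 1/2" by (auto simp: field_simps)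
  show "be x * be y = t00 (x + y) * t00 (x - y) - t10 (x + y) * t10 (x - y)"
    using A[of "x + 1/2" "y + 1/2"] by (simp add: theta_half_period theta_add_1)
  show "be x * al y = t01 (x + y) * t01 (x - y) + t11 (x + y) * t11 (x - y)"
    using A[of "x + 1/2" "y"] by (simp add: theta_half_period del: One_nat_def)
  have B: "t00 (w - 1/2) = t01 w" "t10 (w - 1/2) = - t11 w" for w
    using theta_half_period(2,4)[of "w - 1/2" \<tau>] theta_half_period(1,3)[of "w - 1/2" \<tau>]
     theta_add_1[of 0 0 "w - 1/2" \<tau>] theta_add_1[of 1 0 "w - 1/2" \<tau>] 
      theta_half_period(2,4)[of "w - 1/2 - 1/2" \<tau>]  theta_half_period(1,3)[of "w" \<tau>]
    by (auto simp: diff_add_eq[symmetric] theta_half_period)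
  show "al x * be y = t01 (x + y) * t01 (x - y) - t11 (x + y) * t11 (x - y)"
    using A[of x "y + 1/2"] by (simp add: theta_half_period B del: One_nat_def)
qed

lemma brackets:
  "2 * (t11 (x + y) * t11 (x - y)) = be x * al y - al x * be y"
  "2 * (t00 (x + y) * t00 (x - y)) = al x * al y + be x * be y"
  unfolding products by simp_all

lemma t00_nonzero_at: "\<exists>z. t00 z \<noteq> 0" "al 0 \<noteq> 0" "be (1/2) \<noteq> 0" "\<exists>z. t11 z \<noteq> 0"
proof -
  have a: "t00 0 \<noteq> 0" by (rule theta00_0_nonzero[OF Re_tau Im_tau])
  then show "\<exists>z. t00 z \<noteq> 0" by blast
  show b: "al 0 \<noteq> 0" by (rule theta00_0_nonzero) (use Re_tau Im_tau in auto)
  have "be (0 + 1/2) = al 0" by (rule theta_half_period)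
  then have bhalf: "be (1/2) = al 0" by simp
  show "be (1/2) \<noteq> 0" unfolding bhalf by (rule b)
  show "\<exists>z. t11 z \<noteq> 0"
    by (rule exI[of _ "- (\<tau> / 2) - 1 / 2"], subst theta_eq_theta00) (use a in simp)
qed

text \<open>A common zero \<open>y\<close> would make $[x + y][x - y]$ vanish identically in $x$.\<close>

lemma al_be_not_both_zero: "al y \<noteq> 0 \<or> be y \<noteq> 0"
proof (rule ccontr)
  assume "\<not> ?thesis"
  then have "t11 (x + y) * t11 (x - y) = 0" for x using brackets(1)[of x y] by simp
  then have eq: "t11 (1 * x + y) * t11 (1 * x + (- y)) = t11 (1 * x + y) * 0" for x by simp
  obtain w where w: "t11 w \<noteq> 0" using t00_nonzero_at by blast
  have "(\<lambda>x. t11 (1 * x + (- y))) = (\<lambda>_. 0)"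
    by (rule entire_cancel[OF entire_shift[OF holo_theta] _ entire_shift[OF holo_theta] _ eq, where p = "w - y"])
       (use w in auto)
  from fun_cong[OF this, of "w + y"] w show False by simp
qed

text \<open>At a zero \<open>z0\<close> the vectors \<open>(al, be)\<close> at \<open>y\<close> and at \<open>y + z0\<close> are proportional; comparing the multipliers of
  both under translations determines \<open>z0\<close>.\<close>

lemma t11_period_relation:
  assumes "t11 z0 = 0"
  shows "be (y + z0) * al y = al (y + z0) * be y"
  using brackets(1)[of "y + z0" y] assms by simp

lemma al_add_half_tau: "al (y + \<tau>/2) = exp (- pi * \<i> * (\<tau>/2) - 2 * pi * \<i> * y) * al y"
  "be (y + \<tau>/2) = - exp (- pi * \<i> * (\<tau>/2) - 2 * pi * \<i> * y) * be y"
  using theta_add_tau[of 0 0 y "\<tau>/2"] theta_add_tau[of 0 1 y "\<tau>/2"] by auto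

lemma t11_half_tau_nonzero: "t11 (\<tau>/2) \<noteq> 0"
proof
  assume "t11 (\<tau>/2) = 0"
  from t11_period_relation[OF this] have "al y * be y = al y * 0" for y
    unfolding al_add_half_tau by (simp add: mult.commute)
  then have "(\<lambda>y. be y) = (\<lambda>_. 0)"
    by (intro entire_cancel[OF holo_half _ holo_half t00_nonzero_at(2), of "\<lambda>_. 0"]) auto
  then show False using t00_nonzero_at(3) by metis
qed

lemma t11_zero_shift: "t11 (z + of_int m + of_int n * \<tau>) = 0 \<longleftrightarrow> t11 z = 0"
proof -
  have "(t11 (z + of_int n * \<tau>) = 0) = (t11 z = 0)" for z
    by (rule periodic_of_int[of "\<lambda>z. t11 z = 0"]) (simp add: theta_add_tau)
  moreover have "(t11 (z + of_int m * 1) = 0) = (t11 z = 0)" for z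
    by (rule periodic_of_int[of "\<lambda>z. t11 z = 0"]) (simp add: theta_add_1)
  ultimately show ?thesis by simp
qed

lemma t11_0: "t11 0 = 0"
  using theta_minus[of 1 1 0 \<tau>] by simp

lemma tau_eq: "Complex 0 (Im \<tau>) = \<tau>"
  using Re_tau by (simp add: complex_eq_iff)

text \<open>The proportionality factor \<open>g\<close> between the vectors at \<open>y\<close> and \<open>y + z0\<close> is entire without zeros, because \<open>al\<close> and \<open>be\<close> have no
  common zero. Its logarithmic derivative is doubly periodic, hence constant by Liouville's theorem, and \<open>g\<close>
  is an exponential. Its multipliers under \<open>1\<close> and \<open>\<tau>/2\<close> force \<open>z0\<close> into the lattice generated
  by \<open>1\<close> and \<open>\<tau>/2\<close>; the odd multiples of \<open>\<tau>/2\<close> are excluded since \<open>be\<close> has a sign there which \<open>al\<close> has not.\<close>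

theorem t11_zero_imp:
  assumes "t11 z0 = 0"
  shows "\<exists>m n :: int. z0 = of_int m + of_int n * \<tau>"
proof -
  define g where "g y = (if al y \<noteq> 0 then al (y + z0) / al y else be (y + z0) / be y)" for y
  have gal: "al (y + z0) = g y * al y" and gbe: "be (y + z0) = g y * be y" for y
    using t11_period_relation[OF assms, of y] al_be_not_both_zero[of y]
    by (auto simp: g_def field_simps)
  have g0: "g y \<noteq> 0" for y using al_be_not_both_zero[of "y + z0"] gal[of y] gbe[of y] by auto
  have geqI: "u = v" if "u * al y = v * al y" "u * be y = v * be y" for u v y
    using that al_be_not_both_zero[of y] by auto
  have holg: "g holomorphic_on UNIV"
  proof -
    have cont: "continuous_on UNIV (\<lambda>z. theta a b z (\<tau>/2))" for a b
      using holo_half by (rule holomorphic_on_imp_continuous_on)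
    have sh: "(\<lambda>z. theta a b (z + z0) (\<tau>/2)) holomorphic_on UNIV" for a b
      using entire_shift[OF holo_half, of a b 1 z0] by simp
    have "open {y. al y \<noteq> 0}" "open {y. be y \<noteq> 0}"
      by (intro open_Collect_neq cont continuous_on_const)+
    moreover have "g holomorphic_on {y. al y \<noteq> 0}"
    proof (rule holomorphic_transform)
      show "(\<lambda>y. al (y + z0) / al y) holomorphic_on {y. al y \<noteq> 0}"
        by (intro holomorphic_intros holomorphic_on_subset[OF sh] holomorphic_on_subset[OF holo_half]) auto
    qed (auto simp: g_def)
    moreover have "g holomorphic_on {y. be y \<noteq> 0}"
    proof (rule holomorphic_transform)
      show "(\<lambda>y. be (y + z0) / be y) holomorphic_on {y. be y \<noteq> 0}"
        by (intro holomorphic_intros holomorphic_on_subset[OF sh] holomorphic_on_subset[OF holo_half]) auto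
    qed (auto simp: gbe)
    ultimately have "g holomorphic_on ({y. al y \<noteq> 0} \<union> {y. be y \<noteq> 0})"
      by (intro holomorphic_on_Un)
    moreover have "{y. al y \<noteq> 0} \<union> {y. be y \<noteq> 0} = UNIV" using al_be_not_both_zero by auto
    ultimately show ?thesis by simp
  qed
  have g1: "g (y + 1) = g y" for y
  proof (rule geqI)
    show "g (y + 1) * al y = g y * al y"
      using gal[of "y + 1"] gal[of y] theta_add_1[of 0 0 "y + z0" "\<tau>/2"] theta_add_1[of 0 0 y "\<tau>/2"]
      by (simp add: algebra_simps)
    show "g (y + 1) * be y = g y * be y"
      using gbe[of "y + 1"] gbe[of y] theta_add_1[of 0 1 "y + z0" "\<tau>/2"] theta_add_1[of 0 1 y "\<tau>/2"]
      by (simp add: algebra_simps)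
  qed
  define c where "c = exp (- 2 * pi * \<i> * z0)"
  have g2: "g (y + \<tau>/2) = c * g y" for y
  proof (rule geqI)
    define e where "e = exp (- pi * \<i> * (\<tau>/2) - 2 * pi * \<i> * y)"
    have e: "exp (- pi * \<i> * (\<tau>/2) - 2 * pi * \<i> * (y + z0)) = c * e" "e \<noteq> 0"
      unfolding c_def e_def exp_add[symmetric]
      by (simp, rule arg_cong[where f = exp], simp add: algebra_simps, simp)
    have sw: "y + \<tau>/2 + z0 = y + z0 + \<tau>/2" by simp
    have "e * (g (y + \<tau>/2) * al y) = e * (c * g y * al y)"
      using gal[of "y + \<tau>/2"] unfolding sw al_add_half_tau e(1) e_def[symmetric] gal[of y]
      by (auto simp: mult_ac)
    then show "g (y + \<tau>/2) * al y = c * g y * al y" using e(2) by simp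
    have "e * (g (y + \<tau>/2) * be y) = e * (c * g y * be y)"
      using gbe[of "y + \<tau>/2"] unfolding sw al_add_half_tau e(1) e_def[symmetric] gbe[of y]
      by (auto simp: mult_ac)
    then show "g (y + \<tau>/2) * be y = c * g y * be y" using e(2) by simp
  qed
  have gd: "(g has_field_derivative deriv g z) (at z)" for z
    using holg by (simp add: holomorphic_derivI)
  have d1: "deriv g (y + 1) = deriv g y" for y
  proof -
    have "((\<lambda>y. g (y + 1)) has_field_derivative deriv g (y + 1)) (at y)"
      by (rule DERIV_shift[THEN iffD1, OF gd])
    then show ?thesis unfolding g1 using gd DERIV_unique by blast
  qed
  have d2: "deriv g (y + \<tau>/2) = c * deriv g y" for y
  proof -
    have "((\<lambda>y. g (y + \<tau>/2)) has_field_derivative deriv g (y + \<tau>/2)) (at y)"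
      by (rule DERIV_shift[THEN iffD1, OF gd])
    moreover have "((\<lambda>y. c * g y) has_field_derivative c * deriv g y) (at y)"
      by (rule DERIV_cmult[OF gd])
    ultimately show ?thesis unfolding g2 using DERIV_unique by blast
  qed
  define D where "D y = deriv g y / g y" for y
  have holD: "D holomorphic_on UNIV"
    unfolding D_def using g0 holg by (auto intro!: holomorphic_intros holomorphic_deriv[OF holg])
  have "bounded (range D)"
  proof (rule doubly_periodic_bounded[of _ "Im \<tau> / 2"])
    have t: "Complex 0 (Im \<tau> / 2) = \<tau>/2" using Re_tau by (simp add: complex_eq_iff)
    show "D (z + Complex 0 (Im \<tau> / 2)) = D z" for z
      unfolding t D_def d2 g2 by (simp add: c_def)
    show "D (z + 1) = D z" for z unfolding D_def d1 g1 ..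
  qed (use Im_tau holD in \<open>auto intro: holomorphic_on_imp_continuous_on\<close>)
  with holD have "D constant_on UNIV" by (rule Liouville_theorem)
  then obtain A where A: "\<And>y. D y = A" by (auto simp: constant_on_def)
  then have gA: "deriv g y = A * g y" for y using g0 by (simp add: D_def field_simps)
  have "(\<lambda>y. g y * exp (- A * y)) constant_on UNIV"
  proof -
    have "((\<lambda>y. g y * exp (- A * y)) has_field_derivative 0) (at y)" for y
      by (rule derivative_eq_intros gd refl | simp add: gA)+
    then have "\<exists>k. \<forall>y\<in>UNIV. g y * exp (- A * y) = k"
      by (intro has_field_derivative_zero_constant) auto
    then show ?thesis by (auto simp: constant_on_def)
  qed
  then obtain K where K: "\<And>y. g y * exp (- A * y) = K" by (auto simp: constant_on_def)
  have K0: "K = g 0" using K[of 0] by simp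
  have gexp: "g y = g 0 * exp (A * y)" for y
    using K[of y] by (simp add: K0 exp_minus field_simps)
  have "exp A = exp 0" using gexp[of 1] g1[of 0] g0[of 0] by simp
  then obtain k :: int where k: "A = of_int (2 * k) * pi * \<i>" unfolding exp_eq by auto
  have "exp (A * (\<tau>/2)) = exp (- 2 * pi * \<i> * z0)"
    using gexp[of "\<tau>/2"] g2[of 0] g0[of 0] by (simp add: c_def)
  then obtain n :: int where n: "A * (\<tau>/2) = - 2 * pi * \<i> * z0 + of_int (2 * n) * pi * \<i>"
    unfolding exp_eq by auto
  have z0: "z0 = of_int n - of_int k * (\<tau>/2)"
  proof -
    have "(2 * pi * \<i>) * z0 = (2 * pi * \<i>) * (of_int n - of_int k * (\<tau>/2))"
      using n unfolding k by (simp add: algebra_simps)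
    then show ?thesis by simp
  qed
  show ?thesis
  proof (cases "even k")
    case True
    then obtain j where "k = 2 * j" by (elim evenE)
    then have "z0 = of_int n + of_int (- j) * \<tau>" using z0 by simp
    then show ?thesis by blast
  next
    case False
    then obtain j where "k = 2 * j + 1" by (elim oddE)
    then have "z0 = \<tau>/2 + of_int n + of_int (- j - 1) * \<tau>" using z0 by (simp add: field_simps)
    then have "t11 (\<tau>/2) = 0" using assms t11_zero_shift by metis
    then show ?thesis using t11_half_tau_nonzero by simp
  qed
qed

lemma t11_zero_iff: "t11 z = 0 \<longleftrightarrow> (\<exists>m n :: int. z = of_int m + of_int n * \<tau>)"
  using t11_zero_imp t11_zero_shift[of 0] t11_0 by fastforce

text \<open>At a double zero the Wronskian of \<open>al\<close> and \<open>be\<close> would vanish identically. Then \<open>be\<close> would be a multiple of \<open>al\<close>, and $[x + y][x - y]$ would be identically zero.\<close>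

lemma t11_simple_zero:
  assumes z0: "t11 z0 = 0"
  shows "deriv (\<lambda>z. t11 z) z0 \<noteq> 0"
proof
  assume d0: "deriv (\<lambda>z. t11 z) z0 = 0"
  have der: "((\<lambda>z. theta a b z \<tau>) has_field_derivative deriv (\<lambda>z. theta a b z \<tau>) z) (at z)" for a b z
    by (rule holomorphic_derivI[OF holo_theta]) auto
  have derh: "((\<lambda>z. theta a b z (\<tau>/2)) has_field_derivative deriv (\<lambda>z. theta a b z (\<tau>/2)) z) (at z)" for a b z
    by (rule holomorphic_derivI[OF holo_half]) auto
  have W0: "deriv (\<lambda>z. be z) (y + z0) * al y = deriv (\<lambda>z. al z) (y + z0) * be y" for y
  proof -
    have p: "((\<lambda>x. t11 (x + y)) has_field_derivative deriv (\<lambda>z. t11 z) (y + z0 + y)) (at (y + z0))"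
      by (rule DERIV_shift[THEN iffD1, OF der])
    have m: "((\<lambda>x. t11 (x + - y)) has_field_derivative deriv (\<lambda>z. t11 z) (y + z0 + - y)) (at (y + z0))"
      by (rule DERIV_shift[THEN iffD1, OF der])
    have "((\<lambda>x. 2 * (t11 (x + y) * t11 (x + - y))) has_field_derivative 0) (at (y + z0))"
      by (rule DERIV_cmult[OF DERIV_mult[OF p m], THEN DERIV_cong]) (use d0 z0 in simp)
    then have "((\<lambda>x. be x * al y - al x * be y) has_field_derivative 0) (at (y + z0))"
      by (simp add: brackets(1))
    moreover have "((\<lambda>x. be x * al y - al x * be y) has_field_derivative
        deriv (\<lambda>z. be z) (y + z0) * al y - deriv (\<lambda>z. al z) (y + z0) * be y) (at (y + z0))"
      by (rule derivative_eq_intros derh refl)+ simp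
    ultimately show ?thesis using DERIV_unique by fastforce
  qed
  have W: "deriv (\<lambda>z. be z) w * al w = deriv (\<lambda>z. al z) w * be w" for w
  proof -
    define y where "y = w - z0"
    have "be w * al y = al w * be y" "deriv (\<lambda>z. be z) w * al y = deriv (\<lambda>z. al z) w * be y"
      using t11_period_relation[OF z0, of y] W0[of y] by (auto simp: y_def)
    then have "al y * (deriv (\<lambda>z. be z) w * al w - deriv (\<lambda>z. al z) w * be w) = 0"
       "be y * (deriv (\<lambda>z. be z) w * al w - deriv (\<lambda>z. al z) w * be w) = 0"
      by algebra+
    then show ?thesis using al_be_not_both_zero[of y] by auto
  qed
  have "continuous_on UNIV (\<lambda>z. al z)" using holo_half by (rule holomorphic_on_imp_continuous_on)
  then have "open {z. al z \<noteq> 0}" by (intro open_Collect_neq continuous_on_const)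
  then obtain e where e: "e > 0" "ball 0 e \<subseteq> {z. al z \<noteq> 0}"
    using t00_nonzero_at(2) by (metis (mono_tags) mem_Collect_eq openE)
  have "\<exists>k. \<forall>z\<in>ball 0 e. be z / al z = k"
  proof (rule has_field_derivative_zero_constant)
    fix z :: complex assume "z \<in> ball 0 e"
    then have "al z \<noteq> 0" using e by auto
    then have "((\<lambda>z. be z / al z) has_field_derivative 0) (at z)"
      by - (rule DERIV_cong[OF DERIV_divide[OF derh derh]], use W[of z] in \<open>auto simp: mult_ac\<close>)
    then show "((\<lambda>z. be z / al z) has_field_derivative 0) (at z within ball 0 e)"
      by (rule has_field_derivative_at_within)
  qed auto
  then obtain K where K0: "\<forall>z\<in>ball 0 e. be z / al z = K" ..
  have K: "be z = K * al z" if "z \<in> ball 0 e" for z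
  proof -
    have "al z \<noteq> 0" using e that by auto
    then show ?thesis using bspec[OF K0 that] by (simp add: divide_eq_eq)
  qed
  have beal: "be z = K * al z" for z
    by (rule analytic_continuation_open[of "ball 0 e" UNIV "\<lambda>z. be z" "\<lambda>z. K * al z"])
       (use e K in \<open>auto intro!: holomorphic_intros holo_half\<close>)
  have "t11 (\<tau>/2) = 0"
  proof -
    have "2 * (t11 (\<tau>/4 + \<tau>/4 + 0) * t11 (\<tau>/4 + \<tau>/4 - 0)) = 0"
      unfolding brackets(1) beal by simp
    then show ?thesis by simp
  qed
  then show False using t11_half_tau_nonzero by simp
qed

end

context theta_tau
begin

subsection \<open>Zeros of the even theta functions\<close>

lemma t00_zero_imp:
  assumes "t00 z = 0"
  shows "\<exists>m n :: int. z = of_int m + 1/2 + (of_int n + 1/2) * \<tau>"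
proof -
  have "t11 (z - \<tau>/2 - 1/2) = 0"
    by (subst theta_eq_theta00) (use assms in simp)
  then obtain m n :: int where "z - \<tau>/2 - 1/2 = of_int m + of_int n * \<tau>" by (auto simp: t11_zero_iff)
  then have "z = of_int m + 1/2 + (of_int n + 1/2) * \<tau>" by (simp add: algebra_simps)
  then show ?thesis by blast
qed

lemma t00_nonzero_Im:
  assumes "\<And>n :: int. Im z \<noteq> (of_int n + 1/2) * Im \<tau>"
  shows "t00 z \<noteq> 0"
proof
  assume "t00 z = 0"
  then obtain m n :: int where "z = of_int m + 1/2 + (of_int n + 1/2) * \<tau>" using t00_zero_imp by blast
  then have "Im z = (of_int n + 1/2) * Im \<tau>" by simp
  then show False using assms by blast
qed

lemma half_int_nonzero: "(of_int n + 1/2 :: real) \<noteq> 0"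
proof
  assume "(of_int n + 1/2 :: real) = 0"
  then have "real_of_int (2 * n + 1) = 0" by simp
  then have "2 * n + 1 = 0" by (simp only: of_int_eq_0_iff)
  then show False by presburger
qed

lemma t00_nonzero_real:
  assumes "Im z = 0"
  shows "t00 z \<noteq> 0"
  using half_int_nonzero Im_tau assms by (intro t00_nonzero_Im) auto

lemma t00_nonzero_Re:
  assumes "\<bar>Re z\<bar> < 1/2"
  shows "t00 z \<noteq> 0"
proof
  assume "t00 z = 0"
  then obtain m n :: int where "z = of_int m + 1/2 + (of_int n + 1/2) * \<tau>" using t00_zero_imp by blast
  then have r: "Re z = of_int m + 1/2" using Re_tau by simp
  then have "of_int m < (0 :: real)" "of_int m > (- 1 :: real)" using assms by linarith+
  then have "m < 0" "m > - 1" by linarith+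
  then show False by simp
qed

lemma t01_nonzero_real: "Im z = 0 \<Longrightarrow> t01 z \<noteq> 0"
  using t00_nonzero_real[of "z + 1/2"] by (simp add: theta_half_period)

lemma t11_nonzero_real:
  assumes "Im z = 0" "Re z \<notin> \<int>"
  shows "t11 z \<noteq> 0"
proof
  assume "t11 z = 0"
  then obtain m n :: int where z: "z = of_int m + of_int n * \<tau>" by (auto simp: t11_zero_iff)
  then have "Re z = of_int m" using Re_tau by simp
  then show False using assms by auto
qed

lemma t10_eq: "t10 z = - t11 (z + 1/2)" "t10 z = t11 (z - 1/2)"
  using theta_half_period(3)[of "z - 1/2" \<tau>] theta_half_period(4)[of z \<tau>] by auto

lemma t01_eq: "t01 z = t00 (z + 1/2)" "t01 z = t00 (z - 1/2)"
  using theta_half_period(2)[of "z - 1/2" \<tau>] theta_half_period(1)[of z \<tau>] by auto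

lemma theta_idx_nonzero:
  assumes "\<eta> \<noteq> 0" "\<bar>\<eta>\<bar> \<le> 1/4"
  shows "theta_idx a (complex_of_real \<eta>) \<tau> \<noteq> 0"
proof -
  have n: "x \<notin> \<int>" if "0 < \<bar>x\<bar>" "\<bar>x\<bar> < 1" for x :: real
    using that by (auto elim!: Ints_cases)
  have "0 < \<bar>\<eta>\<bar>" "\<bar>\<eta>\<bar> < 1" "0 < \<bar>\<eta> + 1/2\<bar>" "\<bar>\<eta> + 1/2\<bar> < 1" using assms by linarith+
  then have "\<eta> \<notin> \<int>" "\<eta> + 1/2 \<notin> \<int>" using n by blast+
  then have "t11 \<eta> \<noteq> 0" "t10 \<eta> \<noteq> 0"
    using t11_nonzero_real[of \<eta>] t11_nonzero_real[of "of_real \<eta> + 1/2"] by (auto simp: t10_eq(1))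
  then show ?thesis
    using t00_nonzero_real[of \<eta>] t01_nonzero_real[of \<eta>] by (auto simp: theta_idx_def)
qed

lemma t10_0_nonzero: "t10 0 \<noteq> 0"
proof -
  have "(1/2 :: real) \<notin> \<int>"
  proof
    assume "(1/2 :: real) \<in> \<int>"
    then obtain n where "(1/2 :: real) = of_int n" by (elim Ints_cases)
    then have "of_int (- n) + 1/2 = (0 :: real)" by simp
    then show False using half_int_nonzero by blast
  qed
  then show ?thesis using t11_nonzero_real[of "1/2"] by (simp add: t10_eq(1))
qed

subsection \<open>Three-term and duplication formulas\<close>

text \<open>Each bracket is a determinant, respectively a scalar product, of two of the four vectors \<open>(al, be)\<close> at
  \<open>A\<close>, \<open>B\<close>, \<open>C\<close>, \<open>D\<close>. This is the linear relation between three vectors in the plane, paired with the fourth.\<close>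

lemma three_term:
  "t11 (A + C) * t11 (A - C) * (t00 (B + D) * t00 (B - D))
   - t11 (B + C) * t11 (B - C) * (t00 (A + D) * t00 (A - D))
   + t11 (B + A) * t11 (B - A) * (t00 (C + D) * t00 (C - D)) = 0"
proof -
  have "4 * (t11 (A + C) * t11 (A - C) * (t00 (B + D) * t00 (B - D))
   - t11 (B + C) * t11 (B - C) * (t00 (A + D) * t00 (A - D))
   + t11 (B + A) * t11 (B - A) * (t00 (C + D) * t00 (C - D)))
   = (2 * (t11 (A + C) * t11 (A - C))) * (2 * (t00 (B + D) * t00 (B - D)))
   - (2 * (t11 (B + C) * t11 (B - C))) * (2 * (t00 (A + D) * t00 (A - D)))
   + (2 * (t11 (B + A) * t11 (B - A))) * (2 * (t00 (C + D) * t00 (C - D)))"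
    by algebra
  also have "\<dots> = 0" unfolding brackets by algebra
  finally show ?thesis by (simp only: mult_eq_0_iff) simp
qed

text \<open>The linear relation between the three vectors \<open>(al, be)\<close> at \<open>c + z\<close>, \<open>c - z\<close> and \<open>d\<close>, one component at a time.\<close>

lemma vector_three_term:
  assumes "w = al \<or> w = be"
  shows "w (c - z) * (t11 (c + z + d) * t11 (c + z - d)) - w (c + z) * (t11 (c - z + d) * t11 (c - z - d))
    = w d * (t11 (2 * c) * t11 (2 * z))"
proof -
  have s: "c + z + (c - z) = 2 * c" "c + z - (c - z) = 2 * z" by auto
  have "2 * (w (c - z) * (t11 (c + z + d) * t11 (c + z - d)) - w (c + z) * (t11 (c - z + d) * t11 (c - z - d)))
     = w (c - z) * (2 * (t11 (c + z + d) * t11 (c + z - d))) - w (c + z) * (2 * (t11 (c - z + d) * t11 (c - z - d)))"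
    by algebra
  also have "\<dots> = w d * (be (c + z) * al (c - z) - al (c + z) * be (c - z))"
    unfolding brackets using assms by (auto simp: algebra_simps)
  also have "\<dots> = w d * (2 * (t11 (c + z + (c - z)) * t11 (c + z - (c - z))))" unfolding brackets ..
  also have "\<dots> = 2 * (w d * (t11 (2 * c) * t11 (2 * z)))" unfolding s by simp
  finally show ?thesis by (simp only: mult_cancel_left) simp
qed

lemma odd_t11: "t11 (- z) = - t11 z"
  by (simp add: theta_minus)

text \<open>Specialisations of \<open>three_term\<close>. For the second and fourth one the arguments are moved by quarter periods, which
  turns \<open>t11\<close> into \<open>t10\<close> and \<open>t00\<close> into \<open>t01\<close> in the required places.\<close>

lemma kernel_identities:
  "(t11 (X + Y - k) * t11 (X - Y) * t00 (X + k) - t11 (X - Y + k) * t11 (X + Y) * t00 (X - k)) * t00 X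
     = - (t11 k * t11 (2 * X) * t00 Y * t00 (Y - k))"
  "(t10 (X + Y - k) * t11 (X - Y) * t00 (X + k) + t10 (X - Y + k) * t11 (X + Y) * t00 (X - k)) * t01 X
     = t10 k * t11 (2 * X) * t01 Y * t00 (Y - k)"
  "(t00 (X + Y - k) * t11 (X - Y) * t00 (X + k) - t00 (X - Y + k) * t11 (X + Y) * t00 (X - k)) * t11 X
     = - (t00 k * t11 (2 * X) * t11 Y * t00 (Y - k))"
  "(t01 (X + Y - k) * t11 (X - Y) * t00 (X + k) + t01 (X - Y + k) * t11 (X + Y) * t00 (X - k)) * t10 X
     = t01 k * t11 (2 * X) * t10 Y * t00 (Y - k)"
proof -
  have s0: "X - k/2 + (Y - k/2) = X + Y - k" "X - k/2 - (Y - k/2) = X - Y" "X + k/2 + k/2 = X + k"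
     "X + k/2 - k/2 = X" "X + k/2 + (Y - k/2) = X + Y" "X + k/2 - (Y - k/2) = X - Y + k" "X - k/2 + k/2 = X"
     "X - k/2 - k/2 = X - k" "X + k/2 + (X - k/2) = 2 * X" "X + k/2 - (X - k/2) = k" "Y - k/2 + k/2 = Y"
     "Y - k/2 - k/2 = Y - k" by (auto simp: field_simps)
  show "(t11 (X + Y - k) * t11 (X - Y) * t00 (X + k) - t11 (X - Y + k) * t11 (X + Y) * t00 (X - k)) * t00 X
     = - (t11 k * t11 (2 * X) * t00 Y * t00 (Y - k))"
    using three_term[of "X - k/2" "Y - k/2" "X + k/2" "k/2"] unfolding s0 by algebra
  have s2: "X + Y/2 + Y/2 = X + Y" "X + Y/2 - Y/2 = X" "X - Y/2 + (k - Y/2) = X - Y + k"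
     "X - Y/2 - (k - Y/2) = X - k" "X - Y/2 + Y/2 = X" "X - Y/2 - Y/2 = X - Y"
     "X + Y/2 + (k - Y/2) = X + k" "X + Y/2 - (k - Y/2) = X + Y - k" "X - Y/2 + (X + Y/2) = 2 * X"
     "X - Y/2 - (X + Y/2) = - Y" "Y/2 + (k - Y/2) = k" "Y/2 - (k - Y/2) = Y - k" by (auto simp: field_simps)
  show "(t00 (X + Y - k) * t11 (X - Y) * t00 (X + k) - t00 (X - Y + k) * t11 (X + Y) * t00 (X - k)) * t11 X
     = - (t00 k * t11 (2 * X) * t11 Y * t00 (Y - k))"
    using three_term[of "X + Y/2" "Y/2" "X - Y/2" "k - Y/2"] unfolding s2 odd_t11 by algebra
  have s1: "X - k/2 - 1/4 + (Y - k/2 - 1/4) = X + Y - k - 1/2" "X - k/2 - 1/4 - (Y - k/2 - 1/4) = X - Y"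
     "X + k/2 + 1/4 + (k/2 - 1/4) = X + k" "X + k/2 + 1/4 - (k/2 - 1/4) = X + 1/2"
     "X + k/2 + 1/4 + (Y - k/2 - 1/4) = X + Y" "X + k/2 + 1/4 - (Y - k/2 - 1/4) = X - Y + k + 1/2"
     "X - k/2 - 1/4 + (k/2 - 1/4) = X - 1/2" "X - k/2 - 1/4 - (k/2 - 1/4) = X - k"
     "X + k/2 + 1/4 + (X - k/2 - 1/4) = 2 * X" "X + k/2 + 1/4 - (X - k/2 - 1/4) = k + 1/2"
     "Y - k/2 - 1/4 + (k/2 - 1/4) = Y - 1/2" "Y - k/2 - 1/4 - (k/2 - 1/4) = Y - k" by (auto simp: field_simps)
  show "(t10 (X + Y - k) * t11 (X - Y) * t00 (X + k) + t10 (X - Y + k) * t11 (X + Y) * t00 (X - k)) * t01 X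
     = t10 k * t11 (2 * X) * t01 Y * t00 (Y - k)"
    using three_term[of "X - k/2 - 1/4" "Y - k/2 - 1/4" "X + k/2 + 1/4" "k/2 - 1/4"]
    unfolding s1 t10_eq(2)[symmetric] t01_eq[symmetric] theta_half_period(4) by algebra
  have s3: "X + Y/2 + 1/4 + (Y/2 - 1/4) = X + Y" "X + Y/2 + 1/4 - (Y/2 - 1/4) = X + 1/2"
     "X - Y/2 - 1/4 + (k - Y/2 - 1/4) = X - Y + k - 1/2" "X - Y/2 - 1/4 - (k - Y/2 - 1/4) = X - k"
     "X - Y/2 - 1/4 + (Y/2 - 1/4) = X - 1/2" "X - Y/2 - 1/4 - (Y/2 - 1/4) = X - Y"
     "X + Y/2 + 1/4 + (k - Y/2 - 1/4) = X + k" "X + Y/2 + 1/4 - (k - Y/2 - 1/4) = X + Y - k + 1/2"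
     "X - Y/2 - 1/4 + (X + Y/2 + 1/4) = 2 * X" "X - Y/2 - 1/4 - (X + Y/2 + 1/4) = - (Y + 1/2)"
     "Y/2 - 1/4 + (k - Y/2 - 1/4) = k - 1/2" "Y/2 - 1/4 - (k - Y/2 - 1/4) = Y - k" by (auto simp: field_simps)
  show "(t01 (X + Y - k) * t11 (X - Y) * t00 (X + k) + t01 (X - Y + k) * t11 (X + Y) * t00 (X - k)) * t10 X
     = t01 k * t11 (2 * X) * t10 Y * t00 (Y - k)"
    using three_term[of "X + Y/2 + 1/4" "Y/2 - 1/4" "X - Y/2 - 1/4" "k - Y/2 - 1/4"]
    unfolding s3 odd_t11 t10_eq(2)[symmetric] t01_eq[symmetric] theta_half_period(4) by algebra
qed

lemma duplication: "t11 (2 * X) * (t00 0 * t10 0 * t01 0) = 2 * (t00 X * t01 X * t10 X * t11 X)"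
proof -
  have "(t01 X * t10 X * t00 X + t01 X * t10 X * t00 X) * t11 X = t00 0 * t11 (2 * X) * t10 0 * t01 0"
    using kernel_identities(3)[of X "1/2" 0] theta_half_period(4)[of 0 \<tau>] theta_half_period(1)[of 0 \<tau>]
    by (simp add: theta_half_period t10_eq(2)[symmetric] t01_eq(2)[symmetric])
  then show ?thesis by (simp add: algebra_simps)
qed

text \<open>The index of the theta function by which the identity with index \<open>a\<close> in \<open>kernel_identities\<close> is multiplied.\<close>

definition dual_idx :: "nat \<Rightarrow> nat" where
  "dual_idx a = (if a = 0 then 2 else if a = 1 then 3 else if a = 2 then 0 else 1)"

definition sgn_idx :: "nat \<Rightarrow> complex" where
  "sgn_idx a = (if a = 0 \<or> a = 2 then - 1 else 1)"

abbreviation "tx a z \<equiv> theta_idx a z \<tau>"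

text \<open>By the duplication formula \<open>t11 (2 * X)\<close> is a constant times the product of the four theta functions at \<open>X\<close>.
  The cofactor is what remains after the division by the one with index \<open>dual_idx a\<close>.\<close>

definition cofactor :: "nat \<Rightarrow> complex \<Rightarrow> complex" where
  "cofactor a X = 2 * (if a = 0 then t01 X * t10 X * t11 X else if a = 1 then t00 X * t10 X * t11 X
      else if a = 2 then t00 X * t01 X * t10 X else t00 X * t01 X * t11 X) / (t00 0 * t10 0 * t01 0)"

lemma cofactor: "t11 (2 * X) = cofactor a X * tx (dual_idx a) X"
proof -
  have "t00 0 * t10 0 * t01 0 \<noteq> 0"
    using t00_nonzero_real[of 0] t01_nonzero_real[of 0] t10_0_nonzero by simp
  then show ?thesis using duplication[of X]
    by (auto simp: cofactor_def dual_idx_def theta_idx_def field_simps)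
qed

lemma cofactor_odd: "cofactor a (- X) * tx (dual_idx a) (- Y) = - (cofactor a X * tx (dual_idx a) Y)"
  by (auto simp: cofactor_def dual_idx_def theta_idx_def theta_minus)

lemma holo_tx: "(\<lambda>z. tx a z) holomorphic_on UNIV"
  by (auto simp: theta_idx_def holo_theta)

lemma holo_cofactor: "(\<lambda>z. cofactor a z) holomorphic_on UNIV"
  unfolding cofactor_def by (cases "a = 0"; cases "a = 1"; cases "a = 2")
   (auto intro!: holomorphic_intros holo_theta simp del: times_divide_eq_right)

lemma tx_nonzero: "\<exists>z. tx a z \<noteq> 0"
  using theta_idx_nonzero[of "1/4" a] by auto

text \<open>The left hand side is the numerator that appears when the two integrands in the proof of self-adjointness
  are brought to a common denominator. The factor \<open>t00 (Y - k)\<close> on the right cancels the only pole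
  in the way of a change of contour. The identity follows from \<open>kernel_identities\<close> by cancelling a theta function of \<open>X\<close>.\<close>

lemma kernel_identity:
  assumes "a \<le> 3"
  shows "tx a (X + Y - k) * t11 (X - Y) * t00 (X + k) + sgn_idx a * (tx a (X - Y + k) * t11 (X + Y) * t00 (X - k))
     = sgn_idx a * (tx a k * cofactor a X * tx (dual_idx a) Y * t00 (Y - k))"
proof -
  define F where "F X = tx a (X + Y - k) * t11 (X - Y) * t00 (X + k) + sgn_idx a * (tx a (X - Y + k) * t11 (X + Y) * t00 (X - k))" for X
  define G where "G X = sgn_idx a * (tx a k * cofactor a X * tx (dual_idx a) Y * t00 (Y - k))" for X
  have sh: "(\<lambda>z. theta_idx c (z + w) \<tau>) holomorphic_on UNIV" for c w
    using entire_shift[OF holo_tx, of c 1 w] by simp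
  have sh': "(\<lambda>z. theta c d (z + w) \<tau>) holomorphic_on UNIV" for c d w
    using entire_shift[OF holo_theta, of c d 1 w] by simp
  obtain p where p: "tx (dual_idx a) p \<noteq> 0" using tx_nonzero by blast
  have "F = G"
  proof (rule entire_cancel[OF _ _ holo_tx p])
    show "F holomorphic_on UNIV"
      unfolding F_def diff_conv_add_uminus add.assoc by (intro holomorphic_intros sh sh')
    show "G holomorphic_on UNIV"
      unfolding G_def by (intro holomorphic_intros holo_cofactor)
    show "tx (dual_idx a) X * F X = tx (dual_idx a) X * G X" for X
    proof -
      have "tx (dual_idx a) X * G X = sgn_idx a * (tx a k * t11 (2 * X) * tx (dual_idx a) Y * t00 (Y - k))"
        unfolding G_def cofactor[of X a] by (simp add: mult_ac)
      moreover have "a = 0 \<or> a = 1 \<or> a = 2 \<or> a = 3" using assms by linarith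
      ultimately show ?thesis
        unfolding F_def using kernel_identities[of X Y k]
        by (auto simp: sgn_idx_def theta_idx_def dual_idx_def mult_ac)
    qed
  qed
  then show ?thesis unfolding F_def G_def by (rule fun_cong)
qed

subsection \<open>Factorisation of the L-operator\<close>

text \<open>The minus sign makes the product of a row and a column the determinant in \<open>brackets\<close>; a row and the column
  with the same argument annihilate each other.\<close>

definition colv :: "complex \<Rightarrow> 2 \<Rightarrow> complex" where
  "colv y \<alpha> = (if \<alpha> = 1 then al y else - be y)"

definition rowv :: "complex \<Rightarrow> 2 \<Rightarrow> complex" where
  "rowv y \<alpha> = (if \<alpha> = 1 then be y else al y)"

lemma two_cases: "(\<alpha> :: 2) = 1 \<or> \<alpha> = 2" using exhaust_2 .

lemma L_factorised:
  "(\<Sum>a\<le>3. (if a = 2 then \<i> else 1) * tx a u * tx a (2 * z) * (pauli a $ \<alpha> $ \<beta>))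
     = colv (u/2 - z) \<alpha> * rowv (u/2 + z) \<beta>"
proof -
  have s: "u/2 + z + (u/2 - z) = u" "u/2 + z - (u/2 - z) = 2 * z" by auto
  have e: "{..3::nat} = {0,1,2,3}" by auto
  show ?thesis
    using two_cases[of \<alpha>] two_cases[of \<beta>] products[of "u/2 + z" "u/2 - z"]
    unfolding s e 
    by (auto simp: pauli_def theta_idx_def colv_def rowv_def vector_2 mult_ac)
qed

lemma row_times_col: "(\<Sum>\<beta>\<in>UNIV. rowv x \<beta> * colv y \<beta>) = 2 * (t11 (x + y) * t11 (x - y))"
  unfolding brackets by (simp add: sum_2 rowv_def colv_def)

end

section \<open>The local space and the generators\<close>

lemma quasi_periodic_of_int:
  fixes f :: "complex \<Rightarrow> complex"
  assumes "\<And>z. f (z + \<tau>) = exp (K * (2 * z + \<tau>)) * f z"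
  shows "f (z + of_int n * \<tau>) = exp (K * (2 * of_int n * z + (of_int n)\<^sup>2 * \<tau>)) * f z"
proof (induction n rule: int_induct[of _ 0])
  case (step1 i)
  have "f (z + of_int (i + 1) * \<tau>) = f (z + of_int i * \<tau> + \<tau>)" by (simp add: algebra_simps)
  also have "\<dots> = exp (K * (2 * (z + of_int i * \<tau>) + \<tau>) + K * (2 * of_int i * z + (of_int i)\<^sup>2 * \<tau>)) * f z"
    unfolding assms step1 exp_add by simp
  also have "K * (2 * (z + of_int i * \<tau>) + \<tau>) + K * (2 * of_int i * z + (of_int i)\<^sup>2 * \<tau>)
     = K * (2 * of_int (i + 1) * z + (of_int (i + 1))\<^sup>2 * \<tau>)"
    by (simp add: algebra_simps power2_eq_square)
  finally show ?case .
next
  case (step2 i)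
  define w where "w = z + of_int (i - 1) * \<tau>"
  have "exp (K * (2 * w + \<tau>)) * f w = exp (K * (2 * of_int i * z + (of_int i)\<^sup>2 * \<tau>)) * f z"
    using assms[of w] step2(2) by (simp add: w_def algebra_simps)
  then have "exp (- (K * (2 * w + \<tau>))) * (exp (K * (2 * w + \<tau>)) * f w)
     = exp (- (K * (2 * w + \<tau>))) * (exp (K * (2 * of_int i * z + (of_int i)\<^sup>2 * \<tau>)) * f z)" by simp
  then have "f w = exp (- (K * (2 * w + \<tau>)) + K * (2 * of_int i * z + (of_int i)\<^sup>2 * \<tau>)) * f z"
    by (simp only: mult.assoc[symmetric] exp_add[symmetric]) simp
  also have "- (K * (2 * w + \<tau>)) + K * (2 * of_int i * z + (of_int i)\<^sup>2 * \<tau>)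
     = K * (2 * of_int (i - 1) * z + (of_int (i - 1))\<^sup>2 * \<tau>)"
    by (simp add: w_def algebra_simps power2_eq_square)
  finally show ?case by (simp add: w_def)
qed simp

locale sklyanin = theta_tau +
  fixes \<eta> l :: real
  assumes l_pos: "l > 0" and l_half: "2 * l \<in> \<int>"
    and eta_nonzero: "\<eta> \<noteq> 0" and eta_le: "\<bar>\<eta>\<bar> \<le> 1 / (2 * (2 * l + 1))"
begin

abbreviation "V \<equiv> Theta_space \<tau> l"
abbreviation "n2 \<equiv> twice l"

lemma n2: "real n2 = 2 * l"
  using l_half l_pos by (auto simp: twice_def elim!: Ints_cases)

lemma n2_complex: "complex_of_nat n2 = 2 * of_real l"
  using n2 by (metis of_real_mult of_real_numeral of_real_of_nat_eq)

lemma n2_ge: "n2 \<ge> 1"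
proof -
  have "real n2 > 0" using n2 l_pos by simp
  then show ?thesis by simp
qed

lemma l_ge: "2 * l \<ge> 1" using n2 n2_ge by linarith

lemma exp_l_of_int: "exp (4 * of_real l * pi * \<i> * of_int k) = (1 :: complex)"
proof -
  have "complex_of_real (4 * of_real l * pi) * \<i> * of_int k = of_int (2 * (int n2 * k)) * of_real pi * (\<i> :: complex)"
    using n2_complex by simp
  then show ?thesis by (simp only: exp_of_int_pi)
qed

lemma eta_quarter: "\<bar>\<eta>\<bar> \<le> 1/4"
proof -
  have "1 / (2 * (2 * l + 1)) \<le> 1 / 4" using l_ge by (intro divide_left_mono) auto
  then show ?thesis using eta_le by linarith
qed

lemma tx_eta_nonzero: "tx a (of_real \<eta>) \<noteq> 0"
  by (rule theta_idx_nonzero[OF eta_nonzero eta_quarter])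

lemma V_I:
  assumes "f holomorphic_on UNIV" "\<And>z. f (z + 1) = f z" "\<And>z. f (- z) = f z"
    "\<And>z. f (z + \<tau>) = exp (- 4 * l * pi * \<i> * (2 * z + \<tau>)) * f z"
  shows "f \<in> V"
  using assms by (simp add: Theta_space_def)

lemma V_D:
  assumes "f \<in> V"
  shows V_holo: "f holomorphic_on UNIV" and V_1: "f (z + 1) = f z" and V_even: "f (- z) = f z"
    and V_tau: "f (z + \<tau>) = exp (- 4 * l * pi * \<i> * (2 * z + \<tau>)) * f z"
  using assms by (auto simp: Theta_space_def)

lemma V_zero: "(\<lambda>_. 0) \<in> V" by (rule V_I) auto

lemma V_lin: "f \<in> V \<Longrightarrow> g \<in> V \<Longrightarrow> (\<lambda>z. c * f z + g z) \<in> V"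
  by (rule V_I) (auto simp: V_D algebra_simps intro!: holomorphic_intros)

lemma V_scale: "f \<in> V \<Longrightarrow> (\<lambda>z. c * f z) \<in> V"
  using V_lin[OF _ V_zero, of f c] by simp

lemma V_sum: "(\<And>i. i \<in> I \<Longrightarrow> f i \<in> V) \<Longrightarrow> (\<lambda>z. \<Sum>i\<in>I. c i * f i z) \<in> V"
  by (induction I rule: infinite_finite_induct) (auto intro: V_lin V_zero)

abbreviation "s a z \<equiv> s_fun \<tau> \<eta> a z"

text \<open>\<open>rho\<close> multiplied by \<open>theta 1 1 (2 * z) \<tau>\<close>.\<close>

definition rho_numerator :: "nat \<Rightarrow> (complex \<Rightarrow> complex) \<Rightarrow> complex \<Rightarrow> complex" where
  "rho_numerator a f z = s a (z - l * \<eta>) * f (z + \<eta>) - s a (- z - l * \<eta>) * f (z - \<eta>)"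

lemma theta_add_2: "theta a b (z + 2) \<tau> = theta a b z \<tau>"
  using theta_add_1[of a b "z + 1" \<tau>] theta_add_1[of a b z \<tau>]
  by (simp add: add.assoc power_add[symmetric])

lemma tx_add_1: "tx a (z + 2) = tx a z"
  by (simp add: theta_idx_def theta_add_2)

lemma theta_add_2tau: "theta a b (z + \<tau> + \<tau>) \<tau> = exp (- 4 * pi * \<i> * (z + \<tau>)) * theta a b z \<tau>"
proof -
  have "theta a b (z + \<tau> + \<tau>) \<tau> = (-1) ^ b * (-1) ^ b *
      (exp (- pi * \<i> * \<tau> - 2 * pi * \<i> * (z + \<tau>)) * exp (- pi * \<i> * \<tau> - 2 * pi * \<i> * z)) * theta a b z \<tau>"
    unfolding theta_add_tau by simp
  also have "(-1 :: complex) ^ b * (-1) ^ b = 1" by (simp add: power_add[symmetric])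
  also have "exp (- pi * \<i> * \<tau> - 2 * pi * \<i> * (z + \<tau>)) * exp (- pi * \<i> * \<tau> - 2 * pi * \<i> * z)
     = exp (- 4 * pi * \<i> * (z + \<tau>))"
    unfolding exp_add[symmetric] by (rule arg_cong[where f = exp]) (simp add: algebra_simps)
  finally show ?thesis by simp
qed

lemma tx_add_2tau: "tx a (z + 2 * \<tau>) = exp (- 4 * pi * \<i> * (z + \<tau>)) * tx a z"
  using theta_add_2tau[of _ _ z] by (simp add: theta_idx_def add.assoc)

lemma s_1: "s a (z + 1) = s a z"
  using tx_add_1[of a "2 * z"] by (simp add: s_fun_def algebra_simps)

lemma s_tau: "s a (z + \<tau>) = exp (- 4 * pi * \<i> * (2 * z + \<tau>)) * s a z"
  using tx_add_2tau[of a "2 * z"] by (simp add: s_fun_def algebra_simps)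

lemma s_minus_tau: "s a (z - \<tau>) = exp (4 * pi * \<i> * (2 * z - \<tau>)) * s a z"
proof -
  have "s a z = exp (- 4 * pi * \<i> * (2 * z - \<tau>)) * s a (z - \<tau>)"
    using s_tau[of a "z - \<tau>"] by (simp add: algebra_simps)
  then have "exp (4 * pi * \<i> * (2 * z - \<tau>)) * s a z =
     exp (4 * pi * \<i> * (2 * z - \<tau>) + (- 4 * pi * \<i> * (2 * z - \<tau>))) * s a (z - \<tau>)"
    by (simp only: exp_add mult.assoc)
  then show ?thesis by simp
qed

lemma rho_numerator_props:
  assumes f: "f \<in> V"
  shows rho_numerator_holo: "rho_numerator a f holomorphic_on UNIV" and rho_numerator_odd: "rho_numerator a f (- z) = - rho_numerator a f z"
    and rho_numerator_1: "rho_numerator a f (z + 1) = rho_numerator a f z"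
    and rho_numerator_tau: "rho_numerator a f (z + \<tau>) = exp (- 4 * (l + 1) * pi * \<i> * (2 * z + \<tau>)) * rho_numerator a f z"
proof -
  have sh: "(\<lambda>z. s a (b * z + c)) holomorphic_on UNIV" for b c
  proof -
    have "(\<lambda>z. tx a ((2 * b) * z + (2 * c))) holomorphic_on UNIV" by (rule entire_shift[OF holo_tx])
    then show ?thesis unfolding s_fun_def by (intro holomorphic_intros) (simp add: algebra_simps)
  qed
  have fh: "(\<lambda>z. f (z + c)) holomorphic_on UNIV" for c
    using entire_shift[OF V_holo[OF f], of 1 c] by simp
  show "rho_numerator a f holomorphic_on UNIV"
    using sh[of 1 "- of_real (l * \<eta>)"] sh[of "-1" "- of_real (l * \<eta>)"] fh[of "of_real \<eta>"] fh[of "- of_real \<eta>"]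
    unfolding rho_numerator_def[abs_def] by (auto intro!: holomorphic_intros)
  show "rho_numerator a f (- z) = - rho_numerator a f z"
    using V_even[OF f, of "z - \<eta>"] V_even[OF f, of "z + \<eta>"] by (simp add: rho_numerator_def)
  have s_m1: "s a (w - 1) = s a w" for w using s_1[of a "w - 1"] by simp
  show "rho_numerator a f (z + 1) = rho_numerator a f z"
  proof -
    have r: "z + 1 - l * \<eta> = (z - l * \<eta>) + 1" "z + 1 + \<eta> = (z + \<eta>) + 1"
      "- (z + 1) - l * \<eta> = (- z - l * \<eta>) - 1" "z + 1 - \<eta> = (z - \<eta>) + 1" by auto
    show ?thesis by (simp only: rho_numerator_def r s_1 s_m1 V_1[OF f])
  qed
  let ?E = "exp (- 4 * (l + 1) * pi * \<i> * (2 * z + \<tau>))"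
  have e1: "s a (z + \<tau> - l * \<eta>) * f (z + \<tau> + \<eta>) = ?E * (s a (z - l * \<eta>) * f (z + \<eta>))"
  proof -
    have r: "z + \<tau> - l * \<eta> = (z - l * \<eta>) + \<tau>" "z + \<tau> + \<eta> = (z + \<eta>) + \<tau>" by auto
    show ?thesis unfolding r s_tau V_tau[OF f]
      by (simp add: exp_add[symmetric] algebra_simps)
  qed
  have e2: "s a (- (z + \<tau>) - l * \<eta>) * f (z + \<tau> - \<eta>) = ?E * (s a (- z - l * \<eta>) * f (z - \<eta>))"
  proof -
    have r: "- (z + \<tau>) - l * \<eta> = (- z - l * \<eta>) - \<tau>" "z + \<tau> - \<eta> = (z - \<eta>) + \<tau>" by auto
    show ?thesis unfolding r s_minus_tau V_tau[OF f]
      by (simp add: exp_add[symmetric] algebra_simps)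
  qed
  show "rho_numerator a f (z + \<tau>) = ?E * rho_numerator a f z"
    unfolding rho_numerator_def e1 e2 by (simp add: algebra_simps)
qed

text \<open>At a zero of \<open>t11 (2 * z)\<close> the points \<open>z\<close> and \<open>- z\<close> differ by a period with multiplier \<open>1\<close>, while
  the numerator is odd.\<close>

lemma rho_numerator_vanishes:
  assumes f: "f \<in> V" and z: "t11 (2 * z) = 0"
  shows "rho_numerator a f z = 0"
proof -
  obtain m k :: int where mk: "2 * z = of_int m + of_int k * \<tau>" using z by (auto simp: t11_zero_iff)
  have "z = - z + of_int m * 1 + of_int k * \<tau>" using mk by (simp add: algebra_simps)
  then have "rho_numerator a f z = rho_numerator a f (- z + of_int m * 1 + of_int k * \<tau>)" by (rule arg_cong)
  also have "\<dots> = exp ((- 4 * (l + 1) * pi * \<i>) * (2 * of_int k * (- z + of_int m * 1) + (of_int k)\<^sup>2 * \<tau>))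
      * rho_numerator a f (- z + of_int m * 1)"
    by (rule quasi_periodic_of_int) (simp add: rho_numerator_tau[OF f])
  also have "2 * of_int k * (- z + of_int m * 1) + (of_int k)\<^sup>2 * \<tau> = of_int (k * m)"
  proof -
    have "2 * of_int k * (- z + of_int m * 1) + (of_int k)\<^sup>2 * \<tau> =
        of_int k * (- (2 * z) + 2 * of_int m + of_int k * \<tau>)" by (simp add: algebra_simps power2_eq_square)
    then show ?thesis unfolding mk by simp
  qed
  also have "exp ((- 4 * (l + 1) * pi * \<i>) * of_int (k * m)) =
     exp (4 * of_real l * pi * \<i> * of_int (- (k * m))) * exp (of_int (2 * (- 2 * k * m)) * of_real pi * \<i>)"
    unfolding exp_add[symmetric] by (rule arg_cong[where f = exp]) (simp add: algebra_simps)
  also have "\<dots> = 1" by (simp only: exp_l_of_int exp_of_int_pi mult_1)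
  also have "rho_numerator a f (- z + of_int m * 1) = rho_numerator a f (- z)"
    by (rule periodic_of_int) (rule rho_numerator_1[OF f])
  also have "rho_numerator a f (- z) = - rho_numerator a f z" by (rule rho_numerator_odd[OF f])
  finally show ?thesis by simp
qed

lemma holo_t11_double: "(\<lambda>z. t11 (2 * z)) holomorphic_on UNIV"
  using entire_shift[OF holo_theta, of 1 1 2 0] by simp

lemma t11_double_nonzero: "\<exists>z. t11 (2 * z) \<noteq> 0"
proof -
  obtain w where "t11 w \<noteq> 0" using t00_nonzero_at by blast
  then show ?thesis by (intro exI[of _ "w/2"]) simp
qed

lemma cancel_t11_double:
  assumes "f holomorphic_on UNIV" "g holomorphic_on UNIV" "\<And>z. t11 (2 * z) * f z = t11 (2 * z) * g z"
  shows "f = g"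
proof -
  obtain p where "t11 (2 * p) \<noteq> 0" using t11_double_nonzero by blast
  then show ?thesis by (intro entire_cancel[OF assms(1,2) holo_t11_double _ assms(3)])
qed

abbreviation "rho_l \<equiv> rho \<tau> \<eta> l"

text \<open>The numerator vanishes at the zeros of \<open>t11 (2 * z)\<close>, which are simple. So the quotient is entire, and
  \<open>remove_sings\<close> returns it. From here on \<open>rho\<close> is used through this product formula.\<close>

lemma rho_characterisation:
  assumes f: "f \<in> V"
  shows rho_holo: "rho_l a f holomorphic_on UNIV" and rho_mult: "t11 (2 * z) * rho_l a f z = rho_numerator a f z"
proof -
  have simple: "deriv (\<lambda>z. t11 (2 * z)) z \<noteq> 0" if z: "t11 (2 * z) = 0" for z
  proof -
    have "((\<lambda>z. t11 z) has_field_derivative deriv (\<lambda>z. t11 z) (2 * z)) (at (2 * z))"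
      by (rule holomorphic_derivI[OF holo_theta]) auto
    then have "((\<lambda>z. t11 (2 * z)) has_field_derivative deriv (\<lambda>z. t11 z) (2 * z) * 2) (at z)"
      by (rule DERIV_chain2[where g = "\<lambda>z. 2 * z"]) (rule DERIV_cmult_Id)
    then have "deriv (\<lambda>z. t11 (2 * z)) z = deriv (\<lambda>z. t11 z) (2 * z) * 2" by (rule DERIV_imp_deriv)
    then show ?thesis using t11_simple_zero[OF z] by simp
  qed
  obtain g where g: "g holomorphic_on UNIV" "\<And>z. rho_numerator a f z = t11 (2 * z) * g z"
    using entire_division[OF rho_numerator_holo[OF f] holo_t11_double rho_numerator_vanishes[OF f] simple] by blast
  have "rho_l a f z = g z" for z
  proof -
    obtain p where p: "t11 (2 * p) \<noteq> 0" using t11_double_nonzero by blast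
    have "\<forall>\<^sub>F w in at z. t11 (2 * w) \<noteq> 0 \<and> w \<in> UNIV"
      by (rule non_zero_neighbour_alt[OF holo_t11_double _ _ _ _ p]) auto
    then have ev: "\<forall>\<^sub>F w in at z. rho_numerator a f w / t11 (2 * w) = g w"
      by (rule eventually_mono) (use g(2) in auto)
    have "rho_l a f z = remove_sings (\<lambda>w. rho_numerator a f w / t11 (2 * w)) z"
      unfolding rho_def rho_numerator_def by simp
    also have "\<dots> = remove_sings g z" by (rule remove_sings_cong[OF ev refl])
    also have "\<dots> = g z" using g(1) by (intro remove_sings_at_analytic) (auto simp: analytic_on_holomorphic)
    finally show ?thesis .
  qed
  then have "rho_l a f = g" by auto
  then show "rho_l a f holomorphic_on UNIV" "t11 (2 * z) * rho_l a f z = rho_numerator a f z" using g by auto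
qed

lemma t11_2_1: "t11 (2 * (z + 1)) = t11 (2 * z)"
  using tx_add_1[of 0 "2 * z"] by (simp add: theta_idx_def algebra_simps)

lemma t11_2_tau: "t11 (2 * (z + \<tau>)) = exp (- 4 * pi * \<i> * (2 * z + \<tau>)) * t11 (2 * z)"
  using tx_add_2tau[of 0 "2 * z"] by (simp add: theta_idx_def algebra_simps)

lemma rho_V:
  assumes f: "f \<in> V"
  shows "rho_l a f \<in> V"
proof (rule V_I)
  let ?g = "rho_l a f"
  show hol: "?g holomorphic_on UNIV" by (rule rho_holo[OF f])
  have sh: "(\<lambda>z. ?g (b * z + c)) holomorphic_on UNIV" for b c by (rule entire_shift[OF hol])
  have "(\<lambda>z. ?g (z + 1)) = ?g"
    by (rule cancel_t11_double) (use sh[of 1 1] hol rho_mult[OF f] rho_numerator_1[OF f] t11_2_1 in \<open>auto, metis\<close>)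
  then show "?g (z + 1) = ?g z" for z by (rule fun_cong)
  have "(\<lambda>z. ?g (- z)) = ?g"
  proof (rule cancel_t11_double)
    show "t11 (2 * z) * ?g (- z) = t11 (2 * z) * ?g z" for z
      using rho_mult[OF f, of "- z" a] rho_mult[OF f, of z a] rho_numerator_odd[OF f, of a z] odd_t11[of "2 * z"]
      by (simp add: neg_eq_iff_add_eq_0 add_eq_0_iff)
  qed (use sh[of "-1" 0] hol in auto)
  then show "?g (- z) = ?g z" for z by (rule fun_cong)
  have "(\<lambda>z. ?g (z + \<tau>)) = (\<lambda>z. exp (- 4 * l * pi * \<i> * (2 * z + \<tau>)) * ?g z)"
  proof (rule cancel_t11_double)
    fix z
    let ?e = "exp (- 4 * pi * \<i> * (2 * z + \<tau>))" and ?e' = "exp (- 4 * l * pi * \<i> * (2 * z + \<tau>))"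
    have "?e * (t11 (2 * z) * ?g (z + \<tau>)) = exp (- 4 * (l + 1) * pi * \<i> * (2 * z + \<tau>)) * (t11 (2 * z) * ?g z)"
      using rho_mult[OF f, of "z + \<tau>" a] unfolding t11_2_tau rho_numerator_tau[OF f] rho_mult[OF f, of z] by (simp add: mult.assoc)
    also have "exp (- 4 * (l + 1) * pi * \<i> * (2 * z + \<tau>)) = ?e * ?e'"
      unfolding exp_add[symmetric] by (rule arg_cong[where f = exp]) (simp add: algebra_simps)
    finally have "?e * (t11 (2 * z) * ?g (z + \<tau>)) = ?e * (t11 (2 * z) * (?e' * ?g z))" by (simp add: mult_ac)
    then show "t11 (2 * z) * ?g (z + \<tau>) = t11 (2 * z) * (?e' * ?g z)"
      by (simp only: mult_cancel_left exp_not_eq_zero simp_thms)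
  qed (use sh[of 1 \<tau>] hol in \<open>auto intro!: holomorphic_intros\<close>)
  then show "?g (z + \<tau>) = exp (- 4 * l * pi * \<i> * (2 * z + \<tau>)) * ?g z" for z by (rule fun_cong)
qed

lemma rho_linear:
  assumes f: "f \<in> V" and g: "g \<in> V"
  shows "rho_l a (\<lambda>z. c * f z + g z) = (\<lambda>z. c * rho_l a f z + rho_l a g z)"
proof (rule cancel_t11_double)
  show "t11 (2 * z) * rho_l a (\<lambda>z. c * f z + g z) z = t11 (2 * z) * (c * rho_l a f z + rho_l a g z)" for z
  proof -
    have "t11 (2 * z) * (c * rho_l a f z + rho_l a g z) = c * (t11 (2 * z) * rho_l a f z) + t11 (2 * z) * rho_l a g z"
      by (simp add: algebra_simps)
    then show ?thesis unfolding rho_mult[OF f] rho_mult[OF g] rho_mult[OF V_lin[OF f g]]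
      by (simp add: rho_numerator_def algebra_simps)
  qed
qed (use f g in \<open>auto intro!: holomorphic_intros rho_holo V_lin\<close>)

section \<open>The L-operator and the intertwining vectors\<close>

definition L_entry :: "complex \<Rightarrow> 2 \<Rightarrow> 2 \<Rightarrow> (complex \<Rightarrow> complex) \<Rightarrow> complex \<Rightarrow> complex" where
  "L_entry u \<alpha> \<beta> f z = (\<Sum>a\<le>3. W_L \<tau> \<eta> a u * (pauli a $ \<alpha> $ \<beta>) * rho_l a f z)"

lemma L_entry_V: "f \<in> V \<Longrightarrow> L_entry u \<alpha> \<beta> f \<in> V"
  unfolding L_entry_def[abs_def] by (rule V_sum) (rule rho_V)

lemma L_entry_mult:
  assumes f: "f \<in> V"
  shows "t11 (2 * z) * L_entry u \<alpha> \<beta> f z =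
     colv (u/2 - (z - l * \<eta>)) \<alpha> * rowv (u/2 + (z - l * \<eta>)) \<beta> * f (z + \<eta>)
   - colv (u/2 - (- z - l * \<eta>)) \<alpha> * rowv (u/2 + (- z - l * \<eta>)) \<beta> * f (z - \<eta>)"
proof -
  have W: "W_L \<tau> \<eta> a u * s a x = (if a = 2 then \<i> else 1) * tx a u * tx a (2 * x)" for a x
    using tx_eta_nonzero[of a] by (simp add: W_L_def s_fun_def)
  have "t11 (2 * z) * L_entry u \<alpha> \<beta> f z = (\<Sum>a\<le>3. W_L \<tau> \<eta> a u * (pauli a $ \<alpha> $ \<beta>) * rho_numerator a f z)"
    unfolding L_entry_def sum_distrib_left rho_mult[OF f, symmetric] by (simp add: mult_ac)
  also have "\<dots> = (\<Sum>a\<le>3. (W_L \<tau> \<eta> a u * s a (z - l * \<eta>)) * (pauli a $ \<alpha> $ \<beta>)) * f (z + \<eta>)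
      - (\<Sum>a\<le>3. (W_L \<tau> \<eta> a u * s a (- z - l * \<eta>)) * (pauli a $ \<alpha> $ \<beta>)) * f (z - \<eta>)"
    unfolding sum_distrib_right sum_subtractf[symmetric] rho_numerator_def
    by (rule sum.cong) (auto simp: algebra_simps)
  finally show ?thesis unfolding W L_factorised .
qed

text \<open>The vector \<open>omega\<close> in a centred variable: the zeros of \<open>om p\<close> lie in strings that are symmetric about \<open>p\<close> and \<open>- p\<close>,
  which makes the symmetry \<open>om (- p) = om p\<close> visible.\<close>

definition om :: "complex \<Rightarrow> complex \<Rightarrow> complex" where
  "om p = bracket2 \<tau> \<eta> n2 (p + (1 - 2 * l) * \<eta>)"

lemma omega_eq_om: "omega \<tau> \<eta> l lam u v = om ((lam + u - v) / 2 + l * \<eta>)"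
proof -
  have "(lam + u - v) / 2 + complex_of_real ((- l + 1) * \<eta>) = (lam + u - v) / 2 + l * \<eta> + (1 - 2 * l) * \<eta>"
    by (simp add: algebra_simps)
  then show ?thesis unfolding omega_def om_def by (rule arg_cong)
qed

definition centred_shift :: "nat \<Rightarrow> real" where
  "centred_shift j = (2 * real j + 1 - 2 * l) * \<eta>"

lemma om_prod:
  fixes p z :: complex
  shows "om p z = (\<Prod>j<n2. t11 (z + p + centred_shift j) * t11 (- z + p + centred_shift j))"
  unfolding om_def bracket2_def bracket_def prod.distrib[symmetric]
  by (rule prod.cong) (auto simp: centred_shift_def algebra_simps)

lemma bracket_Suc_shift: fixes x :: complex shows "bracket \<tau> \<eta> (Suc k) x = t11 x * bracket \<tau> \<eta> k (x + 2 * \<eta>)"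
  unfolding bracket_def by (subst prod.lessThan_Suc_shift) (simp add: algebra_simps)

lemma bracket_Suc: fixes x :: complex shows "bracket \<tau> \<eta> (Suc k) x = bracket \<tau> \<eta> k x * t11 (x + 2 * k * \<eta>)"
  unfolding bracket_def by (simp add: mult_ac)

text \<open>A shift of \<open>z\<close> or of \<open>p\<close> by \<open>\<eta>\<close> changes only the ends of the strings of zeros; \<open>G p z\<close> collects the factors that the four have in common.\<close>

lemma om_shifts:
  fixes p z :: complex
  defines "G \<equiv> \<lambda>(p :: complex) (z :: complex). bracket \<tau> \<eta> (n2 - 1) (z + p + (2 - 2 * l) * \<eta>) * bracket \<tau> \<eta> (n2 - 1) (- z + p + (2 - 2 * l) * \<eta>)"
  shows "om p (z + \<eta>) = G p z * t11 (z + p + 2 * l * \<eta>) * t11 (- z + p - 2 * l * \<eta>)"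
    and "om p (z - \<eta>) = G p z * t11 (z + p - 2 * l * \<eta>) * t11 (- z + p + 2 * l * \<eta>)"
    and "om (p - \<eta>) z = G p z * t11 (z + p - 2 * l * \<eta>) * t11 (- z + p - 2 * l * \<eta>)"
    and "om (p + \<eta>) z = G p z * t11 (z + p + 2 * l * \<eta>) * t11 (- z + p + 2 * l * \<eta>)"
proof -
  obtain k where k: "n2 = Suc k" using n2_ge by (cases n2) auto
  have k2: "complex_of_nat k = 2 * of_real l - 1" using n2_complex k by (simp add: algebra_simps)
  have A: "bracket \<tau> \<eta> n2 (x + (1 - 2 * l) * \<eta> - \<eta>) = t11 (x - 2 * l * \<eta>) * bracket \<tau> \<eta> (n2 - 1) (x + (2 - 2 * l) * \<eta>)" for x :: complex
    unfolding k bracket_Suc_shift by (simp add: algebra_simps)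
  have B: "bracket \<tau> \<eta> n2 (x + (1 - 2 * l) * \<eta> + \<eta>) = bracket \<tau> \<eta> (n2 - 1) (x + (2 - 2 * l) * \<eta>) * t11 (x + 2 * l * \<eta>)" for x :: complex
    unfolding k bracket_Suc k2 by (simp add: k2 algebra_simps)
  show "om p (z + \<eta>) = G p z * t11 (z + p + 2 * l * \<eta>) * t11 (- z + p - 2 * l * \<eta>)"
    using A[of "- z + p"] B[of "z + p"] by (simp add: om_def bracket2_def G_def algebra_simps)
  show "om p (z - \<eta>) = G p z * t11 (z + p - 2 * l * \<eta>) * t11 (- z + p + 2 * l * \<eta>)"
    using B[of "- z + p"] A[of "z + p"] by (simp add: om_def bracket2_def G_def algebra_simps)
  show "om (p - \<eta>) z = G p z * t11 (z + p - 2 * l * \<eta>) * t11 (- z + p - 2 * l * \<eta>)"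
    using A[of "- z + p"] A[of "z + p"] by (simp add: om_def bracket2_def G_def algebra_simps)
  show "om (p + \<eta>) z = G p z * t11 (z + p + 2 * l * \<eta>) * t11 (- z + p + 2 * l * \<eta>)"
    using B[of "- z + p"] B[of "z + p"] by (simp add: om_def bracket2_def G_def algebra_simps)
qed

lemma om_holo: "om p holomorphic_on UNIV"
proof -
  have a: "(\<lambda>z. t11 (z + c)) holomorphic_on UNIV" for c
    using entire_shift[OF holo_theta, of 1 1 1 c] by simp
  have b: "(\<lambda>z. t11 (- z + c)) holomorphic_on UNIV" for c
    using entire_shift[OF holo_theta, of 1 1 "-1" c] by simp
  show ?thesis
    unfolding om_prod[abs_def] add.assoc by (intro holomorphic_intros a b)
qed

lemma om_V: "om p \<in> V"
proof (rule V_I[OF om_holo])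
  have m1: "t11 (w - 1) = - t11 w" for w using theta_add_1[of 1 1 "w - 1" \<tau>] by simp
  show "om p (z + 1) = om p z" for z
  proof -
    have r: "z + 1 + p + c = (z + p + c) + 1" "- (z + 1) + p + c = (- z + p + c) - 1" for c by auto
    show ?thesis unfolding om_prod r theta_add_1 m1 by simp
  qed
  show "om p (- z) = om p z" for z
    unfolding om_prod by (simp add: mult.commute)
  have mt: "t11 (w - \<tau>) = - exp (2 * pi * \<i> * w - pi * \<i> * \<tau>) * t11 w" for w
  proof -
    have "t11 w = - exp (- pi * \<i> * \<tau> - 2 * pi * \<i> * (w - \<tau>)) * t11 (w - \<tau>)"
      using theta_add_tau[of 1 1 "w - \<tau>" \<tau>] by simp
    then have "- exp (2 * pi * \<i> * w - pi * \<i> * \<tau>) * t11 w =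
        exp ((2 * pi * \<i> * w - pi * \<i> * \<tau>) + (- pi * \<i> * \<tau> - 2 * pi * \<i> * (w - \<tau>))) * t11 (w - \<tau>)"
      unfolding exp_add by simp
    then show ?thesis by (simp add: algebra_simps)
  qed
  show "om p (z + \<tau>) = exp (- 4 * l * pi * \<i> * (2 * z + \<tau>)) * om p z" for z
  proof -
    have r: "z + \<tau> + p + c = (z + p + c) + \<tau>" "- (z + \<tau>) + p + c = (- z + p + c) - \<tau>" for c by auto
    have "om p (z + \<tau>) = (\<Prod>j<n2. exp (- 2 * pi * \<i> * (2 * z + \<tau>)) *
       (t11 (z + p + centred_shift j) * t11 (- z + p + centred_shift j)))"
      unfolding om_prod
    proof (rule prod.cong[OF refl])
      fix j
      define c :: complex where "c = centred_shift j"
      have "exp (- pi * \<i> * \<tau> - 2 * pi * \<i> * (z + p + c)) * exp (2 * pi * \<i> * (- z + p + c) - pi * \<i> * \<tau>)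
          = exp (- 2 * pi * \<i> * (2 * z + \<tau>))"
        unfolding exp_add[symmetric] by (rule arg_cong[where f = exp]) (simp add: algebra_simps)
      then show "t11 (z + \<tau> + p + centred_shift j) * t11 (- (z + \<tau>) + p + centred_shift j) =
        exp (- 2 * pi * \<i> * (2 * z + \<tau>)) * (t11 (z + p + centred_shift j) * t11 (- z + p + centred_shift j))"
        unfolding r theta_add_tau mt c_def[symmetric] by (simp add: mult_ac)
    qed
    also have "\<dots> = exp (- 2 * pi * \<i> * (2 * z + \<tau>)) ^ n2 * om p z"
      unfolding om_prod prod.distrib prod_constant by simp
    also have "exp (- 2 * pi * \<i> * (2 * z + \<tau>)) ^ n2 = exp (- 4 * l * pi * \<i> * (2 * z + \<tau>))"
      unfolding exp_of_nat_mult[symmetric] n2_complex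
      by (rule arg_cong[where f = exp]) (simp add: algebra_simps)
    finally show ?thesis .
  qed
qed

lemma om_minus: "om (- p) = om p"
proof
  fix z
  have "om (- p) z = (\<Prod>j<n2. t11 (z + p + centred_shift (n2 - Suc j)) * t11 (- z + p + centred_shift (n2 - Suc j)))"
    unfolding om_prod
  proof (rule prod.cong[OF refl])
    fix j assume j: "j \<in> {..<n2}"
    define c :: complex where "c = centred_shift j"
    have c: "complex_of_real (centred_shift (n2 - Suc j)) = - c"
      using j n2 by (simp add: centred_shift_def c_def of_nat_diff algebra_simps)
    have "t11 (z + - p + c) = - t11 (- z + p + - c)" "t11 (- z + - p + c) = - t11 (z + p + - c)"
      using odd_t11[of "z + - p + c"] odd_t11[of "- z + - p + c"] by (auto simp: algebra_simps)
    then show "t11 (z + - p + centred_shift j) * t11 (- z + - p + centred_shift j) =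
      t11 (z + p + centred_shift (n2 - Suc j)) * t11 (- z + p + centred_shift (n2 - Suc j))"
      unfolding c c_def[symmetric] by simp
  qed
  also have "\<dots> = om p z"
    unfolding om_prod
    by (rule prod.nat_diff_reindex[of "\<lambda>j. t11 (z + p + centred_shift j) * t11 (- z + p + centred_shift j)"])
  finally show "om (- p) z = om p z" .
qed

text \<open>Row times column in \<open>L_entry_mult\<close> gives two theta functions. One of them completes the common factor of the shifted
  vectors in \<open>om_shifts\<close>, and the two terms that remain are added by \<open>vector_three_term\<close>.\<close>

lemma L_om_col:
  fixes p u z :: complex
  shows "(\<Sum>\<beta>\<in>UNIV. L_entry u \<alpha> \<beta> (om p) z * colv (u/2 - p + l * \<eta>) \<beta>)
     = 2 * t11 (u + 2 * l * \<eta>) * colv (u/2 - p - l * \<eta>) \<alpha> * om (p - \<eta>) z"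
proof -
  define c d where "c = u/2 + l * \<eta>" and "d = u/2 - p - l * \<eta>"
  obtain G where G: "om p (z + \<eta>) = G z * t11 (z + p + 2 * l * \<eta>) * t11 (- z + p - 2 * l * \<eta>)"
    "om p (z - \<eta>) = G z * t11 (z + p - 2 * l * \<eta>) * t11 (- z + p + 2 * l * \<eta>)"
    "om (p - \<eta>) z = G z * t11 (z + p - 2 * l * \<eta>) * t11 (- z + p - 2 * l * \<eta>)" for z :: complex
    by (rule that[OF om_shifts(1-3)])
  have key: "colv (c - z) \<alpha> * (t11 (c + z + d) * t11 (c + z - d)) - colv (c + z) \<alpha> * (t11 (c - z + d) * t11 (c - z - d))
      = colv d \<alpha> * (t11 (2 * c) * t11 (2 * z))" for z
    using vector_three_term[of al c z d] vector_three_term[of be c z d]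
    by (auto simp: colv_def algebra_simps)
  define y0 where "y0 = u/2 - p + l * \<eta>"
  have a: "u/2 - (z - l * \<eta>) = c - z" "u/2 - (- z - l * \<eta>) = c + z"
    "u/2 + (z - l * \<eta>) + y0 = c + z + d" "u/2 + (z - l * \<eta>) - y0 = z + p - 2 * l * \<eta>"
    "u/2 + (- z - l * \<eta>) + y0 = c - z + d" "u/2 + (- z - l * \<eta>) - y0 = - z + p - 2 * l * \<eta>"
    "z + p + 2 * l * \<eta> = c + z - d" "- z + p + 2 * l * \<eta> = c - z - d" "2 * c = u + 2 * l * \<eta>" for z :: complex
    by (auto simp: c_def d_def y0_def field_simps)
  have "(\<lambda>z. \<Sum>\<beta>\<in>UNIV. L_entry u \<alpha> \<beta> (om p) z * colv y0 \<beta>)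
     = (\<lambda>z. 2 * t11 (u + 2 * l * \<eta>) * colv d \<alpha> * om (p - \<eta>) z)"
  proof (rule cancel_t11_double)
    show "(\<lambda>z. \<Sum>\<beta>\<in>UNIV. L_entry u \<alpha> \<beta> (om p) z * colv y0 \<beta>) holomorphic_on UNIV"
      by (intro holomorphic_intros V_holo[OF L_entry_V[OF om_V]])
    show "(\<lambda>z. 2 * t11 (u + 2 * l * \<eta>) * colv d \<alpha> * om (p - \<eta>) z) holomorphic_on UNIV"
      by (intro holomorphic_intros om_holo)
    fix z
    have "t11 (2 * z) * (\<Sum>\<beta>\<in>UNIV. L_entry u \<alpha> \<beta> (om p) z * colv y0 \<beta>)
       = (\<Sum>\<beta>\<in>UNIV. (t11 (2 * z) * L_entry u \<alpha> \<beta> (om p) z) * colv y0 \<beta>)"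
      by (simp add: sum_distrib_left mult_ac)
    also have "\<dots> = colv (c - z) \<alpha> * (\<Sum>\<beta>\<in>UNIV. rowv (u/2 + (z - l * \<eta>)) \<beta> * colv y0 \<beta>) * om p (z + \<eta>)
        - colv (c + z) \<alpha> * (\<Sum>\<beta>\<in>UNIV. rowv (u/2 + (- z - l * \<eta>)) \<beta> * colv y0 \<beta>) * om p (z - \<eta>)"
      unfolding L_entry_mult[OF om_V] a(1,2) sum_distrib_left sum_distrib_right sum_subtractf[symmetric]
      by (rule sum.cong) (auto simp: algebra_simps)
    also have "\<dots> = 2 * om (p - \<eta>) z * (colv (c - z) \<alpha> * (t11 (c + z + d) * t11 (c + z - d))
         - colv (c + z) \<alpha> * (t11 (c - z + d) * t11 (c - z - d)))"
      unfolding row_times_col a(3-6) G a(7,8) by (simp add: algebra_simps)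
    also have "\<dots> = t11 (2 * z) * (2 * t11 (u + 2 * l * \<eta>) * colv d \<alpha> * om (p - \<eta>) z)"
      unfolding key a(9) by (simp add: mult_ac)
    finally show "t11 (2 * z) * (\<Sum>\<beta>\<in>UNIV. L_entry u \<alpha> \<beta> (om p) z * colv y0 \<beta>)
       = t11 (2 * z) * (2 * t11 (u + 2 * l * \<eta>) * colv d \<alpha> * om (p - \<eta>) z)" .
  qed
  from fun_cong[OF this, of z] show ?thesis unfolding d_def y0_def .
qed

lemma row_L_om:
  fixes p u z :: complex
  shows "(\<Sum>\<alpha>\<in>UNIV. rowv (u/2 - p - l * \<eta>) \<alpha> * L_entry u \<alpha> \<beta> (om p) z)
     = 2 * t11 (u - 2 * l * \<eta>) * rowv (u/2 - p + l * \<eta>) \<beta> * om (p + \<eta>) z"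
proof -
  define c d where "c = u/2 - l * \<eta>" and "d = u/2 - p + l * \<eta>"
  obtain G where G: "om p (z + \<eta>) = G z * t11 (z + p + 2 * l * \<eta>) * t11 (- z + p - 2 * l * \<eta>)"
    "om p (z - \<eta>) = G z * t11 (z + p - 2 * l * \<eta>) * t11 (- z + p + 2 * l * \<eta>)"
    "om (p + \<eta>) z = G z * t11 (z + p + 2 * l * \<eta>) * t11 (- z + p + 2 * l * \<eta>)" for z :: complex
    by (rule that[OF om_shifts(1,2,4)])
  have key: "rowv (c - z) \<beta> * (t11 (c + z + d) * t11 (c + z - d)) - rowv (c + z) \<beta> * (t11 (c - z + d) * t11 (c - z - d))
      = rowv d \<beta> * (t11 (2 * c) * t11 (2 * z))" for z
    using vector_three_term[of al c z d] vector_three_term[of be c z d]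
    by (auto simp: rowv_def)
  define y1 where "y1 = u/2 - p - l * \<eta>"
  have a: "u/2 + (z - l * \<eta>) = c + z" "u/2 + (- z - l * \<eta>) = c - z"
    "y1 + (u/2 - (z - l * \<eta>)) = c - z + d" "y1 - (u/2 - (z - l * \<eta>)) = - (- z + p + 2 * l * \<eta>)"
    "y1 + (u/2 - (- z - l * \<eta>)) = c + z + d" "y1 - (u/2 - (- z - l * \<eta>)) = - (z + p + 2 * l * \<eta>)"
    "z + p - 2 * l * \<eta> = c + z - d" "- z + p - 2 * l * \<eta> = c - z - d" "2 * c = u - 2 * l * \<eta>" for z :: complex
    by (auto simp: c_def d_def y1_def field_simps)
  have "(\<lambda>z. \<Sum>\<alpha>\<in>UNIV. rowv y1 \<alpha> * L_entry u \<alpha> \<beta> (om p) z)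
     = (\<lambda>z. 2 * t11 (u - 2 * l * \<eta>) * rowv d \<beta> * om (p + \<eta>) z)"
  proof (rule cancel_t11_double)
    show "(\<lambda>z. \<Sum>\<alpha>\<in>UNIV. rowv y1 \<alpha> * L_entry u \<alpha> \<beta> (om p) z) holomorphic_on UNIV"
      by (intro holomorphic_intros V_holo[OF L_entry_V[OF om_V]])
    show "(\<lambda>z. 2 * t11 (u - 2 * l * \<eta>) * rowv d \<beta> * om (p + \<eta>) z) holomorphic_on UNIV"
      by (intro holomorphic_intros om_holo)
    fix z
    have "t11 (2 * z) * (\<Sum>\<alpha>\<in>UNIV. rowv y1 \<alpha> * L_entry u \<alpha> \<beta> (om p) z)
       = (\<Sum>\<alpha>\<in>UNIV. rowv y1 \<alpha> * (t11 (2 * z) * L_entry u \<alpha> \<beta> (om p) z))"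
      by (simp add: sum_distrib_left mult_ac)
    also have "\<dots> = rowv (c + z) \<beta> * (\<Sum>\<alpha>\<in>UNIV. rowv y1 \<alpha> * colv (u/2 - (z - l * \<eta>)) \<alpha>) * om p (z + \<eta>)
        - rowv (c - z) \<beta> * (\<Sum>\<alpha>\<in>UNIV. rowv y1 \<alpha> * colv (u/2 - (- z - l * \<eta>)) \<alpha>) * om p (z - \<eta>)"
      unfolding L_entry_mult[OF om_V] a(1,2) sum_distrib_left sum_distrib_right sum_subtractf[symmetric]
      by (rule sum.cong) (auto simp: algebra_simps)
    also have "\<dots> = 2 * om (p + \<eta>) z * (rowv (c - z) \<beta> * (t11 (c + z + d) * t11 (c + z - d))
         - rowv (c + z) \<beta> * (t11 (c - z + d) * t11 (c - z - d)))"
      unfolding row_times_col a(3-6) odd_t11 G a(7,8) by (simp add: algebra_simps)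
    also have "\<dots> = t11 (2 * z) * (2 * t11 (u - 2 * l * \<eta>) * rowv d \<beta> * om (p + \<eta>) z)"
      unfolding key a(9) by (simp add: mult_ac)
    finally show "t11 (2 * z) * (\<Sum>\<alpha>\<in>UNIV. rowv y1 \<alpha> * L_entry u \<alpha> \<beta> (om p) z)
       = t11 (2 * z) * (2 * t11 (u - 2 * l * \<eta>) * rowv d \<beta> * om (p + \<eta>) z)" .
  qed
  from fun_cong[OF this, of z] show ?thesis unfolding d_def y1_def .
qed

end

section \<open>Tensor products\<close>

definition prev :: "nat \<Rightarrow> nat \<Rightarrow> nat" where
  "prev N n = (if n = 1 then N else n - 1)"

lemma prod_prev: "(\<Prod>n=1..N. g (prev N n)) = (\<Prod>n=1..N. g n :: 'a :: comm_monoid_mult)"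
  by (rule prod.reindex_bij_witness[of _ "\<lambda>n. if n = N then 1 else n + 1" "prev N"])
     (auto simp: prev_def)

lemma prod_cyclic_quotient:
  fixes g :: "'b \<Rightarrow> 'a :: field"
  assumes "\<And>n. n \<in> {1..N} \<Longrightarrow> g (i n) \<noteq> 0"
  shows "(\<Prod>n=1..N. g (i n) / g (i (prev N n))) = 1"
  using prod_prev[of "\<lambda>n. g (i n)" N] assms by (simp add: prod_dividef)

definition linear_over :: "(complex \<Rightarrow> complex) set \<Rightarrow> ((complex \<Rightarrow> complex) \<Rightarrow> complex \<Rightarrow> complex) \<Rightarrow> bool" where
  "linear_over W A \<longleftrightarrow> (\<forall>f\<in>W. \<forall>g\<in>W. \<forall>c. A (\<lambda>z. c * f z + g z) = (\<lambda>z. c * A f z + A g z))"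

lemma linear_over_zero: "linear_over W A \<Longrightarrow> (\<lambda>_. 0) \<in> W \<Longrightarrow> A (\<lambda>_. 0) = (\<lambda>_. 0)"
  unfolding linear_over_def by (drule bspec, assumption, drule bspec, assumption) (auto dest: spec[of _ "-1"] simp: fun_eq_iff)

context sklyanin
begin

lemma linear_over_sum:
  assumes A: "linear_over V A" and f: "\<And>p. p \<in> I \<Longrightarrow> f p \<in> V"
  shows "A (\<lambda>z. \<Sum>p\<in>I. c p * f p z) = (\<lambda>z. \<Sum>p\<in>I. c p * A (f p) z)"
proof (cases "finite I")
  case True
  then show ?thesis using f
  proof (induction I)
    case empty
    then show ?case using linear_over_zero[OF A V_zero] by simp
  next
    case (insert x I)
    have "A (\<lambda>z. c x * f x z + (\<Sum>p\<in>I. c p * f p z)) = (\<lambda>z. c x * A (f x) z + A (\<lambda>z. \<Sum>p\<in>I. c p * f p z) z)"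
      using A insert.prems V_sum[of I f c] unfolding linear_over_def by auto
    then show ?case using insert by simp
  qed
next
  case False
  then show ?thesis using linear_over_zero[OF A V_zero] by simp
qed

lemma linear_over_rho: "linear_over V (rho_l a)"
  by (auto simp: linear_over_def rho_linear)

lemma L_entry_linear: "linear_over V (L_entry u \<alpha> \<beta>)"
  unfolding linear_over_def
proof (intro ballI allI ext)
  fix f g c z assume f: "f \<in> V" and g: "g \<in> V"
  show "L_entry u \<alpha> \<beta> (\<lambda>z. c * f z + g z) z = c * L_entry u \<alpha> \<beta> f z + L_entry u \<alpha> \<beta> g z"
    unfolding L_entry_def rho_linear[OF f g] sum_distrib_left sum.distrib[symmetric]
    by (rule sum.cong) (auto simp: algebra_simps)
qed

lemma L_entry_scale: "f \<in> V \<Longrightarrow> L_entry u \<alpha> \<beta> (\<lambda>z. c * f z) = (\<lambda>z. c * L_entry u \<alpha> \<beta> f z)"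
  using linear_over_sum[OF L_entry_linear, of "{()}" "\<lambda>_. f" u \<alpha> \<beta> "\<lambda>_. c"] by simp

lemma L_entry_zero: "L_entry u \<alpha> \<beta> (\<lambda>_. 0) = (\<lambda>_. 0)"
  by (rule linear_over_zero[OF L_entry_linear V_zero])

definition L_matrix :: "complex \<Rightarrow> (complex \<Rightarrow> complex) \<Rightarrow> complex \<Rightarrow> complex^2^2" where
  "L_matrix u f w = (\<chi> \<alpha> \<beta>. L_entry u \<alpha> \<beta> f w)"

primrec L_product :: "complex \<Rightarrow> (nat \<Rightarrow> complex \<Rightarrow> complex) \<Rightarrow> (nat \<Rightarrow> complex) \<Rightarrow> nat \<Rightarrow> complex^2^2" where
  "L_product u f z 0 = mat 1"
| "L_product u f z (Suc n) = L_matrix u (f (Suc n)) (z (Suc n)) ** L_product u f z n"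

lemma L_product_cong: "(\<And>n. n \<in> {1..M} \<Longrightarrow> z n = z' n) \<Longrightarrow> L_product u f z M = L_product u f z' M"
  by (induction M) auto

lemma prod_atLeastSucAtMost_split:
  fixes g :: "nat \<Rightarrow> 'a :: comm_monoid_mult"
  assumes "M < N"
  shows "(\<Prod>n\<in>{Suc M..N}. g n) = g (Suc M) * (\<Prod>n\<in>{Suc (Suc M)..N}. g n)"
  using assms by (simp add: prod.atLeast_Suc_atMost)

lemma monodromy_eq:
  assumes f: "\<And>p n. p \<in> I \<Longrightarrow> n \<in> {1..N} \<Longrightarrow> f p n \<in> V"
    and F: "F = (\<lambda>z. \<Sum>p\<in>I. c p * pure_tensor N (f p) z)" and "M \<le> N"
  shows "monodromy \<tau> \<eta> l M u (\<lambda>\<beta>. if \<beta> = \<alpha> then F else (\<lambda>_. 0)) \<alpha>' z =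
    (\<Sum>p\<in>I. c p * (L_product u (f p) z M $ \<alpha>' $ \<alpha>) * (\<Prod>n\<in>{Suc M..N}. f p n (z n)))"
  using \<open>M \<le> N\<close>
proof (induction M arbitrary: \<alpha>' z)
  case 0
  show ?case by (auto simp: F pure_tensor_def mat_def One_nat_def)
next
  case (Suc M)
  define \<Psi> where "\<Psi> = monodromy \<tau> \<eta> l M u (\<lambda>\<beta>. if \<beta> = \<alpha> then F else (\<lambda>_. 0))"
  define R where "R p = (\<Prod>n\<in>{Suc (Suc M)..N}. f p n (z n))" for p
  have \<Psi>: "\<Psi> \<beta> (z(Suc M := w)) = (\<Sum>p\<in>I. (c p * (L_product u (f p) z M $ \<beta> $ \<alpha>) * R p) * f p (Suc M) w)" for \<beta> w
  proof -
    have "(\<Prod>n\<in>{Suc M..N}. f p n ((z(Suc M := w)) n)) = f p (Suc M) w * R p" for p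
      unfolding R_def using Suc.prems by (subst prod_atLeastSucAtMost_split) auto
    moreover have "L_product u (f p) (z(Suc M := w)) M = L_product u (f p) z M" for p
      by (rule L_product_cong) auto
    ultimately show ?thesis unfolding \<Psi>_def Suc.IH[OF Suc_leD[OF Suc.prems]] by (simp add: mult_ac)
  qed
  have "monodromy \<tau> \<eta> l (Suc M) u (\<lambda>\<beta>. if \<beta> = \<alpha> then F else (\<lambda>_. 0)) \<alpha>' z = L_op \<tau> \<eta> l (Suc M) u \<Psi> \<alpha>' z"
    by (simp add: \<Psi>_def)
  also have "\<dots> = (\<Sum>a\<le>3. \<Sum>\<beta>\<in>UNIV. W_L \<tau> \<eta> a u * (pauli a $ \<alpha>' $ \<beta>) *
      (\<Sum>p\<in>I. (c p * (L_product u (f p) z M $ \<beta> $ \<alpha>) * R p) * rho_l a (f p (Suc M)) (z (Suc M))))"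
    unfolding L_op_def on_site_def \<Psi>
    using linear_over_sum[OF linear_over_rho, of I "\<lambda>p. f p (Suc M)"] f Suc.prems by simp
  also have "\<dots> = (\<Sum>p\<in>I. \<Sum>\<beta>\<in>UNIV. (c p * (L_product u (f p) z M $ \<beta> $ \<alpha>) * R p) *
      L_entry u \<alpha>' \<beta> (f p (Suc M)) (z (Suc M)))"
    unfolding L_entry_def sum_distrib_left
    by (subst sum.swap[of _ _ "{..3}"], subst sum.swap[of _ _ "{..3}"], subst sum.swap) (simp add: mult_ac)
  also have "\<dots> = (\<Sum>p\<in>I. c p * (L_product u (f p) z (Suc M) $ \<alpha>' $ \<alpha>) * R p)"
    by (rule sum.cong) (auto simp: matrix_matrix_mult_def L_matrix_def sum_distrib_left sum_distrib_right mult_ac)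
  finally show ?case unfolding R_def .
qed

abbreviation "T N u \<equiv> transfer_matrix \<tau> \<eta> l N u"

lemma transfer_matrix_eq:
  assumes f: "\<And>p n. p \<in> I \<Longrightarrow> n \<in> {1..N} \<Longrightarrow> f p n \<in> V"
  shows "T N u (\<lambda>z. \<Sum>p\<in>I. c p * pure_tensor N (f p) z) = (\<lambda>z. \<Sum>p\<in>I. c p * trace (L_product u (f p) z N))"
proof
  fix z
  have "T N u (\<lambda>z. \<Sum>p\<in>I. c p * pure_tensor N (f p) z) z = (\<Sum>\<alpha>\<in>UNIV. \<Sum>p\<in>I. c p * (L_product u (f p) z N $ \<alpha> $ \<alpha>))"
    unfolding transfer_matrix_def
    using monodromy_eq[where I = I and f = f and c = c and N = N and M = N, OF f refl order_refl] by simp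
  also have "\<dots> = (\<Sum>p\<in>I. c p * trace (L_product u (f p) z N))"
    by (subst sum.swap) (simp add: trace_def sum_distrib_left)
  finally show "T N u (\<lambda>z. \<Sum>p\<in>I. c p * pure_tensor N (f p) z) z = (\<Sum>p\<in>I. c p * trace (L_product u (f p) z N))" .
qed

text \<open>An operator on one slot acts on a function of all variables by freezing the others; therefore the induction
  treats the slots one after the other, with the first \<open>M\<close> already done.\<close>

lemma tensor_power_eq:
  assumes f: "\<And>p n. p \<in> I \<Longrightarrow> n \<in> {1..N} \<Longrightarrow> f p n \<in> V" and A: "linear_over V A"
  shows "tensor_power N A (\<lambda>z. \<Sum>p\<in>I. c p * pure_tensor N (f p) z) =
     (\<lambda>z. \<Sum>p\<in>I. c p * pure_tensor N (\<lambda>n. A (f p n)) z)"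
proof -
  let ?F = "\<lambda>z. \<Sum>p\<in>I. c p * pure_tensor N (f p) z"
  have "tensor_power M A ?F z =
     (\<Sum>p\<in>I. c p * (\<Prod>n\<in>{1..M}. A (f p n) (z n)) * (\<Prod>n\<in>{Suc M..N}. f p n (z n)))" if "M \<le> N" for M z
    using that
  proof (induction M arbitrary: z)
    case 0
    show ?case by (simp add: pure_tensor_def One_nat_def)
  next
    case (Suc M)
    define R where "R p = (\<Prod>n\<in>{1..M}. A (f p n) (z n)) * (\<Prod>n\<in>{Suc (Suc M)..N}. f p n (z n))" for p
    have "tensor_power M A ?F (z(Suc M := w)) = (\<Sum>p\<in>I. (c p * R p) * f p (Suc M) w)" for w
    proof -
      have "(\<Prod>n\<in>{Suc M..N}. f p n ((z(Suc M := w)) n)) = f p (Suc M) w * (\<Prod>n\<in>{Suc (Suc M)..N}. f p n (z n))" for p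
        using Suc.prems by (subst prod_atLeastSucAtMost_split) auto
      then show ?thesis unfolding Suc.IH[OF Suc_leD[OF Suc.prems]] R_def by (simp add: mult_ac)
    qed
    then have "tensor_power (Suc M) A ?F z = (\<Sum>p\<in>I. (c p * R p) * A (f p (Suc M)) (z (Suc M)))"
      using linear_over_sum[OF A, of I "\<lambda>p. f p (Suc M)"] f Suc.prems by (simp add: on_site_def)
    also have "\<dots> = (\<Sum>p\<in>I. c p * (\<Prod>n\<in>{1..Suc M}. A (f p n) (z n)) * (\<Prod>n\<in>{Suc (Suc M)..N}. f p n (z n)))"
      by (rule sum.cong) (auto simp: R_def mult_ac)
    finally show ?case .
  qed
  from this[OF order_refl] show ?thesis by (auto simp: pure_tensor_def)
qed

subsection \<open>The state space\<close>

abbreviation "HS N \<equiv> H_space \<tau> l N"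

lemma H_E:
  assumes "F \<in> HS N"
  obtains K :: nat and f where "F = (\<lambda>z. \<Sum>p<K. pure_tensor N (f p) z)" "\<And>p n. p < K \<Longrightarrow> n \<in> {1..N} \<Longrightarrow> f p n \<in> V"
proof -
  from assms obtain K :: nat and f where "F = (\<lambda>z. \<Sum>p<K. pure_tensor N (f p) z) \<and> (\<forall>p<K. \<forall>n\<in>{1..N}. f p n \<in> V)"
    unfolding H_space_def by auto
  then show ?thesis using that by blast
qed

lemma H_pure: "(\<And>n. n \<in> {1..N} \<Longrightarrow> f n \<in> V) \<Longrightarrow> pure_tensor N f \<in> HS N"
  unfolding H_space_def by (intro CollectI exI[of _ "1::nat"] exI[of _ "\<lambda>_. f"]) auto

lemma H_zero: "(\<lambda>_. 0) \<in> HS N"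
  unfolding H_space_def by (intro CollectI exI[of _ "0::nat"]) auto

lemma H_add:
  assumes "F \<in> HS N" "G \<in> HS N"
  shows "(\<lambda>z. F z + G z) \<in> HS N"
proof -
  obtain K :: nat and f where F: "F = (\<lambda>z. \<Sum>p<K. pure_tensor N (f p) z)" "\<And>p n. p < K \<Longrightarrow> n \<in> {1..N} \<Longrightarrow> f p n \<in> V"
    using H_E[OF assms(1)] by blast
  obtain K' :: nat and g where G: "G = (\<lambda>z. \<Sum>p<K'. pure_tensor N (g p) z)" "\<And>p n. p < K' \<Longrightarrow> n \<in> {1..N} \<Longrightarrow> g p n \<in> V"
    using H_E[OF assms(2)] by blast
  define h where "h p = (if p < K then f p else g (p - K))" for p :: nat
  have "(\<Sum>p<K + K'. pure_tensor N (h p) z) = F z + G z" for z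
  proof -
    have "(\<Sum>p<K + K'. pure_tensor N (h p) z) = (\<Sum>p<K. pure_tensor N (h p) z) + (\<Sum>p<K'. pure_tensor N (h (p + K)) z)"
      by (subst add.commute) (simp add: sum.nat_group lessThan_atLeast0 sum.atLeastLessThan_concat[symmetric, of 0 K "K' + K"]
          sum.shift_bounds_nat_ivl[of _ 0 K K', simplified])
    then show ?thesis by (simp add: h_def F G)
  qed
  moreover have "h p n \<in> V" if "p < K + K'" "n \<in> {1..N}" for p n
    using that F(2) G(2) by (auto simp: h_def)
  ultimately show ?thesis unfolding H_space_def
    by (intro CollectI exI[of _ "K + K'"] exI[of _ h]) auto
qed

lemma pure_tensor_scale:
  assumes "N > 0"
  shows "c * pure_tensor N f z = pure_tensor N (\<lambda>n w. if n = 1 then c * f n w else f n w) z"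
proof -
  have "{1..N} = insert 1 {2..N}" using assms by auto
  then show ?thesis unfolding pure_tensor_def by (simp add: mult.assoc)
qed

lemma H_scale:
  assumes "N > 0" "F \<in> HS N"
  shows "(\<lambda>z. c * F z) \<in> HS N"
proof -
  obtain K :: nat and f where F: "F = (\<lambda>z. \<Sum>p<K. pure_tensor N (f p) z)" "\<And>p n. p < K \<Longrightarrow> n \<in> {1..N} \<Longrightarrow> f p n \<in> V"
    using H_E[OF assms(2)] by blast
  have "(\<lambda>z. c * F z) = (\<lambda>z. \<Sum>p<K. pure_tensor N (\<lambda>n w. if n = 1 then c * f p n w else f p n w) z)"
    unfolding F sum_distrib_left using pure_tensor_scale[OF assms(1)] by simp
  moreover have "(\<lambda>w. if n = 1 then c * f p n w else f p n w) \<in> V" if "p < K" "n \<in> {1..N}" for p n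
    using V_scale[OF F(2)[OF that]] F(2)[OF that] by (cases "n = 1") auto
  ultimately show ?thesis unfolding H_space_def
    by (intro CollectI exI[of _ K] exI[of _ "\<lambda>p n w. if n = 1 then c * f p n w else f p n w"]) auto
qed

lemma H_sum:
  assumes "N > 0" "\<And>i. i \<in> I \<Longrightarrow> F i \<in> HS N"
  shows "(\<lambda>z. \<Sum>i\<in>I. c i * F i z) \<in> HS N"
proof (cases "finite I")
  case True
  then show ?thesis using assms(2)
    by (induction I) (auto intro!: H_zero H_add H_scale[OF assms(1)])
qed (simp add: H_zero)

subsection \<open>The operators \<open>U1\<close> and \<open>U3\<close>\<close>

lemma linear_over_U: "linear_over V (U1 l)" "linear_over V (U3 \<tau> l)"
  by (auto simp: linear_over_def U1_def U3_def algebra_simps)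

lemma exp_pi_l_4: "exp (complex_of_real (4 * l * pi) * \<i>) = 1"
  using exp_l_of_int[of 1] by (simp add: mult_ac)

lemma U1_V:
  assumes f: "f \<in> V"
  shows "U1 l f \<in> V"
proof (rule V_I)
  have sh: "(\<lambda>z. f (z + 1/2)) holomorphic_on UNIV" using entire_shift[OF V_holo[OF f], of 1 "1/2"] by simp
  show "U1 l f holomorphic_on UNIV" unfolding U1_def by (intro holomorphic_intros sh)
  show "U1 l f (z + 1) = U1 l f z" for z using V_1[OF f, of "z + 1/2"] by (simp add: U1_def algebra_simps)
  show "U1 l f (- z) = U1 l f z" for z
    using V_1[OF f, of "- z - 1/2"] V_even[OF f, of "z + 1/2"] by (simp add: U1_def algebra_simps)
  show "U1 l f (z + \<tau>) = exp (- 4 * l * pi * \<i> * (2 * z + \<tau>)) * U1 l f z" for z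
  proof -
    have r: "z + \<tau> + 1/2 = (z + 1/2) + \<tau>" by simp
    have "exp (- 4 * l * pi * \<i> * (2 * (z + 1/2) + \<tau>)) =
       exp (- 4 * l * pi * \<i> * (2 * z + \<tau>)) * exp (- (complex_of_real (4 * l * pi) * \<i>))"
      unfolding exp_add[symmetric] by (rule arg_cong[where f = exp]) (simp add: algebra_simps)
    also have "exp (- (complex_of_real (4 * l * pi) * \<i>)) = 1" by (simp only: exp_minus exp_pi_l_4 inverse_1)
    finally show ?thesis unfolding U1_def r V_tau[OF f] by simp
  qed
qed

lemma U3_V:
  assumes f: "f \<in> V"
  shows "U3 \<tau> l f \<in> V"
proof (rule V_I)
  have sh: "(\<lambda>z. f (z + \<tau>/2)) holomorphic_on UNIV" using entire_shift[OF V_holo[OF f], of 1 "\<tau>/2"] by simp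
  show "U3 \<tau> l f holomorphic_on UNIV" unfolding U3_def by (intro holomorphic_intros sh)
  show "U3 \<tau> l f (z + 1) = U3 \<tau> l f z" for z
  proof -
    have r: "z + 1 + \<tau>/2 = (z + \<tau>/2) + 1" by simp
    have "exp (pi * \<i> * l * (4 * (z + 1) + \<tau>)) = exp (pi * \<i> * l * (4 * z + \<tau>)) * exp (complex_of_real (4 * l * pi) * \<i>)"
      unfolding exp_add[symmetric] by (rule arg_cong[where f = exp]) (simp add: algebra_simps)
    then show ?thesis unfolding U3_def r V_1[OF f] exp_pi_l_4 by simp
  qed
  show "U3 \<tau> l f (- z) = U3 \<tau> l f z" for z
  proof -
    have "f (- z + \<tau>/2) = f (z - \<tau>/2)" using V_even[OF f, of "z - \<tau>/2"] by simp
    moreover have "f (z + \<tau>/2) = exp (- 4 * l * pi * \<i> * (2 * z)) * f (z - \<tau>/2)"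
      using V_tau[OF f, of "z - \<tau>/2"] by (simp add: algebra_simps)
    moreover have "exp (pi * \<i> * l * (4 * - z + \<tau>)) = exp (pi * \<i> * l * (4 * z + \<tau>)) * exp (- 4 * l * pi * \<i> * (2 * z))"
      unfolding exp_add[symmetric] by (rule arg_cong[where f = exp]) (simp add: algebra_simps)
    ultimately show ?thesis unfolding U3_def by simp
  qed
  show "U3 \<tau> l f (z + \<tau>) = exp (- 4 * l * pi * \<i> * (2 * z + \<tau>)) * U3 \<tau> l f z" for z
  proof -
    have r: "z + \<tau> + \<tau>/2 = (z + \<tau>/2) + \<tau>" by simp
    have "exp (pi * \<i> * l * (4 * (z + \<tau>) + \<tau>)) * exp (- 4 * l * pi * \<i> * (2 * (z + \<tau>/2) + \<tau>))
       = exp (- 4 * l * pi * \<i> * (2 * z + \<tau>)) * exp (pi * \<i> * l * (4 * z + \<tau>))"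
      unfolding exp_add[symmetric] by (rule arg_cong[where f = exp]) (simp add: algebra_simps)
    then show ?thesis unfolding U3_def r V_tau[OF f] by (simp add: mult_ac)
  qed
qed

lemma U1_square:
  assumes f: "f \<in> V"
  shows "U1 l (U1 l f) = (\<lambda>z. exp (2 * pi * \<i> * l) * f z)"
proof
  fix z
  have "exp (pi * \<i> * l) * exp (pi * \<i> * l) = exp (2 * pi * \<i> * l)"
    unfolding exp_add[symmetric] by (rule arg_cong[where f = exp]) (simp add: algebra_simps)
  moreover have "(z :: complex) + 1/2 + 1/2 = z + 1" by simp
  ultimately show "U1 l (U1 l f) z = exp (2 * pi * \<i> * l) * f z"
    unfolding U1_def by (simp only: V_1[OF f] mult.assoc[symmetric])
qed

lemma U3_square:
  assumes f: "f \<in> V"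
  shows "U3 \<tau> l (U3 \<tau> l f) = (\<lambda>z. exp (2 * pi * \<i> * l) * f z)"
proof
  fix z
  have "exp (pi * \<i> * l) * exp (pi * \<i> * l * (4 * z + \<tau>)) * (exp (pi * \<i> * l) * exp (pi * \<i> * l * (4 * (z + \<tau>/2) + \<tau>)) *
     exp (- 4 * l * pi * \<i> * (2 * z + \<tau>))) = exp (2 * pi * \<i> * l)"
    unfolding exp_add[symmetric] by (rule arg_cong[where f = exp]) (simp add: algebra_simps)
  moreover have "z + \<tau>/2 + \<tau>/2 = z + \<tau>" by simp
  ultimately show "U3 \<tau> l (U3 \<tau> l f) z = exp (2 * pi * \<i> * l) * f z"
    unfolding U3_def by (simp only: V_tau[OF f] mult.assoc[symmetric])
qed

lemma U1_om: "U1 l (om p) = (\<lambda>z. exp (- pi * \<i> * l) * om (p + 1/2) z)"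
proof
  fix z
  have m: "t11 (- (z + 1/2) + p + c) = - t11 (- z + (p + 1/2) + c)" for c
    using theta_add_1[of 1 1 "- (z + 1/2) + p + c" \<tau>] by (simp add: algebra_simps)
  have q: "z + 1/2 + p + c = z + (p + 1/2) + c" for c by simp
  have "om p (z + 1/2) = (\<Prod>j<n2. (-1) * (t11 (z + (p + 1/2) + centred_shift j) * t11 (- z + (p + 1/2) + centred_shift j)))"
    unfolding om_prod m q by simp
  also have "\<dots> = (-1) ^ n2 * om (p + 1/2) z"
    unfolding prod.distrib[of "\<lambda>_. -1"] om_prod by simp
  also have "(-1 :: complex) ^ n2 = exp (- 2 * pi * \<i> * l)"
  proof -
    have "(-1 :: complex) ^ n2 = exp (- (of_real pi * \<i>)) ^ n2" by (simp add: exp_minus)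
    also have "\<dots> = exp (of_nat n2 * (- (of_real pi * \<i>)))" by (rule exp_of_nat_mult[symmetric])
    finally show ?thesis unfolding n2_complex by (simp add: mult_ac)
  qed
  finally have "om p (z + 1/2) = exp (- 2 * pi * \<i> * l) * om (p + 1/2) z" .
  moreover have "exp (pi * \<i> * l) * exp (- 2 * pi * \<i> * l) = exp (- pi * \<i> * l)"
    unfolding exp_add[symmetric] by (rule arg_cong[where f = exp]) (simp add: algebra_simps)
  ultimately show "U1 l (om p) z = exp (- pi * \<i> * l) * om (p + 1/2) z"
    unfolding U1_def by (simp add: mult.assoc[symmetric])
qed

lemma sum_cs: "(\<Sum>j<n2. complex_of_real (centred_shift j)) = 0"
proof -
  have "(\<Sum>j<n. complex_of_real (2 * real j + 1)) = of_nat n ^ 2" for n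
    by (induction n) (auto simp: power2_eq_square algebra_simps)
  then have "(\<Sum>j<n2. complex_of_real (2 * real j + 1 - 2 * l)) = of_nat n2 ^ 2 - of_nat n2 * (2 * of_real l)"
    by (simp add: sum_subtractf)
  also have "\<dots> = 0" unfolding n2_complex by (simp add: power2_eq_square)
  finally show ?thesis unfolding centred_shift_def of_real_mult sum_distrib_right[symmetric] by simp
qed

lemma U3_om: "U3 \<tau> l (om p) = (\<lambda>z. exp (pi * \<i> * l * (\<tau> - 1) + 4 * pi * \<i> * l * p) * om (p + \<tau>/2) z)"
proof
  fix z
  have m: "t11 (- (z + \<tau>/2) + p + c) = - exp (2 * pi * \<i> * (- z + p + c)) * t11 (- z + (p + \<tau>/2) + c)" for c
  proof -
    have "t11 (- z + (p + \<tau>/2) + c) = - exp (- pi * \<i> * \<tau> - 2 * pi * \<i> * (- (z + \<tau>/2) + p + c)) * t11 (- (z + \<tau>/2) + p + c)"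
      using theta_add_tau[of 1 1 "- (z + \<tau>/2) + p + c" \<tau>] by (simp add: algebra_simps)
    moreover have e: "- pi * \<i> * \<tau> - 2 * pi * \<i> * (- (z + \<tau>/2) + p + c) = - (2 * pi * \<i> * (- z + p + c))"
      by (simp add: algebra_simps)
    ultimately have "exp (2 * pi * \<i> * (- z + p + c)) * t11 (- z + (p + \<tau>/2) + c) =
      - (exp (2 * pi * \<i> * (- z + p + c)) * exp (- (2 * pi * \<i> * (- z + p + c)))) * t11 (- (z + \<tau>/2) + p + c)"
      by (simp only: mult_minus_left mult_minus_right mult.assoc)
    then show ?thesis by (simp only: exp_minus_inverse mult_minus_left mult_1_left minus_minus)
  qed
  have q: "z + \<tau>/2 + p + c = z + (p + \<tau>/2) + c" for c by simp
  have "om p (z + \<tau>/2) = (\<Prod>j<n2. (- exp (2 * pi * \<i> * (- z + p + centred_shift j))) * (t11 (z + (p + \<tau>/2) + centred_shift j) * t11 (- z + (p + \<tau>/2) + centred_shift j)))"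
    unfolding om_prod m q by (simp add: mult_ac)
  also have "\<dots> = (\<Prod>j<n2. - exp (2 * pi * \<i> * (- z + p + centred_shift j))) * om (p + \<tau>/2) z"
    unfolding prod.distrib om_prod by simp
  also have "(\<Prod>j<n2. - exp (2 * pi * \<i> * (- z + p + centred_shift j))) = exp (\<Sum>j<n2. - (of_real pi * \<i>) + 2 * pi * \<i> * (- z + p + centred_shift j))"
    by (subst exp_sum) (auto simp: exp_diff)
  also have "(\<Sum>j<n2. - (of_real pi * \<i>) + 2 * pi * \<i> * (- z + p + centred_shift j)) = 2 * l * (- (of_real pi * \<i>) + 2 * pi * \<i> * (- z + p))"
  proof -
    have "- (of_real pi * \<i>) + 2 * pi * \<i> * (- z + p + centred_shift j) = (- (of_real pi * \<i>) + 2 * pi * \<i> * (- z + p)) + 2 * pi * \<i> * centred_shift j" for j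
      by (simp add: algebra_simps)
    then show ?thesis
      unfolding sum.distrib sum_distrib_left[symmetric] by (simp add: sum.distrib sum_distrib_left[symmetric] sum_cs n2_complex, simp add: algebra_simps)
  qed
  finally have "om p (z + \<tau>/2) = exp (2 * l * (- (of_real pi * \<i>) + 2 * pi * \<i> * (- z + p))) * om (p + \<tau>/2) z" .
  moreover have "exp (pi * \<i> * l) * exp (pi * \<i> * l * (4 * z + \<tau>)) * exp (2 * l * (- (of_real pi * \<i>) + 2 * pi * \<i> * (- z + p)))
     = exp (pi * \<i> * l * (\<tau> - 1) + 4 * pi * \<i> * l * p)"
    unfolding exp_add[symmetric] by (rule arg_cong[where f = exp]) (simp add: algebra_simps)
  ultimately show "U3 \<tau> l (om p) z = exp (pi * \<i> * l * (\<tau> - 1) + 4 * pi * \<i> * l * p) * om (p + \<tau>/2) z"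
    unfolding U3_def by (simp add: mult.assoc[symmetric])
qed

end

text \<open>The row \<open>\<phi>\<close> annihilates the column \<open>\<psi>\<close>, so that in a basis beginning with \<open>\<psi>\<close> the matrix is triangular
  with diagonal entries \<open>a\<close> and \<open>d\<close>.\<close>

lemma trace_triangular_2:
  fixes A :: "complex^2^2" and \<phi> \<psi> :: "2 \<Rightarrow> complex"
  assumes \<psi>: "\<And>\<alpha>. (\<Sum>\<beta>\<in>UNIV. A $ \<alpha> $ \<beta> * \<psi> \<beta>) = a * \<psi> \<alpha>" and \<phi>: "\<And>\<beta>. (\<Sum>\<alpha>\<in>UNIV. \<phi> \<alpha> * A $ \<alpha> $ \<beta>) = d * \<phi> \<beta>"
    and "\<psi> 1 \<noteq> 0 \<or> \<psi> 2 \<noteq> 0" and \<phi>\<psi>: "\<phi> 1 = - \<psi> 2" "\<phi> 2 = \<psi> 1"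
  shows "trace A = a + d"
proof -
  have 1: "A$1$1 * \<psi> 1 + A$1$2 * \<psi> 2 = a * \<psi> 1" "A$2$1 * \<psi> 1 + A$2$2 * \<psi> 2 = a * \<psi> 2"
    using \<psi>[of 1] \<psi>[of 2] by (simp_all add: sum_2)
  have 2: "- \<psi> 2 * A$1$1 + \<psi> 1 * A$2$1 = - d * \<psi> 2" "- \<psi> 2 * A$1$2 + \<psi> 1 * A$2$2 = d * \<psi> 1"
    using \<phi>[of 1] \<phi>[of 2] by (simp_all add: sum_2 \<phi>\<psi>)
  have "\<psi> 1 * (A$1$1 + A$2$2 - a - d) = 0" "\<psi> 2 * (A$1$1 + A$2$2 - a - d) = 0"
    using 1 2 by algebra+
  then have "A$1$1 + A$2$2 - a - d = 0" using assms(3) by auto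
  then show ?thesis by (simp add: trace_def sum_2 algebra_simps)
qed

section \<open>The operator $Q_R$\<close>

context theta_tau
begin

lemma al_be_periodic: "al (y + 1) = al y" "be (y + 1) = be y"
  by (simp_all add: theta_add_1)

lemma colv_minus: "colv (- y) = colv y" and rowv_minus: "rowv (- y) = rowv y"
  by (auto simp: colv_def rowv_def theta_minus fun_eq_iff)

lemma colv_of_int: "colv (y + of_int k) = colv y" and rowv_of_int: "rowv (y + of_int k) = rowv y"
  using periodic_of_int[of al 1 y k] periodic_of_int[of be 1 y k] al_be_periodic
  by (auto simp: colv_def rowv_def fun_eq_iff)

end

locale sklyanin_Q = sklyanin +
  fixes N r :: nat and r' :: int and lam0 v :: complex and t :: "nat \<Rightarrow> nat \<Rightarrow> complex"
  assumes N_pos: "N > 0" and N_even: "even N" and r_pos: "r > 0"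
    and eta_eq: "\<eta> = of_int r' / (2 * l * of_nat r)"
begin

abbreviation "S u i j k \<equiv> S_basis \<tau> \<eta> l r lam0 v t u i j k"
abbreviation "QR u \<equiv> Q_R \<tau> \<eta> l N r lam0 v t u"
abbreviation "K \<equiv> multi_idx l N"
abbreviation "walks \<equiv> {1..N} \<rightarrow>\<^sub>E {1..2 * r}"
abbreviation "pr \<equiv> prev N"

lemma eta_r: "2 * l * real r * \<eta> = of_int r'"
  using eta_eq l_pos r_pos by simp

lemma finite_K: "finite K" and finite_walks: "finite walks"
  unfolding multi_idx_def by (auto intro: finite_PiE)

text \<open>\<open>S_basis\<close> tests the upward step first, so a downward step excludes it.\<close>

definition step_up :: "nat \<Rightarrow> nat \<Rightarrow> bool" where "step_up i j \<longleftrightarrow> [int i = int j + 1] (mod (2 * int r))"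
definition step_down :: "nat \<Rightarrow> nat \<Rightarrow> bool" where "step_down i j \<longleftrightarrow> \<not> step_up i j \<and> [int i = int j - 1] (mod (2 * int r))"

text \<open>The vector \<open>S u i j k\<close> is a multiple of \<open>om (centre b u j)\<close>, where \<open>b\<close> tells whether the step goes up.\<close>

definition centre :: "bool \<Rightarrow> complex \<Rightarrow> nat \<Rightarrow> complex" where
  "centre b u j = (if b then (lam0 - v) / 2 + 2 * j * l * \<eta> else - ((lam0 - v) / 2 + 2 * j * l * \<eta>)) + u / 2 + l * \<eta>"

lemma S_up: "step_up i j \<Longrightarrow> S u i j k = (\<lambda>z. t k j * om (centre True u j) z)"
proof -
  assume "step_up i j"
  moreover have "(lam0 + complex_of_real (4 * of_nat j * l * \<eta>) + u - v) / 2 + l * \<eta> = centre True u j"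
    by (simp add: centre_def field_simps)
  ultimately show ?thesis unfolding S_basis_def step_up_def omega_eq_om by simp
qed

lemma S_down: "step_down i j \<Longrightarrow> S u i j k = (\<lambda>z. t k j * om (centre False u j) z)"
proof -
  assume "step_down i j"
  moreover have "(- lam0 - complex_of_real (4 * of_nat j * l * \<eta>) + u - (- v)) / 2 + l * \<eta> = centre False u j"
    by (simp add: centre_def field_simps)
  ultimately show ?thesis unfolding S_basis_def step_up_def step_down_def omega_eq_om by simp
qed

lemma S_none: "\<not> step_up i j \<Longrightarrow> \<not> step_down i j \<Longrightarrow> S u i j k = (\<lambda>z. 0)"
  unfolding S_basis_def step_up_def step_down_def by simp

lemma step_cases:
  obtains "step_up i j" | "step_down i j" | "\<not> step_up i j" "\<not> step_down i j"
  by blast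

lemma S_V: "S u i j k \<in> V"
  by (rule step_cases[of i j]) (simp_all add: S_up S_down S_none V_scale om_V V_zero)

text \<open>The argument of the column attached to the vertex \<open>j\<close>. A step in either direction leads from the column at
  one vertex to the column at the next one.\<close>

definition psi :: "int \<Rightarrow> complex" where
  "psi j = (v - lam0) / 2 - 2 * of_int j * l * \<eta>"

text \<open>The arguments differ by \<open>2 * l * r * \<eta>\<close> times an even integer, which is an integer, and \<open>al\<close> and \<open>be\<close> have period \<open>1\<close>.\<close>

lemma psi_cong:
  assumes "[i = j] (mod (2 * int r))"
  shows "colv (psi i) = colv (psi j)" "rowv (psi i) = rowv (psi j)"
proof -
  obtain k where k: "i = j + 2 * int r * k" using cong_sym[OF assms] by (auto simp: cong_iff_lin)
  have e: "2 * complex_of_int (2 * int r * k) * l * \<eta> = of_int (2 * r' * k)"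
  proof -
    have "2 * complex_of_int (2 * int r * k) * l * \<eta> = 2 * k * complex_of_real (2 * l * real r * \<eta>)" by simp
    then show ?thesis unfolding eta_r by simp
  qed
  have "psi i = psi j - 2 * complex_of_int (2 * int r * k) * l * \<eta>"
    unfolding k psi_def of_int_add by (simp add: algebra_simps)
  then have "psi i = psi j + of_int (- 2 * r' * k)" unfolding e by simp
  then show "colv (psi i) = colv (psi j)" "rowv (psi i) = rowv (psi j)"
    by (simp_all only: colv_of_int rowv_of_int)
qed

lemma L_S_col:
  "(\<Sum>\<beta>\<in>UNIV. L_entry u \<alpha> \<beta> (S u i j k) z * colv (psi (int j)) \<beta>)
     = (2 * t11 (u + 2 * l * \<eta>) * S (u - 2 * \<eta>) i j k z) * colv (psi (int i)) \<alpha>"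
proof (rule step_cases[of i j])
  assume step_up: "step_up i j"
  let ?p = "centre True u j"
  have a: "u/2 - ?p + l * \<eta> = psi (int j)" "u/2 - ?p - l * \<eta> = psi (int j + 1)" "?p - \<eta> = centre True (u - 2 * \<eta>) j"
    by (auto simp: psi_def centre_def field_simps)
  have b: "colv (psi (int i)) = colv (psi (int j + 1))" using step_up unfolding step_up_def by (rule psi_cong)
  have "(\<Sum>\<beta>\<in>UNIV. L_entry u \<alpha> \<beta> (S u i j k) z * colv (psi (int j)) \<beta>)
     = t k j * (\<Sum>\<beta>\<in>UNIV. L_entry u \<alpha> \<beta> (om ?p) z * colv (u/2 - ?p + l * \<eta>) \<beta>)"
    unfolding S_up[OF step_up] L_entry_scale[OF om_V] a(1)[symmetric] by (simp add: sum_distrib_left mult_ac)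
  then show ?thesis unfolding L_om_col unfolding a b by (simp add: S_up[OF step_up] mult_ac)
next
  assume step_down: "step_down i j"
  let ?p = "centre False u j"
  have a: "u/2 - ?p + l * \<eta> = - psi (int j)" "u/2 - ?p - l * \<eta> = - psi (int j - 1)" "?p - \<eta> = centre False (u - 2 * \<eta>) j"
    by (auto simp: psi_def centre_def field_simps)
  have b: "colv (psi (int i)) = colv (psi (int j - 1))" using step_down unfolding step_down_def by (intro psi_cong) simp
  have "(\<Sum>\<beta>\<in>UNIV. L_entry u \<alpha> \<beta> (S u i j k) z * colv (psi (int j)) \<beta>)
     = t k j * (\<Sum>\<beta>\<in>UNIV. L_entry u \<alpha> \<beta> (om ?p) z * colv (u/2 - ?p + l * \<eta>) \<beta>)"
    unfolding S_down[OF step_down] L_entry_scale[OF om_V] colv_minus[of "psi (int j)", symmetric] a(1)[symmetric]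
    by (simp add: sum_distrib_left mult_ac)
  then show ?thesis unfolding L_om_col unfolding a b by (simp add: S_down[OF step_down] colv_minus mult_ac)
qed (simp add: S_none L_entry_zero)

lemma row_L_S:
  "(\<Sum>\<alpha>\<in>UNIV. rowv (psi (int i)) \<alpha> * L_entry u \<alpha> \<beta> (S u i j k) z)
     = (2 * t11 (u - 2 * l * \<eta>) * S (u + 2 * \<eta>) i j k z) * rowv (psi (int j)) \<beta>"
proof (rule step_cases[of i j])
  assume step_up: "step_up i j"
  let ?p = "centre True u j"
  have a: "u/2 - ?p + l * \<eta> = psi (int j)" "u/2 - ?p - l * \<eta> = psi (int j + 1)" "?p + \<eta> = centre True (u + 2 * \<eta>) j"
    by (auto simp: psi_def centre_def field_simps)
  have b: "rowv (psi (int i)) = rowv (psi (int j + 1))" using step_up unfolding step_up_def by (rule psi_cong)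
  have "(\<Sum>\<alpha>\<in>UNIV. rowv (psi (int i)) \<alpha> * L_entry u \<alpha> \<beta> (S u i j k) z)
     = t k j * (\<Sum>\<alpha>\<in>UNIV. rowv (u/2 - ?p - l * \<eta>) \<alpha> * L_entry u \<alpha> \<beta> (om ?p) z)"
    unfolding S_up[OF step_up] L_entry_scale[OF om_V] b a(2)[symmetric] by (simp add: sum_distrib_left mult_ac)
  then show ?thesis unfolding row_L_om unfolding a by (simp add: S_up[OF step_up] mult_ac)
next
  assume step_down: "step_down i j"
  let ?p = "centre False u j"
  have a: "u/2 - ?p + l * \<eta> = - psi (int j)" "u/2 - ?p - l * \<eta> = - psi (int j - 1)" "?p + \<eta> = centre False (u + 2 * \<eta>) j"
    by (auto simp: psi_def centre_def field_simps)
  have b: "rowv (psi (int i)) = rowv (psi (int j - 1))" using step_down unfolding step_down_def by (intro psi_cong) simp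
  have "(\<Sum>\<alpha>\<in>UNIV. rowv (psi (int i)) \<alpha> * L_entry u \<alpha> \<beta> (S u i j k) z)
     = t k j * (\<Sum>\<alpha>\<in>UNIV. rowv (u/2 - ?p - l * \<eta>) \<alpha> * L_entry u \<alpha> \<beta> (om ?p) z)"
    unfolding S_down[OF step_down] L_entry_scale[OF om_V] b rowv_minus[of "psi (int j - 1)", symmetric] a(2)[symmetric]
    by (simp add: sum_distrib_left mult_ac)
  then show ?thesis unfolding row_L_om unfolding a by (simp add: S_down[OF step_down] rowv_minus mult_ac)
qed (simp add: S_none L_entry_zero)

definition chain :: "complex \<Rightarrow> (nat \<Rightarrow> nat) \<Rightarrow> (nat \<Rightarrow> nat) \<Rightarrow> nat \<Rightarrow> complex \<Rightarrow> complex" where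
  "chain u i k n = S u (i n) (i (pr n)) (k n)"

lemma chain_V: "chain u i k n \<in> V" by (simp add: chain_def S_V)

lemma QR_eq: "QR u c = (\<lambda>z. \<Sum>q\<in>K \<times> walks. c (fst q) * pure_tensor N (chain u (snd q) (fst q)) z)"
  unfolding Q_R_def chain_def prev_def sum.cartesian_product[symmetric] sum_distrib_left
  by (simp add: sum.cartesian_product split_def)

lemma L_product_chain_col:
  assumes "M \<le> N"
  shows "(\<Sum>\<beta>\<in>UNIV. L_product u (chain u i k) z M $ \<alpha> $ \<beta> * colv (psi (int (i N))) \<beta>)
     = (\<Prod>n=1..M. 2 * t11 (u + 2 * l * \<eta>) * chain (u - 2 * \<eta>) i k n (z n)) * colv (psi (int (i (if M = 0 then N else M)))) \<alpha>"
  using assms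
proof (induction M arbitrary: \<alpha>)
  case 0
  show ?case by (simp add: mat_def if_distrib[of "\<lambda>x. x * _"] cong: if_cong)
next
  case (Suc M)
  have p: "pr (Suc M) = (if M = 0 then N else M)" by (auto simp: prev_def)
  have "(\<Sum>\<beta>\<in>UNIV. L_product u (chain u i k) z (Suc M) $ \<alpha> $ \<beta> * colv (psi (int (i N))) \<beta>)
    = (\<Sum>\<gamma>\<in>UNIV. L_entry u \<alpha> \<gamma> (chain u i k (Suc M)) (z (Suc M)) *
        (\<Sum>\<beta>\<in>UNIV. L_product u (chain u i k) z M $ \<gamma> $ \<beta> * colv (psi (int (i N))) \<beta>))"
    by (simp add: matrix_matrix_mult_def L_matrix_def sum_distrib_left sum_distrib_right mult.assoc)
       (rule sum.swap)
  also have "\<dots> = (\<Prod>n=1..M. 2 * t11 (u + 2 * l * \<eta>) * chain (u - 2 * \<eta>) i k n (z n)) *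
      (\<Sum>\<gamma>\<in>UNIV. L_entry u \<alpha> \<gamma> (S u (i (Suc M)) (i (pr (Suc M))) (k (Suc M))) (z (Suc M)) * colv (psi (int (i (pr (Suc M))))) \<gamma>)"
    unfolding Suc.IH[OF Suc_leD[OF Suc.prems]] p[symmetric] chain_def sum_distrib_left by (simp add: mult_ac)
  also have "\<dots> = (\<Prod>n=1..Suc M. 2 * t11 (u + 2 * l * \<eta>) * chain (u - 2 * \<eta>) i k n (z n)) * colv (psi (int (i (Suc M)))) \<alpha>"
    unfolding L_S_col by (simp add: chain_def mult_ac)
  finally show ?case by simp
qed

lemma L_product_chain_row:
  assumes "M \<le> N"
  shows "(\<Sum>\<alpha>\<in>UNIV. rowv (psi (int (i (if M = 0 then N else M)))) \<alpha> * L_product u (chain u i k) z M $ \<alpha> $ \<beta>)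
     = (\<Prod>n=1..M. 2 * t11 (u - 2 * l * \<eta>) * chain (u + 2 * \<eta>) i k n (z n)) * rowv (psi (int (i N))) \<beta>"
  using assms
proof (induction M arbitrary: \<beta>)
  case 0
  show ?case by (simp add: mat_def if_distrib[of "\<lambda>x. _ * x"] cong: if_cong)
next
  case (Suc M)
  have p: "pr (Suc M) = (if M = 0 then N else M)" by (auto simp: prev_def)
  have "(\<Sum>\<alpha>\<in>UNIV. rowv (psi (int (i (Suc M)))) \<alpha> * L_product u (chain u i k) z (Suc M) $ \<alpha> $ \<beta>)
    = (\<Sum>\<gamma>\<in>UNIV. (\<Sum>\<alpha>\<in>UNIV. rowv (psi (int (i (Suc M)))) \<alpha> * L_entry u \<alpha> \<gamma> (chain u i k (Suc M)) (z (Suc M))) *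
        L_product u (chain u i k) z M $ \<gamma> $ \<beta>)"
    by (simp add: matrix_matrix_mult_def L_matrix_def sum_distrib_left sum_distrib_right mult.assoc)
       (rule sum.swap)
  also have "\<dots> = (2 * t11 (u - 2 * l * \<eta>) * chain (u + 2 * \<eta>) i k (Suc M) (z (Suc M))) *
      (\<Sum>\<gamma>\<in>UNIV. rowv (psi (int (i (if M = 0 then N else M)))) \<gamma> * L_product u (chain u i k) z M $ \<gamma> $ \<beta>)"
    unfolding chain_def[of u] row_L_S p[symmetric] sum_distrib_left by (simp add: chain_def mult_ac)
  also have "\<dots> = (\<Prod>n=1..Suc M. 2 * t11 (u - 2 * l * \<eta>) * chain (u + 2 * \<eta>) i k n (z n)) * rowv (psi (int (i N))) \<beta>"
    unfolding Suc.IH[OF Suc_leD[OF Suc.prems]] by (simp add: mult_ac)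
  finally show ?case by simp
qed

abbreviation "hp \<equiv> h_plus \<tau> \<eta> l N"
abbreviation "hm \<equiv> h_minus \<tau> \<eta> l N"

text \<open>For a closed walk the columns at its two ends agree. So the monodromy matrix has an eigencolumn and an
  eigenrow for the two products of scalars, and \<open>trace_triangular_2\<close> applies.\<close>

lemma trace_chain:
  "trace (L_product u (chain u i k) z N) =
     hm u * pure_tensor N (chain (u - 2 * \<eta>) i k) z + hp u * pure_tensor N (chain (u + 2 * \<eta>) i k) z"
proof -
  let ?y = "psi (int (i N))"
  have one: "(\<Prod>n=1..N. c * f n) = c ^ N * (\<Prod>n=1..N. f n)" for c :: complex and f :: "nat \<Rightarrow> complex"
    by (simp add: prod.distrib)
  have "trace (L_product u (chain u i k) z N) =
    (\<Prod>n=1..N. 2 * t11 (u + 2 * l * \<eta>) * chain (u - 2 * \<eta>) i k n (z n)) +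
    (\<Prod>n=1..N. 2 * t11 (u - 2 * l * \<eta>) * chain (u + 2 * \<eta>) i k n (z n))"
  proof (rule trace_triangular_2)
    have N: "(if N = 0 then N else N) = N" by simp
    show "(\<Sum>\<beta>\<in>UNIV. L_product u (chain u i k) z N $ \<alpha> $ \<beta> * colv ?y \<beta>) =
        (\<Prod>n=1..N. 2 * t11 (u + 2 * l * \<eta>) * chain (u - 2 * \<eta>) i k n (z n)) * colv ?y \<alpha>" for \<alpha>
      using L_product_chain_col[OF order_refl, of u i k z \<alpha>] unfolding N .
    show "(\<Sum>\<alpha>\<in>UNIV. rowv ?y \<alpha> * L_product u (chain u i k) z N $ \<alpha> $ \<beta>) =
        (\<Prod>n=1..N. 2 * t11 (u - 2 * l * \<eta>) * chain (u + 2 * \<eta>) i k n (z n)) * rowv ?y \<beta>" for \<beta>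
      using L_product_chain_row[OF order_refl, of i u k z \<beta>] unfolding N .
  qed (use al_be_not_both_zero[of ?y] in \<open>auto simp: colv_def rowv_def\<close>)
  then show ?thesis unfolding one h_plus_def h_minus_def pure_tensor_def by simp
qed

theorem TQ_R:
  "T N u (QR u c) = (\<lambda>z. hm u * QR (u - 2 * \<eta>) c z + hp u * QR (u + 2 * \<eta>) c z)"
proof -
  have "T N u (QR u c) = (\<lambda>z. \<Sum>q\<in>K \<times> walks. c (fst q) * trace (L_product u (chain u (snd q) (fst q)) z N))"
    unfolding QR_eq by (rule transfer_matrix_eq) (rule chain_V)
  then show ?thesis
    unfolding trace_chain QR_eq by (simp add: sum_distrib_left sum.distrib[symmetric] algebra_simps)
qed

lemma QR_H: "QR u c \<in> HS N"
  unfolding QR_eq by (intro H_sum[OF N_pos] H_pure chain_V)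

lemma QR_linear: "QR u (\<lambda>k. a * c k + d k) = (\<lambda>z. a * QR u c z + QR u d z)"
  unfolding QR_eq by (simp add: sum_distrib_left sum.distrib[symmetric] algebra_simps)

abbreviation "UT A \<equiv> tensor_power N A"
abbreviation "e1 \<equiv> exp (- of_nat N * l * pi * \<i>)"
abbreviation "e3 u \<equiv> exp (of_nat N * l * pi * \<i> * (\<tau> - 1) + 2 * of_nat N * l * pi * \<i> * u)"

lemma U1_S: "U1 l (S u i j k) = (\<lambda>z. exp (- pi * \<i> * l) * S (u + 1) i j k z)"
proof -
  have sc: "U1 l (\<lambda>z. c * f z) = (\<lambda>z. c * U1 l f z)" for c f by (auto simp: U1_def)
  have c: "centre b u j + 1/2 = centre b (u + 1) j" for b by (simp add: centre_def field_simps)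
  show ?thesis
    by (rule step_cases[of i j])
       (simp_all add: S_up S_down S_none sc U1_om c mult_ac, simp add: U1_def)
qed

theorem U1_QR: "UT (U1 l) (QR u c) = (\<lambda>z. e1 * QR (u + 1) c z)"
proof -
  have e: "exp (- pi * \<i> * l) ^ N = e1"
    unfolding exp_of_nat_mult[symmetric] by (rule arg_cong[where f = exp]) (simp add: algebra_simps)
  have "UT (U1 l) (QR u c) = (\<lambda>z. \<Sum>q\<in>K \<times> walks. c (fst q) *
      pure_tensor N (\<lambda>n. U1 l (chain u (snd q) (fst q) n)) z)"
    unfolding QR_eq by (rule tensor_power_eq[OF chain_V linear_over_U(1)])
  also have "\<dots> = (\<lambda>z. e1 * QR (u + 1) c z)"
    unfolding QR_eq chain_def U1_S pure_tensor_def prod.distrib prod_constant e[symmetric]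
    by (simp add: sum_distrib_left mult_ac)
  finally show ?thesis .
qed

lemma exp_two_pi_int: "exp (2 * pi * \<i> * of_int k) = 1"
  using exp_of_int_pi[of k] by (simp add: mult_ac)

text \<open>The multiplier of \<open>om\<close> under \<open>U3\<close> depends on the centre of the step. It is the quotient of a Gaussian potential at the ends of the step; as
  \<open>4 * l * l * r * \<eta>\<close> is an integer, the potential has period \<open>2 * r\<close>, and the quotients cancel along a closed walk.\<close>

lemma U3_S:
  fixes r'' :: int
  assumes r'': "lam0 - v = 2 * of_int r'' * l * \<eta>"
  defines "pot \<equiv> \<lambda>j :: int. exp (4 * pi * \<i> * l * l * \<eta> * of_int (r'' * j + j * j) :: complex)"
  shows "U3 \<tau> l (S u i j k) = (\<lambda>z. exp (pi * \<i> * l * (\<tau> - 1) + 2 * pi * \<i> * l * u) * (pot (int i) / pot (int j)) * S (u + \<tau>) i j k z)"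
proof -
  have pot_cong: "pot a = pot b" if ab: "[a = b] (mod (2 * int r))" for a b
  proof -
    obtain m where m: "a = b + 2 * int r * m" using cong_sym[OF ab] by (auto simp: cong_iff_lin)
    define X where "X = m * (r'' + 2 * b + 2 * int r * m)"
    have "r'' * a + a * a = (r'' * b + b * b) + int r * (2 * X)"
      unfolding m X_def by (simp add: algebra_simps)
    moreover have "4 * pi * \<i> * l * l * \<eta> * of_int (int r * (2 * X)) = 2 * pi * \<i> * of_int (int n2 * r' * X)"
    proof -
      have "4 * pi * \<i> * l * l * \<eta> * of_int (int r * (2 * X)) = 2 * pi * \<i> * (2 * of_real l * of_real (2 * l * real r * \<eta>) * of_int X)"
        by simp
      then show ?thesis unfolding eta_r n2_complex[symmetric] by simp
    qed
    ultimately have "pot a = pot b * exp (2 * pi * \<i> * of_int (int n2 * r' * X))"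
      unfolding pot_def exp_add[symmetric] by (simp only: of_int_add distrib_left)
    then show ?thesis by (simp only: exp_two_pi_int mult_1_right)
  qed
  have sc: "U3 \<tau> l (\<lambda>z. c * f z) = (\<lambda>z. c * U3 \<tau> l f z)" for c f by (auto simp: U3_def)
  have c: "centre b u j + \<tau>/2 = centre b (u + \<tau>) j" for b by (simp add: centre_def field_simps)
  have lv: "(lam0 - v) / 2 = of_int r'' * l * \<eta>" using r'' by simp
  have step_up: "exp (pi * \<i> * l * (\<tau> - 1) + 4 * pi * \<i> * l * centre True u j) =
     exp (pi * \<i> * l * (\<tau> - 1) + 2 * pi * \<i> * l * u) * (pot (int j + 1) / pot (int j))"
    unfolding pot_def exp_diff[symmetric] exp_add[symmetric] centre_def lv
    by (rule arg_cong[where f = exp]) (simp add: algebra_simps)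
  have step_down: "exp (pi * \<i> * l * (\<tau> - 1) + 4 * pi * \<i> * l * centre False u j) =
     exp (pi * \<i> * l * (\<tau> - 1) + 2 * pi * \<i> * l * u) * (pot (int j - 1) / pot (int j))"
    unfolding pot_def exp_diff[symmetric] exp_add[symmetric] centre_def lv
    by (rule arg_cong[where f = exp]) (simp add: algebra_simps)
  show ?thesis
  proof (rule step_cases[of i j])
    assume u: "step_up i j"
    then have p: "pot (int i) = pot (int j + 1)" unfolding step_up_def by (rule pot_cong)
    show ?thesis unfolding S_up[OF u] sc U3_om c step_up p by (simp add: mult_ac)
  next
    assume u: "step_down i j"
    then have p: "pot (int i) = pot (int j - 1)" unfolding step_down_def by (intro pot_cong) simp
    show ?thesis unfolding S_down[OF u] sc U3_om c step_down p by (simp add: mult_ac)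
  qed (simp add: S_none U3_def)
qed

theorem U3_QR:
  fixes r'' :: int
  assumes r'': "lam0 - v = 2 * of_int r'' * l * \<eta>"
  shows "UT (U3 \<tau> l) (QR u c) = (\<lambda>z. e3 u * QR (u + \<tau>) c z)"
proof -
  define pot where "pot j = exp (4 * pi * \<i> * l * l * \<eta> * of_int (r'' * j + j * j) :: complex)" for j :: int
  have e: "exp (pi * \<i> * l * (\<tau> - 1) + 2 * pi * \<i> * l * u) ^ N = e3 u"
    unfolding exp_of_nat_mult[symmetric] by (rule arg_cong[where f = exp]) (simp add: algebra_simps)
  have "UT (U3 \<tau> l) (QR u c) = (\<lambda>z. \<Sum>q\<in>K \<times> walks. c (fst q) *
      pure_tensor N (\<lambda>n. U3 \<tau> l (chain u (snd q) (fst q) n)) z)"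
    unfolding QR_eq by (rule tensor_power_eq[OF chain_V linear_over_U(2)])
  also have "\<dots> = (\<lambda>z. \<Sum>q\<in>K \<times> walks. c (fst q) * (e3 u * pure_tensor N (chain (u + \<tau>) (snd q) (fst q)) z))"
  proof (intro ext sum.cong refl arg_cong2[where f = "(*)"])
    fix z :: "nat \<Rightarrow> complex" and q :: "(nat \<Rightarrow> nat) \<times> (nat \<Rightarrow> nat)"
    have "(\<Prod>n=1..N. pot (int (snd q n)) / pot (int (snd q (pr n)))) = 1"
      by (rule prod_cyclic_quotient[of N "\<lambda>j. pot (int j)"]) (simp add: pot_def)
    then show "pure_tensor N (\<lambda>n. U3 \<tau> l (chain u (snd q) (fst q) n)) z = e3 u * pure_tensor N (chain (u + \<tau>) (snd q) (fst q)) z"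
      unfolding pure_tensor_def chain_def U3_S[OF r''] prod.distrib prod_constant pot_def e[symmetric] by simp
  qed
  also have "\<dots> = (\<lambda>z. e3 u * QR (u + \<tau>) c z)"
    unfolding QR_eq by (simp add: sum_distrib_left mult_ac)
  finally show ?thesis .
qed

end

section \<open>Integrals of periodic functions\<close>

lemma integral_periodic_shift:
  fixes g :: "real \<Rightarrow> complex"
  assumes cont: "continuous_on UNIV g" and per: "\<And>y. g (y + T) = g y" and T: "T > 0"
  shows "integral {0..T} (\<lambda>y. g (y + a)) = integral {0..T} g"
proof -
  define M where "M = \<bar>a\<bar> + T + 1"
  obtain G where G: "\<And>x. x \<in> {-M..M} \<Longrightarrow> (G has_vector_derivative g x) (at x within {-M..M})"
    using antiderivative_continuous[OF continuous_on_subset[OF cont subset_UNIV]] by blast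
  have G': "(G has_vector_derivative g x) (at x)" if "-M < x" "x < M" for x
  proof -
    have "at x within {-M..M} = at x" by (rule at_within_Icc_at[OF that])
    moreover have "x \<in> {-M..M}" using that by simp
    ultimately show ?thesis using G[of x] by simp
  qed
  have int: "(g has_integral (G (T + b) - G b)) {b..T + b}" if "\<bar>b\<bar> \<le> \<bar>a\<bar>" for b
  proof (rule fundamental_theorem_of_calculus)
    fix x assume "x \<in> {b..T + b}"
    then have x: "b \<le> x" "x \<le> T + b" by auto
    have "- \<bar>a\<bar> \<le> b" "b \<le> \<bar>a\<bar>" using that by linarith+
    then have "-M < x" "x < M" using x T unfolding M_def by linarith+
    then show "(G has_vector_derivative g x) (at x within {b..T + b})"
      by (rule has_vector_derivative_at_within[OF G'])
  qed (use T in auto)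
  have "\<exists>c. \<forall>s\<in>{-\<bar>a\<bar>..\<bar>a\<bar>}. G (s + T) - G s = c"
  proof (rule has_derivative_zero_constant)
    fix s assume s: "s \<in> {-\<bar>a\<bar>..\<bar>a\<bar>}"
    have "(G has_vector_derivative g s) (at s)" by (rule G') (use s T in \<open>unfold M_def atLeastAtMost_iff, linarith+\<close>)
    moreover have "((\<lambda>s. G (s + T)) has_vector_derivative g (s + T)) (at s)"
    proof -
      have "(G has_vector_derivative g (s + T)) (at (s + T))"
        by (rule G') (use s T in \<open>unfold M_def atLeastAtMost_iff, linarith+\<close>)
      then have "((G \<circ> (\<lambda>s. s + T)) has_vector_derivative 1 *\<^sub>R g (s + T)) (at s)"
        by (intro vector_diff_chain_at) (auto intro!: derivative_eq_intros)
      then show ?thesis by (simp add: o_def)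
    qed
    ultimately have "((\<lambda>s. G (s + T) - G s) has_vector_derivative g (s + T) - g s) (at s)"
      by (intro has_vector_derivative_diff)
    then show "((\<lambda>s. G (s + T) - G s) has_derivative (\<lambda>h. 0)) (at s within {-\<bar>a\<bar>..\<bar>a\<bar>})"
      unfolding per by (simp add: has_vector_derivative_def has_derivative_at_withinI)
  qed auto
  then obtain c where c: "\<And>s. s \<in> {-\<bar>a\<bar>..\<bar>a\<bar>} \<Longrightarrow> G (s + T) - G s = c" by blast
  have "G (a + T) - G a = G (0 + T) - G 0" 
  proof -
    have "a \<in> {-\<bar>a\<bar>..\<bar>a\<bar>}" "0 \<in> {-\<bar>a\<bar>..\<bar>a\<bar>}" unfolding atLeastAtMost_iff by linarith+
    then show ?thesis using c by metis
  qed
  then have "integral {a..T + a} g = integral {0..T + 0} g"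
    using integral_unique[OF int[of a]] integral_unique[OF int[of 0]] by (simp add: add.commute)
  moreover have "integral {0..T} (\<lambda>y. g (y + a)) = integral {a..T + a} g"
    using integral_shift_Icc_real[of 0 T g a] by (simp add: o_def add.commute)
  ultimately show ?thesis by simp
qed

lemma integral_periodic_reflect:
  fixes g :: "real \<Rightarrow> complex"
  assumes cont: "continuous_on UNIV g" and per: "\<And>y. g (y + T) = g y" and T: "T > 0"
  shows "integral {0..T} (\<lambda>y. g (- y)) = integral {0..T} g"
proof -
  have "integral {0..T} (\<lambda>y. g (- y)) = integral {-T..0} g"
    using Henstock_Kurzweil_Integration.integral_reflect_real[of 0 "-T" g] by simp
  also have "\<dots> = integral {0..T} (\<lambda>y. g (y + - T))"
    using integral_shift_Icc_real[of 0 T g "- T"] by (simp add: o_def add.commute)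
  also have "\<dots> = integral {0..T} g" by (rule integral_periodic_shift[OF assms])
  finally show ?thesis .
qed

text \<open>A primitive \<open>G\<close> on the strip satisfies \<open>G (z + T) - G z = c\<close> with a constant \<open>c\<close>, because the derivative of the
  left hand side vanishes. Both integrals are equal to \<open>c\<close>.\<close>

lemma integral_holomorphic_shift:
  fixes h :: "complex \<Rightarrow> complex"
  assumes h: "h holomorphic_on {z. p < Im z \<and> Im z < q}" and per: "\<And>z. p < Im z \<Longrightarrow> Im z < q \<Longrightarrow> h (z + of_real T) = h z"
    and T: "T > 0" and p: "p < 0" "0 < q" and s: "p < Im s" "Im s < q"
  shows "integral {0..T} (\<lambda>y. h (of_real y + s)) = integral {0..T} (\<lambda>y. h (of_real y))"
proof -
  define A where "A = {z. p < Im z \<and> Im z < q}"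
  have A_eq: "A = {z. p < Im z} \<inter> {z. Im z < q}" by (auto simp: A_def)
  have opA: "open A" unfolding A_eq by (intro open_Int open_halfspace_Im_gt open_halfspace_Im_lt)
  have cvA: "convex A" unfolding A_eq by (intro convex_Int convex_halfspace_Im_gt convex_halfspace_Im_lt)
  obtain G where G: "\<And>z. z \<in> A \<Longrightarrow> (G has_field_derivative h z) (at z within A)"
    using holomorphic_convex_primitive'[OF cvA opA] h unfolding A_def by blast
  then have G: "(G has_field_derivative h z) (at z)" if "z \<in> A" for z
    using that opA by (metis at_within_open)
  have int: "((\<lambda>y. h (of_real y + b)) has_integral (G (of_real T + b) - G (of_real 0 + b))) {0..T}" if b: "b \<in> A" for b
  proof (rule fundamental_theorem_of_calculus)
    fix y :: real
    have "((G \<circ> (\<lambda>y. of_real y + b)) has_vector_derivative 1 * h (of_real y + b)) (at y)"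
    proof (rule field_vector_diff_chain_at)
      show "((\<lambda>y. of_real y + b) has_vector_derivative 1) (at y)"
        by (auto intro!: derivative_eq_intros)
      show "(G has_field_derivative h (of_real y + b)) (at (of_real y + b))"
        by (rule G) (use b in \<open>auto simp: A_def\<close>)
    qed
    then show "((\<lambda>y. G (of_real y + b)) has_vector_derivative h (of_real y + b)) (at y within {0..T})"
      by (simp add: o_def has_vector_derivative_at_within)
  qed (use T in auto)
  have "\<exists>c. \<forall>z\<in>A. G (z + of_real T) - G z = c"
  proof (rule has_field_derivative_zero_constant[OF cvA])
    fix z assume z: "z \<in> A"
    then have zT: "z + of_real T \<in> A" by (auto simp: A_def)
    have "((\<lambda>z. G (z + of_real T) - G z) has_field_derivative h (z + of_real T) - h z) (at z)"
      by (intro DERIV_diff G z DERIV_shift[THEN iffD1, OF G[OF zT]])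
    then show "((\<lambda>z. G (z + of_real T) - G z) has_field_derivative 0) (at z within A)"
      using per[of z] z by (auto simp: A_def has_field_derivative_at_within)
  qed
  moreover have "s \<in> A" "0 \<in> A" using s p by (auto simp: A_def)
  ultimately have "G (s + of_real T) - G s = G (0 + of_real T) - G 0" by metis
  then show ?thesis
    using integral_unique[OF int[OF \<open>s \<in> A\<close>]] integral_unique[OF int[OF \<open>0 \<in> A\<close>]] by (simp add: add.commute)
qed

section \<open>The double integral over the period rectangle\<close>

definition double_integral :: "real \<Rightarrow> (complex \<Rightarrow> complex) \<Rightarrow> complex" where
  "double_integral T \<Phi> = integral {0..1} (\<lambda>x. integral {0..T} (\<lambda>y. \<Phi> (Complex x y)))"

lemma Complex_add: "Complex a b + Complex c d = Complex (a + c) (b + d)"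
  by (simp add: complex_eq_iff)

lemma double_integral_inner_continuous:
  fixes \<Phi> :: "complex \<Rightarrow> complex"
  assumes "continuous_on UNIV \<Phi>"
  shows "continuous_on UNIV (\<lambda>x. integral {0..T} (\<lambda>y. \<Phi> (Complex x y)))"
proof -
  have "continuous_on (UNIV \<times> cbox 0 T) (\<lambda>(x, y). \<Phi> (Complex x y))"
    unfolding split_def by (intro continuous_on_compose2[OF assms] continuous_intros) auto
  then show ?thesis using integral_continuous_on_param[of UNIV 0 T "\<lambda>x y. \<Phi> (Complex x y)"] by simp
qed

lemma double_integral_integrable:
  fixes \<Phi> :: "complex \<Rightarrow> complex"
  assumes "continuous_on UNIV \<Phi>"
  shows "(\<lambda>y. \<Phi> (Complex x y)) integrable_on {0..T}"
    and "(\<lambda>x. integral {0..T} (\<lambda>y. \<Phi> (Complex x y))) integrable_on {0..1}"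
proof -
  show "(\<lambda>y. \<Phi> (Complex x y)) integrable_on {0..T}"
    by (intro integrable_continuous_real continuous_on_compose2[OF assms] continuous_intros) auto
  show "(\<lambda>x. integral {0..T} (\<lambda>y. \<Phi> (Complex x y))) integrable_on {0..1}"
    by (intro integrable_continuous_real continuous_on_subset[OF double_integral_inner_continuous[OF assms]]) auto
qed

lemma double_integral_add:
  assumes "continuous_on UNIV \<Phi>" "continuous_on UNIV \<Psi>"
  shows "double_integral T (\<lambda>z. \<Phi> z + \<Psi> z) = double_integral T \<Phi> + double_integral T \<Psi>"
  unfolding double_integral_def using double_integral_integrable[OF assms(1)] double_integral_integrable[OF assms(2)]
  by (simp add: Henstock_Kurzweil_Integration.integral_add)

lemma double_integral_cmult: "double_integral T (\<lambda>z. c * \<Phi> z) = c * double_integral T \<Phi>"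
  unfolding double_integral_def by simp

lemma double_integral_shift:
  assumes cont: "continuous_on UNIV \<Phi>" and T: "T > 0"
    and p1: "\<And>z. \<Phi> (z + 1) = \<Phi> z" and p2: "\<And>z. \<Phi> (z + Complex 0 T) = \<Phi> z"
  shows "double_integral T (\<lambda>z. \<Phi> (z + Complex a b)) = double_integral T \<Phi>"
proof -
  define J where "J x = integral {0..T} (\<lambda>y. \<Phi> (Complex x y))" for x
  have "integral {0..T} (\<lambda>y. \<Phi> (Complex x y + Complex a b)) = J (x + a)" for x
  proof -
    have "integral {0..T} (\<lambda>y. \<Phi> (Complex (x + a) (y + b))) = J (x + a)"
      unfolding J_def
    proof (rule integral_periodic_shift[OF _ _ T])
      show "continuous_on UNIV (\<lambda>y. \<Phi> (Complex (x + a) y))"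
        by (intro continuous_on_compose2[OF cont] continuous_intros) auto
      show "\<Phi> (Complex (x + a) (y + T)) = \<Phi> (Complex (x + a) y)" for y
        using p2[of "Complex (x + a) y"] by (simp add: Complex_add)
    qed
    then show ?thesis by (simp add: Complex_add)
  qed
  moreover have "integral {0..1} (\<lambda>x. J (x + a)) = integral {0..1} J"
  proof (rule integral_periodic_shift)
    show "continuous_on UNIV J" unfolding J_def by (rule double_integral_inner_continuous[OF cont])
    have "\<Phi> (Complex (x + 1) y) = \<Phi> (Complex x y)" for x y
      using p1[of "Complex x y"] by (simp add: one_complex.code Complex_add)
    then show "J (x + 1) = J x" for x unfolding J_def by simp
  qed simp
  ultimately show ?thesis unfolding double_integral_def by (simp add: J_def[abs_def])
qed

lemma double_integral_reflect:
  assumes cont: "continuous_on UNIV \<Phi>" and T: "T > 0"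
    and p1: "\<And>z. \<Phi> (z + 1) = \<Phi> z" and p2: "\<And>z. \<Phi> (z + Complex 0 T) = \<Phi> z"
  shows "double_integral T (\<lambda>z. \<Phi> (- z)) = double_integral T \<Phi>" and "double_integral T (\<lambda>z. \<Phi> (cnj z)) = double_integral T \<Phi>"
proof -
  define J where "J x = integral {0..T} (\<lambda>y. \<Phi> (Complex x y))" for x
  have r: "integral {0..T} (\<lambda>y. \<Phi> (Complex x (- y))) = J x" for x
    unfolding J_def
  proof (rule integral_periodic_reflect[OF _ _ T])
    show "continuous_on UNIV (\<lambda>y. \<Phi> (Complex x y))"
      by (intro continuous_on_compose2[OF cont] continuous_intros) auto
    show "\<Phi> (Complex x (y + T)) = \<Phi> (Complex x y)" for y
      using p2[of "Complex x y"] by (simp add: Complex_add)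
  qed
  show "double_integral T (\<lambda>z. \<Phi> (cnj z)) = double_integral T \<Phi>"
    unfolding double_integral_def complex_cnj r by (simp add: J_def)
  have "integral {0..1} (\<lambda>x. J (- x)) = integral {0..1} J"
  proof (rule integral_periodic_reflect)
    show "continuous_on UNIV J" unfolding J_def by (rule double_integral_inner_continuous[OF cont])
    have "\<Phi> (Complex (x + 1) y) = \<Phi> (Complex x y)" for x y
      using p1[of "Complex x y"] by (simp add: one_complex.code Complex_add)
    then show "J (x + 1) = J x" for x unfolding J_def by simp
  qed simp
  moreover have "- Complex x y = Complex (- x) (- y)" for x y by (simp add: complex_eq_iff)
  ultimately show "double_integral T (\<lambda>z. \<Phi> (- z)) = double_integral T \<Phi>"
    unfolding double_integral_def by (simp add: r) (simp add: J_def[abs_def])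
qed

text \<open>With $z = x + iy$ and $w = x - iy$ as independent variables, the translation of \<open>z\<close> alone by \<open>\<eta>\<close> is the composition of
  the translation of $x$ by $\eta/2$, harmless by periodicity, and of $y$ by an imaginary
  amount, a change of contour.\<close>

lemma double_integral_contour_shift:
  fixes F :: "complex \<Rightarrow> complex \<Rightarrow> complex"
  assumes cont: "continuous_on UNIV (\<lambda>z. F z (cnj z))" and T: "T > 0"
    and p1: "\<And>z w. F (z + 1) (w + 1) = F z w" and p2: "\<And>z w. F (z + Complex 0 T) (w - Complex 0 T) = F z w"
    and hol: "\<And>x :: real. (\<lambda>\<zeta>. F (of_real (x + \<eta>) + \<i> * \<zeta>) (of_real x - \<i> * \<zeta>)) holomorphic_on {z. p < Im z \<and> Im z < q}"
    and p: "p < 0" "0 < q" "p < \<eta>/2" "\<eta>/2 < q"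
  shows "double_integral T (\<lambda>z. F (z + of_real \<eta>) (cnj z)) = double_integral T (\<lambda>z. F z (cnj z))"
proof -
  have "integral {0..T} (\<lambda>y. F (Complex x y + of_real \<eta>) (cnj (Complex x y))) =
     integral {0..T} (\<lambda>y. F (Complex x y + Complex (\<eta>/2) 0) (cnj (Complex x y + Complex (\<eta>/2) 0)))" for x
  proof -
    define h where "h \<zeta> = F (of_real (x + \<eta>) + \<i> * \<zeta>) (of_real x - \<i> * \<zeta>)" for \<zeta>
    have iT: "Complex 0 T = \<i> * of_real T" by (simp add: complex_eq_iff)
    have "integral {0..T} (\<lambda>y. h (of_real y + Complex 0 (\<eta>/2))) = integral {0..T} (\<lambda>y. h (of_real y))"
    proof (rule integral_holomorphic_shift[OF _ _ T])
      show "h holomorphic_on {z. p < Im z \<and> Im z < q}" unfolding h_def by (rule hol)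
      show "h (z + of_real T) = h z" for z
        using p2[of "of_real (x + \<eta>) + \<i> * z" "of_real x - \<i> * z"] unfolding iT by (simp add: h_def algebra_simps)
    qed (use p in auto)
    moreover have "h (of_real y) = F (Complex x y + of_real \<eta>) (cnj (Complex x y))" for y
      unfolding h_def by (rule arg_cong2[where f = F]) (auto simp: complex_eq_iff)
    moreover have "h (of_real y + Complex 0 (\<eta>/2)) = F (Complex x y + Complex (\<eta>/2) 0) (cnj (Complex x y + Complex (\<eta>/2) 0))" for y
      unfolding h_def by (rule arg_cong2[where f = F]) (auto simp: complex_eq_iff)
    ultimately show ?thesis by simp
  qed
  then have "double_integral T (\<lambda>z. F (z + of_real \<eta>) (cnj z)) = double_integral T (\<lambda>z. (\<lambda>z. F z (cnj z)) (z + Complex (\<eta>/2) 0))"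
    unfolding double_integral_def by simp
  also have "\<dots> = double_integral T (\<lambda>z. F z (cnj z))"
  proof (rule double_integral_shift[OF cont T])
    show "F (z + 1) (cnj (z + 1)) = F z (cnj z)" for z using p1 by simp
    have "cnj (Complex 0 T) = - Complex 0 T" by (simp add: complex_eq_iff)
    then show "F (z + Complex 0 T) (cnj (z + Complex 0 T)) = F z (cnj z)" for z using p2[of z "cnj z"] by simp
  qed
  finally show ?thesis .
qed

text \<open>It supplies the continuity by which \<open>walk_symmetric\<close> reaches the heights where theta functions may vanish.\<close>

lemma double_integral_continuous_param:
  fixes G :: "'a :: metric_space \<Rightarrow> complex \<Rightarrow> complex"
  assumes "continuous_on UNIV (\<lambda>(p, z). G p z)"
  shows "continuous_on UNIV (\<lambda>p. double_integral T (G p))"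
proof -
  have "continuous_on (UNIV \<times> cbox 0 1) (\<lambda>(p, x). integral {0..T} (\<lambda>y. G p (Complex x y)))"
  proof -
    have "continuous_on ((UNIV \<times> UNIV) \<times> cbox 0 T)
       ((\<lambda>(p, z). G p z) \<circ> (\<lambda>p :: ('a \<times> real) \<times> real. (fst (fst p), Complex (snd (fst p)) (snd p))))"
      by (intro continuous_on_compose continuous_on_subset[OF assms] continuous_intros) auto
    then have "continuous_on ((UNIV \<times> UNIV) \<times> cbox 0 T) (\<lambda>(px :: 'a \<times> real, y). G (fst px) (Complex (snd px) y))"
      unfolding o_def split_def fst_conv snd_conv .
    then have "continuous_on (UNIV \<times> UNIV) (\<lambda>px :: 'a \<times> real. integral (cbox 0 T) (\<lambda>y. G (fst px) (Complex (snd px) y)))"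
      by (rule integral_continuous_on_param)
    then have "continuous_on (UNIV \<times> cbox 0 1) (\<lambda>px :: 'a \<times> real. integral (cbox 0 T) (\<lambda>y. G (fst px) (Complex (snd px) y)))"
      by (rule continuous_on_subset) auto
    then show ?thesis unfolding split_def by simp
  qed
  from integral_continuous_on_param[OF this] show ?thesis by (simp add: double_integral_def)
qed

section \<open>The Sklyanin form\<close>

locale sklyanin_form_loc = sklyanin +
  assumes eta_less: "\<bar>\<eta>\<bar> < 1 / (2 * (2 * l + 1))"
begin

abbreviation "Tm \<equiv> Im \<tau>"

lemma eta_bound: "(2 * l + 1) * \<bar>\<eta>\<bar> < 1/2"
  using eta_less l_pos by (simp add: field_simps)

text \<open>The denominators of \<open>mu\<close> and of the kernels below are products over a string of \<open>n + 1\<close> arguments with spacing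
  \<open>2 * \<eta>\<close>, centred at \<open>x\<close>.\<close>

definition theta_string :: "nat \<Rightarrow> complex \<Rightarrow> complex" where
  "theta_string n x = (\<Prod>j=0..n. t00 (x + (2 * real j - real n) * \<eta>))"

abbreviation "mu_string \<equiv> theta_string (n2 + 1)"

lemma mu_eq: "mu \<tau> \<eta> l z w = t11 (2 * z) * t11 (2 * w) / (mu_string (z + w) * mu_string (z - w))"
proof -
  have "2 * real j - real (n2 + 1) = 2 * real j - 2 * l - 1" for j using n2 by simp
  then show ?thesis unfolding mu_def theta_string_def by (simp only: prod.distrib)
qed

text \<open>The zeros of \<open>t00\<close> lie on the lines where the real part is a half-integer and on those where the imaginary part is an
  odd multiple of \<open>Im \<tau> / 2\<close>. The second alternative is where the bound on \<open>\<eta>\<close> enters.\<close>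

lemma theta_string_nonzero:
  assumes "Im x = 0 \<or> \<bar>Re x\<bar> + real n * \<bar>\<eta>\<bar> < 1/2"
  shows "theta_string n x \<noteq> 0"
proof -
  have "t00 (x + (2 * real j - real n) * \<eta>) \<noteq> 0" if "j \<in> {0..n}" for j
    using assms
  proof
    assume "Im x = 0" then show ?thesis by (intro t00_nonzero_real) simp
  next
    assume x: "\<bar>Re x\<bar> + real n * \<bar>\<eta>\<bar> < 1/2"
    have "\<bar>2 * real j - real n\<bar> \<le> real n" using that by (simp add: abs_le_iff)
    then have "\<bar>2 * real j - real n\<bar> * \<bar>\<eta>\<bar> \<le> real n * \<bar>\<eta>\<bar>" by (rule mult_right_mono) simp
    then have "\<bar>(2 * real j - real n) * \<eta>\<bar> \<le> real n * \<bar>\<eta>\<bar>" by (simp add: abs_mult)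
    then have "\<bar>Re x + (2 * real j - real n) * \<eta>\<bar> < 1/2" using x by linarith
    then show ?thesis by (intro t00_nonzero_Re) simp
  qed
  then show ?thesis unfolding theta_string_def by simp
qed

lemma theta_string_Suc:
  "theta_string (Suc n) x = theta_string n (x - \<eta>) * t00 (x + real (Suc n) * \<eta>)"
  "theta_string (Suc n) x = t00 (x - real (Suc n) * \<eta>) * theta_string n (x + \<eta>)"
proof -
  have r: "x + complex_of_real ((2 * real j - real (Suc n)) * \<eta>) = x - \<eta> + complex_of_real ((2 * real j - real n) * \<eta>)" for j
    by (simp add: algebra_simps)
  have "2 * real (Suc n) - real (Suc n) = real (Suc n)" by simp
  then show "theta_string (Suc n) x = theta_string n (x - \<eta>) * t00 (x + real (Suc n) * \<eta>)"
    unfolding theta_string_def prod.atLeast0_atMost_Suc by (simp only: r)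
  have r: "x + complex_of_real ((2 * real (Suc j) - real (Suc n)) * \<eta>) = x + \<eta> + complex_of_real ((2 * real j - real n) * \<eta>)" for j
    by (simp add: algebra_simps)
  have "x + complex_of_real ((2 * real 0 - real (Suc n)) * \<eta>) = x - real (Suc n) * \<eta>"
    by (simp add: algebra_simps)
  then show "theta_string (Suc n) x = t00 (x - real (Suc n) * \<eta>) * theta_string n (x + \<eta>)"
    unfolding theta_string_def prod.atLeast0_atMost_Suc_shift o_def by (simp only: r)
qed

lemma theta_string_even: "theta_string n (- x) = theta_string n x"
proof -
  have "theta_string n (- x) = (\<Prod>j=0..n. t00 (x + (2 * real (n - j) - real n) * \<eta>))"
    unfolding theta_string_def
  proof (rule prod.cong[OF refl])
    fix j assume "j \<in> {0..n}"
    then have R: "real (n - j) = real n - real j" by (simp add: of_nat_diff)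
    have "(2 * real (n - j) - real n) * \<eta> = - ((2 * real j - real n) * \<eta>)"
      unfolding R by (simp add: algebra_simps)
    then have "- x + complex_of_real ((2 * real j - real n) * \<eta>) = - (x + complex_of_real ((2 * real (n - j) - real n) * \<eta>))"
      by (simp only: of_real_minus) simp
    then show "t00 (- x + (2 * real j - real n) * \<eta>) = t00 (x + (2 * real (n - j) - real n) * \<eta>)"
      using theta_minus[of 0 0 "x + (2 * real (n - j) - real n) * \<eta>" \<tau>] by (simp only:) simp
  qed
  also have "\<dots> = theta_string n x" unfolding theta_string_def
    by (rule prod.reindex_bij_witness[of _ "\<lambda>j. n - j" "\<lambda>j. n - j"]) auto
  finally show ?thesis .
qed

lemma theta_string_1: "theta_string n (x + 1) = theta_string n x"
proof -
  have r: "x + 1 + c = (x + c) + 1" for c :: complex by simp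
  show ?thesis unfolding theta_string_def r theta_add_1 by simp
qed

lemma sum_shifts: "(\<Sum>j=0..n. 2 * real j - real n) = 0"
proof -
  have "(\<Sum>j=0..n. 2 * real j) = real n * (real n + 1)"
    by (induction n) (auto simp: algebra_simps)
  then show ?thesis by (simp add: sum_subtractf algebra_simps)
qed

lemma theta_string_tau: "theta_string n (x + \<tau>) = exp (- (real n + 1) * pi * \<i> * (2 * x + \<tau>)) * theta_string n x"
proof -
  have r: "x + \<tau> + c = (x + c) + \<tau>" for c :: complex by simp
  let ?c = "\<lambda>j. complex_of_real ((2 * real j - real n) * \<eta>)"
  have "theta_string n (x + \<tau>) = (\<Prod>j=0..n. exp (- pi * \<i> * \<tau> - 2 * pi * \<i> * (x + ?c j))) * theta_string n x"
    unfolding theta_string_def r theta_add_tau by (simp add: prod.distrib)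
  also have "(\<Prod>j=0..n. exp (- pi * \<i> * \<tau> - 2 * pi * \<i> * (x + ?c j))) =
      exp (\<Sum>j=0..n. (- pi * \<i> * \<tau> - 2 * pi * \<i> * x) + (- 2 * pi * \<i>) * ?c j)"
    by (subst exp_sum) (auto intro!: prod.cong arg_cong[where f = exp] simp: algebra_simps)
  also have "(\<Sum>j=0..n. (- pi * \<i> * \<tau> - 2 * pi * \<i> * x) + (- 2 * pi * \<i>) * ?c j)
      = of_nat (n + 1) * (- pi * \<i> * \<tau> - 2 * pi * \<i> * x) + (- 2 * pi * \<i>) * complex_of_real ((\<Sum>j=0..n. 2 * real j - real n) * \<eta>)"
    unfolding sum.distrib sum_distrib_left[symmetric] of_real_sum[symmetric] sum_distrib_right[symmetric] by simp
  also have "\<dots> = - (real n + 1) * pi * \<i> * (2 * x + \<tau>)"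
    unfolding sum_shifts by (simp add: algebra_simps)
  finally show ?thesis .
qed

lemma theta_string_2tau: "theta_string n (x + \<tau> + \<tau>) = exp (- 4 * (real n + 1) * pi * \<i> * (x + \<tau>)) * theta_string n x"
  unfolding theta_string_tau mult.assoc[symmetric] exp_add[symmetric]
  by (rule arg_cong[where f = "\<lambda>e. exp e * theta_string n x"]) (simp add: algebra_simps)

lemma theta_string_holo: "theta_string n holomorphic_on UNIV"
proof -
  have "(\<lambda>z. t00 (z + c)) holomorphic_on UNIV" for c
    using entire_shift[OF holo_theta, of 0 0 1 c] by simp
  then show ?thesis unfolding theta_string_def[abs_def] by (intro holomorphic_intros)
qed

lemma mu_string_nonzero:
  assumes "Im x = 0 \<or> Re x = 0"
  shows "mu_string x \<noteq> 0"
  by (rule theta_string_nonzero) (use assms eta_bound n2 in auto)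

text \<open>The integrands are products of a function of \<open>z\<close> and a function of \<open>cnj z\<close> from this space, divided by
  \<open>mu_string (z + cnj z) * mu_string (z - cnj z)\<close>. The weight is chosen such that the quotient is doubly periodic.\<close>

definition Weight_space :: "(complex \<Rightarrow> complex) set" where
  "Weight_space = {f. f holomorphic_on UNIV \<and> (\<forall>z. f (z + 1) = f z) \<and>
     (\<forall>z. f (z + \<tau>) = exp (- 4 * (l + 1) * pi * \<i> * (2 * z + \<tau>)) * f z)}"

lemma Weight_space_D:
  assumes "p \<in> Weight_space"
  shows Weight_space_holo: "p holomorphic_on UNIV" and Weight_space_1: "p (z + 1) = p z"
    and Weight_space_tau: "p (z + \<tau>) = exp (- 4 * (l + 1) * pi * \<i> * (2 * z + \<tau>)) * p z"
  using assms by (auto simp: Weight_space_def)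

lemma Weight_space_minus_tau:
  assumes "p \<in> Weight_space"
  shows "p (z - \<tau>) = exp (4 * (l + 1) * pi * \<i> * (2 * z - \<tau>)) * p z"
proof -
  have "p z = exp (- 4 * (l + 1) * pi * \<i> * (2 * z - \<tau>)) * p (z - \<tau>)"
    using Weight_space_tau[OF assms, of "z - \<tau>"] by (simp add: algebra_simps)
  then have "exp (4 * (l + 1) * pi * \<i> * (2 * z - \<tau>)) * p z =
     exp (4 * (l + 1) * pi * \<i> * (2 * z - \<tau>) + (- 4 * (l + 1) * pi * \<i> * (2 * z - \<tau>))) * p (z - \<tau>)"
    by (simp only: exp_add mult.assoc)
  moreover have "4 * (l + 1) * pi * \<i> * (2 * z - \<tau>) + (- 4 * (l + 1) * pi * \<i> * (2 * z - \<tau>)) = 0"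
    by (simp add: algebra_simps)
  ultimately show ?thesis by (simp only: exp_zero mult_1_left)
qed

lemma Weight_space_uminus:
  assumes "p \<in> Weight_space"
  shows "(\<lambda>z. p (- z)) \<in> Weight_space"
proof -
  have "p (- (z + 1)) = p (- z)" for z using Weight_space_1[OF assms, of "- (z + 1)"] by simp
  moreover have "p (- (z + \<tau>)) = exp (- 4 * (l + 1) * pi * \<i> * (2 * z + \<tau>)) * p (- z)" for z
  proof -
    have r: "- (z + \<tau>) = - z - \<tau>" by simp
    have e: "4 * (l + 1) * pi * \<i> * (2 * - z - \<tau>) = - 4 * (l + 1) * pi * \<i> * (2 * z + \<tau>)" by (simp add: algebra_simps)
    show ?thesis unfolding r Weight_space_minus_tau[OF assms, of "- z"] e ..
  qed
  moreover have "(\<lambda>z. p (- z)) holomorphic_on UNIV"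
    using entire_shift[OF Weight_space_holo[OF assms], of "-1" 0] by simp
  ultimately show ?thesis by (simp add: Weight_space_def)
qed

lemma Weight_space_lin: "p \<in> Weight_space \<Longrightarrow> q \<in> Weight_space \<Longrightarrow> (\<lambda>z. c * p z + q z) \<in> Weight_space"
  by (auto simp: Weight_space_def algebra_simps intro!: holomorphic_intros)

lemma Weight_space_double: "f \<in> V \<Longrightarrow> (\<lambda>z. f z * t11 (2 * z)) \<in> Weight_space"
proof -
  assume f: "f \<in> V"
  have e: "exp (- 4 * (l + 1) * pi * \<i> * (2 * z + \<tau>)) = exp (- 4 * l * pi * \<i> * (2 * z + \<tau>)) * exp (- 4 * pi * \<i> * (2 * z + \<tau>))" for z
    unfolding exp_add[symmetric] by (rule arg_cong[where f = exp]) (simp add: algebra_simps)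
  have "f (z + \<tau>) * t11 (2 * (z + \<tau>)) = exp (- 4 * (l + 1) * pi * \<i> * (2 * z + \<tau>)) * (f z * t11 (2 * z))" for z
    unfolding V_tau[OF f] t11_2_tau e by (simp only: mult_ac)
  then show ?thesis
    using V_1[OF f] t11_2_1 V_holo[OF f] holo_t11_double by (auto simp: Weight_space_def intro!: holomorphic_intros)
qed

lemma Weight_space_s:
  assumes f: "f \<in> V"
  shows "(\<lambda>z :: complex. s a (z - l * \<eta>) * f (z + \<eta>)) \<in> Weight_space"
proof -
  let ?g = "\<lambda>z :: complex. s a (z - l * \<eta>) * f (z + \<eta>)"
  have "(\<lambda>z. tx a (2 * z + 2 * - complex_of_real (l * \<eta>))) holomorphic_on UNIV" by (rule entire_shift[OF holo_tx])
  then have "(\<lambda>z. s a (z - l * \<eta>)) holomorphic_on UNIV" unfolding s_fun_def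
    by (intro holomorphic_intros) (simp add: algebra_simps)
  moreover have "(\<lambda>z. f (z + \<eta>)) holomorphic_on UNIV"
    using entire_shift[OF V_holo[OF f], of 1 \<eta>] by simp
  ultimately have "?g holomorphic_on UNIV" by (intro holomorphic_intros)
  moreover have "?g (z + 1) = ?g z" for z
  proof -
    have r: "z + 1 - l * \<eta> = (z - l * \<eta>) + 1" "z + 1 + \<eta> = (z + \<eta>) + 1" by auto
    show ?thesis by (simp only: r s_1 V_1[OF f])
  qed
  moreover have "?g (z + \<tau>) = exp (- 4 * (l + 1) * pi * \<i> * (2 * z + \<tau>)) * ?g z" for z
  proof -
    have r: "z + \<tau> - l * \<eta> = (z - l * \<eta>) + \<tau>" "z + \<tau> + \<eta> = (z + \<eta>) + \<tau>" by auto
    show ?thesis unfolding r s_tau V_tau[OF f] by (simp add: exp_add[symmetric] algebra_simps)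
  qed
  ultimately show ?thesis by (simp add: Weight_space_def)
qed

definition pairing_density :: "(complex \<Rightarrow> complex) \<Rightarrow> (complex \<Rightarrow> complex) \<Rightarrow> complex \<Rightarrow> complex" where
  "pairing_density q p z = q (cnj z) * p z / (mu_string (z + cnj z) * mu_string (z - cnj z))"

text \<open>The scalar product as a bilinear form: its antilinear argument enters through the function \<open>star f\<close> of \<open>cnj z\<close>. Both
  arguments then belong to the same space, and complex conjugation of the integration variable makes the form symmetric.\<close>

definition pairing :: "(complex \<Rightarrow> complex) \<Rightarrow> (complex \<Rightarrow> complex) \<Rightarrow> complex" where
  "pairing q p = double_integral Tm (pairing_density q p)"

lemma den_nonzero: "mu_string (z + cnj z) \<noteq> 0" "mu_string (z - cnj z) \<noteq> 0"
  by (auto intro!: mu_string_nonzero)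

lemma continuous_compose_holo:
  assumes "f holomorphic_on UNIV" "continuous_on S g"
  shows "continuous_on S (\<lambda>x. f (g x))"
  by (rule continuous_on_compose2[OF holomorphic_on_imp_continuous_on[OF assms(1)] assms(2)]) auto

lemma pairing_density_continuous:
  assumes "q holomorphic_on UNIV" "p holomorphic_on UNIV"
  shows "continuous_on UNIV (pairing_density q p)"
  unfolding pairing_density_def[abs_def] using den_nonzero
  by (intro continuous_intros continuous_compose_holo[OF theta_string_holo] continuous_compose_holo[OF assms(1)]
      continuous_compose_holo[OF assms(2)]) auto

lemma cnj_tau: "cnj \<tau> = - \<tau>" using Re_tau by (simp add: complex_eq_iff)

lemma pairing_density_periodic:
  assumes q: "q \<in> Weight_space" and p: "p \<in> Weight_space"
  shows "pairing_density q p (z + 1) = pairing_density q p z" "pairing_density q p (z + Complex 0 Tm) = pairing_density q p z"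
proof -
  have "z + 1 + cnj (z + 1) = z + cnj z + 1 + 1" "z + 1 - cnj (z + 1) = z - cnj z" "cnj (z + 1) = cnj z + 1" by auto
  then show "pairing_density q p (z + 1) = pairing_density q p z"
    unfolding pairing_density_def by (simp only: theta_string_1 Weight_space_1[OF q] Weight_space_1[OF p])
  define w where "w = cnj z"
  have c: "cnj (z + \<tau>) = w - \<tau>" by (simp add: w_def cnj_tau)
  have r: "z + \<tau> + (w - \<tau>) = z + w" "z + \<tau> - (w - \<tau>) = z - w + \<tau> + \<tau>" by auto
  define E where "E = exp (4 * (l + 1) * pi * \<i> * (2 * w - \<tau>) + (- 4 * (l + 1) * pi * \<i> * (2 * z + \<tau>)))"
  have "exp (- 4 * (real (n2 + 1) + 1) * pi * \<i> * (z - w + \<tau>)) = E"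
    unfolding E_def by (rule arg_cong[where f = exp]) (simp add: n2_complex algebra_simps)
  then have "mu_string (z - w + \<tau> + \<tau>) = E * mu_string (z - w)"
    unfolding theta_string_2tau by simp
  moreover have "q (w - \<tau>) * p (z + \<tau>) = E * (q w * p z)"
    unfolding Weight_space_minus_tau[OF q] Weight_space_tau[OF p] E_def exp_add by (simp add: mult_ac)
  moreover have "E \<noteq> 0" by (simp add: E_def)
  ultimately show "pairing_density q p (z + Complex 0 Tm) = pairing_density q p z"
    unfolding pairing_density_def tau_eq c r by (simp add: w_def)
qed

lemma pairing_add_right:
  assumes "q holomorphic_on UNIV" "p holomorphic_on UNIV" "p' holomorphic_on UNIV"
  shows "pairing q (\<lambda>z. c * p z + p' z) = c * pairing q p + pairing q p'"
proof -
  have "pairing_density q (\<lambda>z. c * p z + p' z) = (\<lambda>z. c * pairing_density q p z + pairing_density q p' z)"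
    by (auto simp: pairing_density_def fun_eq_iff add_divide_distrib algebra_simps)
  then show ?thesis unfolding pairing_def
    using double_integral_add[of "\<lambda>z. c * pairing_density q p z" "pairing_density q p'" Tm] pairing_density_continuous[OF assms(1,2)] pairing_density_continuous[OF assms(1,3)]
    by (simp add: double_integral_cmult continuous_intros)
qed

lemma pairing_add_left:
  assumes "q holomorphic_on UNIV" "p holomorphic_on UNIV" "q' holomorphic_on UNIV"
  shows "pairing (\<lambda>z. c * q z + q' z) p = c * pairing q p + pairing q' p"
proof -
  have "pairing_density (\<lambda>z. c * q z + q' z) p = (\<lambda>z. c * pairing_density q p z + pairing_density q' p z)"
    by (auto simp: pairing_density_def fun_eq_iff add_divide_distrib algebra_simps)
  then show ?thesis unfolding pairing_def
    using double_integral_add[of "\<lambda>z. c * pairing_density q p z" "pairing_density q' p" Tm] pairing_density_continuous[OF assms(1,2)] pairing_density_continuous[OF assms(3,2)]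
    by (simp add: double_integral_cmult continuous_intros)
qed

lemma pairing_swap:
  assumes "q \<in> Weight_space" "p \<in> Weight_space"
  shows "pairing q p = pairing p q"
proof -
  have "pairing_density q p (cnj z) = pairing_density p q z" for z
    using theta_string_even[of "n2 + 1" "z - cnj z"] by (simp add: pairing_density_def add.commute mult.commute)
  then have "pairing p q = double_integral Tm (\<lambda>z. pairing_density q p (cnj z))" by (simp add: pairing_def)
  also have "\<dots> = pairing q p" unfolding pairing_def
    using assms by (intro double_integral_reflect(2) pairing_density_continuous Weight_space_holo pairing_density_periodic Im_tau)
  finally show ?thesis ..
qed

lemma pairing_reflect:
  assumes "q \<in> Weight_space" "p \<in> Weight_space"
  shows "pairing (\<lambda>z. q (- z)) (\<lambda>z. p (- z)) = pairing q p"
proof -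
  have "pairing_density q p (- z) = pairing_density (\<lambda>z. q (- z)) (\<lambda>z. p (- z)) z" for z
  proof -
    have "- z + cnj (- z) = - (z + cnj z)" "- z - cnj (- z) = - (z - cnj z)" by auto
    then show ?thesis unfolding pairing_density_def by (simp only: theta_string_even) simp
  qed
  then have "pairing (\<lambda>z. q (- z)) (\<lambda>z. p (- z)) = double_integral Tm (\<lambda>z. pairing_density q p (- z))" by (simp add: pairing_def)
  also have "\<dots> = pairing q p" unfolding pairing_def
    using assms by (intro double_integral_reflect(1) pairing_density_continuous Weight_space_holo pairing_density_periodic Im_tau)
  finally show ?thesis .
qed

definition star :: "(complex \<Rightarrow> complex) \<Rightarrow> complex \<Rightarrow> complex" where
  "star f z = cnj (f (cnj z))"

lemma star_holo: "f holomorphic_on UNIV \<Longrightarrow> star f holomorphic_on UNIV"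
  unfolding star_def[abs_def]
  using holomorphic_on_compose_cnj_cnj[of f UNIV] by (auto simp: o_def intro: holomorphic_on_subset)

lemma star_V:
  assumes f: "f \<in> V"
  shows "star f \<in> V"
proof (rule V_I)
  show "star f holomorphic_on UNIV" by (rule star_holo[OF V_holo[OF f]])
  show "star f (z + 1) = star f z" "star f (- z) = star f z" for z
    using V_1[OF f] V_even[OF f] by (simp_all add: star_def)
  fix z
  have "f (cnj z) = exp (- 4 * l * pi * \<i> * (2 * cnj z - \<tau>)) * f (cnj z - \<tau>)"
    using V_tau[OF f, of "cnj z - \<tau>"] by (simp add: algebra_simps)
  then have "exp (4 * l * pi * \<i> * (2 * cnj z - \<tau>)) * f (cnj z) =
     exp (4 * l * pi * \<i> * (2 * cnj z - \<tau>) + (- 4 * l * pi * \<i> * (2 * cnj z - \<tau>))) * f (cnj z - \<tau>)"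
    by (simp only: exp_add mult.assoc)
  then have "f (cnj z - \<tau>) = exp (4 * l * pi * \<i> * (2 * cnj z - \<tau>)) * f (cnj z)" by simp
  moreover have "cnj (exp (4 * l * pi * \<i> * (2 * cnj z - \<tau>))) = exp (- 4 * l * pi * \<i> * (2 * z + \<tau>))"
    unfolding exp_cnj by (rule arg_cong[where f = exp]) (simp add: cnj_tau)
  ultimately show "star f (z + \<tau>) = exp (- 4 * l * pi * \<i> * (2 * z + \<tau>)) * star f z"
    unfolding star_def complex_cnj_add cnj_tau diff_conv_add_uminus[symmetric] by simp
qed

abbreviation "sf \<equiv> sklyanin_form \<tau> \<eta> l"

lemma cnj_t11: "cnj (t11 z) = t11 (cnj z)"
  by (rule theta_cnj[OF Re_tau])

lemma sf_eq: "sf f g = pairing (\<lambda>w. star f w * t11 (2 * w)) (\<lambda>z. g z * t11 (2 * z))"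
  unfolding sklyanin_form_def pairing_def double_integral_def pairing_density_def Let_def mu_eq star_def
  by (simp add: mult_ac)

lemma sf_linear:
  assumes "f \<in> V" "g \<in> V" "k \<in> V"
  shows "sf (\<lambda>z. c * f z + g z) k = cnj c * sf f k + sf g k"
    and "sf k (\<lambda>z. c * f z + g z) = c * sf k f + sf k g"
proof -
  have h: "(\<lambda>z. f z * t11 (2 * z)) holomorphic_on UNIV" if "f \<in> V" for f
    using Weight_space_holo[OF Weight_space_double[OF that]] .
  have st: "star (\<lambda>z. c * f z + g z) = (\<lambda>z. cnj c * star f z + star g z)"
    by (auto simp: star_def)
  show "sf (\<lambda>z. c * f z + g z) k = cnj c * sf f k + sf g k"
    using pairing_add_left[OF h[OF star_V[OF assms(1)]] h[OF assms(3)] h[OF star_V[OF assms(2)]], of "cnj c"]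
    unfolding sf_eq st by (simp add: algebra_simps)
  show "sf k (\<lambda>z. c * f z + g z) = c * sf k f + sf k g"
    using pairing_add_right[OF h[OF star_V[OF assms(3)]] h[OF assms(1)] h[OF assms(2)], of c]
    unfolding sf_eq by (simp add: algebra_simps)
qed

subsection \<open>Unitarity of the half-period shifts\<close>

lemma sf_dint: "sf f g = double_integral Tm (\<lambda>z. cnj (f z) * g z * mu \<tau> \<eta> l z (cnj z))"
  by (simp add: sklyanin_form_def double_integral_def Let_def)

lemma sf_integrand:
  assumes "f \<in> V" "g \<in> V"
  defines "\<Phi> \<equiv> \<lambda>z. cnj (f z) * g z * mu \<tau> \<eta> l z (cnj z)"
  shows "continuous_on UNIV \<Phi>" "\<Phi> (z + 1) = \<Phi> z" "\<Phi> (z + Complex 0 Tm) = \<Phi> z"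
proof -
  have e: "\<Phi> = pairing_density (\<lambda>w. star f w * t11 (2 * w)) (\<lambda>z. g z * t11 (2 * z))"
    unfolding \<Phi>_def pairing_density_def[abs_def] mu_eq star_def by (simp add: mult_ac)
  note W = Weight_space_double[OF star_V[OF assms(1)]] Weight_space_double[OF assms(2)]
  show "continuous_on UNIV \<Phi>" "\<Phi> (z + 1) = \<Phi> z" "\<Phi> (z + Complex 0 Tm) = \<Phi> z"
    unfolding e by (intro pairing_density_continuous Weight_space_holo W pairing_density_periodic)+
qed

lemma U1_unitary:
  assumes "f \<in> V" "g \<in> V"
  shows "sf (U1 l f) (U1 l g) = sf f g"
proof -
  let ?\<Phi> = "\<lambda>z. cnj (f z) * g z * mu \<tau> \<eta> l z (cnj z)"
  have m: "mu \<tau> \<eta> l (z + 1/2) (w + 1/2) = mu \<tau> \<eta> l z w" for z w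
  proof -
    have "2 * (z + 1/2) = 2 * z + 1" "2 * (w + 1/2) = 2 * w + 1" "z + 1/2 + (w + 1/2) = z + w + 1" "z + 1/2 - (w + 1/2) = z - w" by auto
    then show ?thesis unfolding mu_eq by (simp only: theta_add_1 theta_string_1) simp
  qed
  have e: "cnj (exp (complex_of_real pi * \<i> * complex_of_real l)) * exp (complex_of_real pi * \<i> * complex_of_real l) = 1"
    by (simp add: exp_cnj exp_add[symmetric])
  have "cnj (U1 l f z) * U1 l g z * mu \<tau> \<eta> l z (cnj z) = ?\<Phi> (z + Complex (1/2) 0)" for z
  proof -
    have h: "Complex (1/2) 0 = 1/2" by (simp add: complex_eq_iff)
    have "cnj (U1 l f z) * U1 l g z * mu \<tau> \<eta> l z (cnj z) =
      (cnj (exp (complex_of_real pi * \<i> * complex_of_real l)) * exp (complex_of_real pi * \<i> * complex_of_real l)) *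
        (cnj (f (z + 1/2)) * g (z + 1/2) * mu \<tau> \<eta> l (z + 1/2) (cnj z + 1/2))"
      unfolding m U1_def by simp
    then show ?thesis unfolding e h by simp
  qed
  then have "sf (U1 l f) (U1 l g) = double_integral Tm (\<lambda>z. ?\<Phi> (z + Complex (1/2) 0))" unfolding sf_dint by simp
  also have "\<dots> = double_integral Tm ?\<Phi>"
    by (rule double_integral_shift) (intro sf_integrand assms Im_tau)+
  finally show ?thesis unfolding sf_dint .
qed

text \<open>The multiplier of \<open>mu\<close> under the shift by \<open>\<tau>/2\<close> cancels the absolute square of the factor in \<open>U3\<close>.\<close>

lemma U3_unitary:
  assumes "f \<in> V" "g \<in> V"
  shows "sf (U3 \<tau> l f) (U3 \<tau> l g) = sf f g"
proof -
  let ?\<Phi> = "\<lambda>z. cnj (f z) * g z * mu \<tau> \<eta> l z (cnj z)"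
  have m: "mu \<tau> \<eta> l (z + \<tau>/2) (w - \<tau>/2) = exp (pi * \<i> * l * (4 * (z - w) + 2 * \<tau>)) * mu \<tau> \<eta> l z w" for z w
  proof -
    have r: "2 * (z + \<tau>/2) = 2 * z + \<tau>" "2 * (w - \<tau>/2) = - (- (2 * w) + \<tau>)" "z + \<tau>/2 + (w - \<tau>/2) = z + w" "z + \<tau>/2 - (w - \<tau>/2) = z - w + \<tau>" by auto
    define A where "A = exp (- pi * \<i> * \<tau> - 2 * pi * \<i> * (2 * z)) * exp (- pi * \<i> * \<tau> - 2 * pi * \<i> * (- (2 * w)))"
    define B where "B = exp (- (real (n2 + 1) + 1) * pi * \<i> * (2 * (z - w) + \<tau>))"
    have "A = B * exp (pi * \<i> * l * (4 * (z - w) + 2 * \<tau>))"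
      unfolding A_def B_def exp_add[symmetric] by (rule arg_cong[where f = exp]) (simp add: n2_complex algebra_simps)
    moreover have "mu \<tau> \<eta> l (z + \<tau>/2) (w - \<tau>/2) = A * (t11 (2 * z) * t11 (2 * w)) / (B * (mu_string (z + w) * mu_string (z - w)))"
      unfolding mu_eq r odd_t11 theta_add_tau theta_string_tau A_def B_def by (simp add: odd_t11 mult_ac)
    moreover have "B \<noteq> 0" by (simp add: B_def)
    ultimately show ?thesis unfolding mu_eq by simp
  qed
  have "cnj (U3 \<tau> l f z) * U3 \<tau> l g z * mu \<tau> \<eta> l z (cnj z) = ?\<Phi> (z + Complex 0 (Tm/2))" for z
  proof -
    have h: "Complex 0 (Tm/2) = \<tau>/2" using Re_tau by (simp add: complex_eq_iff)
    have c: "cnj (z + \<tau>/2) = cnj z - \<tau>/2" by (simp add: cnj_tau)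
    define a where "a = exp (complex_of_real pi * \<i> * complex_of_real l) * exp (complex_of_real pi * \<i> * complex_of_real l * (4 * z + \<tau>))"
    have "cnj a * a = exp (complex_of_real pi * \<i> * complex_of_real l * (4 * (z - cnj z) + 2 * \<tau>))"
      unfolding a_def complex_cnj_mult exp_cnj exp_add[symmetric]
      by (rule arg_cong[where f = exp]) (simp add: cnj_tau algebra_simps)
    moreover have "cnj (U3 \<tau> l f z) * U3 \<tau> l g z * mu \<tau> \<eta> l z (cnj z) =
      (cnj a * a) * (cnj (f (z + \<tau>/2)) * g (z + \<tau>/2) * mu \<tau> \<eta> l z (cnj z))"
      unfolding U3_def a_def by simp
    ultimately show ?thesis unfolding h c m by (simp add: mult_ac)
  qed
  then have "sf (U3 \<tau> l f) (U3 \<tau> l g) = double_integral Tm (\<lambda>z. ?\<Phi> (z + Complex 0 (Tm/2)))" unfolding sf_dint by simp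
  also have "\<dots> = double_integral Tm ?\<Phi>"
    by (rule double_integral_shift) (intro sf_integrand assms Im_tau)+
  finally show ?thesis unfolding sf_dint .
qed

end

section \<open>Self-adjointness of the generators\<close>

context sklyanin_form_loc
begin

lemma cnj_theta_idx: "cnj (tx a z) = tx a (cnj z)"
  by (simp add: theta_idx_def theta_cnj[OF Re_tau])

lemma star_s: "star (s a) z = (if a = 2 then - s a z else s a z)"
  by (simp add: star_def s_fun_def cnj_theta_idx)

lemma tx_minus: "tx a (- z) = (if a = 0 then - tx a z else tx a z)"
  by (simp add: theta_idx_def theta_minus)

lemma cofactor_2: "cofactor a (X + 2) = cofactor a X"
  by (simp add: cofactor_def theta_add_2)

definition kernel_shift :: complex where "kernel_shift = of_real ((2 * l + 2) * \<eta>)"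

abbreviation "kernel_string \<equiv> theta_string (Suc (n2 + 1))"

lemma kernel_denominators:
  fixes X Y :: complex
  shows "kernel_string X = mu_string (X - \<eta>) * t00 (X + kernel_shift)" "kernel_string X = t00 (X - kernel_shift) * mu_string (X + \<eta>)"
  "mu_string (Y - \<eta>) = t00 (Y - kernel_shift) * theta_string n2 Y"
proof -
  have k: "complex_of_real (real (Suc (n2 + 1)) * \<eta>) = kernel_shift" using n2 by (simp add: kernel_shift_def algebra_simps)
  show "kernel_string X = mu_string (X - \<eta>) * t00 (X + kernel_shift)" "kernel_string X = t00 (X - kernel_shift) * mu_string (X + \<eta>)"
    using theta_string_Suc[of "n2 + 1" X] unfolding k by simp_all
  have k': "Y - complex_of_real \<eta> - complex_of_real (real (Suc n2) * \<eta>) = Y - kernel_shift"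
    using n2 by (simp add: kernel_shift_def algebra_simps)
  show "mu_string (Y - \<eta>) = t00 (Y - kernel_shift) * theta_string n2 Y"
    using theta_string_Suc(2)[of n2 "Y - \<eta>"] unfolding k' unfolding Suc_eq_plus1 by simp
qed

text \<open>What the sum of the two integrands in \<open>rho_selfadjoint\<close> becomes by \<open>kernel_identity\<close>, up to a constant.\<close>

definition exchange_kernel :: "nat \<Rightarrow> (complex \<Rightarrow> complex) \<Rightarrow> (complex \<Rightarrow> complex) \<Rightarrow> complex \<Rightarrow> complex \<Rightarrow> complex" where
  "exchange_kernel a f g z w = f w * g z * (cofactor a (z + w) * tx (dual_idx a) (z - w)) / (kernel_string (z + w) * theta_string n2 (z - w))"

lemma n2_eta_bound: "real n2 * \<bar>\<eta>\<bar> + \<bar>\<eta>\<bar> < 1/2"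
  using eta_bound n2 by (simp add: algebra_simps)

text \<open>The translation of \<open>z\<close> by \<open>\<eta>\<close> is removed by a change of contour. It meets no pole, since the string in the
  denominator that depends on \<open>z - w\<close> has only \<open>n2 + 1\<close> members. Without the translation the integrand is odd.\<close>

lemma kernel_integral:
  assumes f: "f \<in> V" and g: "g \<in> V"
  shows "double_integral Tm (\<lambda>z. exchange_kernel a f g (z + \<eta>) (cnj z)) = 0"
proof -
  let ?\<Phi> = "\<lambda>z. exchange_kernel a f g z (cnj z)"
  have den: "kernel_string (z + cnj z) \<noteq> 0" "theta_string n2 (z - cnj z) \<noteq> 0" for z
    using n2_eta_bound by (auto intro!: theta_string_nonzero)
  have cont: "continuous_on UNIV ?\<Phi>"
    unfolding exchange_kernel_def using den
    by (intro continuous_intros continuous_compose_holo[OF theta_string_holo] continuous_compose_holo[OF V_holo[OF f]]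
      continuous_compose_holo[OF V_holo[OF g]] continuous_compose_holo[OF holo_cofactor] continuous_compose_holo[OF holo_tx]) auto
  have p1: "exchange_kernel a f g (z + 1) (w + 1) = exchange_kernel a f g z w" for z w
  proof -
    have r: "z + 1 + (w + 1) = z + w + 2" "z + 1 - (w + 1) = z - w" by auto
    have "kernel_string (z + w + 2) = kernel_string (z + w)"
      using theta_string_1[of "Suc (n2 + 1)" "z + w + 1"] theta_string_1[of "Suc (n2 + 1)" "z + w"] by (simp add: add.assoc)
    then show ?thesis unfolding exchange_kernel_def r by (simp add: cofactor_2 V_1[OF f] V_1[OF g])
  qed
  have p2: "exchange_kernel a f g (z + Complex 0 Tm) (w - Complex 0 Tm) = exchange_kernel a f g z w" for z w
  proof -
    have r: "z + \<tau> + (w - \<tau>) = z + w" "z + \<tau> - (w - \<tau>) = z - w + \<tau> + \<tau>" by auto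
    have fw: "f (w - \<tau>) = exp (4 * l * pi * \<i> * (2 * w - \<tau>)) * f w"
    proof -
      have "f (- w + \<tau>) = exp (- 4 * l * pi * \<i> * (2 * - w + \<tau>)) * f (- w)" by (rule V_tau[OF f])
      then show ?thesis using V_even[OF f, of "w - \<tau>"] V_even[OF f, of w] by (simp add: algebra_simps)
    qed
    have t: "tx (dual_idx a) (z - w + \<tau> + \<tau>) = exp (- 4 * pi * \<i> * (z - w + \<tau>)) * tx (dual_idx a) (z - w)"
      using tx_add_2tau[of "dual_idx a" "z - w"] by (simp add: add.assoc)
    define E where "E = exp (- 4 * (real n2 + 1) * pi * \<i> * (z - w + \<tau>))"
    have "exp (4 * l * pi * \<i> * (2 * w - \<tau>)) * exp (- 4 * l * pi * \<i> * (2 * z + \<tau>)) * exp (- 4 * pi * \<i> * (z - w + \<tau>)) = E"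
      unfolding E_def exp_add[symmetric] by (rule arg_cong[where f = exp]) (simp add: n2_complex algebra_simps)
    then have eq: "f (w - \<tau>) * g (z + \<tau>) * (cofactor a (z + w) * tx (dual_idx a) (z - w + \<tau> + \<tau>))
        = E * (f w * g z * (cofactor a (z + w) * tx (dual_idx a) (z - w)))"
      unfolding fw V_tau[OF g] t by (simp only: mult_ac)
    have E0: "E \<noteq> 0" by (simp add: E_def)
    have "kernel_string (z + w) * (E * theta_string n2 (z - w)) = E * (kernel_string (z + w) * theta_string n2 (z - w))" by (simp only: mult_ac)
    then show ?thesis unfolding exchange_kernel_def tau_eq r theta_string_2tau E_def[symmetric] eq
      by (simp only: mult_divide_mult_cancel_left[OF E0])
  qed
  have "double_integral Tm (\<lambda>z. exchange_kernel a f g (z + \<eta>) (cnj z)) = double_integral Tm ?\<Phi>"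
  proof (rule double_integral_contour_shift[OF cont Im_tau p1 p2])
    define d where "d = 1/2 - real n2 * \<bar>\<eta>\<bar>"
    have d: "d > \<bar>\<eta>\<bar>" using n2_eta_bound by (simp add: d_def)
    show "(\<eta> - d) / 2 < 0" "0 < (\<eta> + d) / 2" "(\<eta> - d) / 2 < \<eta> / 2" "\<eta> / 2 < (\<eta> + d) / 2" using d by auto
    show "(\<lambda>\<zeta>. exchange_kernel a f g (of_real (x + \<eta>) + \<i> * \<zeta>) (of_real x - \<i> * \<zeta>)) holomorphic_on {z. (\<eta> - d) / 2 < Im z \<and> Im z < (\<eta> + d) / 2}" for x
    proof -
      have r: "of_real (x + \<eta>) + \<i> * \<zeta> + (of_real x - \<i> * \<zeta>) = of_real (2 * x + \<eta>)"
        "of_real (x + \<eta>) + \<i> * \<zeta> - (of_real x - \<i> * \<zeta>) = (2 * \<i>) * \<zeta> + \<eta>"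
        "of_real (x + \<eta>) + \<i> * \<zeta> = \<i> * \<zeta> + of_real (x + \<eta>)"
        "of_real x - \<i> * \<zeta> = (- \<i>) * \<zeta> + of_real x" for \<zeta> by (auto simp: algebra_simps)
      have nz: "theta_string n2 ((2 * \<i>) * \<zeta> + \<eta>) \<noteq> 0" if "\<zeta> \<in> {z. (\<eta> - d) / 2 < Im z \<and> Im z < (\<eta> + d) / 2}" for \<zeta>
      proof (rule theta_string_nonzero, rule disjI2)
        have "\<bar>\<eta> - 2 * Im \<zeta>\<bar> < d" using that by (simp add: abs_less_iff field_simps)
        then show "\<bar>Re ((2 * \<i>) * \<zeta> + \<eta>)\<bar> + real n2 * \<bar>\<eta>\<bar> < 1/2" by (simp add: d_def abs_minus_commute)
      qed
      have nz': "kernel_string (of_real (2 * x + \<eta>)) \<noteq> 0" by (rule theta_string_nonzero) simp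
      show ?thesis
        unfolding exchange_kernel_def r(1,2) unfolding r(3,4)
        by (intro holomorphic_intros holomorphic_on_subset[OF entire_shift[OF V_holo[OF f]]] holomorphic_on_subset[OF entire_shift[OF V_holo[OF g]]]
          holomorphic_on_subset[OF entire_shift[OF holo_tx]] holomorphic_on_subset[OF entire_shift[OF theta_string_holo]])
          (use nz nz' in auto)
    qed
  qed
  also have "double_integral Tm ?\<Phi> = 0"
  proof -
    have "?\<Phi> (- z) = - ?\<Phi> z" for z
    proof -
      have "- z + cnj (- z) = - (z + cnj z)" "- z - cnj (- z) = - (z - cnj z)" "cnj (- z) = - cnj z" by auto
      then show ?thesis unfolding exchange_kernel_def by (simp only: theta_string_even cofactor_odd V_even[OF f] V_even[OF g]) simp
    qed
    then have "double_integral Tm (\<lambda>z. ?\<Phi> (- z)) = - double_integral Tm ?\<Phi>" using double_integral_cmult[of Tm "-1" ?\<Phi>] by simp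
    moreover have "double_integral Tm (\<lambda>z. ?\<Phi> (- z)) = double_integral Tm ?\<Phi>"
    proof (rule double_integral_reflect(1)[OF cont Im_tau])
      show "?\<Phi> (z + 1) = ?\<Phi> z" for z using p1[of z "cnj z"] by simp
      have "cnj (z + Complex 0 Tm) = cnj z - Complex 0 Tm" for z by (simp add: complex_eq_iff)
      then show "?\<Phi> (z + Complex 0 Tm) = ?\<Phi> z" for z using p2[of z "cnj z"] by simp
    qed
    ultimately show ?thesis by simp
  qed
  finally show ?thesis .
qed

lemma rho_numerator_split: "rho_numerator a g z = s a (z - l * \<eta>) * g (z + \<eta>) - s a (- z - l * \<eta>) * g (- z + \<eta>)" if "g \<in> V"
  using V_even[OF that, of "z - \<eta>"] by (simp add: rho_numerator_def algebra_simps)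

lemma pairing_uminus: "pairing (\<lambda>z. - q z) p = - pairing q p" "pairing q (\<lambda>z. - p z) = - pairing q p"
proof -
  have "pairing_density (\<lambda>z. - q z) p = (\<lambda>z. (-1) * pairing_density q p z)" "pairing_density q (\<lambda>z. - p z) = (\<lambda>z. (-1) * pairing_density q p z)"
    by (auto simp: pairing_density_def)
  then show "pairing (\<lambda>z. - q z) p = - pairing q p" "pairing q (\<lambda>z. - p z) = - pairing q p"
    unfolding pairing_def by (simp_all only: double_integral_cmult) simp_all
qed

lemma pairing_odd_part:
  assumes "q \<in> Weight_space" "p \<in> Weight_space" and odd: "\<And>z. q (- z) = - q z"
  shows "pairing q (\<lambda>z. p z - p (- z)) = 2 * pairing q p"
proof -
  have "pairing q (\<lambda>z. (-1) * p (- z) + p z) = (-1) * pairing q (\<lambda>z. p (- z)) + pairing q p"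
    by (intro pairing_add_right Weight_space_holo Weight_space_uminus assms)
  moreover have "pairing q p = - pairing q (\<lambda>z. p (- z))"
    using pairing_reflect[OF assms(1,2)] by (simp add: odd pairing_uminus)
  ultimately show ?thesis by simp
qed

text \<open>Both scalar products consist of two terms which are exchanged by \<open>z \<mapsto> - z\<close>, so one term is enough on either side. After a real
  translation of one of the integrals, the sum of the integrands is a multiple of \<open>exchange_kernel\<close> at \<open>z + \<eta>\<close>.\<close>

theorem rho_selfadjoint:
  assumes f: "f \<in> V" and g: "g \<in> V" and a: "a \<le> 3"
  shows "sf f (rho_l a g) = sf (rho_l a f) g"
proof -
  define q0 p0 where "q0 = (\<lambda>w. star f w * t11 (2 * w))" and "p0 = (\<lambda>z. g z * t11 (2 * z))"
  define A where "A = (\<lambda>z :: complex. s a (z - l * \<eta>) * g (z + \<eta>))"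
  define c where "c = (if a = 2 then - 1 else 1 :: complex)"
  define B where "B = (\<lambda>z :: complex. c * (s a (z - l * \<eta>) * star f (z + \<eta>)))"
  have sV: "star f \<in> V" by (rule star_V[OF f])
  have W: "q0 \<in> Weight_space" "p0 \<in> Weight_space" "A \<in> Weight_space" unfolding q0_def p0_def A_def by (intro Weight_space_double Weight_space_s sV g)+
  have WB: "B \<in> Weight_space"
    using Weight_space_lin[OF Weight_space_s[OF sV, of a] Weight_space_s[OF sV, of a], of "c - 1"] by (simp add: B_def algebra_simps)
  have odd: "q0 (- z) = - q0 z" "p0 (- z) = - p0 z" for z
    by (simp_all add: q0_def p0_def odd_t11 V_even[OF sV] V_even[OF g])
  have "sf f (rho_l a g) = pairing q0 (\<lambda>z. A z - A (- z))"
    unfolding sf_eq q0_def[symmetric] A_def using rho_mult[OF g, of _ a] rho_numerator_split[OF g, of a] by (simp add: mult.commute)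
  also have "\<dots> = 2 * pairing q0 A" by (rule pairing_odd_part[OF W(1,3) odd(1)])
  finally have 1: "sf f (rho_l a g) = 2 * pairing q0 A" .
  have "star (rho_l a f) w * t11 (2 * w) = B w - B (- w)" for w
  proof -
    have "star (rho_l a f) w * t11 (2 * w) = cnj (t11 (2 * cnj w) * rho_l a f (cnj w))"
      by (simp add: star_def cnj_t11 mult.commute)
    also have "\<dots> = cnj (s a (cnj (w - l * \<eta>)) * f (cnj (w + \<eta>)) - s a (cnj (- w - l * \<eta>)) * f (cnj (- w + \<eta>)))"
      unfolding rho_mult[OF f] rho_numerator_split[OF f] by simp
    also have "\<dots> = star (s a) (w - l * \<eta>) * star f (w + \<eta>) - star (s a) (- w - l * \<eta>) * star f (- w + \<eta>)"
      unfolding star_def by (simp only: complex_cnj_mult complex_cnj_diff)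
    also have "\<dots> = B w - B (- w)" unfolding star_s B_def c_def by simp
    finally show ?thesis .
  qed
  then have "sf (rho_l a f) g = pairing (\<lambda>w. B w - B (- w)) p0" unfolding sf_eq p0_def by simp
  also have "\<dots> = pairing p0 (\<lambda>w. B w - B (- w))"
  proof (rule pairing_swap[OF _ W(2)])
    show "(\<lambda>w. B w - B (- w)) \<in> Weight_space" using Weight_space_lin[OF Weight_space_uminus[OF WB] WB, of "-1"] by simp
  qed
  also have "\<dots> = 2 * pairing p0 B" by (rule pairing_odd_part[OF W(2) WB odd(2)])
  also have "pairing p0 B = pairing B p0" by (rule pairing_swap[OF W(2) WB])
  also have "pairing B p0 = - pairing (\<lambda>z. B (- z)) p0"
    using pairing_reflect[OF WB W(2)] by (simp add: odd pairing_uminus)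
  finally have 2: "sf (rho_l a f) g = - 2 * pairing (\<lambda>z. B (- z)) p0" by simp
  have WB': "(\<lambda>z. B (- z)) \<in> Weight_space" by (rule Weight_space_uminus[OF WB])
  define C where "C = (if a = 2 then \<i> else 1) * tx a \<eta> * (sgn_idx a * tx a kernel_shift)"
  have pt: "pairing_density q0 A z + pairing_density (\<lambda>z. B (- z)) p0 (z + Complex \<eta> 0) = C * exchange_kernel a (star f) g (z + \<eta>) (cnj z)" for z
  proof -
    define w X Y where "w = cnj z" and "X = z + w + \<eta>" and "Y = z - w + \<eta>"
    have eta: "Complex \<eta> 0 = of_real \<eta>" by (simp add: complex_eq_iff)
    have r: "z + w = X - \<eta>" "z - w = Y - \<eta>" "z + \<eta> + (w + \<eta>) = X + \<eta>" "z + \<eta> - (w + \<eta>) = Y - \<eta>"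
      "z + \<eta> + w = X" "z + \<eta> - w = Y" "2 * (z - l * \<eta>) = X + Y - kernel_shift" "2 * w = X - Y" "2 * (z + \<eta>) = X + Y"
      "2 * (- (w + \<eta>) - l * \<eta>) = - (X - Y + kernel_shift)" "cnj (z + \<eta>) = w + \<eta>" "- (w + \<eta>) + \<eta> = - w"
      by (auto simp: X_def Y_def w_def kernel_shift_def algebra_simps)
    have imX: "Im X = 0" by (simp add: X_def w_def)
    have reY: "Re (Y - \<eta>) = 0" by (simp add: Y_def w_def)
    define u1 u2 D P1 P2 where "u1 = t00 (X + kernel_shift)" and "u2 = t00 (X - kernel_shift)" and "D = theta_string n2 Y"
      and "P1 = mu_string (X - \<eta>)" and "P2 = mu_string (X + \<eta>)"
    have R: "kernel_string X = P1 * u1" "kernel_string X = P2 * u2"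
      unfolding P1_def P2_def u1_def u2_def
      by (rule kernel_denominators(1), rule kernel_denominators(2)[THEN trans], rule mult.commute)
    have nz: "u1 \<noteq> 0" "u2 \<noteq> 0" "P1 \<noteq> 0" "P2 \<noteq> 0" unfolding u1_def u2_def P1_def P2_def
      using imX by (auto intro!: t00_nonzero_real mu_string_nonzero simp: kernel_shift_def)
    have "mu_string (Y - \<eta>) \<noteq> 0" using reY by (intro mu_string_nonzero) auto
    then have nzY: "t00 (Y - kernel_shift) \<noteq> 0" "D \<noteq> 0" unfolding kernel_denominators(3) D_def by auto
    define M1 M2 where "M1 = tx a (X + Y - kernel_shift) * t11 (X - Y)" and "M2 = sgn_idx a * (tx a (X - Y + kernel_shift) * t11 (X + Y))"
    define L where "L = (if a = 2 then \<i> else 1) * tx a \<eta> * (star f w * g (z + \<eta>))"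
    have j1: "pairing_density q0 A z = L * M1 / (P1 * (t00 (Y - kernel_shift) * D))"
      unfolding pairing_density_def w_def[symmetric] r(1,2) kernel_denominators(3) P1_def D_def q0_def A_def s_fun_def r(7,8) M1_def L_def by (simp add: mult_ac)
    have j2: "pairing_density (\<lambda>z. B (- z)) p0 (z + Complex \<eta> 0) = L * M2 / (P2 * (t00 (Y - kernel_shift) * D))"
      unfolding pairing_density_def eta r(3,4,9-12) kernel_denominators(3) P2_def D_def p0_def B_def s_fun_def V_even[OF sV] M2_def L_def c_def sgn_idx_def tx_minus
      by simp
    have K: "M1 * u1 + M2 * u2 = (sgn_idx a * tx a kernel_shift) * (cofactor a X * tx (dual_idx a) Y) * t00 (Y - kernel_shift)"
      using kernel_identity[OF a, of X Y kernel_shift] unfolding M1_def M2_def u1_def u2_def by (simp add: mult_ac)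
    have "L * M1 / (P1 * (t00 (Y - kernel_shift) * D)) + L * M2 / (P2 * (t00 (Y - kernel_shift) * D))
        = L * (M1 * u1) / ((P1 * u1) * (t00 (Y - kernel_shift) * D)) + L * (M2 * u2) / ((P2 * u2) * (t00 (Y - kernel_shift) * D))"
      using nz by simp
    also have "\<dots> = L * (M1 * u1 + M2 * u2) / (kernel_string X * (t00 (Y - kernel_shift) * D))"
      unfolding R(1)[symmetric] R(2)[symmetric] by (simp add: add_divide_distrib distrib_left)
    also have "\<dots> = L * (sgn_idx a * tx a kernel_shift) * (cofactor a X * tx (dual_idx a) Y) / (kernel_string X * D)"
      unfolding K using nzY by simp
    also have "\<dots> = C * exchange_kernel a (star f) g (z + \<eta>) w"
      unfolding exchange_kernel_def r(5,6) C_def L_def D_def by simp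
    finally show ?thesis unfolding j1 j2 w_def .
  qed
  have "pairing (\<lambda>z. B (- z)) p0 = double_integral Tm (\<lambda>z. pairing_density (\<lambda>z. B (- z)) p0 (z + Complex \<eta> 0))"
    unfolding pairing_def by (rule double_integral_shift[symmetric]) (intro pairing_density_continuous pairing_density_periodic Weight_space_holo WB' W Im_tau)+
  then have "pairing q0 A + pairing (\<lambda>z. B (- z)) p0 = double_integral Tm (\<lambda>z. pairing_density q0 A z + pairing_density (\<lambda>z. B (- z)) p0 (z + Complex \<eta> 0))"
    unfolding pairing_def[of q0]
    by (subst double_integral_add) (auto intro!: pairing_density_continuous Weight_space_holo W continuous_on_compose2[OF pairing_density_continuous[OF Weight_space_holo[OF WB'] Weight_space_holo[OF W(2)]]] continuous_intros)
  also have "\<dots> = 0" unfolding pt double_integral_cmult kernel_integral[OF sV g] by simp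
  finally show ?thesis unfolding 1 2 by (simp add: add_eq_0_iff)
qed

lemma sf_sum_right:
  assumes f: "f \<in> V" and g: "\<And>i. i \<in> I \<Longrightarrow> g i \<in> V"
  shows "sf f (\<lambda>z. \<Sum>i\<in>I. c i * g i z) = (\<Sum>i\<in>I. c i * sf f (g i))"
proof -
  have "sf f (\<lambda>_. 0) = 0" using sf_linear(2)[OF V_zero V_zero f, of "-1"] by simp
  then show ?thesis using g
  proof (induction I rule: infinite_finite_induct)
    case (insert x I)
    have "sf f (\<lambda>z. c x * g x z + (\<Sum>i\<in>I. c i * g i z)) = c x * sf f (g x) + sf f (\<lambda>z. \<Sum>i\<in>I. c i * g i z)"
      using insert.prems by (intro sf_linear(2) f V_sum) auto
    then show ?case using insert by simp
  qed auto
qed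

lemma sf_sum_left:
  assumes f: "f \<in> V" and g: "\<And>i. i \<in> I \<Longrightarrow> g i \<in> V"
  shows "sf (\<lambda>z. \<Sum>i\<in>I. c i * g i z) f = (\<Sum>i\<in>I. cnj (c i) * sf (g i) f)"
proof -
  have "sf (\<lambda>_. 0) f = 0" using sf_linear(1)[OF V_zero V_zero f, of "-1"] by simp
  then show ?thesis using g
  proof (induction I rule: infinite_finite_induct)
    case (insert x I)
    have "sf (\<lambda>z. c x * g x z + (\<Sum>i\<in>I. c i * g i z)) f = cnj (c x) * sf (g x) f + sf (\<lambda>z. \<Sum>i\<in>I. c i * g i z) f"
      using insert.prems by (intro sf_linear(1) f V_sum) auto
    then show ?case using insert by simp
  qed auto
qed

definition flip :: "2 \<Rightarrow> 2" where "flip \<alpha> = (if \<alpha> = 1 then 2 else 1)"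
definition parity :: "2 \<Rightarrow> 2 \<Rightarrow> complex" where "parity \<alpha> \<beta> = (if \<alpha> = \<beta> then - 1 else 1)"

lemma W_L_cnj: "cnj (W_L \<tau> \<eta> a (- cnj u)) = (if a = 0 then - W_L \<tau> \<eta> a u else W_L \<tau> \<eta> a u)"
  using tx_minus[of a u] by (simp add: W_L_def cnj_theta_idx)

text \<open>\<open>W_0\<close> is odd and the other coefficients are even, while complex conjugation of the Pauli matrices changes the sign of $\sigma^2$. Both effects together are the
  conjugation by $\sigma^2$, up to an overall sign; \<open>flip\<close> and \<open>parity\<close> are its action on matrix entries.\<close>

lemma L_entry_adjoint:
  assumes f: "f \<in> V" and g: "g \<in> V"
  shows "sf f (L_entry u \<alpha> \<beta> g) = parity \<alpha> \<beta> * sf (L_entry (- cnj u) (flip \<alpha>) (flip \<beta>) f) g"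
proof -
  have e: "W_L \<tau> \<eta> a u * pauli a $ \<alpha> $ \<beta> = parity \<alpha> \<beta> * cnj (W_L \<tau> \<eta> a (- cnj u) * pauli a $ (flip \<alpha>) $ (flip \<beta>))" if "a \<le> 3" for a
  proof -
    have "a = 0 \<or> a = 1 \<or> a = 2 \<or> a = 3" using that by linarith
    then show ?thesis unfolding complex_cnj_mult W_L_cnj
      using two_cases[of \<alpha>] two_cases[of \<beta>]
      by (auto simp: pauli_def parity_def flip_def vector_2)
  qed
  have "sf f (L_entry u \<alpha> \<beta> g) = (\<Sum>a\<le>3. W_L \<tau> \<eta> a u * pauli a $ \<alpha> $ \<beta> * sf f (rho_l a g))"
    unfolding L_entry_def[abs_def] by (rule sf_sum_right[OF f rho_V[OF g]])
  also have "\<dots> = (\<Sum>a\<le>3. parity \<alpha> \<beta> * (cnj (W_L \<tau> \<eta> a (- cnj u) * pauli a $ (flip \<alpha>) $ (flip \<beta>)) * sf (rho_l a f) g))"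
    using e rho_selfadjoint[OF f g] by (intro sum.cong) auto
  also have "\<dots> = parity \<alpha> \<beta> * sf (L_entry (- cnj u) (flip \<alpha>) (flip \<beta>) f) g"
    unfolding L_entry_def[abs_def] sum_distrib_left[symmetric] sf_sum_left[OF g rho_V[OF f]] ..
  finally show ?thesis .
qed

section \<open>Scalar products of the intertwining vectors\<close>

definition Phi :: "complex \<Rightarrow> complex \<Rightarrow> complex" where
  "Phi p q = sf (om (cnj p)) (om q)"

lemma star_om: "star (om (cnj p)) = om p"
proof
  fix z
  have "cnj (t11 (cnj z + cnj p + complex_of_real c)) = t11 (z + p + c)"
    "cnj (t11 (- cnj z + cnj p + complex_of_real c)) = t11 (- z + p + c)" for c
    by (simp_all add: cnj_t11)
  then show "star (om (cnj p)) z = om p z" by (simp only: star_def om_prod cnj_prod complex_cnj_mult)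
qed

lemma Phi_JJ: "Phi p q = pairing (\<lambda>w. om p w * t11 (2 * w)) (\<lambda>z. om q z * t11 (2 * z))"
  unfolding Phi_def sf_eq star_om ..

lemma Phi_sym: "Phi p q = Phi q p"
  unfolding Phi_JJ by (intro pairing_swap Weight_space_double om_V)

lemma Phi_minus: "Phi p (- q) = Phi p q"
  by (simp add: Phi_def om_minus)

text \<open>The scalar product of \<open>om (cnj p)\<close> with \<open>L u (om q)\<close> is evaluated in two ways by \<open>L_om_col\<close>, on the right factor and, by
  adjunction, on the left one. The parameter \<open>u\<close> is chosen such that the two columns that occur have arguments differing
  by \<open>1/2 - \<tau>/2\<close>. This shift exchanges \<open>al\<close> and \<open>be\<close> up to sign and a common factor, and it turns \<open>t11\<close> into \<open>t00\<close>.\<close>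

lemma Phi_recursion:
  fixes p q :: complex
  shows "t00 (p - q + 2 * l * \<eta>) * Phi (p - \<eta>) q = t00 (q - p + 2 * l * \<eta>) * Phi p (q - \<eta>)"
proof -
  define P where "P = cnj p"
  define h where "h = 1/2 - \<tau>/2"
  define u u' where "u = q - p + h" and "u' = - cnj u"
  define y0 y1 x where "y0 = u/2 - q + l * \<eta>" and "y1 = u'/2 - P + l * \<eta>" and "x = cnj y1"
  have x: "x = (- q - p - h) / 2 + l * \<eta>" by (simp add: x_def y1_def u'_def u_def P_def field_simps)
  have y0: "y0 = x + h" by (simp add: x y0_def u_def field_simps)
  define Sm where "Sm i j = sf (L_entry u' i j (om P)) (om q)" for i j
  have omP: "om P \<in> V" "om q \<in> V" by (rule om_V)+
  have eq1: "(\<Sum>\<beta>\<in>UNIV. colv y0 \<beta> * (parity \<alpha> \<beta> * Sm (flip \<alpha>) (flip \<beta>))) = 2 * t11 (u + 2 * l * \<eta>) * colv (y0 - 2 * l * \<eta>) \<alpha> * Phi p (q - \<eta>)" for \<alpha>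
  proof -
    have y: "u/2 - q - l * \<eta> = y0 - 2 * l * \<eta>" by (simp add: y0_def)
    have "(\<lambda>z. \<Sum>\<beta>\<in>UNIV. colv y0 \<beta> * L_entry u \<alpha> \<beta> (om q) z) = (\<lambda>z. \<Sum>i\<in>{()}. (2 * t11 (u + 2 * l * \<eta>) * colv (y0 - 2 * l * \<eta>) \<alpha>) * om (q - \<eta>) z)"
      using L_om_col[of u \<alpha> q] unfolding y y0_def[symmetric] by (simp add: mult.commute)
    then have "sf (om P) (\<lambda>z. \<Sum>\<beta>\<in>UNIV. colv y0 \<beta> * L_entry u \<alpha> \<beta> (om q) z) =
       sf (om P) (\<lambda>z. \<Sum>i\<in>{()}. (2 * t11 (u + 2 * l * \<eta>) * colv (y0 - 2 * l * \<eta>) \<alpha>) * om (q - \<eta>) z)" by simp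
    then show ?thesis
      unfolding sf_sum_right[OF omP(1) L_entry_V[OF omP(2)]] sf_sum_right[OF omP(1) om_V]
        L_entry_adjoint[OF omP] u'_def[symmetric] Sm_def[symmetric] by (simp add: Phi_def P_def)
  qed
  have eq2: "(\<Sum>\<beta>\<in>UNIV. cnj (colv y1 \<beta>) * Sm \<alpha> \<beta>) = 2 * t11 (- u + 2 * l * \<eta>) * cnj (colv (y1 - 2 * l * \<eta>) \<alpha>) * Phi (p - \<eta>) q" for \<alpha>
  proof -
    have y: "u'/2 - P - l * \<eta> = y1 - 2 * l * \<eta>" by (simp add: y1_def)
    have "(\<lambda>z. \<Sum>\<beta>\<in>UNIV. colv y1 \<beta> * L_entry u' \<alpha> \<beta> (om P) z) = (\<lambda>z. \<Sum>i\<in>{()}. (2 * t11 (u' + 2 * l * \<eta>) * colv (y1 - 2 * l * \<eta>) \<alpha>) * om (P - \<eta>) z)"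
      using L_om_col[of u' \<alpha> P] unfolding y y1_def[symmetric] by (simp add: mult.commute)
    then have "sf (\<lambda>z. \<Sum>\<beta>\<in>UNIV. colv y1 \<beta> * L_entry u' \<alpha> \<beta> (om P) z) (om q) =
       sf (\<lambda>z. \<Sum>i\<in>{()}. (2 * t11 (u' + 2 * l * \<eta>) * colv (y1 - 2 * l * \<eta>) \<alpha>) * om (P - \<eta>) z) (om q)" by simp
    then show ?thesis
      unfolding sf_sum_left[OF omP(2) L_entry_V[OF omP(1)]] sf_sum_left[OF omP(2) om_V] Sm_def[symmetric]
      by (simp add: Phi_def P_def u'_def cnj_t11)
  qed
  define e where "e y = exp (- pi * \<i> * (\<tau>/2) - 2 * pi * \<i> * y)" for y
  have shift: "e (y + h) * al (y + h) = be y" "e (y + h) * be (y + h) = - al y" for y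
  proof -
    have r: "y + h + \<tau>/2 = y + 1/2" by (simp add: h_def)
    show "e (y + h) * al (y + h) = be y"
      using al_add_half_tau(1)[of "y + h"] unfolding r e_def[symmetric] theta_half_period by simp
    show "e (y + h) * be (y + h) = - al y"
      using al_add_half_tau(2)[of "y + h"] unfolding r e_def[symmetric] theta_half_period by simp
  qed
  have cab: "cnj (al w) = al (cnj w)" "cnj (be w) = be (cnj w)" for w
    using Re_tau by (simp_all add: theta_cnj)
  have cc: "cnj (colv w 1) = al (cnj w)" "cnj (colv w 2) = - be (cnj w)" for w
    by (simp_all add: colv_def cab)
  have y0': "y0 - 2 * l * \<eta> = (x - 2 * l * \<eta>) + h" by (simp add: y0)
  have y1': "cnj (y1 - 2 * l * \<eta>) = x - 2 * l * \<eta>" by (simp add: x_def)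
  define E E' where "E = e y0" and "E' = e (y0 - 2 * l * \<eta>)"
  have s0: "E * al y0 = be x" "E * be y0 = - al x" using shift[of x] unfolding y0[symmetric] E_def by auto
  have s1: "E' * al (y0 - 2 * l * \<eta>) = be (x - 2 * l * \<eta>)" "E' * be (y0 - 2 * l * \<eta>) = - al (x - 2 * l * \<eta>)"
    using shift[of "x - 2 * l * \<eta>"] unfolding y0'[symmetric] E'_def by auto
  have a1: "al y0 * - Sm 2 2 + - be y0 * Sm 2 1 = 2 * t11 (u + 2 * l * \<eta>) * al (y0 - 2 * l * \<eta>) * Phi p (q - \<eta>)"
    using eq1[of 1] by (simp add: sum_2 colv_def parity_def flip_def)
  have a2: "al y0 * Sm 1 2 + - be y0 * - Sm 1 1 = 2 * t11 (u + 2 * l * \<eta>) * - be (y0 - 2 * l * \<eta>) * Phi p (q - \<eta>)"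
    using eq1[of 2] by (simp add: sum_2 colv_def parity_def flip_def)
  have b1: "al x * Sm 1 1 + - be x * Sm 1 2 = 2 * t11 (- u + 2 * l * \<eta>) * al (x - 2 * l * \<eta>) * Phi (p - \<eta>) q"
    using eq2[of 1] unfolding sum_2 cc y1' x_def[symmetric] .
  have b2: "al x * Sm 2 1 + - be x * Sm 2 2 = 2 * t11 (- u + 2 * l * \<eta>) * - be (x - 2 * l * \<eta>) * Phi (p - \<eta>) q"
    using eq2[of 2] unfolding sum_2 cc y1' x_def[symmetric] .
  define F G where "F = t11 (u + 2 * l * \<eta>) * E * Phi p (q - \<eta>)" and "G = t11 (- u + 2 * l * \<eta>) * E' * Phi (p - \<eta>) q"
  have double_cancel: "b * (F + G) = 0" if "2 * (b * F) = - 2 * (b * G)" for b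
  proof -
    have "2 * (b * (F + G)) = 2 * (b * F) + 2 * (b * G)" by (simp only: distrib_left)
    also have "\<dots> = 0" unfolding that by simp
    finally show ?thesis by (simp only: mult_eq_0_iff) simp
  qed
  have "2 * (be (x - 2 * l * \<eta>) * F) = E' * (E * (2 * t11 (u + 2 * l * \<eta>) * al (y0 - 2 * l * \<eta>) * Phi p (q - \<eta>)))"
    unfolding s1(1)[symmetric] F_def by (simp only: mult_ac)
  also have "\<dots> = E' * ((E * al y0) * - Sm 2 2 - (E * be y0) * Sm 2 1)"
    unfolding a1[symmetric] by (simp add: algebra_simps)
  also have "\<dots> = E' * (al x * Sm 2 1 + - be x * Sm 2 2)" unfolding s0 by simp
  also have "\<dots> = - 2 * (be (x - 2 * l * \<eta>) * G)" unfolding b2 G_def by (simp add: mult_ac)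
  finally have be0: "be (x - 2 * l * \<eta>) * (F + G) = 0" by (rule double_cancel)
  have "2 * (al (x - 2 * l * \<eta>) * F) = E' * (E * (2 * t11 (u + 2 * l * \<eta>) * - be (y0 - 2 * l * \<eta>) * Phi p (q - \<eta>)))"
  proof -
    have "al (x - 2 * l * \<eta>) = - (E' * be (y0 - 2 * l * \<eta>))" using s1(2) by simp
    then show ?thesis unfolding F_def by (simp add: mult_ac)
  qed
  then have "2 * (al (x - 2 * l * \<eta>) * F) = E' * (E * (al y0 * Sm 1 2 + - be y0 * - Sm 1 1))" unfolding a2 .
  also have "\<dots> = E' * ((E * al y0) * Sm 1 2 + (E * be y0) * Sm 1 1)" by (simp add: algebra_simps)
  also have "\<dots> = - E' * (al x * Sm 1 1 + - be x * Sm 1 2)" unfolding s0 by (simp add: algebra_simps)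
  also have "\<dots> = - 2 * (al (x - 2 * l * \<eta>) * G)" unfolding b1 G_def by (simp add: mult_ac)
  finally have al0: "al (x - 2 * l * \<eta>) * (F + G) = 0" by (rule double_cancel)
  have FG: "F + G = 0" using be0 al0 al_be_not_both_zero[of "x - 2 * l * \<eta>"] by auto
  define a b where "a = q - p + 2 * l * \<eta>" and "b = p - q + 2 * l * \<eta>"
  have th: "t11 (w + h) = - exp (- pi * \<i> * \<tau> / 4 + pi * \<i> * w) * t00 w" for w
  proof -
    have "t11 (w + h) = exp (pi * \<i> * (\<tau>/4 + (1/2 + (w + h)))) * t00 (w + h + \<tau>/2 + 1/2)"
      using theta_eq_theta00[of 1 1 "w + h" \<tau>] by simp
    also have "w + h + \<tau>/2 + 1/2 = w + 1" by (simp add: h_def)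
    also have "t00 (w + 1) = t00 w" by (simp add: theta_add_1)
    also have "exp (pi * \<i> * (\<tau>/4 + (1/2 + (w + h)))) = exp (- pi * \<i> * \<tau> / 4 + pi * \<i> * w) * exp (of_real pi * \<i>)"
      unfolding exp_add[symmetric] h_def by (rule arg_cong[where f = exp]) (simp add: field_simps)
    finally show ?thesis by simp
  qed
  have tu: "t11 (u + 2 * l * \<eta>) = - exp (- pi * \<i> * \<tau> / 4 + pi * \<i> * a) * t00 a"
    using th[of a] by (simp add: a_def u_def algebra_simps)
  have tu': "t11 (- u + 2 * l * \<eta>) = exp (- pi * \<i> * \<tau> / 4 - pi * \<i> * b) * t00 b"
  proof -
    have "- u + 2 * l * \<eta> = - (- b + h)" by (simp add: b_def u_def)
    then have "t11 (- u + 2 * l * \<eta>) = - t11 (- b + h)" by (simp only: odd_t11)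
    then show ?thesis unfolding th using theta_minus[of 0 0 b \<tau>] by simp
  qed
  have EE: "exp (- pi * \<i> * \<tau> / 4 - pi * \<i> * b) * E' = exp (- pi * \<i> * \<tau> / 4 + pi * \<i> * a) * E"
    unfolding E_def E'_def e_def exp_add[symmetric]
    by (rule arg_cong[where f = exp]) (simp add: a_def b_def algebra_simps)
  have "F + G = (exp (- pi * \<i> * \<tau> / 4 - pi * \<i> * b) * E') * (t00 b * Phi (p - \<eta>) q)
      - (exp (- pi * \<i> * \<tau> / 4 + pi * \<i> * a) * E) * (t00 a * Phi p (q - \<eta>))"
    unfolding F_def G_def tu tu' by simp
  then have "F + G = (exp (- pi * \<i> * \<tau> / 4 + pi * \<i> * a) * E) * (t00 b * Phi (p - \<eta>) q - t00 a * Phi p (q - \<eta>))"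
    unfolding EE by (simp only: right_diff_distrib)
  then have "(exp (- pi * \<i> * \<tau> / 4 + pi * \<i> * a) * E) * (t00 b * Phi (p - \<eta>) q - t00 a * Phi p (q - \<eta>)) = 0" using FG by simp
  moreover have "exp (- pi * \<i> * \<tau> / 4 + pi * \<i> * a) * E \<noteq> 0" by (simp add: E_def e_def)
  ultimately show ?thesis by (simp add: a_def b_def)
qed

end

section \<open>The scalar product on the state space\<close>

lemma sum_lessThan_add:
  fixes f :: "nat \<Rightarrow> 'a :: comm_monoid_add"
  shows "(\<Sum>p<a + b. f p) = (\<Sum>p<a. f p) + (\<Sum>p<b. f (p + a))"
  by (induction b) (auto simp: add.assoc add.commute[of a])

locale sklyanin_QF = sklyanin_Q + sklyanin_form_loc
begin

definition linear_functional :: "((complex \<Rightarrow> complex) \<Rightarrow> complex) \<Rightarrow> bool" where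
  "linear_functional \<phi> \<longleftrightarrow> (\<forall>(I :: nat set) c f. (\<forall>p\<in>I. f p \<in> V) \<longrightarrow> \<phi> (\<lambda>z. \<Sum>p\<in>I. c p * f p z) = (\<Sum>p\<in>I. c p * \<phi> (f p)))"

text \<open>A product of linear functionals, one for each slot, is well defined on sums of pure tensors: a relation between pure tensors
  persists when one variable after the other is replaced by its functional.\<close>

lemma slotwise_functional:
  fixes I J :: "nat set"
  assumes \<phi>: "\<And>n. n \<in> {1..N} \<Longrightarrow> linear_functional (\<phi> n)"
    and f: "\<And>p n. p \<in> I \<Longrightarrow> n \<in> {1..N} \<Longrightarrow> f p n \<in> V" and g: "\<And>p n. p \<in> J \<Longrightarrow> n \<in> {1..N} \<Longrightarrow> g p n \<in> V"
    and eq: "(\<lambda>z. \<Sum>p\<in>I. pure_tensor N (f p) z) = (\<lambda>z. \<Sum>p\<in>J. pure_tensor N (g p) z)"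
  shows "(\<Sum>p\<in>I. \<Prod>n=1..N. \<phi> n (f p n)) = (\<Sum>p\<in>J. \<Prod>n=1..N. \<phi> n (g p n))"
proof -
  define val where "val M h z p = (\<Prod>n\<in>{1..M}. \<phi> n (h p n)) * (\<Prod>n\<in>{Suc M..N}. h p n (z n))"
    for M and h :: "nat \<Rightarrow> nat \<Rightarrow> complex \<Rightarrow> complex" and z and p
  have step: "(\<Sum>p\<in>I. val (Suc M) h z p) = \<phi> (Suc M) (\<lambda>w. \<Sum>p\<in>I. val M h (z(Suc M := w)) p)"
    if "Suc M \<le> N" and h: "\<And>p n. p \<in> I \<Longrightarrow> n \<in> {1..N} \<Longrightarrow> h p n \<in> V" for I M h z
  proof -
    define R where "R p = (\<Prod>n\<in>{1..M}. \<phi> n (h p n)) * (\<Prod>n\<in>{Suc (Suc M)..N}. h p n (z n))" for p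
    have "val M h (z(Suc M := w)) p = R p * h p (Suc M) w" for w p
    proof -
      have "(\<Prod>n\<in>{Suc M..N}. h p n ((z(Suc M := w)) n)) = h p (Suc M) w * (\<Prod>n\<in>{Suc (Suc M)..N}. h p n (z n))"
        using that by (subst prod_atLeastSucAtMost_split) auto
      then show ?thesis by (simp add: val_def R_def mult_ac)
    qed
    then have "\<phi> (Suc M) (\<lambda>w. \<Sum>p\<in>I. val M h (z(Suc M := w)) p) = (\<Sum>p\<in>I. R p * \<phi> (Suc M) (h p (Suc M)))"
      using \<phi>[of "Suc M"] h that unfolding linear_functional_def by simp
    also have "\<dots> = (\<Sum>p\<in>I. val (Suc M) h z p)"
      by (rule sum.cong) (auto simp: val_def R_def mult_ac)
    finally show ?thesis ..
  qed
  have "(\<Sum>p\<in>I. val M f z p) = (\<Sum>p\<in>J. val M g z p)" if "M \<le> N" for M z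
    using that
  proof (induction M arbitrary: z)
    case 0
    show ?case using fun_cong[OF eq, of z] by (simp add: val_def pure_tensor_def One_nat_def)
  next
    case (Suc M)
    have "(\<Sum>p\<in>I. val (Suc M) f z p) = \<phi> (Suc M) (\<lambda>w. \<Sum>p\<in>I. val M f (z(Suc M := w)) p)"
      by (rule step[OF Suc.prems f])
    moreover have "(\<Sum>p\<in>J. val (Suc M) g z p) = \<phi> (Suc M) (\<lambda>w. \<Sum>p\<in>J. val M g (z(Suc M := w)) p)"
      by (rule step[OF Suc.prems g])
    moreover have "(\<lambda>w. \<Sum>p\<in>I. val M f (z(Suc M := w)) p) = (\<lambda>w. \<Sum>p\<in>J. val M g (z(Suc M := w)) p)"
      by (intro ext Suc.IH Suc_leD[OF Suc.prems])
    ultimately show ?case by (simp only:)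
  qed
  from this[OF order_refl] show ?thesis by (simp add: val_def)
qed

lemma linear_functional_sf: "k \<in> V \<Longrightarrow> linear_functional (\<lambda>f. sf k f)" "k \<in> V \<Longrightarrow> linear_functional (\<lambda>f. cnj (sf f k))"
  unfolding linear_functional_def by (simp_all add: sf_sum_right sf_sum_left cnj_sum)

abbreviation "H \<equiv> HS N"

definition represents :: "nat \<Rightarrow> (nat \<Rightarrow> nat \<Rightarrow> complex \<Rightarrow> complex) \<Rightarrow> mfun \<Rightarrow> bool" where
  "represents k f F \<longleftrightarrow> F = (\<lambda>z. \<Sum>p<k. pure_tensor N (f p) z) \<and> (\<forall>p<k. \<forall>n\<in>{1..N}. f p n \<in> V)"

text \<open>The value does not depend on the chosen representations, by \<open>slotwise_functional\<close> applied first to the functionals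
  $\langle f, \cdot\rangle$ and then to the conjugates of $\langle\cdot, g\rangle$.\<close>

definition form :: "mfun \<Rightarrow> mfun \<Rightarrow> complex" where
  "form F G = (if F \<in> H \<and> G \<in> H then
     (SOME x. \<exists>k f k' g. represents k f F \<and> represents k' g G \<and> x = (\<Sum>p<k. \<Sum>q<k'. \<Prod>n=1..N. sf (f p n) (g q n))) else 0)"

lemma H_represents: "F \<in> H \<longleftrightarrow> (\<exists>k f. represents k f F)"
  unfolding H_space_def represents_def by blast

lemma form_eq:
  assumes F: "represents k f F" and G: "represents k' g G"
  shows "form F G = (\<Sum>p<k. \<Sum>q<k'. \<Prod>n=1..N. sf (f p n) (g q n))"
proof -
  have unique: "(\<Sum>p<k1. \<Sum>q<k1'. \<Prod>n=1..N. sf (f1 p n) (g1 q n)) = (\<Sum>p<k. \<Sum>q<k'. \<Prod>n=1..N. sf (f p n) (g q n))"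
    if F1: "represents k1 f1 F" and G1: "represents k1' g1 G" for k1 f1 k1' g1
  proof -
    have right: "(\<Sum>q<k1'. \<Prod>n=1..N. sf (f1 p n) (g1 q n)) = (\<Sum>q<k'. \<Prod>n=1..N. sf (f1 p n) (g q n))" if "p < k1" for p
    proof (rule slotwise_functional[where f = g1 and g = g and \<phi> = "\<lambda>n f. sf (f1 p n) f"])
      show "linear_functional (sf (f1 p n))" if "n \<in> {1..N}" for n
        using F1 \<open>p < k1\<close> that unfolding represents_def by (intro linear_functional_sf) blast
      show "(\<lambda>z. \<Sum>p<k1'. pure_tensor N (g1 p) z) = (\<lambda>z. \<Sum>p<k'. pure_tensor N (g p) z)"
        using G1 G unfolding represents_def by argo
    qed (use G1 G in \<open>auto simp: represents_def\<close>)
    have left: "(\<Sum>p<k1. \<Prod>n=1..N. sf (f1 p n) (g q n)) = (\<Sum>p<k. \<Prod>n=1..N. sf (f p n) (g q n))" if "q < k'" for q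
    proof -
      have "(\<Sum>p<k1. \<Prod>n=1..N. cnj (sf (f1 p n) (g q n))) = (\<Sum>p<k. \<Prod>n=1..N. cnj (sf (f p n) (g q n)))"
      proof (rule slotwise_functional[where f = f1 and g = f and \<phi> = "\<lambda>n f. cnj (sf f (g q n))"])
        show "linear_functional (\<lambda>f. cnj (sf f (g q n)))" if "n \<in> {1..N}" for n
          using G \<open>q < k'\<close> that unfolding represents_def by (intro linear_functional_sf) blast
        show "(\<lambda>z. \<Sum>p<k1. pure_tensor N (f1 p) z) = (\<lambda>z. \<Sum>p<k. pure_tensor N (f p) z)"
          using F1 F unfolding represents_def by argo
      qed (use F1 F in \<open>auto simp: represents_def\<close>)
      then have "cnj (\<Sum>p<k1. \<Prod>n=1..N. sf (f1 p n) (g q n)) = cnj (\<Sum>p<k. \<Prod>n=1..N. sf (f p n) (g q n))"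
        by (simp only: cnj_sum cnj_prod)
      then show ?thesis by (simp only: complex_cnj_cancel_iff)
    qed
    have "(\<Sum>p<k1. \<Sum>q<k1'. \<Prod>n=1..N. sf (f1 p n) (g1 q n)) = (\<Sum>p<k1. \<Sum>q<k'. \<Prod>n=1..N. sf (f1 p n) (g q n))"
      by (rule sum.cong[OF refl]) (simp only: right lessThan_iff)
    also have "\<dots> = (\<Sum>q<k'. \<Sum>p<k1. \<Prod>n=1..N. sf (f1 p n) (g q n))" by (rule sum.swap)
    also have "\<dots> = (\<Sum>q<k'. \<Sum>p<k. \<Prod>n=1..N. sf (f p n) (g q n))"
      by (rule sum.cong[OF refl]) (simp only: left lessThan_iff)
    also have "\<dots> = (\<Sum>p<k. \<Sum>q<k'. \<Prod>n=1..N. sf (f p n) (g q n))" by (rule sum.swap)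
    finally show ?thesis .
  qed
  have "F \<in> H" "G \<in> H" using F G H_represents by blast+
  moreover have "(SOME x. \<exists>k f k' g. represents k f F \<and> represents k' g G \<and> x = (\<Sum>p<k. \<Sum>q<k'. \<Prod>n=1..N. sf (f p n) (g q n)))
      = (\<Sum>p<k. \<Sum>q<k'. \<Prod>n=1..N. sf (f p n) (g q n))"
  proof (rule some_equality)
    show "\<exists>k1 f1 k1' g1. represents k1 f1 F \<and> represents k1' g1 G \<and>
        (\<Sum>p<k. \<Sum>q<k'. \<Prod>n=1..N. sf (f p n) (g q n)) = (\<Sum>p<k1. \<Sum>q<k1'. \<Prod>n=1..N. sf (f1 p n) (g1 q n))"
      using F G by blast
  qed (use unique in blast)
  ultimately show ?thesis unfolding form_def by (simp only: if_True simp_thms)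
qed

lemma represents_lin:
  assumes F: "represents k f F" and G: "represents k' g G"
  shows "represents (k + k') (\<lambda>p. if p < k then (\<lambda>n w. if n = 1 then c * f p n w else f p n w) else g (p - k)) (\<lambda>z. c * F z + G z)"
proof -
  define h where "h p = (if p < k then (\<lambda>n w. if n = 1 then c * f p n w else f p n w) else g (p - k))" for p
  have "(\<Sum>p<k + k'. pure_tensor N (h p) z) = c * F z + G z" for z
  proof -
    have "(\<Sum>p<k + k'. pure_tensor N (h p) z) = (\<Sum>p<k. pure_tensor N (h p) z) + (\<Sum>p<k'. pure_tensor N (h (p + k)) z)"
      by (rule sum_lessThan_add)
    moreover have "(\<Sum>p<k. pure_tensor N (h p) z) = c * F z"
      using F by (simp add: h_def represents_def sum_distrib_left pure_tensor_scale[OF N_pos])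
    ultimately show ?thesis using G by (simp add: h_def represents_def)
  qed
  moreover have "h p n \<in> V" if "p < k + k'" "n \<in> {1..N}" for p n
    using that F G V_scale[of "f p n" c] by (cases "n = 1") (auto simp: h_def represents_def)
  ultimately show ?thesis unfolding h_def[symmetric, abs_def] represents_def by auto
qed

lemma form_sesquilinear: "sesquilinear_on H form"
  unfolding sesquilinear_on_def
proof (intro ballI allI)
  fix F G K c assume "F \<in> H" "G \<in> H" "K \<in> H"
  then obtain k f k' g k'' h where F: "represents k f F" and G: "represents k' g G" and K: "represents k'' h K"
    using H_represents by meson
  have s: "sf (\<lambda>w. c * a w) b = cnj c * sf a b" "sf b (\<lambda>w. c * a w) = c * sf b a" if "a \<in> V" "b \<in> V" for a b
    using sf_sum_left[of b "{()}" "\<lambda>_. a" "\<lambda>_. c"] sf_sum_right[of b "{()}" "\<lambda>_. a" "\<lambda>_. c"] that by simp_all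
  have first: "{1..N} = insert 1 {2..N}" using N_pos by auto
  have l: "(\<Prod>n=1..N. sf (\<lambda>w. if n = 1 then c * f p n w else f p n w) (h q n)) = cnj c * (\<Prod>n=1..N. sf (f p n) (h q n))"
    if "p < k" "q < k''" for p q
  proof -
    have "f p 1 \<in> V" "h q 1 \<in> V" using that F K N_pos by (auto simp: represents_def)
    then show ?thesis unfolding first by (simp add: s mult.assoc)
  qed
  have r: "(\<Prod>n=1..N. sf (h q n) (\<lambda>w. if n = 1 then c * f p n w else f p n w)) = c * (\<Prod>n=1..N. sf (h q n) (f p n))"
    if "p < k" "q < k''" for p q
  proof -
    have "f p 1 \<in> V" "h q 1 \<in> V" using that F K N_pos by (auto simp: represents_def)
    then show ?thesis unfolding first by (simp add: s mult.assoc)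
  qed
  show "form (\<lambda>x. c * F x + G x) K = cnj c * form F K + form G K \<and> form K (\<lambda>x. c * F x + G x) = c * form K F + form K G"
    unfolding form_eq[OF represents_lin[OF F G] K] form_eq[OF K represents_lin[OF F G]]
      form_eq[OF F K] form_eq[OF G K] form_eq[OF K F] form_eq[OF K G] sum_lessThan_add
    using l r by (auto simp: sum_distrib_left sum.distrib intro!: sum.cong)
qed

lemma form_pure:
  assumes "\<forall>n\<in>{1..N}. f n \<in> V \<and> g n \<in> V"
  shows "form (pure_tensor N f) (pure_tensor N g) = (\<Prod>n=1..N. sf (f n) (g n))"
  using form_eq[of 1 "\<lambda>_. f" "pure_tensor N f" 1 "\<lambda>_. g" "pure_tensor N g"] assms
  by (simp add: represents_def)

lemma sesquilinear_D:
  assumes "sesquilinear_on H B" "F \<in> H" "G \<in> H" "E \<in> H"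
  shows "B (\<lambda>x. c * F x + G x) E = cnj c * B F E + B G E \<and> B E (\<lambda>x. c * F x + G x) = c * B E F + B E G"
  by (rule assms(1)[unfolded sesquilinear_on_def, rule_format, OF assms(2-4)])

lemma sesquilinear_zero:
  assumes B: "sesquilinear_on H B" and "G \<in> H"
  shows "B (\<lambda>_. 0) G = 0" "B G (\<lambda>_. 0) = 0"
proof -
  have "B (\<lambda>x. (-1) * 0 + 0) G = cnj (-1) * B (\<lambda>_. 0) G + B (\<lambda>_. 0) G" "B G (\<lambda>x. (-1) * 0 + 0) = (-1) * B G (\<lambda>_. 0) + B G (\<lambda>_. 0)"
    using sesquilinear_D[OF B H_zero H_zero assms(2), of "-1"] by auto
  then show "B (\<lambda>_. 0) G = 0" "B G (\<lambda>_. 0) = 0" by simp_all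
qed

lemma sesquilinear_sum:
  assumes B: "sesquilinear_on H B" and G: "G \<in> H" and F: "\<And>i. i \<in> I \<Longrightarrow> F i \<in> H"
  shows "B (\<lambda>z. \<Sum>i\<in>I. c i * F i z) G = (\<Sum>i\<in>I. cnj (c i) * B (F i) G)"
    and "B G (\<lambda>z. \<Sum>i\<in>I. c i * F i z) = (\<Sum>i\<in>I. c i * B G (F i))"
proof -
  have "B (\<lambda>z. \<Sum>i\<in>I. c i * F i z) G = (\<Sum>i\<in>I. cnj (c i) * B (F i) G) \<and> B G (\<lambda>z. \<Sum>i\<in>I. c i * F i z) = (\<Sum>i\<in>I. c i * B G (F i))"
    using F
  proof (induction I rule: infinite_finite_induct)
    case (insert x I)
    let ?S = "\<lambda>z. \<Sum>i\<in>I. c i * F i z"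
    have "?S \<in> H" "F x \<in> H" using insert.prems by (auto intro: H_sum[OF N_pos])
    then have "B (\<lambda>z. c x * F x z + ?S z) G = cnj (c x) * B (F x) G + B ?S G \<and> B G (\<lambda>z. c x * F x z + ?S z) = c x * B G (F x) + B G ?S"
      by (intro sesquilinear_D[OF B] G)
    then show ?case using insert by simp
  qed (auto simp: sesquilinear_zero[OF B G])
  then show "B (\<lambda>z. \<Sum>i\<in>I. c i * F i z) G = (\<Sum>i\<in>I. cnj (c i) * B (F i) G)"
    "B G (\<lambda>z. \<Sum>i\<in>I. c i * F i z) = (\<Sum>i\<in>I. c i * B G (F i))" by auto
qed

lemma sesquilinear_determined:
  assumes B: "sesquilinear_on H B" and B': "sesquilinear_on H B'" and F: "F \<in> H" and G: "G \<in> H"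
    and pure: "\<And>f g. (\<And>n. n \<in> {1..N} \<Longrightarrow> f n \<in> V) \<Longrightarrow> (\<And>n. n \<in> {1..N} \<Longrightarrow> g n \<in> V) \<Longrightarrow> B (pure_tensor N f) (pure_tensor N g) = B' (pure_tensor N f) (pure_tensor N g)"
  shows "B F G = B' F G"
proof -
  obtain k :: nat and f where F': "F = (\<lambda>z. \<Sum>p<k. 1 * pure_tensor N (f p) z)" "\<And>p n. p < k \<Longrightarrow> n \<in> {1..N} \<Longrightarrow> f p n \<in> V"
    using F unfolding H_represents represents_def by auto
  obtain k' :: nat and g where G': "G = (\<lambda>z. \<Sum>p<k'. 1 * pure_tensor N (g p) z)" "\<And>p n. p < k' \<Longrightarrow> n \<in> {1..N} \<Longrightarrow> g p n \<in> V"
    using G unfolding H_represents represents_def by auto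
  have fH: "p < k \<Longrightarrow> pure_tensor N (f p) \<in> H" and gH: "p < k' \<Longrightarrow> pure_tensor N (g p) \<in> H" for p
    using F'(2) G'(2) by (auto intro: H_pure)
  have "B'' F G = (\<Sum>p<k. \<Sum>q<k'. B'' (pure_tensor N (f p)) (pure_tensor N (g q)))" if "sesquilinear_on H B''" for B''
  proof -
    have "B'' F G = (\<Sum>p<k. B'' (pure_tensor N (f p)) G)"
      unfolding F'(1) by (subst sesquilinear_sum(1)[OF that G]) (auto intro: fH)
    also have "\<dots> = (\<Sum>p<k. \<Sum>q<k'. B'' (pure_tensor N (f p)) (pure_tensor N (g q)))"
      unfolding G'(1) by (intro sum.cong refl, subst sesquilinear_sum(2)[OF that]) (auto intro: fH gH)
    finally show ?thesis .
  qed
  from this[OF B] this[OF B'] show ?thesis using pure F'(2) G'(2) by simp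
qed

abbreviation "form_H \<equiv> H_form \<tau> \<eta> l N"

definition multiplicative_on_pure :: "(mfun \<Rightarrow> mfun \<Rightarrow> complex) \<Rightarrow> bool" where
  "multiplicative_on_pure B \<longleftrightarrow> (\<forall>f g. (\<forall>n\<in>{1..N}. f n \<in> V \<and> g n \<in> V) \<longrightarrow>
     B (pure_tensor N f) (pure_tensor N g) = (\<Prod>n=1..N. sf (f n) (g n)))"

lemma multiplicative_on_pure_form: "multiplicative_on_pure form"
  unfolding multiplicative_on_pure_def by (intro allI impI form_pure)

lemma form_H_eq_form: "form_H = form"
  unfolding H_form_def multiplicative_on_pure_def[symmetric]
proof (rule the_equality)
  show "sesquilinear_on H form \<and> multiplicative_on_pure form \<and> (\<forall>F G. F \<notin> H \<or> G \<notin> H \<longrightarrow> form F G = 0)"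
    using form_sesquilinear multiplicative_on_pure_form by (auto simp: form_def)
next
  fix B
  assume B: "sesquilinear_on H B \<and> multiplicative_on_pure B \<and> (\<forall>F G. F \<notin> H \<or> G \<notin> H \<longrightarrow> B F G = 0)"
  have pure: "B (pure_tensor N f) (pure_tensor N g) = form (pure_tensor N f) (pure_tensor N g)"
    if "\<And>n. n \<in> {1..N} \<Longrightarrow> f n \<in> V" "\<And>n. n \<in> {1..N} \<Longrightarrow> g n \<in> V" for f g
  proof -
    have fg: "\<forall>n\<in>{1..N}. f n \<in> V \<and> g n \<in> V" using that by blast
    show ?thesis using conjunct1[OF conjunct2[OF B]] fg unfolding form_pure[OF fg] multiplicative_on_pure_def by blast
  qed
  have "B F G = form F G" for F G
  proof (cases "F \<in> H \<and> G \<in> H")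
    case True
    show ?thesis
      by (rule sesquilinear_determined[OF conjunct1[OF B] form_sesquilinear conjunct1[OF True] conjunct2[OF True] pure])
  next
    case False
    then show ?thesis using B by (auto simp: form_def)
  qed
  then show "B = form" by blast
qed

lemma form_H_sesquilinear: "sesquilinear_on H form_H"
  unfolding form_H_eq_form by (rule form_sesquilinear)

lemma form_H_pure:
  assumes "\<And>n. n \<in> {1..N} \<Longrightarrow> f n \<in> V" "\<And>n. n \<in> {1..N} \<Longrightarrow> g n \<in> V"
  shows "form_H (pure_tensor N f) (pure_tensor N g) = (\<Prod>n=1..N. sf (f n) (g n))"
  unfolding form_H_eq_form using assms by (intro form_pure) auto

lemmas form_H_sum = sesquilinear_sum[OF form_H_sesquilinear]

lemma form_H_scale:
  assumes "G \<in> H" "F \<in> H"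
  shows "form_H G (\<lambda>z. c * F z) = c * form_H G F" "form_H (\<lambda>z. c * F z) G = cnj c * form_H F G"
  using form_H_sum[OF assms(1), of "{()}" "\<lambda>_. F" "\<lambda>_. c"] assms(2) by simp_all

section \<open>The adjoint of the transfer matrix\<close>

definition sign_2 :: "2 \<Rightarrow> complex" where "sign_2 \<alpha> = (if \<alpha> = 1 then 1 else - 1)"

primrec mprod :: "(nat \<Rightarrow> 2 \<Rightarrow> 2 \<Rightarrow> complex) \<Rightarrow> nat \<Rightarrow> 2 \<Rightarrow> 2 \<Rightarrow> complex" where
  "mprod m 0 \<alpha> \<beta> = (if \<alpha> = \<beta> then 1 else 0)"
| "mprod m (Suc n) \<alpha> \<beta> = (\<Sum>\<gamma>\<in>UNIV. m (Suc n) \<alpha> \<gamma> * mprod m n \<gamma> \<beta>)"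

text \<open>The sign \<open>parity\<close> is minus the product of the signs of both indices, so that the signs of the inner indices cancel in a matrix product.\<close>

lemma mprod_flip:
  assumes "\<And>n \<alpha> \<beta>. n \<in> {1..M} \<Longrightarrow> m n \<alpha> \<beta> = parity \<alpha> \<beta> * m' n (flip \<alpha>) (flip \<beta>)"
  shows "mprod m M \<alpha> \<beta> = (-1) ^ M * (sign_2 \<alpha> * sign_2 \<beta>) * mprod m' M (flip \<alpha>) (flip \<beta>)"
  using assms
proof (induction M arbitrary: \<alpha> \<beta>)
  case 0
  show ?case using two_cases[of \<alpha>] two_cases[of \<beta>] by (auto simp: sign_2_def flip_def)
next
  case (Suc M)
  have IH: "mprod m M \<gamma> \<beta> = (-1) ^ M * (sign_2 \<gamma> * sign_2 \<beta>) * mprod m' M (flip \<gamma>) (flip \<beta>)" for \<gamma>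
    by (rule Suc.IH) (use Suc.prems in auto)
  have P: "parity \<alpha> \<gamma> * sign_2 \<gamma> = - sign_2 \<alpha>" for \<gamma>
    using two_cases[of \<alpha>] two_cases[of \<gamma>] by (auto simp: parity_def sign_2_def)
  have "mprod m (Suc M) \<alpha> \<beta> = (\<Sum>\<gamma>\<in>UNIV. (parity \<alpha> \<gamma> * sign_2 \<gamma>) * ((-1) ^ M * sign_2 \<beta> * (m' (Suc M) (flip \<alpha>) (flip \<gamma>) * mprod m' M (flip \<gamma>) (flip \<beta>))))"
    using Suc.prems[of "Suc M"] by (simp add: IH mult_ac)
  also have "\<dots> = (-1) ^ Suc M * (sign_2 \<alpha> * sign_2 \<beta>) * (\<Sum>\<gamma>\<in>UNIV. m' (Suc M) (flip \<alpha>) (flip \<gamma>) * mprod m' M (flip \<gamma>) (flip \<beta>))"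
    unfolding P by (simp add: sum_distrib_left mult_ac sum_negf)
  also have "(\<Sum>\<gamma>\<in>UNIV. m' (Suc M) (flip \<alpha>) (flip \<gamma>) * mprod m' M (flip \<gamma>) (flip \<beta>)) = mprod m' (Suc M) (flip \<alpha>) (flip \<beta>)"
    by (simp add: sum_2 flip_def add.commute)
  finally show ?case .
qed

text \<open>The entries of the monodromy after \<open>M\<close> sites, applied to a pure tensor. It is not itself a pure tensor; \<open>partial_Suc\<close> writes
  it as a sum of such partial products with one site less.\<close>

definition partial :: "complex \<Rightarrow> (nat \<Rightarrow> complex \<Rightarrow> complex) \<Rightarrow> nat \<Rightarrow> 2 \<Rightarrow> 2 \<Rightarrow> mfun" where
  "partial u f M \<alpha> \<beta> = (\<lambda>z. (L_product u f z M $ \<alpha> $ \<beta>) * (\<Prod>n\<in>{Suc M..N}. f n (z n)))"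

lemma partial_0: "partial u f 0 \<alpha> \<beta> = (\<lambda>z. (if \<alpha> = \<beta> then 1 else 0) * pure_tensor N f z)"
  by (auto simp: partial_def mat_def pure_tensor_def One_nat_def)

lemma partial_Suc:
  assumes "Suc M \<le> N"
  shows "partial u f (Suc M) \<alpha> \<beta> = (\<lambda>z. \<Sum>\<gamma>\<in>UNIV. 1 * partial u (f(Suc M := L_entry u \<alpha> \<gamma> (f (Suc M)))) M \<gamma> \<beta> z)"
proof
  fix z
  have L: "L_product u (f(Suc M := h)) z k = L_product u f z k" if "k \<le> M" for h k
    using that by (induction k) auto
  have P: "(\<Prod>n\<in>{Suc M..N}. (f(Suc M := h)) n (z n)) = h (z (Suc M)) * (\<Prod>n\<in>{Suc (Suc M)..N}. f n (z n))" for h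
    using assms by (subst prod_atLeastSucAtMost_split) auto
  show "partial u f (Suc M) \<alpha> \<beta> z = (\<Sum>\<gamma>\<in>UNIV. 1 * partial u (f(Suc M := L_entry u \<alpha> \<gamma> (f (Suc M)))) M \<gamma> \<beta> z)"
    unfolding partial_def P L[OF order_refl] by (simp add: matrix_matrix_mult_def L_matrix_def sum_distrib_right sum_distrib_left mult_ac)
qed

lemma partial_H:
  assumes "M \<le> N" "\<And>n. n \<in> {1..N} \<Longrightarrow> f n \<in> V"
  shows "partial u f M \<alpha> \<beta> \<in> H"
  using assms
proof (induction M arbitrary: f \<alpha> \<beta>)
  case 0
  then show ?case unfolding partial_0 by (intro H_scale[OF N_pos] H_pure)
next
  case (Suc M)
  show ?case unfolding partial_Suc[OF Suc.prems(1)]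
    using Suc.prems by (intro H_sum[OF N_pos] Suc.IH) (auto intro: L_entry_V)
qed

lemma form_H_partial:
  assumes "M \<le> N" "\<And>n. n \<in> {1..N} \<Longrightarrow> f n \<in> V" "\<And>n. n \<in> {1..N} \<Longrightarrow> g n \<in> V"
  shows "form_H (pure_tensor N g) (partial u f M \<alpha> \<beta>) =
      mprod (\<lambda>n \<alpha> \<beta>. sf (g n) (L_entry u \<alpha> \<beta> (f n))) M \<alpha> \<beta> * (\<Prod>n\<in>{Suc M..N}. sf (g n) (f n))"
    and "form_H (partial u f M \<alpha> \<beta>) (pure_tensor N g) =
      mprod (\<lambda>n \<alpha> \<beta>. sf (L_entry u \<alpha> \<beta> (f n)) (g n)) M \<alpha> \<beta> * (\<Prod>n\<in>{Suc M..N}. sf (f n) (g n))"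
proof -
  have gH: "pure_tensor N g \<in> H" by (intro H_pure assms)
  have "form_H (pure_tensor N g) (partial u f M \<alpha> \<beta>) =
      mprod (\<lambda>n \<alpha> \<beta>. sf (g n) (L_entry u \<alpha> \<beta> (f n))) M \<alpha> \<beta> * (\<Prod>n\<in>{Suc M..N}. sf (g n) (f n)) \<and>
     form_H (partial u f M \<alpha> \<beta>) (pure_tensor N g) =
      mprod (\<lambda>n \<alpha> \<beta>. sf (L_entry u \<alpha> \<beta> (f n)) (g n)) M \<alpha> \<beta> * (\<Prod>n\<in>{Suc M..N}. sf (f n) (g n))"
    using assms(1,2)
  proof (induction M arbitrary: f \<alpha> \<beta>)
    case 0
    have fH: "pure_tensor N f \<in> H" by (intro H_pure 0)
    have "form_H (pure_tensor N g) (pure_tensor N f) = (\<Prod>n=1..N. sf (g n) (f n))" "form_H (pure_tensor N f) (pure_tensor N g) = (\<Prod>n=1..N. sf (f n) (g n))"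
      by (intro form_H_pure assms(3) 0; assumption)+
    then show ?case unfolding partial_0 form_H_scale[OF gH fH] by (simp add: One_nat_def)
  next
    case (Suc M)
    let ?f = "\<lambda>\<gamma>. f(Suc M := L_entry u \<alpha> \<gamma> (f (Suc M)))"
    have fV: "?f \<gamma> n \<in> V" if "n \<in> {1..N}" for \<gamma> n using that Suc.prems by (auto intro: L_entry_V)
    have pH: "partial u (?f \<gamma>) M \<gamma> \<beta> \<in> H" for \<gamma> by (rule partial_H) (use Suc.prems fV in auto)
    have IH: "form_H (pure_tensor N g) (partial u (?f \<gamma>) M \<gamma> \<beta>) =
      mprod (\<lambda>n \<alpha> \<beta>. sf (g n) (L_entry u \<alpha> \<beta> (?f \<gamma> n))) M \<gamma> \<beta> * (\<Prod>n\<in>{Suc M..N}. sf (g n) (?f \<gamma> n)) \<and>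
      form_H (partial u (?f \<gamma>) M \<gamma> \<beta>) (pure_tensor N g) =
      mprod (\<lambda>n \<alpha> \<beta>. sf (L_entry u \<alpha> \<beta> (?f \<gamma> n)) (g n)) M \<gamma> \<beta> * (\<Prod>n\<in>{Suc M..N}. sf (?f \<gamma> n) (g n))" for \<gamma>
      by (rule Suc.IH) (use Suc.prems fV in auto)
    have M1: "mprod (\<lambda>n \<alpha> \<beta>. X n \<alpha> \<beta> ((f(Suc M := h)) n)) k \<gamma> \<beta> = mprod (\<lambda>n \<alpha> \<beta>. X n \<alpha> \<beta> (f n)) k \<gamma> \<beta>"
      if "k \<le> M" for X h k \<gamma> \<beta>
      using that by (induction k arbitrary: \<gamma> \<beta>) auto
    have P: "(\<Prod>n\<in>{Suc M..N}. X n ((f(Suc M := h)) n)) = X (Suc M) h * (\<Prod>n\<in>{Suc (Suc M)..N}. X n (f n) :: complex)" for X h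
      using Suc.prems by (subst prod_atLeastSucAtMost_split) auto
    show ?case
      unfolding partial_Suc[OF Suc.prems(1)] form_H_sum[OF gH pH]
      using IH M1[OF order_refl, of "\<lambda>n \<alpha> \<beta> x. sf (g n) (L_entry u \<alpha> \<beta> x)"] M1[OF order_refl, of "\<lambda>n \<alpha> \<beta> x. sf (L_entry u \<alpha> \<beta> x) (g n)"]
        P[of "\<lambda>n x. sf (g n) x"] P[of "\<lambda>n x. sf x (g n)"]
      by (simp add: sum_distrib_left mult_ac)
  qed
  then show "form_H (pure_tensor N g) (partial u f M \<alpha> \<beta>) =
      mprod (\<lambda>n \<alpha> \<beta>. sf (g n) (L_entry u \<alpha> \<beta> (f n))) M \<alpha> \<beta> * (\<Prod>n\<in>{Suc M..N}. sf (g n) (f n))"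
    "form_H (partial u f M \<alpha> \<beta>) (pure_tensor N g) =
      mprod (\<lambda>n \<alpha> \<beta>. sf (L_entry u \<alpha> \<beta> (f n)) (g n)) M \<alpha> \<beta> * (\<Prod>n\<in>{Suc M..N}. sf (f n) (g n))" by auto
qed

end

context sklyanin_QF
begin

lemma form_H_sum_1:
  assumes "G \<in> H" "\<And>i. i \<in> I \<Longrightarrow> F i \<in> H"
  shows "form_H (\<lambda>z. \<Sum>i\<in>I. 1 * F i z) G = (\<Sum>i\<in>I. form_H (F i) G)"
    and "form_H G (\<lambda>z. \<Sum>i\<in>I. 1 * F i z) = (\<Sum>i\<in>I. form_H G (F i))"
  using form_H_sum[of G I F "\<lambda>_. 1"] assms by simp_all

lemma T_pure:
  assumes "\<And>n. n \<in> {1..N} \<Longrightarrow> f n \<in> V"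
  shows "T N u (pure_tensor N f) = (\<lambda>z. \<Sum>\<alpha>\<in>UNIV. 1 * partial u f N \<alpha> \<alpha> z)"
proof -
  have "T N u (\<lambda>z. \<Sum>p\<in>{()}. 1 * pure_tensor N f z) = (\<lambda>z. \<Sum>p\<in>{()}. 1 * trace (L_product u f z N))"
    by (rule transfer_matrix_eq[where f = "\<lambda>_. f" and c = "\<lambda>_. 1"]) (rule assms)
  then show ?thesis by (simp add: trace_def partial_def)
qed

text \<open>Both sides are traces of products of \<open>2 \<times> 2\<close> matrices of scalar products, related entrywise by
  \<open>L_entry_adjoint\<close>; the total sign is \<open>(-1) ^ N\<close>.\<close>

lemma T_adjoint_pure:
  assumes f: "\<And>n. n \<in> {1..N} \<Longrightarrow> f n \<in> V" and g: "\<And>n. n \<in> {1..N} \<Longrightarrow> g n \<in> V"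
  shows "form_H (pure_tensor N g) (T N u (pure_tensor N f)) = form_H (T N (- cnj u) (pure_tensor N g)) (pure_tensor N f)"
proof -
  let ?m = "\<lambda>n \<alpha> \<beta>. sf (g n) (L_entry u \<alpha> \<beta> (f n))" and ?m' = "\<lambda>n \<alpha> \<beta>. sf (L_entry (- cnj u) \<alpha> \<beta> (g n)) (f n)"
  have fH: "pure_tensor N f \<in> H" and gH: "pure_tensor N g \<in> H" by (intro H_pure f g; assumption)+
  have flip: "mprod ?m N \<alpha> \<beta> = (-1) ^ N * (sign_2 \<alpha> * sign_2 \<beta>) * mprod ?m' N (flip \<alpha>) (flip \<beta>)" for \<alpha> \<beta>
    by (rule mprod_flip) (use L_entry_adjoint f g in auto)
  have pf: "partial u f N \<alpha> \<beta> \<in> H" and pg: "partial (- cnj u) g N \<alpha> \<beta> \<in> H" for \<alpha> \<beta>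
    by (intro partial_H order_refl f g; assumption)+
  have hf: "form_H (pure_tensor N g) (partial u f N \<alpha> \<beta>) = mprod ?m N \<alpha> \<beta>" for \<alpha> \<beta>
    using form_H_partial(1)[OF order_refl, of f g u \<alpha> \<beta>] f g by simp
  have hg: "form_H (partial (- cnj u) g N \<alpha> \<beta>) (pure_tensor N f) = mprod ?m' N \<alpha> \<beta>" for \<alpha> \<beta>
    using form_H_partial(2)[OF order_refl, of g f "- cnj u" \<alpha> \<beta>] f g by simp
  have Tf: "T N u (pure_tensor N f) = (\<lambda>z. \<Sum>\<alpha>\<in>UNIV. 1 * partial u f N \<alpha> \<alpha> z)" by (intro T_pure f; assumption)
  have Tg: "T N (- cnj u) (pure_tensor N g) = (\<lambda>z. \<Sum>\<alpha>\<in>UNIV. 1 * partial (- cnj u) g N \<alpha> \<alpha> z)" by (intro T_pure g; assumption)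
  have "form_H (pure_tensor N g) (T N u (pure_tensor N f)) = (\<Sum>\<alpha>\<in>UNIV. mprod ?m N \<alpha> \<alpha>)"
    unfolding Tf by (subst form_H_sum(2)[OF gH pf]) (simp add: hf)
  also have "\<dots> = (\<Sum>\<alpha>\<in>UNIV. mprod ?m' N \<alpha> \<alpha>)"
    unfolding flip using N_even by (simp add: sum_2 sign_2_def flip_def)
  also have "\<dots> = form_H (T N (- cnj u) (pure_tensor N g)) (pure_tensor N f)"
    unfolding Tg by (subst form_H_sum(1)[OF fH pg]) (simp add: hg)
  finally show ?thesis .
qed

lemma T_rep:
  fixes f :: "nat \<Rightarrow> nat \<Rightarrow> complex \<Rightarrow> complex"
  assumes "\<And>p n. p < k \<Longrightarrow> n \<in> {1..N} \<Longrightarrow> f p n \<in> V"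
  shows "T N u (\<lambda>z. \<Sum>p<k. 1 * pure_tensor N (f p) z) = (\<lambda>z. \<Sum>p<k. 1 * T N u (pure_tensor N (f p)) z)"
proof -
  have "T N u (\<lambda>z. \<Sum>p<k. 1 * pure_tensor N (f p) z) = (\<lambda>z. \<Sum>p<k. 1 * trace (L_product u (f p) z N))"
    by (rule transfer_matrix_eq[where f = f and c = "\<lambda>_. 1"]) (use assms in simp)
  moreover have single: "T N u (pure_tensor N (f p)) = (\<lambda>z. trace (L_product u (f p) z N))" if "p < k" for p
  proof -
    have "T N u (pure_tensor N (f p)) = (\<lambda>z. \<Sum>\<alpha>\<in>UNIV. 1 * partial u (f p) N \<alpha> \<alpha> z)"
      by (rule T_pure) (use assms that in simp)
    then show ?thesis by (simp add: trace_def partial_def)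
  qed
  moreover have "(\<lambda>z. \<Sum>p<k. 1 * trace (L_product u (f p) z N)) = (\<lambda>z. \<Sum>p<k. 1 * T N u (pure_tensor N (f p)) z)"
    by (intro ext sum.cong refl) (simp add: single)
  ultimately show ?thesis by (simp only:)
qed

lemma T_pure_H:
  assumes "\<And>n. n \<in> {1..N} \<Longrightarrow> f n \<in> V"
  shows "T N u (pure_tensor N f) \<in> H"
proof -
  have "T N u (pure_tensor N f) = (\<lambda>z. \<Sum>\<alpha>\<in>UNIV. 1 * partial u f N \<alpha> \<alpha> z)" by (intro T_pure assms; assumption)
  moreover have "(\<lambda>z. \<Sum>\<alpha>\<in>UNIV. 1 * partial u f N \<alpha> \<alpha> z) \<in> H"
    by (rule H_sum[OF N_pos], rule partial_H[OF order_refl]) (rule assms)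
  ultimately show ?thesis by (simp only:)
qed

lemma H_sum_of_pure:
  assumes "F \<in> H"
  obtains k :: nat and f where "F = (\<lambda>z. \<Sum>p<k. 1 * pure_tensor N (f p) z)" "\<And>p n. p < k \<Longrightarrow> n \<in> {1..N} \<Longrightarrow> f p n \<in> V"
  by (rule H_E[OF assms], rule that) (simp_all only: mult_1)

lemma T_H:
  assumes "F \<in> H"
  shows "T N u F \<in> H"
proof -
  obtain k :: nat and f where F: "F = (\<lambda>z. \<Sum>p<k. 1 * pure_tensor N (f p) z)" and f: "\<And>p n. p < k \<Longrightarrow> n \<in> {1..N} \<Longrightarrow> f p n \<in> V"
    using H_sum_of_pure[OF assms] by blast
  have TF: "T N u F = (\<lambda>z. \<Sum>p<k. 1 * T N u (pure_tensor N (f p)) z)"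
    unfolding F by (rule T_rep[OF f])
  have "T N u (pure_tensor N (f p)) \<in> H" if "p \<in> {..<k}" for p
    by (rule T_pure_H) (use f that in simp)
  then show ?thesis unfolding TF by (rule H_sum[OF N_pos])
qed

theorem T_adjoint:
  assumes F: "F \<in> H" and G: "G \<in> H"
  shows "form_H G (T N u F) = form_H (T N (- cnj u) G) F"
proof -
  obtain k :: nat and f where F': "F = (\<lambda>z. \<Sum>p<k. 1 * pure_tensor N (f p) z)" and f: "\<And>p n. p < k \<Longrightarrow> n \<in> {1..N} \<Longrightarrow> f p n \<in> V"
    using H_sum_of_pure[OF F] by blast
  obtain k' :: nat and g where G': "G = (\<lambda>z. \<Sum>p<k'. 1 * pure_tensor N (g p) z)" and g: "\<And>p n. p < k' \<Longrightarrow> n \<in> {1..N} \<Longrightarrow> g p n \<in> V"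
    using H_sum_of_pure[OF G] by blast
  have fH: "pure_tensor N (f p) \<in> H" if "p \<in> {..<k}" for p
    by (rule H_pure, rule f) (use that in auto)
  have gH: "pure_tensor N (g p) \<in> H" if "p \<in> {..<k'}" for p
    by (rule H_pure, rule g) (use that in auto)
  have TF: "T N u F = (\<lambda>z. \<Sum>p<k. 1 * T N u (pure_tensor N (f p)) z)" unfolding F' by (rule T_rep[OF f])
  have TG: "T N (- cnj u) G = (\<lambda>z. \<Sum>p<k'. 1 * T N (- cnj u) (pure_tensor N (g p)) z)" unfolding G' by (rule T_rep[OF g])
  have TfH: "T N u (pure_tensor N (f p)) \<in> H" if "p \<in> {..<k}" for p
    by (rule T_pure_H, rule f) (use that in auto)
  have TgH: "T N (- cnj u) (pure_tensor N (g p)) \<in> H" if "p \<in> {..<k'}" for p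
    by (rule T_pure_H, rule g) (use that in auto)
  have "form_H G (T N u F) = (\<Sum>p<k. form_H G (T N u (pure_tensor N (f p))))"
    unfolding TF by (rule form_H_sum_1(2)[OF G TfH])
  also have "\<dots> = (\<Sum>p<k. \<Sum>q<k'. form_H (pure_tensor N (g q)) (T N u (pure_tensor N (f p))))"
    unfolding G' by (intro sum.cong refl form_H_sum_1(1)[OF TfH gH])
  also have "\<dots> = (\<Sum>p<k. \<Sum>q<k'. form_H (T N (- cnj u) (pure_tensor N (g q))) (pure_tensor N (f p)))"
    by (intro sum.cong refl T_adjoint_pure) (use f g in simp_all)
  also have "\<dots> = (\<Sum>p<k. form_H (T N (- cnj u) G) (pure_tensor N (f p)))"
    unfolding TG by (intro sum.cong refl form_H_sum_1(1)[OF fH TgH, symmetric])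
  also have "\<dots> = form_H (T N (- cnj u) G) F"
    unfolding F' by (rule form_H_sum_1(2)[OF T_H[OF G] fH, symmetric])
  finally show ?thesis .
qed

end

section \<open>The operator $Q_L$\<close>

context sklyanin_QF
begin

abbreviation "C \<equiv> C_space l N"
abbreviation "QL u \<equiv> Q_L \<tau> \<eta> l N r lam0 v t u"

definition unit_vec :: "(nat \<Rightarrow> nat) \<Rightarrow> (nat \<Rightarrow> nat) \<Rightarrow> complex" where
  "unit_vec k = (\<lambda>k'. if k' = k then 1 else 0)"

abbreviation "QK u k \<equiv> QR u (unit_vec k)"

lemma unit_vec_C: "k \<in> K \<Longrightarrow> unit_vec k \<in> C"
  by (auto simp: unit_vec_def C_space_def)

lemma C_form_unit_vec: "k \<in> K \<Longrightarrow> C_form l N (unit_vec k) d = d k"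
proof -
  assume k: "k \<in> K"
  have "C_form l N (unit_vec k) d = (\<Sum>k'\<in>K. if k' = k then d k' else 0)"
    unfolding C_form_def unit_vec_def by (intro sum.cong) auto
  then show ?thesis using k finite_K by (simp add: sum.delta)
qed

lemma QK_eq: "k \<in> K \<Longrightarrow> QK u k = (\<lambda>z. \<Sum>i\<in>walks. 1 * pure_tensor N (chain u i k) z)"
proof
  fix z assume k: "k \<in> K"
  have "QK u k z = (\<Sum>k'\<in>K. \<Sum>i\<in>walks. unit_vec k k' * pure_tensor N (chain u i k') z)"
    unfolding QR_eq by (simp add: sum.cartesian_product split_def)
  also have "\<dots> = (\<Sum>k'\<in>K. if k' = k then \<Sum>i\<in>walks. 1 * pure_tensor N (chain u i k') z else 0)"
    by (intro sum.cong) (auto simp: unit_vec_def)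
  finally show "QK u k z = (\<Sum>i\<in>walks. 1 * pure_tensor N (chain u i k) z)"
    using k finite_K by (simp add: sum.delta)
qed

lemma QR_expand: "QR u c = (\<lambda>z. \<Sum>k\<in>K. c k * QK u k z)"
proof
  fix z
  have "QR u c z = (\<Sum>k\<in>K. c k * (\<Sum>i\<in>walks. 1 * pure_tensor N (chain u i k) z))"
    unfolding QR_eq by (simp add: sum.cartesian_product split_def sum_distrib_left)
  then show "QR u c z = (\<Sum>k\<in>K. c k * QK u k z)" by (simp add: QK_eq)
qed

text \<open>The candidate for the adjoint: its components are the scalar products with the images of the basis vectors.\<close>

definition QLF :: "complex \<Rightarrow> mfun \<Rightarrow> (nat \<Rightarrow> nat) \<Rightarrow> complex" where
  "QLF u = restrict (\<lambda>F k. if k \<in> K then form_H (QK (- cnj u) k) F else 0) H"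

lemma QLF_pairing:
  assumes F: "F \<in> H"
  shows "form_H (QR (- cnj u) c) F = C_form l N c (QLF u F)"
proof -
  have "form_H (\<lambda>z. \<Sum>k\<in>K. c k * QK (- cnj u) k z) F = (\<Sum>k\<in>K. cnj (c k) * form_H (QK (- cnj u) k) F)"
    by (rule form_H_sum(1)[OF F QR_H])
  then show ?thesis unfolding QR_expand[of _ c] C_form_def using F by (simp add: QLF_def)
qed

lemma QL_eq: "QL u = QLF u"
  unfolding Q_L_def hermitian_adjoint_def
proof (rule the_equality, intro conjI ballI)
  show "QLF u \<in> H \<rightarrow>\<^sub>E C" by (auto simp: QLF_def C_space_def)
  show "form_H (QR (- cnj u) c) F = C_form l N c (QLF u F)" if "F \<in> H" for c F
    by (rule QLF_pairing[OF that])
next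
  fix B
  assume B: "B \<in> H \<rightarrow>\<^sub>E C \<and> (\<forall>x\<in>C. \<forall>y\<in>H. form_H (QR (- cnj u) x) y = C_form l N x (B y))"
  show "B = QLF u"
  proof
    fix F
    show "B F = QLF u F"
    proof (cases "F \<in> H")
      case True
      have "B F k = QLF u F k" for k
      proof (cases "k \<in> K")
        case k: True
        have "form_H (QK (- cnj u) k) F = C_form l N (unit_vec k) (B F)"
          using B unit_vec_C[OF k] True by blast
        then show ?thesis using k True by (simp add: C_form_unit_vec QLF_def)
      next
        case False
        have "B F \<in> C" using B True by blast
        then show ?thesis using False True by (simp add: C_space_def QLF_def)
      qed
      then show ?thesis by blast
    next
      case False
      then show ?thesis using B by (auto simp: QLF_def PiE_def extensional_def)
    qed
  qed
qed

lemma QL_apply: "F \<in> H \<Longrightarrow> QL u F = (\<lambda>k. if k \<in> K then form_H (QK (- cnj u) k) F else 0)"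
  unfolding QL_eq QLF_def by simp

lemma cnj_h: "cnj (h_minus \<tau> \<eta> l N (- cnj u)) = hp u" "cnj (h_plus \<tau> \<eta> l N (- cnj u)) = hm u"
proof -
  have a: "t11 (- u + 2 * l * \<eta>) = - t11 (u - 2 * l * \<eta>)" "t11 (- u - 2 * l * \<eta>) = - t11 (u + 2 * l * \<eta>)"
    using odd_t11[of "u - 2 * l * \<eta>"] odd_t11[of "u + 2 * l * \<eta>"] by simp_all
  have "cnj (2 * t11 (- cnj u + 2 * l * \<eta>)) = 2 * t11 (- u + 2 * l * \<eta>)"
    "cnj (2 * t11 (- cnj u - 2 * l * \<eta>)) = 2 * t11 (- u - 2 * l * \<eta>)"
    by (simp_all add: cnj_t11)
  then show "cnj (h_minus \<tau> \<eta> l N (- cnj u)) = hp u" "cnj (h_plus \<tau> \<eta> l N (- cnj u)) = hm u"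
    unfolding h_minus_def h_plus_def complex_cnj_power a using N_even by simp_all
qed

theorem QL_T:
  assumes F: "F \<in> H"
  shows "QL u (T N u F) = (\<lambda>k. hm u * QL (u - 2 * \<eta>) F k + hp u * QL (u + 2 * \<eta>) F k)"
proof
  fix k
  let ?w = "- cnj u"
  have w: "?w - 2 * \<eta> = - cnj (u + 2 * \<eta>)" "?w + 2 * \<eta> = - cnj (u - 2 * \<eta>)" by simp_all
  have "form_H (QK ?w k) (T N u F) = form_H (\<lambda>z. hm ?w * QK (?w - 2 * \<eta>) k z + (hp ?w * QK (?w + 2 * \<eta>) k z)) F"
    unfolding T_adjoint[OF F QR_H] TQ_R ..
  also have "\<dots> = cnj (hm ?w) * form_H (QK (?w - 2 * \<eta>) k) F + form_H (\<lambda>z. hp ?w * QK (?w + 2 * \<eta>) k z) F"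
    by (rule sesquilinear_D[OF form_H_sesquilinear QR_H H_scale[OF N_pos QR_H] F, THEN conjunct1])
  also have "form_H (\<lambda>z. hp ?w * QK (?w + 2 * \<eta>) k z) F = cnj (hp ?w) * form_H (QK (?w + 2 * \<eta>) k) F"
    by (rule form_H_scale(2)[OF F QR_H])
  finally show "QL u (T N u F) k = hm u * QL (u - 2 * \<eta>) F k + hp u * QL (u + 2 * \<eta>) F k"
    unfolding QL_apply[OF F] QL_apply[OF T_H[OF F]] cnj_h w by simp
qed

subsection \<open>The symmetries\<close>

text \<open>The square of the operator on one slot is \<open>exp (2 * pi * \<i> * l) = \<plusminus> 1\<close>. On an even number of slots its tensor power is a unitary involution, hence self-adjoint.\<close>

lemma UT_selfadjoint:
  assumes lin: "linear_over V A" and AV: "\<And>f. f \<in> V \<Longrightarrow> A f \<in> V"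
    and unitary: "\<And>f g. f \<in> V \<Longrightarrow> g \<in> V \<Longrightarrow> sf (A f) (A g) = sf f g"
    and square: "\<And>f. f \<in> V \<Longrightarrow> A (A f) = (\<lambda>z. exp (2 * pi * \<i> * l) * f z)"
  shows UT_H: "F \<in> H \<Longrightarrow> UT A F \<in> H"
    and UT_square: "F \<in> H \<Longrightarrow> UT A (UT A F) = F"
    and UT_adjoint: "F \<in> H \<Longrightarrow> G \<in> H \<Longrightarrow> form_H G (UT A F) = form_H (UT A G) F"
proof -
  have rep: "\<exists>(k :: nat) f. F = (\<lambda>z. \<Sum>p<k. 1 * pure_tensor N (f p) z) \<and> (\<forall>p<k. \<forall>n\<in>{1..N}. f p n \<in> V) \<and>
      UT A F = (\<lambda>z. \<Sum>p<k. 1 * pure_tensor N (\<lambda>n. A (f p n)) z)" if "F \<in> H" for F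
  proof -
    obtain k :: nat and f where F: "F = (\<lambda>z. \<Sum>p<k. 1 * pure_tensor N (f p) z)" and f: "\<And>p n. p < k \<Longrightarrow> n \<in> {1..N} \<Longrightarrow> f p n \<in> V"
      using H_sum_of_pure[OF \<open>F \<in> H\<close>] by blast
    have "UT A F = (\<lambda>z. \<Sum>p<k. 1 * pure_tensor N (\<lambda>n. A (f p n)) z)"
      unfolding F by (rule tensor_power_eq[OF _ lin]) (use f in simp)
    then show ?thesis using F f by blast
  qed
  have H: "UT A F \<in> H" if "F \<in> H" for F
  proof -
    obtain k :: nat and f where f: "\<forall>p<k. \<forall>n\<in>{1..N}. f p n \<in> V" and U: "UT A F = (\<lambda>z. \<Sum>p<k. 1 * pure_tensor N (\<lambda>n. A (f p n)) z)"
      using rep[OF \<open>F \<in> H\<close>] by blast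
    show ?thesis unfolding U by (rule H_sum[OF N_pos], rule H_pure, rule AV) (use f in blast)
  qed
  have sq: "UT A (UT A F) = F" if "F \<in> H" for F
  proof -
    obtain k :: nat and f where F: "F = (\<lambda>z. \<Sum>p<k. 1 * pure_tensor N (f p) z)" and f: "\<forall>p<k. \<forall>n\<in>{1..N}. f p n \<in> V"
      and U: "UT A F = (\<lambda>z. \<Sum>p<k. 1 * pure_tensor N (\<lambda>n. A (f p n)) z)"
      using rep[OF \<open>F \<in> H\<close>] by blast
    have c: "exp (2 * pi * \<i> * l) ^ N = 1"
    proof -
      obtain m where m: "N = 2 * m" using N_even by blast
      have "exp (2 * pi * \<i> * l) ^ N = exp (2 * pi * \<i> * of_int (int (n2 * m)))"
        unfolding exp_of_nat_mult[symmetric] m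
        by (rule arg_cong[where f = exp]) (simp add: n2_complex)
      then show ?thesis by (simp only: exp_two_pi_int)
    qed
    have "UT A (UT A F) = (\<lambda>z. \<Sum>p<k. 1 * pure_tensor N (\<lambda>n. A (A (f p n))) z)"
      unfolding U by (rule tensor_power_eq[OF AV lin]) (use f in simp)
    also have "\<dots> = F" unfolding F
    proof (intro ext sum.cong refl arg_cong2[where f = "(*)"])
      fix z p assume "p \<in> {..<k}"
      then have "pure_tensor N (\<lambda>n. A (A (f p n))) z = (\<Prod>n=1..N. exp (2 * pi * \<i> * l) * f p n (z n))"
        unfolding pure_tensor_def by (intro prod.cong refl) (use square f in simp)
      also have "\<dots> = exp (2 * pi * \<i> * l) ^ N * pure_tensor N (f p) z"
        by (simp add: prod.distrib pure_tensor_def)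
      finally show "pure_tensor N (\<lambda>n. A (A (f p n))) z = pure_tensor N (f p) z" unfolding c by simp
    qed
    finally show ?thesis .
  qed
  have un: "form_H (UT A G) (UT A F) = form_H G F" if "F \<in> H" "G \<in> H" for F G
  proof -
    obtain k :: nat and f where F: "F = (\<lambda>z. \<Sum>p<k. 1 * pure_tensor N (f p) z)" and f: "\<forall>p<k. \<forall>n\<in>{1..N}. f p n \<in> V"
      and U: "UT A F = (\<lambda>z. \<Sum>p<k. 1 * pure_tensor N (\<lambda>n. A (f p n)) z)"
      using rep[OF \<open>F \<in> H\<close>] by blast
    obtain k' :: nat and g where G: "G = (\<lambda>z. \<Sum>p<k'. 1 * pure_tensor N (g p) z)" and g: "\<forall>p<k'. \<forall>n\<in>{1..N}. g p n \<in> V"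
      and UG: "UT A G = (\<lambda>z. \<Sum>p<k'. 1 * pure_tensor N (\<lambda>n. A (g p n)) z)"
      using rep[OF \<open>G \<in> H\<close>] by blast
    have fH: "pure_tensor N (f p) \<in> H" if "p \<in> {..<k}" for p
      by (rule H_pure) (use f that in simp)
    have gH: "pure_tensor N (g p) \<in> H" if "p \<in> {..<k'}" for p
      by (rule H_pure) (use g that in simp)
    have AfH: "pure_tensor N (\<lambda>n. A (f p n)) \<in> H" if "p \<in> {..<k}" for p
      by (rule H_pure, rule AV) (use f that in simp)
    have AgH: "pure_tensor N (\<lambda>n. A (g p n)) \<in> H" if "p \<in> {..<k'}" for p
      by (rule H_pure, rule AV) (use g that in simp)
    have "form_H (UT A G) (UT A F) = (\<Sum>p<k. form_H (UT A G) (pure_tensor N (\<lambda>n. A (f p n))))"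
      unfolding U by (rule form_H_sum_1(2)[OF H[OF that(2)] AfH])
    also have "\<dots> = (\<Sum>p<k. \<Sum>q<k'. form_H (pure_tensor N (\<lambda>n. A (g q n))) (pure_tensor N (\<lambda>n. A (f p n))))"
      unfolding UG by (rule sum.cong[OF refl], rule form_H_sum_1(1)[OF AfH AgH])
    also have "\<dots> = (\<Sum>p<k. \<Sum>q<k'. form_H (pure_tensor N (g q)) (pure_tensor N (f p)))"
    proof (rule sum.cong[OF refl], rule sum.cong[OF refl])
      fix p q assume "p \<in> {..<k}" "q \<in> {..<k'}"
      then have fp: "\<And>n. n \<in> {1..N} \<Longrightarrow> f p n \<in> V" and gq: "\<And>n. n \<in> {1..N} \<Longrightarrow> g q n \<in> V" using f g by auto
      have "form_H (pure_tensor N (\<lambda>n. A (g q n))) (pure_tensor N (\<lambda>n. A (f p n))) = (\<Prod>n=1..N. sf (A (g q n)) (A (f p n)))"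
        by (rule form_H_pure[where f = "\<lambda>n. A (g q n)" and g = "\<lambda>n. A (f p n)"]) (use AV fp gq in blast)+
      also have "\<dots> = (\<Prod>n=1..N. sf (g q n) (f p n))" by (rule prod.cong[OF refl]) (use unitary fp gq in blast)
      also have "\<dots> = form_H (pure_tensor N (g q)) (pure_tensor N (f p))"
        by (rule form_H_pure[symmetric]) (use fp gq in blast)+
      finally show "form_H (pure_tensor N (\<lambda>n. A (g q n))) (pure_tensor N (\<lambda>n. A (f p n))) = form_H (pure_tensor N (g q)) (pure_tensor N (f p))" .
    qed
    also have "\<dots> = (\<Sum>p<k. form_H G (pure_tensor N (f p)))"
      unfolding G by (rule sum.cong[OF refl], rule form_H_sum_1(1)[OF fH gH, symmetric])
    also have "\<dots> = form_H G F"
      unfolding F by (rule form_H_sum_1(2)[OF that(2) fH, symmetric])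
    finally show ?thesis .
  qed
  show "F \<in> H \<Longrightarrow> UT A F \<in> H" by (rule H)
  show "F \<in> H \<Longrightarrow> UT A (UT A F) = F" by (rule sq)
  show "form_H G (UT A F) = form_H (UT A G) F" if "F \<in> H" "G \<in> H"
    using un[OF H[OF that(1)] that(2)] unfolding sq[OF that(1)] ..
qed

lemma UT1:
  shows "F \<in> H \<Longrightarrow> UT (U1 l) F \<in> H" "F \<in> H \<Longrightarrow> UT (U1 l) (UT (U1 l) F) = F"
    "F \<in> H \<Longrightarrow> G \<in> H \<Longrightarrow> form_H G (UT (U1 l) F) = form_H (UT (U1 l) G) F"
  by (rule UT_selfadjoint; (rule linear_over_U U1_V U1_unitary U1_square | assumption)+)+

lemma UT3:
  shows "F \<in> H \<Longrightarrow> UT (U3 \<tau> l) F \<in> H" "F \<in> H \<Longrightarrow> UT (U3 \<tau> l) (UT (U3 \<tau> l) F) = F"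
    "F \<in> H \<Longrightarrow> G \<in> H \<Longrightarrow> form_H G (UT (U3 \<tau> l) F) = form_H (UT (U3 \<tau> l) G) F"
  by (rule UT_selfadjoint; (rule linear_over_U U3_V U3_unitary U3_square | assumption)+)+

lemma exp_2Nl: "exp (2 * of_nat N * l * pi * \<i>) = 1"
proof -
  obtain m where m: "N = 2 * m" using N_even by blast
  have "exp (2 * of_nat N * l * pi * \<i>) = exp (2 * pi * \<i> * of_int (int (n2 * m)))"
    unfolding m by (rule arg_cong[where f = exp]) (simp add: n2_complex)
  then show ?thesis by (simp only: exp_two_pi_int)
qed

lemma e1_square: "e1 * e1 = 1"
proof -
  have "e1 * e1 = inverse (exp (2 * of_nat N * l * pi * \<i>))"
    unfolding exp_minus[symmetric] exp_add[symmetric] by (rule arg_cong[where f = exp]) simp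
  then show ?thesis unfolding exp_2Nl by simp
qed

text \<open>Applying the involution \<open>U1\<close> twice moves \<open>u\<close> by \<open>2\<close>. This is needed because the adjoint of a shift by \<open>1\<close> is a shift by \<open>- 1\<close>.\<close>

lemma QR_add_2: "QR (u + 2) c = QR u c"
proof -
  have U: "UT (U1 l) (\<lambda>z. e1 * QR (u + 1) c z) = (\<lambda>z. e1 * UT (U1 l) (QR (u + 1) c) z)"
  proof -
    have "UT (U1 l) (QR (u + 1) (\<lambda>k. e1 * c k + 0)) = (\<lambda>z. e1 * QR (u + 1 + 1) (\<lambda>k. e1 * c k + 0) z)"
      by (rule U1_QR)
    moreover have q: "QR w (\<lambda>k. e1 * c k + 0) = (\<lambda>z. e1 * QR w c z)" for w
      unfolding QR_linear by (simp add: QR_eq)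
    ultimately show ?thesis unfolding q U1_QR[of "u + 1"] by simp
  qed
  have "QR u c = UT (U1 l) (UT (U1 l) (QR u c))" by (rule UT1(2)[OF QR_H, symmetric])
  also have "\<dots> = (\<lambda>z. (e1 * e1) * QR (u + 1 + 1) c z)"
    unfolding U1_QR[of u] U U1_QR by (simp only: mult.assoc)
  finally show ?thesis unfolding e1_square by (simp add: add.assoc)
qed

theorem QL_U1:
  assumes F: "F \<in> H"
  shows "QL u (UT (U1 l) F) = (\<lambda>k. e1 * QL (u + 1) F k)"
proof
  fix k
  have c: "cnj e1 = e1"
  proof -
    have "e1 * cnj e1 = 1" unfolding exp_cnj exp_add[symmetric] by simp
    then have "e1 * cnj e1 = e1 * e1" unfolding e1_square .
    then show ?thesis by (simp only: mult_cancel_left) simp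
  qed
  have w: "- cnj u + 1 = - cnj (u + 1) + 2" by simp
  have "form_H (QK (- cnj u) k) (UT (U1 l) F) = form_H (\<lambda>z. e1 * QK (- cnj (u + 1)) k z) F"
    unfolding UT1(3)[OF F QR_H] U1_QR w QR_add_2 ..
  also have "\<dots> = cnj e1 * form_H (QK (- cnj (u + 1)) k) F" by (rule form_H_scale(2)[OF F QR_H])
  finally show "QL u (UT (U1 l) F) k = e1 * QL (u + 1) F k"
    unfolding QL_apply[OF F] QL_apply[OF UT1(1)[OF F]] c by simp
qed

theorem QL_U3:
  fixes r'' :: int
  assumes r'': "lam0 - v = 2 * of_int r'' * l * \<eta>" and F: "F \<in> H"
  shows "QL u (UT (U3 \<tau> l) F) = (\<lambda>k. e3 u * QL (u + \<tau>) F k)"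
proof
  fix k
  have c: "cnj (e3 (- cnj u)) = e3 u"
  proof -
    have "cnj (e3 (- cnj u)) = e3 u * exp (2 * of_nat N * l * pi * \<i>)"
      unfolding exp_cnj exp_add[symmetric]
      by (rule arg_cong[where f = exp]) (simp add: cnj_tau algebra_simps)
    then show ?thesis unfolding exp_2Nl by simp
  qed
  have w: "- cnj u + \<tau> = - cnj (u + \<tau>)" by (simp add: cnj_tau)
  have "form_H (QK (- cnj u) k) (UT (U3 \<tau> l) F) = form_H (\<lambda>z. e3 (- cnj u) * QK (- cnj (u + \<tau>)) k z) F"
    unfolding UT3(3)[OF F QR_H] U3_QR[OF r''] w ..
  also have "\<dots> = cnj (e3 (- cnj u)) * form_H (QK (- cnj (u + \<tau>)) k) F" by (rule form_H_scale(2)[OF F QR_H])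
  finally show "QL u (UT (U3 \<tau> l) F) k = e3 u * QL (u + \<tau>) F k"
    unfolding QL_apply[OF F] QL_apply[OF UT3(1)[OF F]] c by simp
qed

end

section \<open>Potentials on a cycle of even length\<close>

text \<open>The reflection \<open>m \<mapsto> - m\<close> maps the progression \<open>a + 2 * s\<close> modulo \<open>r\<close> to itself, by \<open>s \<mapsto> - a - s\<close>.\<close>

lemma prod_reflect_period:
  fixes f :: "int \<Rightarrow> complex"
  assumes r: "r > 0" and per: "\<And>m k. f (m + r * k) = f m"
  shows "(\<Prod>s\<in>{0..<r}. f (a + 2 * s)) = (\<Prod>s\<in>{0..<r}. f (- (a + 2 * s)))"
proof (rule prod.reindex_bij_witness[of _ "\<lambda>s. (- a - s) mod r" "\<lambda>s. (- a - s) mod r"])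
  fix s assume s: "s \<in> {0..<r}"
  have inv: "(- a - (- a - s) mod r) mod r = s mod r"
    by (metis add_diff_cancel_left' diff_add_cancel mod_diff_right_eq diff_diff_eq2 add.commute)
  then show "(- a - (- a - s) mod r) mod r = s" using s by simp
  then show "(- a - (- a - s) mod r) mod r = s" .
  show "(- a - s) mod r \<in> {0..<r}" "(- a - s) mod r \<in> {0..<r}" using r by simp_all
  have "(- a - s) mod r = - a - s - r * ((- a - s) div r)" by (simp add: minus_mult_div_eq_mod)
  moreover have "r * (2 * ((- a - s) div r)) = 2 * (r * ((- a - s) div r))" by simp
  ultimately have "- (a + 2 * ((- a - s) mod r)) = a + 2 * s + r * (2 * ((- a - s) div r))" by linarith
  then show "f (- (a + 2 * ((- a - s) mod r))) = f (a + 2 * s)" by (simp only: per)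
qed

text \<open>\<open>G\<close> is the partial product of the required quotients along the residues of one parity. It closes up after \<open>r\<close> steps
  because the product of all quotients is \<open>1\<close>, by \<open>prod_reflect_period\<close>.\<close>

lemma cyclic_potential:
  fixes f :: "int \<Rightarrow> complex"
  assumes r: "r > 0" and per: "\<And>m k. f (m + r * k) = f m" and nz: "\<And>m. f m \<noteq> 0"
  obtains G :: "int \<Rightarrow> complex"
  where "\<And>J. G J \<noteq> 0" "\<And>J k. G (J + 2 * r * k) = G J" "\<And>J. G (J + 2) = G J * (f (c + J) / f (- (c + J)))"
proof
  define F where "F m = f m / f (- m)" for m
  define G where "G J = (\<Prod>s\<in>{0..<(J mod (2 * r)) div 2}. F (c + J mod 2 + 2 * s))" for J
  have F_per: "F (m + r * k) = F m" for m k
  proof -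
    have "- (m + r * k) = - m + r * (- k)" by simp
    then show ?thesis unfolding F_def by (simp only: per)
  qed
  have F_nz: "F m \<noteq> 0" for m by (simp add: F_def nz)
  show "G J \<noteq> 0" for J unfolding G_def by (simp add: F_nz)
  show "G (J + 2 * r * k) = G J" for J k
  proof -
    have "(J + 2 * r * k) mod (2 * r) = J mod (2 * r)" by simp
    moreover have "(J + 2 * r * k) mod 2 = J mod 2" by (simp add: mult.assoc)
    ultimately show ?thesis unfolding G_def by (simp only:)
  qed
  show "G (J + 2) = G J * (f (c + J) / f (- (c + J)))" for J
  proof -
    define R e q where "R = J mod (2 * r)" and "e = J mod 2" and "q = R div 2"
    have R: "0 \<le> R" "R < 2 * r" using r by (auto simp: R_def)
    have e: "R mod 2 = e" by (simp add: R_def e_def mod_mod_cancel)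
    have Rq: "R = 2 * q + e" using mult_div_mod_eq[of 2 R] unfolding q_def e by simp
    have e01: "0 \<le> e" "e < 2" by (simp_all add: e_def)
    have q: "0 \<le> q" "q < r" using R Rq e01 by auto
    have J: "J = R + r * (2 * (J div (2 * r)))" 
    proof -
      have "r * (2 * (J div (2 * r))) = 2 * r * (J div (2 * r))" by simp
      then show ?thesis using mult_div_mod_eq[of "2 * r" J] unfolding R_def by linarith
    qed
    have FJ: "F (c + J) = F (c + e + 2 * q)"
    proof -
      have "c + J = c + e + 2 * q + r * (2 * (J div (2 * r)))" using J Rq by linarith
      then show ?thesis by (simp only: F_per)
    qed
    have parity: "(J + 2) mod 2 = e" by (simp add: e_def)
    have split: "(\<Prod>s\<in>{0..<q + 1}. F (c + e + 2 * s)) = G J * F (c + J)"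
    proof -
      have "{0..<q + 1} = insert q {0..<q}" using q by auto
      then show ?thesis unfolding G_def FJ R_def[symmetric] e_def[symmetric] q_def[symmetric] by (simp add: mult.commute)
    qed
    have J2: "(J + 2) mod (2 * r) = (R + 2) mod (2 * r)" unfolding R_def by (simp add: mod_add_left_eq)
    have "G (J + 2) = G J * F (c + J)"
    proof (cases "q + 1 < r")
      case True
      then have "(R + 2) mod (2 * r) = R + 2" using R Rq e01 by simp
      moreover have "(R + 2) div 2 = q + 1" by (simp add: q_def)
      ultimately have "G (J + 2) = (\<Prod>s\<in>{0..<q + 1}. F (c + e + 2 * s))"
        unfolding G_def parity J2 by simp
      then show ?thesis unfolding split .
    next
      case False
      then have qr: "q + 1 = r" using q by simp
      then have "R + 2 = e + 2 * r" using Rq by simp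
      then have "(R + 2) mod (2 * r) = e" using e01 r by (simp add: mod_pos_pos_trivial)
      then have "G (J + 2) = 1" unfolding G_def parity J2 using e01 by simp
      moreover have "(\<Prod>s\<in>{0..<r}. F (c + e + 2 * s)) = 1"
        using prod_reflect_period[OF r per, of "c + e"] nz by (simp add: F_def prod_dividef)
      ultimately show ?thesis using split unfolding qr by simp
    qed
    then show ?thesis unfolding F_def .
  qed
qed

lemma continuous_vanishing_right:
  fixes h :: "real \<Rightarrow> complex"
  assumes h: "continuous_on UNIV h" and d: "d > 0" and z: "\<And>s. 0 < s \<Longrightarrow> s < d \<Longrightarrow> h s = 0"
  shows "h 0 = 0"
proof (rule tendsto_unique[of "at_right (0 :: real)"])
  have "isCont h 0" using h by (simp add: continuous_on_eq_continuous_at)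
  then show "(h \<longlongrightarrow> h 0) (at_right 0)"
    unfolding isCont_def by (rule filterlim_mono[OF _ order_refl at_le]) simp
  have "eventually (\<lambda>s. h s = 0) (at_right 0)"
    using eventually_at_right_less[of 0] eventually_at_right_real[OF d] by eventually_elim (use z in auto)
  then show "(h \<longlongrightarrow> 0) (at_right 0)" by (rule tendsto_eventually)
qed simp

section \<open>Symmetry of $Q_L Q_R$\<close>

context sklyanin_form_loc
begin

text \<open>In these variables the recursion involves one variable at a time, and the symmetries of \<open>Phi\<close> become symmetry and evenness.\<close>

definition Psi :: "complex \<Rightarrow> complex \<Rightarrow> complex" where
  "Psi x y = Phi ((x + y) / 2) ((x - y) / 2)"

lemma Phi_Psi: "Phi p q = Psi (p + q) (p - q)"
  by (simp add: Psi_def)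

lemma Psi_swap: "Psi x y = Psi y x"
  using Phi_minus[of "(x + y) / 2" "(x - y) / 2"] by (simp add: Psi_def add.commute minus_divide_left)

lemma Psi_minus: "Psi (- x) y = Psi x y"
proof -
  have "Psi (- x) y = Phi (- ((x - y) / 2)) (- ((x + y) / 2))" by (simp add: Psi_def minus_divide_left)
  also have "\<dots> = Phi ((x + y) / 2) ((x - y) / 2)" by (metis Phi_minus Phi_sym)
  finally show ?thesis by (simp add: Psi_def)
qed

text \<open>The solution of the first-order difference equation that \<open>\<lambda>x. Psi x y\<close> satisfies, for all \<open>y\<close> at once.\<close>

definition Psi_weight :: "complex \<Rightarrow> complex" where "Psi_weight = theta_string (n2 - 1)"

definition generic :: "complex \<Rightarrow> bool" where
  "generic x \<longleftrightarrow> (\<forall>n :: int. Im x \<noteq> (of_int n + 1/2) * Im \<tau>)"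

lemma generic_add_real: "generic x \<Longrightarrow> Im y = 0 \<Longrightarrow> generic (x + y)"
  by (simp add: generic_def)

lemma t00_generic: "generic x \<Longrightarrow> t00 x \<noteq> 0"
  unfolding generic_def by (rule t00_nonzero_Im) blast

lemma Psi_weight_nonzero: "generic x \<Longrightarrow> Psi_weight x \<noteq> 0"
  unfolding Psi_weight_def theta_string_def by (auto intro!: t00_generic generic_add_real)

lemma Psi_step:
  assumes x: "generic x"
  shows "Psi_weight x * Psi (x + 2 * \<eta>) y = Psi_weight (x + 2 * \<eta>) * Psi x y"
proof -
  define w where "w = x + \<eta>"
  have w: "w - \<eta> = x" "w + \<eta> = x + 2 * \<eta>" by (simp_all add: w_def)
  have n2: "Suc (n2 - 1) = n2" "real n2 = 2 * l" using n2 l_pos by (cases n2; simp)+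
  have f: "Psi_weight (w - \<eta>) * t00 (w + 2 * l * \<eta>) = t00 (w - 2 * l * \<eta>) * Psi_weight (w + \<eta>)"
    using theta_string_Suc[of "n2 - 1" w] unfolding n2 Psi_weight_def by simp
  have p: "t00 (w + 2 * l * \<eta>) * Psi (w - \<eta>) y = t00 (w - 2 * l * \<eta>) * Psi (w + \<eta>) y"
  proof -
    define p q :: complex where "p = (w + y + \<eta>) / 2" and "q = (y - w + \<eta>) / 2"
    have a: "p - q = w" "q - p = - w" by (simp_all add: p_def q_def field_simps)
    have b: "p - \<eta> + q = y" "p - \<eta> - q = w - \<eta>" "p + (q - \<eta>) = y" "p - (q - \<eta>) = w + \<eta>"
      by (simp_all add: p_def q_def field_simps)
    have "t00 (- w + 2 * l * \<eta>) = t00 (w - 2 * l * \<eta>)"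
      using theta_minus[of 0 0 "w - 2 * l * \<eta>" \<tau>] by simp
    then show ?thesis
      using Phi_recursion[of p q] unfolding Phi_Psi b a Psi_swap[of y] by simp
  qed
  have nz: "t00 (w - 2 * l * \<eta>) \<noteq> 0"
  proof -
    have e: "w - 2 * l * \<eta> = x + complex_of_real (\<eta> - 2 * l * \<eta>)" by (simp add: w_def)
    show ?thesis unfolding e by (rule t00_generic[OF generic_add_real[OF x]]) simp
  qed
  have "t00 (w - 2 * l * \<eta>) * (Psi_weight (w - \<eta>) * Psi (w + \<eta>) y) = Psi_weight (w - \<eta>) * (t00 (w - 2 * l * \<eta>) * Psi (w + \<eta>) y)"
    by (simp only: mult_ac)
  also have "\<dots> = (Psi_weight (w - \<eta>) * t00 (w + 2 * l * \<eta>)) * Psi (w - \<eta>) y" unfolding p[symmetric] by (simp only: mult_ac)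
  also have "\<dots> = t00 (w - 2 * l * \<eta>) * (Psi_weight (w + \<eta>) * Psi (w - \<eta>) y)" unfolding f by (simp only: mult_ac)
  finally show ?thesis using nz unfolding w by (simp only: mult_cancel_left) simp
qed

text \<open>\<open>Psi\<close> and \<open>Psi_weight\<close> satisfy the same difference equation in \<open>x\<close>. On a line where no theta function vanishes, their quotient has period \<open>2 * \<eta>\<close>.\<close>

lemma Psi_steps:
  assumes x: "generic x"
  shows "Psi_weight x * Psi (x + 2 * of_int n * \<eta>) y = Psi_weight (x + 2 * of_int n * \<eta>) * Psi x y"
proof -
  have nat: "Psi_weight x * Psi (x + 2 * of_nat n * \<eta>) y = Psi_weight (x + 2 * of_nat n * \<eta>) * Psi x y" if "generic x" for n :: nat and x
  proof (induction n)
    case (Suc n)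
    let ?x = "x + 2 * of_nat n * \<eta>"
    have g: "generic ?x" using generic_add_real[OF that, of "complex_of_real (2 * real n * \<eta>)"] by simp
    have s: "x + 2 * of_nat (Suc n) * \<eta> = ?x + 2 * \<eta>" by (simp add: algebra_simps)
    have "Psi_weight ?x * (Psi_weight x * Psi (?x + 2 * \<eta>) y) = Psi_weight x * (Psi_weight ?x * Psi (?x + 2 * \<eta>) y)" by (simp only: mult_ac)
    also have "\<dots> = Psi_weight (?x + 2 * \<eta>) * (Psi_weight x * Psi ?x y)" unfolding Psi_step[OF g] by (simp only: mult_ac)
    also have "\<dots> = Psi_weight ?x * (Psi_weight (?x + 2 * \<eta>) * Psi x y)" unfolding Suc.IH by (simp only: mult_ac)
    finally show ?case unfolding s using Psi_weight_nonzero[OF g] by (simp only: mult_cancel_left) simp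
  qed simp
  show ?thesis
  proof (cases "n \<ge> 0")
    case True
    then show ?thesis using nat[OF x, of "nat n"] by simp
  next
    case False
    let ?x = "x + 2 * of_int n * \<eta>"
    have g: "generic ?x" using generic_add_real[OF x, of "complex_of_real (2 * real_of_int n * \<eta>)"] by simp
    have e: "?x + 2 * of_nat (nat (- n)) * \<eta> = x" using False by simp
    show ?thesis using nat[OF g, of "nat (- n)"] unfolding e by (simp only: mult.commute)
  qed
qed

lemma Phi_continuous: "continuous_on UNIV (\<lambda>q. Phi p q)"
proof -
  have c: "continuous_on UNIV (\<lambda>(q, z). pairing_density (\<lambda>w. om p w * t11 (2 * w)) (\<lambda>z. om q z * t11 (2 * z)) z)"
    unfolding pairing_density_def split_def om_prod[of "fst _"]
    using den_nonzero
    by (intro continuous_intros continuous_compose_holo[OF theta_string_holo] continuous_compose_holo[OF om_holo]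
        continuous_compose_holo[OF holo_theta]) auto
  show ?thesis unfolding Phi_JJ pairing_def using double_integral_continuous_param[OF c] .
qed

end

context sklyanin_QF
begin

definition pair_factor :: "(nat \<Rightarrow> nat) \<Rightarrow> (nat \<Rightarrow> nat) \<Rightarrow> (nat \<Rightarrow> nat) \<Rightarrow> (nat \<Rightarrow> nat) \<Rightarrow> nat \<Rightarrow> complex \<Rightarrow> complex \<Rightarrow> complex" where
  "pair_factor k i k' i' n u u' = sf (chain (- cnj u) i k n) (chain u' i' k' n)"

lemma QK_QK:
  assumes "k \<in> K" "k' \<in> K"
  shows "form_H (QK (- cnj u) k) (QK u' k') = (\<Sum>i\<in>walks. \<Sum>i'\<in>walks. \<Prod>n=1..N. pair_factor k i k' i' n u u')"
proof -
  have H: "pure_tensor N (chain w i k) \<in> H" for w i k by (rule H_pure) (rule chain_V)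
  have "form_H (QK (- cnj u) k) (QK u' k') = (\<Sum>i\<in>walks. form_H (pure_tensor N (chain (- cnj u) i k)) (QK u' k'))"
    unfolding QK_eq[OF assms(1)] by (rule form_H_sum_1(1)[OF QR_H H])
  also have "\<dots> = (\<Sum>i\<in>walks. \<Sum>i'\<in>walks. form_H (pure_tensor N (chain (- cnj u) i k)) (pure_tensor N (chain u' i' k')))"
    unfolding QK_eq[OF assms(2)] by (rule sum.cong[OF refl], rule form_H_sum_1(2)[OF H H])
  also have "\<dots> = (\<Sum>i\<in>walks. \<Sum>i'\<in>walks. \<Prod>n=1..N. pair_factor k i k' i' n u u')"
    unfolding pair_factor_def by (intro sum.cong refl form_H_pure chain_V)
  finally show ?thesis .
qed

definition step_in :: "bool \<Rightarrow> nat \<Rightarrow> nat \<Rightarrow> bool" where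
  "step_in b i j \<longleftrightarrow> (if b then step_up i j else step_down i j)"

lemma S_dir: "step_in b i j \<Longrightarrow> S u i j k = (\<lambda>z. t k j * om (centre b u j) z)"
  by (cases b) (simp_all add: step_in_def S_up S_down)

lemma not_dir: "(\<And>b. \<not> step_in b i j) \<Longrightarrow> S u i j k = (\<lambda>z. 0)"
  using S_none[of i j u k] by (metis step_in_def)

definition step_in_sign :: "bool \<Rightarrow> int" where "step_in_sign b = (if b then 1 else - 1)"

lemma step_in_cong: "step_in b i j \<Longrightarrow> [int i = int j + step_in_sign b] (mod (2 * int r))"
  by (cases b) (auto simp: step_in_def step_up_def step_down_def step_in_sign_def)

lemma pair_factor_none:
  assumes "(\<forall>b. \<not> step_in b (i n) (i (pr n))) \<or> (\<forall>b. \<not> step_in b (i' n) (i' (pr n)))"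
  shows "pair_factor k i k' i' n u u' = 0"
proof -
  have z: "sf (\<lambda>z. 0) g = 0" "sf g (\<lambda>z. 0) = 0" if "g \<in> V" for g
    using sf_sum_left[OF that, of "{}"] sf_sum_right[OF that, of "{}"] by simp_all
  from assms show ?thesis unfolding pair_factor_def
  proof
    assume "\<forall>b. \<not> step_in b (i n) (i (pr n))"
    then have "chain (- cnj u) i k n = (\<lambda>z. 0)" unfolding chain_def by (intro not_dir) blast
    then show "sf (chain (- cnj u) i k n) (chain u' i' k' n) = 0" using z(1)[OF chain_V] by simp
  next
    assume "\<forall>b. \<not> step_in b (i' n) (i' (pr n))"
    then have "chain u' i' k' n = (\<lambda>z. 0)" unfolding chain_def by (intro not_dir) blast
    then show "sf (chain (- cnj u) i k n) (chain u' i' k' n) = 0" using z(2)[OF chain_V] by simp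
  qed
qed

lemma pair_factor_Phi:
  assumes "step_in b (i n) (i (pr n))" "step_in b' (i' n) (i' (pr n))"
  shows "pair_factor k i k' i' n u u' = cnj (t (k n) (i (pr n))) * t (k' n) (i' (pr n)) *
    Phi (cnj (centre b (- cnj u) (i (pr n)))) (centre b' u' (i' (pr n)))"
proof -
  have "sf (\<lambda>z. c * om p z) (\<lambda>z. d * om q z) = cnj c * d * sf (om p) (om q)" for c d p q
    using sf_sum_left[of "\<lambda>z. d * om q z" "{()}" "\<lambda>_. om p" "\<lambda>_. c"] sf_sum_right[of "om p" "{()}" "\<lambda>_. om q" "\<lambda>_. d"]
    by (simp add: om_V V_scale)
  then show ?thesis unfolding pair_factor_def chain_def S_dir[OF assms(1)] S_dir[OF assms(2)] Phi_def by simp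
qed

lemma pair_factor_continuous:
  "continuous_on UNIV (\<lambda>u'. pair_factor k i k' i' n u u')" "continuous_on UNIV (\<lambda>u. pair_factor k i k' i' n u u')"
proof -
  have "continuous_on UNIV (\<lambda>u'. pair_factor k i k' i' n u u') \<and> continuous_on UNIV (\<lambda>u. pair_factor k i k' i' n u u')"
  proof (cases "(\<exists>b. step_in b (i n) (i (pr n))) \<and> (\<exists>b. step_in b (i' n) (i' (pr n)))")
    case True
    then obtain b b' where d: "step_in b (i n) (i (pr n))" "step_in b' (i' n) (i' (pr n))" by blast
    have c: "continuous_on UNIV (\<lambda>w. Phi p (g w))" if "continuous_on UNIV g" for p and g :: "complex \<Rightarrow> complex"
      by (rule continuous_on_compose2[OF Phi_continuous that]) simp
    have c': "continuous_on UNIV (\<lambda>w. Phi (g w) p)" if "continuous_on UNIV g" for p and g :: "complex \<Rightarrow> complex"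
      using c[OF that, of p] unfolding Phi_sym[of p] .
    have g: "continuous_on UNIV (\<lambda>w. centre b w j)" "continuous_on UNIV (\<lambda>w. cnj (centre b (- cnj w) j))" for b j
      unfolding centre_def by (cases b; simp; intro continuous_intros)+
    show ?thesis unfolding pair_factor_Phi[where i = i and i' = i', OF d]
      by (intro conjI continuous_intros c[OF g(1)] c'[OF g(2)])
  next
    case False
    then have "pair_factor k i k' i' n u u' = 0" for u u' by (intro pair_factor_none) blast
    then show ?thesis by simp
  qed
  then show "continuous_on UNIV (\<lambda>u'. pair_factor k i k' i' n u u')" "continuous_on UNIV (\<lambda>u. pair_factor k i k' i' n u u')" by auto
qed

lemma Psi_weight_of_int: "Psi_weight (x + of_int k) = Psi_weight x"
  unfolding Psi_weight_def using periodic_of_int[of "theta_string (n2 - 1)" 1 x k] theta_string_1 by simp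

definition Psi_weight_at :: "complex \<Rightarrow> int \<Rightarrow> complex" where
  "Psi_weight_at \<delta> m = Psi_weight (2 * complex_of_int m * l * \<eta> + \<delta>)"

lemma Psi_weight_at_periodic: "Psi_weight_at \<delta> (m + int r * k) = Psi_weight_at \<delta> m"
proof -
  have "2 * complex_of_int (int r * k) * l * \<eta> = of_int k * complex_of_real (2 * l * real r * \<eta>)" by simp
  then have "2 * complex_of_int (m + int r * k) * l * \<eta> + \<delta> = (2 * complex_of_int m * l * \<eta> + \<delta>) + complex_of_int (r' * k)"
    unfolding eta_r by (simp add: algebra_simps)
  then show ?thesis unfolding Psi_weight_at_def by (simp only: Psi_weight_of_int)
qed

lemma Psi_weight_at_nonzero: "generic \<delta> \<Longrightarrow> Psi_weight_at \<delta> m \<noteq> 0"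
  unfolding Psi_weight_at_def using Psi_weight_nonzero[OF generic_add_real[of \<delta> "complex_of_real (2 * real_of_int m * l * \<eta>)"]]
  by (simp add: add.commute)

text \<open>In terms of \<open>Psi\<close>, the exchange of \<open>u\<close> and \<open>u'\<close> moves the first variable from \<open>2 * m * l * \<eta> + \<delta>\<close> to
  \<open>2 * m * l * \<eta> - \<delta>\<close>, where \<open>\<delta> = (u' - u) / 2\<close>, and fixes the second one. As \<open>Psi\<close> is even in the first variable, this
  is a move from \<open>2 * m * l * \<eta> + \<delta>\<close> to \<open>- 2 * m * l * \<eta> + \<delta>\<close>, by a multiple of \<open>2 * \<eta>\<close>.\<close>

lemma pair_factor_exchange:
  fixes r'' :: int
  assumes r'': "lam0 - v = 2 * of_int r'' * l * \<eta>" and gen: "generic ((u' - u) / 2)"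
    and d: "step_in b (i n) (i (pr n))" "step_in b' (i' n) (i' (pr n))"
  defines "m \<equiv> step_in_sign b * (if b = b' then r'' + int (i (pr n)) + int (i' (pr n)) else int (i (pr n)) - int (i' (pr n))) + 1"
  shows "pair_factor k i k' i' n u u' = pair_factor k i k' i' n u' u * (Psi_weight_at ((u' - u) / 2) m / Psi_weight_at ((u' - u) / 2) (- m))"
proof -
  let ?j = "i (pr n)" and ?j' = "i' (pr n)" and ?\<delta> = "(u' - u) / 2" and ?X = "2 * complex_of_int m * l * \<eta>"
  have lv: "(lam0 - v) / 2 = of_int r'' * l * \<eta>" using r'' by simp
  define y where "y = complex_of_int (step_in_sign b * (r'' + 2 * int ?j) - step_in_sign b' * (r'' + 2 * int ?j')) * l * \<eta> - (u + u') / 2"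
  define c where "c = cnj (t (k n) ?j) * t (k' n) ?j'"
  have val: "pair_factor k i k' i' n u u' = c * Psi (?X + (u' - u) / 2) (complex_of_int (step_in_sign b * (r'' + 2 * int ?j) - step_in_sign b' * (r'' + 2 * int ?j')) * l * \<eta> - (u + u') / 2)" for u u'
  proof -
    have 1: "cnj (centre b (- cnj u) ?j) = complex_of_int (step_in_sign b * (r'' + 2 * int ?j)) * l * \<eta> - u / 2 + l * \<eta>"
      unfolding centre_def lv step_in_sign_def by (simp add: algebra_simps)
    have 2: "centre b' u' ?j' = complex_of_int (step_in_sign b' * (r'' + 2 * int ?j')) * l * \<eta> + u' / 2 + l * \<eta>"
      unfolding centre_def lv step_in_sign_def by (simp add: algebra_simps)
    have m2: "step_in_sign b * (r'' + 2 * int ?j) + step_in_sign b' * (r'' + 2 * int ?j') + 2 = 2 * m"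
      unfolding m_def step_in_sign_def by (cases b; cases b') (auto simp: algebra_simps)
    have "complex_of_int (step_in_sign b * (r'' + 2 * int ?j)) * l * \<eta> - u / 2 + l * \<eta> + (complex_of_int (step_in_sign b' * (r'' + 2 * int ?j')) * l * \<eta> + u' / 2 + l * \<eta>)
      = complex_of_int (step_in_sign b * (r'' + 2 * int ?j) + step_in_sign b' * (r'' + 2 * int ?j') + 2) * l * \<eta> + (u' - u) / 2"
      by (simp add: algebra_simps diff_divide_distrib)
    then have x: "cnj (centre b (- cnj u) ?j) + centre b' u' ?j' = ?X + (u' - u) / 2"
      unfolding 1 2 m2 by simp
    have y: "cnj (centre b (- cnj u) ?j) - centre b' u' ?j' = complex_of_int (step_in_sign b * (r'' + 2 * int ?j) - step_in_sign b' * (r'' + 2 * int ?j')) * l * \<eta> - (u + u') / 2"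
      unfolding 1 2 by (simp add: algebra_simps add_divide_distrib)
    show ?thesis unfolding pair_factor_Phi[where i = i and i' = i', OF d] Phi_Psi x y c_def ..
  qed
  have 1: "pair_factor k i k' i' n u u' = c * Psi (?X + ?\<delta>) y" unfolding val y_def ..
  have "?X + (u - u') / 2 = - (- ?X + ?\<delta>)" by (simp add: diff_divide_distrib)
  then have 2: "pair_factor k i k' i' n u' u = c * Psi (- ?X + ?\<delta>) y"
    unfolding val y_def by (simp only: Psi_minus add.commute[of u' u])
  have g: "generic (- ?X + ?\<delta>)"
    using generic_add_real[OF gen, of "complex_of_real (- (2 * real_of_int m * l * \<eta>))"] by (simp add: add.commute)
  have "- ?X + ?\<delta> + 2 * of_int (m * int n2) * \<eta> = ?X + ?\<delta>" by (simp add: n2_complex)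
  then have s: "Psi_weight (- ?X + ?\<delta>) * Psi (?X + ?\<delta>) y = Psi_weight (?X + ?\<delta>) * Psi (- ?X + ?\<delta>) y"
    using Psi_steps[OF g, of "m * int n2" y] by (simp only:)
  have f: "Psi_weight (- ?X + ?\<delta>) = Psi_weight_at ?\<delta> (- m)" "Psi_weight (?X + ?\<delta>) = Psi_weight_at ?\<delta> m" by (simp_all add: Psi_weight_at_def)
  show ?thesis unfolding 1 2 using s Psi_weight_at_nonzero[OF gen, of "- m"] unfolding f by (simp add: field_simps)
qed

text \<open>Two steps in the same direction change the sum of the positions of the walks by \<open>2\<close> or \<open>- 2\<close> and fix the difference; two steps in opposite directions
  do the converse. So one potential in the sum and one in the difference account for all factors in \<open>pair_factor_exchange\<close>.\<close>

lemma walk_symmetric_generic: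
  fixes r'' :: int
  assumes r'': "lam0 - v = 2 * of_int r'' * l * \<eta>" and gen: "generic ((u' - u) / 2)"
  shows "(\<Prod>n=1..N. pair_factor k i k' i' n u u') = (\<Prod>n=1..N. pair_factor k i k' i' n u' u)"
proof (cases "\<forall>n\<in>{1..N}. (\<exists>b. step_in b (i n) (i (pr n))) \<and> (\<exists>b. step_in b (i' n) (i' (pr n)))")
  case False
  then obtain n where n: "n \<in> {1..N}" "(\<forall>b. \<not> step_in b (i n) (i (pr n))) \<or> (\<forall>b. \<not> step_in b (i' n) (i' (pr n)))" by blast
  have "(\<Prod>n=1..N. pair_factor k i k' i' n u u') = 0" for u u'
  proof (rule prod_zero)
    show "\<exists>n\<in>{1..N}. pair_factor k i k' i' n u u' = 0" using pair_factor_none[where i = i and i' = i', OF n(2)] n(1) by blast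
  qed simp
  then show ?thesis by (simp only:)
next
  case True
  let ?\<delta> = "(u' - u) / 2"
  have r: "int r > 0" using r_pos by simp
  obtain A where A: "\<And>J. A J \<noteq> 0" "\<And>J k. A (J + 2 * int r * k) = A J"
      "\<And>J. A (J + 2) = A J * (Psi_weight_at ?\<delta> (r'' + 1 + J) / Psi_weight_at ?\<delta> (- (r'' + 1 + J)))"
    using cyclic_potential[OF r Psi_weight_at_periodic Psi_weight_at_nonzero[OF gen], of "r'' + 1"] by blast
  obtain B where B: "\<And>J. B J \<noteq> 0" "\<And>J k. B (J + 2 * int r * k) = B J"
      "\<And>J. B (J + 2) = B J * (Psi_weight_at ?\<delta> (1 + J) / Psi_weight_at ?\<delta> (- (1 + J)))"
    using cyclic_potential[OF r Psi_weight_at_periodic Psi_weight_at_nonzero[OF gen], of 1] by blast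
  have cong: "G a = G b" if per: "\<And>J k. G (J + 2 * int r * k) = G J" and ab: "[a = b] (mod (2 * int r))" for G :: "int \<Rightarrow> complex" and a b
  proof -
    obtain k where "a = b + 2 * int r * k" using cong_sym[OF ab] by (auto simp: cong_iff_lin)
    then show ?thesis by (simp only: per)
  qed
  have upG: "G b / G a = Psi_weight_at ?\<delta> (c + a) / Psi_weight_at ?\<delta> (- (c + a))"
    if "\<And>J. G J \<noteq> 0" "\<And>J. G (J + 2) = G J * (Psi_weight_at ?\<delta> (c + J) / Psi_weight_at ?\<delta> (- (c + J)))" "G b = G (a + 2)"
    for G :: "int \<Rightarrow> complex" and c a b
    unfolding that(3) that(2) using that(1)[of a] by simp
  have downG: "G b / G a = Psi_weight_at ?\<delta> (2 - c - a) / Psi_weight_at ?\<delta> (- (2 - c - a))"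
    if "\<And>J. G J \<noteq> 0" "\<And>J. G (J + 2) = G J * (Psi_weight_at ?\<delta> (c + J) / Psi_weight_at ?\<delta> (- (c + J)))" "G b = G (a - 2)"
    for G :: "int \<Rightarrow> complex" and c a b
  proof -
    have e: "c + (a - 2) = - (2 - c - a)" "- (- (2 - c - a)) = 2 - c - a" by simp_all
    have "G a = G b * (Psi_weight_at ?\<delta> (- (2 - c - a)) / Psi_weight_at ?\<delta> (2 - c - a))"
      using that(2)[of "a - 2"] unfolding e that(3) by simp
    then show ?thesis using that(1)[of a] that(1)[of b] Psi_weight_at_nonzero[OF gen] by (simp add: field_simps)
  qed
  define a where "a n = A (int (i n) + int (i' n))" for n
  define b where "b n = B (int (i n) - int (i' n))" for n
  have "pair_factor k i k' i' n u u' = pair_factor k i k' i' n u' u * (a n / a (pr n) * (b n / b (pr n)))" if n: "n \<in> {1..N}" for n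
  proof -
    obtain d d' where d: "step_in d (i n) (i (pr n))" "step_in d' (i' n) (i' (pr n))" using True n by blast
    let ?j = "int (i (pr n))" and ?j' = "int (i' (pr n))"
    have c: "[int (i n) + int (i' n) = (?j + step_in_sign d) + (?j' + step_in_sign d')] (mod (2 * int r))"
      "[int (i n) - int (i' n) = (?j + step_in_sign d) - (?j' + step_in_sign d')] (mod (2 * int r))"
      by (intro cong_add cong_diff step_in_cong d)+
    have cA: "A (int (i n) + int (i' n)) = A ((?j + step_in_sign d) + (?j' + step_in_sign d'))" by (rule cong[OF A(2) c(1)])
    have cB: "B (int (i n) - int (i' n)) = B ((?j + step_in_sign d) - (?j' + step_in_sign d'))" by (rule cong[OF B(2) c(2)])
    define m where "m = step_in_sign d * (if d = d' then r'' + ?j + ?j' else ?j - ?j') + 1"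
    have "a n / a (pr n) * (b n / b (pr n)) = Psi_weight_at ?\<delta> m / Psi_weight_at ?\<delta> (- m)"
    proof (cases "d = d'")
      case True
      have bn: "b n = b (pr n)" unfolding b_def cB True by simp
      have bnz: "b (pr n) \<noteq> 0" unfolding b_def by (rule B(1))
      have "a n / a (pr n) = Psi_weight_at ?\<delta> m / Psi_weight_at ?\<delta> (- m)"
      proof (cases d)
        case d: True
        have e: "r'' + 1 + (?j + ?j') = m" using True d by (simp add: m_def step_in_sign_def)
        have "A (int (i n) + int (i' n)) = A (?j + ?j' + 2)" unfolding cA using True d by (simp add: step_in_sign_def algebra_simps)
        from upG[OF A(1) A(3) this] show ?thesis unfolding a_def e .
      next
        case d: False
        have e: "2 - (r'' + 1) - (?j + ?j') = m" using True d by (simp add: m_def step_in_sign_def)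
        have "A (int (i n) + int (i' n)) = A (?j + ?j' - 2)" unfolding cA using True d by (simp add: step_in_sign_def algebra_simps)
        from downG[OF A(1) A(3) this] show ?thesis unfolding a_def e .
      qed
      then show ?thesis unfolding bn using bnz by simp
    next
      case False
      have an: "a n = a (pr n)" unfolding a_def cA using False by (cases d) (auto simp: step_in_sign_def)
      have anz: "a (pr n) \<noteq> 0" unfolding a_def by (rule A(1))
      have "b n / b (pr n) = Psi_weight_at ?\<delta> m / Psi_weight_at ?\<delta> (- m)"
      proof (cases d)
        case d: True
        have e: "1 + (?j - ?j') = m" using False d by (simp add: m_def step_in_sign_def)
        have "B (int (i n) - int (i' n)) = B (?j - ?j' + 2)" unfolding cB using False d by (simp add: step_in_sign_def algebra_simps)
        from upG[OF B(1) B(3) this] show ?thesis unfolding b_def e .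
      next
        case d: False
        have e: "2 - 1 - (?j - ?j') = m" using False d by (simp add: m_def step_in_sign_def)
        have "B (int (i n) - int (i' n)) = B (?j - ?j' - 2)" unfolding cB using False d by (simp add: step_in_sign_def algebra_simps)
        from downG[OF B(1) B(3) this] show ?thesis unfolding b_def e .
      qed
      then show ?thesis unfolding an using anz by simp
    qed
    then show ?thesis using pair_factor_exchange[where i = i and i' = i', OF r'' gen d, of k k'] unfolding m_def by simp
  qed
  then have "(\<Prod>n=1..N. pair_factor k i k' i' n u u') =
      (\<Prod>n=1..N. pair_factor k i k' i' n u' u * (a n / a (pr n) * (b n / b (pr n))))"
    by (intro prod.cong refl)
  also have "\<dots> = (\<Prod>n=1..N. pair_factor k i k' i' n u' u) * ((\<Prod>n=1..N. a n / a (pr n)) * (\<Prod>n=1..N. b n / b (pr n)))"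
    by (simp only: prod.distrib)
  also have "(\<Prod>n=1..N. a n / a (pr n)) = 1"
    by (rule prod_cyclic_quotient[of N a "\<lambda>n. n"]) (simp add: a_def A(1))
  also have "(\<Prod>n=1..N. b n / b (pr n)) = 1"
    by (rule prod_cyclic_quotient[of N b "\<lambda>n. n"]) (simp add: b_def B(1))
  finally show ?thesis by simp
qed

text \<open>The exceptional heights are limits of generic ones, and both sides are continuous in \<open>u'\<close>.\<close>

lemma walk_symmetric:
  fixes r'' :: int
  assumes r'': "lam0 - v = 2 * of_int r'' * l * \<eta>"
  shows "(\<Prod>n=1..N. pair_factor k i k' i' n u u') = (\<Prod>n=1..N. pair_factor k i k' i' n u' u)"
proof (cases "generic ((u' - u) / 2)")
  case True
  then show ?thesis by (rule walk_symmetric_generic[OF r''])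
next
  case False
  then obtain n0 :: int where n0: "Im ((u' - u) / 2) = (of_int n0 + 1/2) * Im \<tau>" by (auto simp: generic_def)
  define w where "w s = u' + \<i> * complex_of_real s" for s
  define h where "h s = (\<Prod>n=1..N. pair_factor k i k' i' n u (w s)) - (\<Prod>n=1..N. pair_factor k i k' i' n (w s) u)" for s
  have w: "continuous_on UNIV w" unfolding w_def by (intro continuous_intros)
  have "h 0 = 0"
  proof (rule continuous_vanishing_right)
    show "continuous_on UNIV h"
      unfolding h_def
      by (intro continuous_intros continuous_on_compose2[OF pair_factor_continuous(1) w] continuous_on_compose2[OF pair_factor_continuous(2) w]) auto
    show "2 * Im \<tau> > 0" using Im_tau by simp
    fix s assume s: "0 < s" "s < 2 * Im \<tau>"
    have "generic ((w s - u) / 2)"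
      unfolding generic_def
    proof (intro allI notI)
      fix n :: int assume n: "Im ((w s - u) / 2) = (of_int n + 1/2) * Im \<tau>"
      have "Im ((w s - u) / 2) = Im ((u' - u) / 2) + s / 2" by (simp add: w_def field_simps)
      define X where "X = real_of_int (n - n0)"
      have "s / 2 = (of_int n + 1/2) * Im \<tau> - (of_int n0 + 1/2) * Im \<tau>" using \<open>Im ((w s - u) / 2) = Im ((u' - u) / 2) + s / 2\<close> n n0 by linarith
      then have e: "s / 2 = X * Im \<tau>" by (simp add: X_def algebra_simps)
      have "0 < X * Im \<tau>" "X * Im \<tau> < 1 * Im \<tau>" using s unfolding e[symmetric] by simp_all
      then have "0 < X" "X < 1" using zero_less_mult_pos2[OF _ Im_tau] mult_less_cancel_right_pos[OF Im_tau] by blast+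
      then show False by (simp add: X_def)
    qed
    from walk_symmetric_generic[OF r'' this, of k i k' i'] show "h s = 0" unfolding h_def by simp
  qed
  then show ?thesis by (simp add: h_def w_def)
qed

theorem QL_QR:
  fixes r'' :: int
  assumes r'': "lam0 - v = 2 * of_int r'' * l * \<eta>"
  shows "QL u (QR u' c) = QL u' (QR u c)"
proof
  fix k
  have e: "form_H (QK (- cnj u) k) (QR u' c) = (\<Sum>k'\<in>K. c k' * form_H (QK (- cnj u) k) (QK u' k'))" for u u'
    unfolding QR_expand[of u' c] by (rule form_H_sum(2)[OF QR_H QR_H])
  have "form_H (QK (- cnj u) k) (QK u' k') = form_H (QK (- cnj u') k) (QK u k')" if "k \<in> K" "k' \<in> K" for k'
    unfolding QK_QK[OF that] walk_symmetric[OF r'', of _ _ _ _ u u'] ..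
  then show "QL u (QR u' c) k = QL u' (QR u c) k"
    unfolding QL_apply[OF QR_H] e by simp
qed

end

section \<open>Commuting operators\<close>

context sklyanin_QF
begin

lemma H_lin2:
  assumes "F \<in> H" "G \<in> H"
  shows "(\<lambda>z. a * F z + b * G z) \<in> H"
  by (rule H_add[OF H_scale[OF N_pos assms(1)] H_scale[OF N_pos assms(2)]])

lemma QL_lin2:
  assumes F: "F \<in> H" and G: "G \<in> H"
  shows "QL u (\<lambda>z. a * F z + b * G z) = (\<lambda>k. a * QL u F k + b * QL u G k)"
proof -
  have "form_H (QK w k) (\<lambda>z. a * F z + b * G z) = a * form_H (QK w k) F + form_H (QK w k) (\<lambda>z. b * G z)" for w k
    by (rule sesquilinear_D[OF form_H_sesquilinear F H_scale[OF N_pos G] QR_H, THEN conjunct2])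
  then show ?thesis
    unfolding QL_apply[OF F] QL_apply[OF G] QL_apply[OF H_lin2[OF F G]]
    by (auto simp: form_H_scale(1)[OF QR_H G])
qed

lemma QL_scale:
  assumes F: "F \<in> H"
  shows "QL u (\<lambda>z. a * F z) = (\<lambda>k. a * QL u F k)"
  unfolding QL_apply[OF F] QL_apply[OF H_scale[OF N_pos F]] by (auto simp: form_H_scale(1)[OF QR_H F])

context
  fixes r'' :: int and u0 :: complex
  assumes r'': "lam0 - v = 2 * of_int r'' * l * \<eta>"
    and R: "bij_betw (QR u0) C H" and L: "bij_betw (QL u0) H C"
begin

definition Q :: "complex \<Rightarrow> mfun \<Rightarrow> mfun" where
  "Q u F = QR u (the_inv_into C (QR u0) F)"

lemma Q_H: "Q u F \<in> H" unfolding Q_def by (rule QR_H)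

lemma inv_QR: "F \<in> H \<Longrightarrow> QR u0 (the_inv_into C (QR u0) F) = F"
  using R by (simp add: bij_betw_def f_the_inv_into_f)

text \<open>By the symmetry of $Q_L Q_R$ the operator \<open>Q u\<close> becomes \<open>QL u\<close> after an application of the injective \<open>QL u0\<close>; the identities below are all
  compared there.\<close>

lemma QL_u0_Q: "F \<in> H \<Longrightarrow> QL u0 (Q u F) = QL u F"
  unfolding Q_def QL_QR[OF r'', of u0 u] by (simp add: inv_QR)

lemma QL_u0_inj: "X \<in> H \<Longrightarrow> Y \<in> H \<Longrightarrow> QL u0 X = QL u0 Y \<Longrightarrow> X = Y"
  using L by (auto simp: bij_betw_def inj_on_def)

lemma Q_left: "F \<in> H \<Longrightarrow> Q u F = the_inv_into H (QL u0) (QL u F)"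
  unfolding QL_u0_Q[symmetric] using L Q_H by (intro the_inv_into_f_f[symmetric]) (auto simp: bij_betw_def)

lemma T_Q: "T N u (Q u F) = (\<lambda>z. hm u * Q (u - 2 * \<eta>) F z + hp u * Q (u + 2 * \<eta>) F z)"
  unfolding Q_def by (rule TQ_R)

lemma Q_T:
  assumes F: "F \<in> H"
  shows "Q u (T N u F) = (\<lambda>z. hm u * Q (u - 2 * \<eta>) F z + hp u * Q (u + 2 * \<eta>) F z)"
proof (rule QL_u0_inj[OF Q_H H_lin2[OF Q_H Q_H]])
  show "QL u0 (Q u (T N u F)) = QL u0 (\<lambda>z. hm u * Q (u - 2 * \<eta>) F z + hp u * Q (u + 2 * \<eta>) F z)"
    unfolding QL_u0_Q[OF T_H[OF F]] QL_T[OF F] QL_lin2[OF Q_H Q_H] QL_u0_Q[OF F] ..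
qed

lemma Q_commute:
  assumes F: "F \<in> H"
  shows "Q u (Q w F) = Q w (Q u F)"
proof (rule QL_u0_inj[OF Q_H Q_H])
  show "QL u0 (Q u (Q w F)) = QL u0 (Q w (Q u F))"
    unfolding QL_u0_Q[OF Q_H] unfolding Q_def by (rule QL_QR[OF r''])
qed

lemma U1_Q: "UT (U1 l) (Q u F) = (\<lambda>z. e1 * Q (u + 1) F z)"
  unfolding Q_def by (rule U1_QR)

lemma U3_Q: "UT (U3 \<tau> l) (Q u F) = (\<lambda>z. e3 u * Q (u + \<tau>) F z)"
  unfolding Q_def by (rule U3_QR[OF r''])

lemma Q_U1:
  assumes F: "F \<in> H"
  shows "Q u (UT (U1 l) F) = (\<lambda>z. e1 * Q (u + 1) F z)"
proof (rule QL_u0_inj[OF Q_H H_scale[OF N_pos Q_H]])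
  show "QL u0 (Q u (UT (U1 l) F)) = QL u0 (\<lambda>z. e1 * Q (u + 1) F z)"
    unfolding QL_u0_Q[OF UT1(1)[OF F]] QL_U1[OF F] QL_scale[OF Q_H] QL_u0_Q[OF F] ..
qed

lemma Q_U3:
  assumes F: "F \<in> H"
  shows "Q u (UT (U3 \<tau> l) F) = (\<lambda>z. e3 u * Q (u + \<tau>) F z)"
proof (rule QL_u0_inj[OF Q_H H_scale[OF N_pos Q_H]])
  show "QL u0 (Q u (UT (U3 \<tau> l) F)) = QL u0 (\<lambda>z. e3 u * Q (u + \<tau>) F z)"
    unfolding QL_u0_Q[OF UT3(1)[OF F]] QL_U3[OF r'' F] QL_scale[OF Q_H] QL_u0_Q[OF F] ..
qed

end

end

theorem mainTheorem2:
  fixes N r :: nat and r' :: int and l \<eta> :: real and \<tau> lam0 v :: complex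
    and t :: "nat \<Rightarrow> nat \<Rightarrow> complex"
  defines "T \<equiv> transfer_matrix \<tau> \<eta> l N"
    and "QR \<equiv> Q_R \<tau> \<eta> l N r lam0 v t"
    and "QL \<equiv> Q_L \<tau> \<eta> l N r lam0 v t"
    and "hp \<equiv> h_plus \<tau> \<eta> l N"
    and "hm \<equiv> h_minus \<tau> \<eta> l N"
    and "U1N \<equiv> tensor_power N (U1 l)"
    and "U3N \<equiv> tensor_power N (U3 \<tau> l)"
    and "H \<equiv> H_space \<tau> l N"
    and "C \<equiv> C_space l N"
    and "e1 \<equiv> exp (- of_nat N * l * pi * \<i>)"
    and "e3 \<equiv> (\<lambda>u. exp (of_nat N * l * pi * \<i> * (\<tau> - 1) + 2 * of_nat N * l * pi * \<i> * u))"
  assumes N: "N > 0" "even N"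
    and l: "l > 0" "2 * l \<in> \<int>"
    and \<tau>: "Re \<tau> = 0" "Im \<tau> > 0"
    and r: "r > 0"
    and \<eta>: "\<eta> = of_int r' / (2 * l * of_nat r)" "\<bar>\<eta>\<bar> \<le> 1 / (2 * (2 * l + 1))"
    and \<eta>_nonzero: "\<eta> \<noteq> 0"
  shows
    \<comment> \<open>(i)\<close>
    "(\<forall>u :: complex. \<forall>c\<in>C. T u (QR u c) = (\<lambda>z. hm u * QR (u - 2 * \<eta>) c z + hp u * QR (u + 2 * \<eta>) c z))
    \<and> \<comment> \<open>(ii)\<close>
    (\<bar>\<eta>\<bar> < 1 / (2 * (2 * l + 1)) \<longrightarrow>
      (\<forall>u :: complex. \<forall>F\<in>H. QL u (T u F) = (\<lambda>k. hm u * QL (u - 2 * \<eta>) F k + hp u * QL (u + 2 * \<eta>) F k)))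
    \<and> ((\<exists>r'' :: int. lam0 - v = 2 * of_int r'' * l * \<eta>) \<longrightarrow>
      \<comment> \<open>(iv), right part\<close>
      (\<forall>u :: complex. \<forall>c\<in>C. U1N (QR u c) = (\<lambda>z. e1 * QR (u + 1) c z)
              \<and> U3N (QR u c) = (\<lambda>z. e3 u * QR (u + \<tau>) c z))
      \<and> (\<bar>\<eta>\<bar> < 1 / (2 * (2 * l + 1)) \<longrightarrow>
        \<comment> \<open>(iii)\<close>
        (\<forall>(u :: complex) (u' :: complex). \<forall>c\<in>C. QL u (QR u' c) = QL u' (QR u c))
        \<and> \<comment> \<open>(iv), left part\<close>
        (\<forall>u :: complex. \<forall>F\<in>H. QL u (U1N F) = (\<lambda>k. e1 * QL (u + 1) F k)
                \<and> QL u (U3N F) = (\<lambda>k. e3 u * QL (u + \<tau>) F k))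
        \<and> \<comment> \<open>(v)\<close>
        (\<forall>u\<^sub>0 :: complex. bij_betw (QR u\<^sub>0) C H \<and> bij_betw (QL u\<^sub>0) H C \<longrightarrow>
          (let Q = (\<lambda>(u :: complex) F. QR u (the_inv_into C (QR u\<^sub>0) F)) in
            (\<forall>u :: complex. \<forall>F\<in>H. Q u F = the_inv_into H (QL u\<^sub>0) (QL u F))
            \<and> (\<forall>(u :: complex) (w :: complex). \<forall>F\<in>H.
                T u (Q u F) = Q u (T u F)
                \<and> Q u (T u F) = (\<lambda>z. hm u * Q (u - 2 * \<eta>) F z + hp u * Q (u + 2 * \<eta>) F z)
                \<and> Q u (Q w F) = Q w (Q u F)
                \<and> U1N (Q u F) = Q u (U1N F)
                \<and> Q u (U1N F) = (\<lambda>z. e1 * Q (u + 1) F z)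
                \<and> U3N (Q u F) = Q u (U3N F)
                \<and> Q u (U3N F) = (\<lambda>z. e3 u * Q (u + \<tau>) F z))))))"
proof -
  interpret S: sklyanin_Q \<tau> \<eta> l N r r' lam0 v t
    by unfold_locales (use N l \<tau> r \<eta> \<eta>_nonzero in auto)
  have QF: "sklyanin_QF \<tau> \<eta> l N r r'" if "\<bar>\<eta>\<bar> < 1 / (2 * (2 * l + 1))"
    by unfold_locales (rule that)
  note defs = T_def QR_def QL_def hp_def hm_def U1N_def U3N_def H_def C_def e1_def e3_def
  have i: "\<forall>u :: complex. \<forall>c\<in>C. T u (QR u c) = (\<lambda>z. hm u * QR (u - 2 * \<eta>) c z + hp u * QR (u + 2 * \<eta>) c z)"
    unfolding defs using S.TQ_R by blast
  have ii: "\<forall>u :: complex. \<forall>F\<in>H. QL u (T u F) = (\<lambda>k. hm u * QL (u - 2 * \<eta>) F k + hp u * QL (u + 2 * \<eta>) F k)"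
    if "\<bar>\<eta>\<bar> < 1 / (2 * (2 * l + 1))"
    unfolding defs using sklyanin_QF.QL_T[OF QF[OF that]] by blast
  have ivR: "\<forall>u :: complex. \<forall>c\<in>C. U1N (QR u c) = (\<lambda>z. e1 * QR (u + 1) c z) \<and> U3N (QR u c) = (\<lambda>z. e3 u * QR (u + \<tau>) c z)"
    if "lam0 - v = 2 * of_int r'' * l * \<eta>" for r'' :: int
    unfolding defs using S.U1_QR S.U3_QR[OF that] by blast
  have rest: "(\<forall>(u :: complex) (u' :: complex). \<forall>c\<in>C. QL u (QR u' c) = QL u' (QR u c))
    \<and> (\<forall>u :: complex. \<forall>F\<in>H. QL u (U1N F) = (\<lambda>k. e1 * QL (u + 1) F k) \<and> QL u (U3N F) = (\<lambda>k. e3 u * QL (u + \<tau>) F k))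
    \<and> (\<forall>u\<^sub>0 :: complex. bij_betw (QR u\<^sub>0) C H \<and> bij_betw (QL u\<^sub>0) H C \<longrightarrow>
          (let Q = (\<lambda>(u :: complex) F. QR u (the_inv_into C (QR u\<^sub>0) F)) in
            (\<forall>u :: complex. \<forall>F\<in>H. Q u F = the_inv_into H (QL u\<^sub>0) (QL u F))
            \<and> (\<forall>(u :: complex) (w :: complex). \<forall>F\<in>H.
                T u (Q u F) = Q u (T u F)
                \<and> Q u (T u F) = (\<lambda>z. hm u * Q (u - 2 * \<eta>) F z + hp u * Q (u + 2 * \<eta>) F z)
                \<and> Q u (Q w F) = Q w (Q u F)
                \<and> U1N (Q u F) = Q u (U1N F)
                \<and> Q u (U1N F) = (\<lambda>z. e1 * Q (u + 1) F z)
                \<and> U3N (Q u F) = Q u (U3N F)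
                \<and> Q u (U3N F) = (\<lambda>z. e3 u * Q (u + \<tau>) F z))))"
    if eta: "\<bar>\<eta>\<bar> < 1 / (2 * (2 * l + 1))" and r'': "lam0 - v = 2 * of_int r'' * l * \<eta>" for r'' :: int
  proof -
    interpret F: sklyanin_QF \<tau> \<eta> l N r r' lam0 v t by (rule QF[OF eta])
    show ?thesis
    proof (intro conjI allI ballI impI)
      show "QL u (QR u' c) = QL u' (QR u c)" for u u' c
        unfolding defs by (rule F.QL_QR[OF r''])
      show "QL u (U1N F) = (\<lambda>k. e1 * QL (u + 1) F k)" "QL u (U3N F) = (\<lambda>k. e3 u * QL (u + \<tau>) F k)" if "F \<in> H" for u F
        using that F.QL_U1 F.QL_U3[OF r''] unfolding defs by blast+
    next
      fix u\<^sub>0 :: complex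
      assume bij: "bij_betw (QR u\<^sub>0) C H \<and> bij_betw (QL u\<^sub>0) H C"
      define Q where "Q = (\<lambda>(u :: complex) F. QR u (the_inv_into C (QR u\<^sub>0) F))"
      have b: "bij_betw (S.QR u\<^sub>0) F.C F.H" "bij_betw (F.QL u\<^sub>0) F.H F.C" using bij unfolding defs by blast+
      have Q: "Q = F.Q u\<^sub>0" unfolding Q_def F.Q_def[OF r'' b, abs_def] QR_def C_def ..
      show "let Q = (\<lambda>(u :: complex) F. QR u (the_inv_into C (QR u\<^sub>0) F)) in
            (\<forall>u :: complex. \<forall>F\<in>H. Q u F = the_inv_into H (QL u\<^sub>0) (QL u F))
            \<and> (\<forall>(u :: complex) (w :: complex). \<forall>F\<in>H.
                T u (Q u F) = Q u (T u F)
                \<and> Q u (T u F) = (\<lambda>z. hm u * Q (u - 2 * \<eta>) F z + hp u * Q (u + 2 * \<eta>) F z)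
                \<and> Q u (Q w F) = Q w (Q u F)
                \<and> U1N (Q u F) = Q u (U1N F)
                \<and> Q u (U1N F) = (\<lambda>z. e1 * Q (u + 1) F z)
                \<and> U3N (Q u F) = Q u (U3N F)
                \<and> Q u (U3N F) = (\<lambda>z. e3 u * Q (u + \<tau>) F z))"
        unfolding Q_def[symmetric] Let_def unfolding Q
        unfolding T_def QL_def hp_def hm_def U1N_def U3N_def H_def e1_def e3_def
        by (intro conjI allI ballI;
            (rule F.Q_left[OF r'' b] F.Q_T[OF r'' b] F.Q_commute[OF r'' b] F.Q_U1[OF r'' b] F.Q_U3[OF r'' b]
              trans[OF F.T_Q[OF r'' b] F.Q_T[OF r'' b, symmetric]]
              trans[OF F.U1_Q[OF r'' b] F.Q_U1[OF r'' b, symmetric]]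
              trans[OF F.U3_Q[OF r'' b] F.Q_U3[OF r'' b, symmetric]]; assumption))
    qed
  qed
  show ?thesis using i ii ivR rest by blast
qed

end
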